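(* Let $\mathcal O$ be an admissible dg operad and let $f:\mathcal O\to\mathcal E(V)$ be a map of dg operads determining an $\mathcal O$-algebra structure on a dg vector space $V$. Let $\tilde f:\mathcal O\to\mathcal E(V)$ be the minimal $\mathcal O$-algebra structure on $V$ associated with a given splitting $k:\mathcal O\to\mathsf{bv}\mathcal O$ (that is, $p\circ k=\mathrm{id}_{\mathcal O}$) of the canonical resolution $p:\mathsf{bv}\mathcal O\to\mathcal O$ and a canonical Hodge decomposition of $V$. Then the two $\mathcal O$-algebra structures on $V$ corresponding to $f$ and $\tilde f$ are homotopy equivalent. In particular, any two minimal models (regarded as $\mathcal O$-algebra structures on $V$) are homotopy equivalent.
   Context: **Conventions.** $\mathbf k$ is a field of characteristic zero. All vector spaces are $\mathbb Z/2$-graded; "dg" means differential $\mathbb Z/2$-graded (odd differential $d$). A dg operad $\mathcal O=\{\mathcal O(n)\}_{n\ge1}$ is given by dg $\mathbb S_n$-modules and compositions $\circ_i$. A unital dg operad is *admissible* if $\mathcal O(1)=\mathbf k\mathbf 1$ and every $\mathcal O(n)$ is finite-dimensional; $\bar{\mathcal O}$ is the non-unital operad with $\bar{\mathcal O}(1)=0$, $\bar{\mathcal O}(n)=\mathcal O(n)$ for $n>1$. $\mathcal E(V)(n)=\operatorname{Hom}(V^{\otimes n},V)$ is the endomorphism operad; an $\mathcal O$-algebra structure on $V$ is a map of dg operads $\mathcal O\to\mathcal E(V)$ with $\mathbf 1\mapsto\mathrm{id}_V$ (equivalently, a map of non-unital dg operads $\bar{\mathcal O}\to\mathcal E(V)$).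 **Homotopy.** $D=\mathbf k[z,dz]$ is the dg commutative algebra on an even $z$ and an odd $dz$ with $d(z)=dz$; $\mathrm{ev}_0,\mathrm{ev}_1:D\to\mathbf k$ are evaluation at $z=0,1$ (with $dz\mapsto0$). Two operad maps $f_0,f_1:\mathcal O\to\mathcal O'$ are *homotopic* if there is a map of dg operads $F:\mathcal O\to\mathcal O'\otimes D$ with $(\mathrm{id}\otimes\mathrm{ev}_j)\circ F=f_j$, $j=0,1$. Two $\mathcal O$-algebra structures on the same dg vector space $V$ are *homotopy equivalent* if the corresponding maps $\mathcal O\to\mathcal E(V)$ are homotopic. **Hodge decompositions.** A Hodge decomposition of a dg vector space $V$ is an odd operator $s$ and an even operator $t$ on $V$ with $s^2=0$, $t^2=t$, $dt=td$, $st=ts=0$, $ds+sd=\mathrm{id}-t$. It is *canonical* if $dt=0$; then $\operatorname{Im}(t)\cong H(V)$. **$\mathsf{BV}$ and $\mathsf{bv}$.** $\mathsf{BV}\mathcal O$ is the unital dg operad freely generated over $\mathcal O$ by an odd $s$ and an even $t$ in arity $1$, modulo $s^2=0$, $t^2=t$, $st=ts=0$, with $d(s)=\mathbf 1-t$, $d(t)=0$. Let $q:\mathsf{BV}\mathcal O\to\mathcal O$ be the map that is the identity on $\mathcal O$ and sends $s\mapsto0$, $t\mapsto\mathbf 1$. $\mathsf{bv}\mathcal O\subset\mathsf{BV}\mathcal O$ is the suboperad $\mathsf{bv}\mathcal O(n)=t\circ\mathsf{BV}\mathcal O(n)\circ t^{\otimes n}$, with unit $t$. Let $i$ be the inclusion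 and $p=q\circ i:\mathsf{bv}\mathcal O\to\mathcal O$. Given an $\mathcal O$-algebra structure $f$ and a Hodge decomposition on $V$, let $h:\mathsf{BV}\mathcal O\to\mathcal E(V)$ be the operad map that equals $f$ on $\mathcal O$ and sends the generators $s,t$ to the operators $s,t$. **Minimal model.** Given a canonical Hodge decomposition of $V$ and a map of operads $k:\mathcal O\to\mathsf{bv}\mathcal O$ with $p\circ k=\mathrm{id}_{\mathcal O}$, the minimal model of the $\mathcal O$-algebra $(V,f)$ is the $\mathcal O$-algebra structure $\tilde f=h\circ i\circ k$ on $V$. Here $h\circ i\circ k$ is used in arities $n\ge2$, while the unit $\mathbf 1$ acts as $\mathrm{id}_V$. *)

theory Defs
  imports
    "HOL-Algebra.Algebraic_Closure_Type"
    "HOL-Combinatorics.Permutations"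
    "HOL-Library.Z2"
begin

section \<open>Differential graded spaces with a carrier\<close>

text \<open>
  The ground field is a type of class \<open>field_char_0\<close>; seen as a ring with carrier it is
  the constant \<open>ring_of_type_algebra\<close>. The arity components of an operad vary with the arity and
  are therefore modules with a carrier. A grading by \<open>\<int>/2\<close> (the type \<open>bit\<close>) is given by
  the two projections onto homogeneous components. The fields \<open>mult\<close> and \<open>one\<close> inherited from
  the record of modules play no role.
\<close>

record ('k, 'a) dg_space = "('k, 'a) module" +
  hcomp :: "bit \<Rightarrow> 'a \<Rightarrow> 'a"
  dif :: "'a \<Rightarrow> 'a"

definition mk_dg_space ::
  "'a set \<Rightarrow> 'a \<Rightarrow> ('a \<Rightarrow> 'a \<Rightarrow> 'a) \<Rightarrow> ('k \<Rightarrow> 'a \<Rightarrow> 'a) \<Rightarrow> (bit \<Rightarrow> 'a \<Rightarrow> 'a) \<Rightarrow> ('a \<Rightarrow> 'a)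
    \<Rightarrow> ('k, 'a) dg_space" where
  "mk_dg_space C z pl sm hc df =
    \<lparr>carrier = C, monoid.mult = undefined, one = undefined, ring.zero = z, add = pl, module.smult = sm,
     hcomp = hc, dif = df\<rparr>"

definition linear_map ::
  "('k, 'a, 'm) module_scheme \<Rightarrow> ('k, 'b, 'n) module_scheme \<Rightarrow> ('a \<Rightarrow> 'b) \<Rightarrow> bool" where
  "linear_map M N f \<longleftrightarrow>
    f \<in> carrier M \<rightarrow> carrier N \<and>
    (\<forall>x\<in>carrier M. \<forall>y\<in>carrier M. f (x \<oplus>\<^bsub>M\<^esub> y) = f x \<oplus>\<^bsub>N\<^esub> f y) \<and>
    (\<forall>c. \<forall>x\<in>carrier M. f (c \<odot>\<^bsub>M\<^esub> x) = c \<odot>\<^bsub>N\<^esub> f x)"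

locale dg_space = module "ring_of_type_algebra :: 'k::field_char_0 ring" M
  for M :: "('k::field_char_0, 'a) dg_space" (structure) +
  assumes hcomp_linear: "linear_map M M (hcomp M p)"
    and hcomp_hcomp: "x \<in> carrier M \<Longrightarrow> hcomp M p (hcomp M q x) = (if p = q then hcomp M p x else \<zero>\<^bsub>M\<^esub>)"
    and hcomp_sum: "x \<in> carrier M \<Longrightarrow> hcomp M 0 x \<oplus>\<^bsub>M\<^esub> hcomp M 1 x = x"
    and dif_linear: "linear_map M M (dif M)"
    and dif_odd: "x \<in> carrier M \<Longrightarrow> hcomp M (p + 1) (dif M x) = dif M (hcomp M p x)"
    and dif_dif: "x \<in> carrier M \<Longrightarrow> dif M (dif M x) = \<zero>\<^bsub>M\<^esub>"

definition homogeneous :: "('k, 'a) dg_space \<Rightarrow> bit \<Rightarrow> 'a set" where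
  "homogeneous M p = {x \<in> carrier M. hcomp M p x = x}"

text \<open>\<open>ksign p q\<close> is $(-1)^{pq}$; \<open>gsign M x\<close> is $(-1)^{|x|} x$, extended linearly.\<close>

definition ksign :: "bit \<Rightarrow> bit \<Rightarrow> 'k::field" where
  "ksign p q = (if p = 1 \<and> q = 1 then - 1 else 1)"

definition gsign :: "('k::field, 'a) dg_space \<Rightarrow> 'a \<Rightarrow> 'a" where
  "gsign M x = hcomp M 0 x \<oplus>\<^bsub>M\<^esub> (- 1) \<odot>\<^bsub>M\<^esub> hcomp M 1 x"

definition finite_dim :: "('k, 'a) dg_space \<Rightarrow> bool" where
  "finite_dim M \<longleftrightarrow> (\<exists>B. finite B \<and> B \<subseteq> carrier M \<and>
    (\<forall>x\<in>carrier M. \<exists>c. x = (\<Oplus>\<^bsub>M\<^esub>b\<in>B. c b \<odot>\<^bsub>M\<^esub> b)))"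


section \<open>Differential graded operads\<close>

text \<open>
  \<open>Sp P n\<close> is the space of operations of arity \<open>n\<close>, \<open>act P n x \<sigma>\<close> the right action of a
  permutation of \<open>{1..n}\<close>, and \<open>pcomp P m n i x y\<close> is $x \circ_i y$ for \<open>x\<close> of arity \<open>m\<close>
  and \<open>y\<close> of arity \<open>n\<close>. Only arities \<open>n \<ge> 1\<close> are meaningful.
\<close>

record ('k, 'a) operad =
  Sp :: "nat \<Rightarrow> ('k, 'a) dg_space"
  act :: "nat \<Rightarrow> 'a \<Rightarrow> (nat \<Rightarrow> nat) \<Rightarrow> 'a"
  pcomp :: "nat \<Rightarrow> nat \<Rightarrow> nat \<Rightarrow> 'a \<Rightarrow> 'a \<Rightarrow> 'a"
  ounit :: 'a

text \<open>
  The block permutations with $(x \sigma) \circ_i y = (x \circ_{\sigma(i)} y)\,\sigma'$ and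
  $x \circ_i (y \tau) = (x \circ_i y)\,\tau'$, where \<open>y\<close> has arity \<open>n\<close>. The convention behind both
  is that in $x\sigma$ the \<open>j\<close>-th input is fed into the slot $\sigma(j)$ of \<open>x\<close>.
\<close>

definition outer_perm :: "nat \<Rightarrow> nat \<Rightarrow> (nat \<Rightarrow> nat) \<Rightarrow> nat \<Rightarrow> nat" where
  "outer_perm n i \<sigma> a =
    (let shift = (\<lambda>b. if b < \<sigma> i then b else b + n - 1) in
     if a < i then shift (\<sigma> a)
     else if a < i + n then \<sigma> i + (a - i)
     else shift (\<sigma> (a + 1 - n)))"

definition inner_perm :: "nat \<Rightarrow> nat \<Rightarrow> (nat \<Rightarrow> nat) \<Rightarrow> nat \<Rightarrow> nat" where
  "inner_perm n i \<tau> a = (if i \<le> a \<and> a < i + n then i + \<tau> (a + 1 - i) - 1 else a)"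

locale dg_operad =
  fixes P :: "('k::field_char_0, 'a) operad"
  assumes space: "n \<ge> 1 \<Longrightarrow> dg_space (Sp P n)"
    and act_linear: "n \<ge> 1 \<Longrightarrow> \<sigma> permutes {1..n} \<Longrightarrow> linear_map (Sp P n) (Sp P n) (\<lambda>x. act P n x \<sigma>)"
    and act_hcomp: "n \<ge> 1 \<Longrightarrow> \<sigma> permutes {1..n} \<Longrightarrow> x \<in> carrier (Sp P n) \<Longrightarrow>
      hcomp (Sp P n) p (act P n x \<sigma>) = act P n (hcomp (Sp P n) p x) \<sigma>"
    and act_dif: "n \<ge> 1 \<Longrightarrow> \<sigma> permutes {1..n} \<Longrightarrow> x \<in> carrier (Sp P n) \<Longrightarrow>
      dif (Sp P n) (act P n x \<sigma>) = act P n (dif (Sp P n) x) \<sigma>"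
    and act_id: "n \<ge> 1 \<Longrightarrow> x \<in> carrier (Sp P n) \<Longrightarrow> act P n x id = x"
    and act_act: "n \<ge> 1 \<Longrightarrow> \<sigma> permutes {1..n} \<Longrightarrow> \<tau> permutes {1..n} \<Longrightarrow> x \<in> carrier (Sp P n) \<Longrightarrow>
      act P n x (\<sigma> \<circ> \<tau>) = act P n (act P n x \<sigma>) \<tau>"
    and pcomp_linear_left: "n \<ge> 1 \<Longrightarrow> i \<in> {1..m} \<Longrightarrow> y \<in> carrier (Sp P n) \<Longrightarrow>
      linear_map (Sp P m) (Sp P (m + n - 1)) (\<lambda>x. pcomp P m n i x y)"
    and pcomp_linear_right: "n \<ge> 1 \<Longrightarrow> i \<in> {1..m} \<Longrightarrow> x \<in> carrier (Sp P m) \<Longrightarrow>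
      linear_map (Sp P n) (Sp P (m + n - 1)) (\<lambda>y. pcomp P m n i x y)"
    and pcomp_degree: "n \<ge> 1 \<Longrightarrow> i \<in> {1..m} \<Longrightarrow> x \<in> homogeneous (Sp P m) p \<Longrightarrow>
      y \<in> homogeneous (Sp P n) q \<Longrightarrow> pcomp P m n i x y \<in> homogeneous (Sp P (m + n - 1)) (p + q)"
    and pcomp_dif: "n \<ge> 1 \<Longrightarrow> i \<in> {1..m} \<Longrightarrow> x \<in> carrier (Sp P m) \<Longrightarrow> y \<in> carrier (Sp P n) \<Longrightarrow>
      dif (Sp P (m + n - 1)) (pcomp P m n i x y) =
        pcomp P m n i (dif (Sp P m) x) y
          \<oplus>\<^bsub>Sp P (m + n - 1)\<^esub> pcomp P m n i (gsign (Sp P m) x) (dif (Sp P n) y)"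
    and pcomp_sequential: "r \<ge> 1 \<Longrightarrow> i \<in> {1..m} \<Longrightarrow> j \<in> {1..n} \<Longrightarrow>
      x \<in> carrier (Sp P m) \<Longrightarrow> y \<in> carrier (Sp P n) \<Longrightarrow> z \<in> carrier (Sp P r) \<Longrightarrow>
      pcomp P (m + n - 1) r (i + j - 1) (pcomp P m n i x y) z =
        pcomp P m (n + r - 1) i x (pcomp P n r j y z)"
    and pcomp_parallel: "n \<ge> 1 \<Longrightarrow> r \<ge> 1 \<Longrightarrow> 1 \<le> i \<Longrightarrow> i < j \<Longrightarrow> j \<le> m \<Longrightarrow>
      x \<in> carrier (Sp P m) \<Longrightarrow> y \<in> homogeneous (Sp P n) p \<Longrightarrow> z \<in> homogeneous (Sp P r) q \<Longrightarrow>
      pcomp P (m + n - 1) r (j + n - 1) (pcomp P m n i x y) z =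
        ksign p q \<odot>\<^bsub>Sp P (m + n + r - 2)\<^esub> pcomp P (m + r - 1) n i (pcomp P m r j x z) y"
    and pcomp_outer: "n \<ge> 1 \<Longrightarrow> i \<in> {1..m} \<Longrightarrow> \<sigma> permutes {1..m} \<Longrightarrow>
      x \<in> carrier (Sp P m) \<Longrightarrow> y \<in> carrier (Sp P n) \<Longrightarrow>
      pcomp P m n i (act P m x \<sigma>) y = act P (m + n - 1) (pcomp P m n (\<sigma> i) x y) (outer_perm n i \<sigma>)"
    and pcomp_inner: "n \<ge> 1 \<Longrightarrow> i \<in> {1..m} \<Longrightarrow> \<tau> permutes {1..n} \<Longrightarrow>
      x \<in> carrier (Sp P m) \<Longrightarrow> y \<in> carrier (Sp P n) \<Longrightarrow>
      pcomp P m n i x (act P n y \<tau>) = act P (m + n - 1) (pcomp P m n i x y) (inner_perm n i \<tau>)"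
    and unit_even: "ounit P \<in> homogeneous (Sp P 1) 0"
    and unit_left: "n \<ge> 1 \<Longrightarrow> x \<in> carrier (Sp P n) \<Longrightarrow> pcomp P 1 n 1 (ounit P) x = x"
    and unit_right: "i \<in> {1..n} \<Longrightarrow> x \<in> carrier (Sp P n) \<Longrightarrow> pcomp P n 1 i x (ounit P) = x"

definition admissible :: "('k::field_char_0, 'a) operad \<Rightarrow> bool" where
  "admissible P \<longleftrightarrow> dg_operad P \<and>
    carrier (Sp P 1) = range (\<lambda>c. c \<odot>\<^bsub>Sp P 1\<^esub> ounit P) \<and> ounit P \<noteq> \<zero>\<^bsub>Sp P 1\<^esub> \<and>
    (\<forall>n\<ge>1. finite_dim (Sp P n))"

definition operad_map ::
  "('k::field_char_0, 'a) operad \<Rightarrow> ('k, 'b) operad \<Rightarrow> (nat \<Rightarrow> 'a \<Rightarrow> 'b) \<Rightarrow> bool" where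
  "operad_map P Q f \<longleftrightarrow>
    (\<forall>n\<ge>1. linear_map (Sp P n) (Sp Q n) (f n)) \<and>
    (\<forall>n\<ge>1. \<forall>x\<in>carrier (Sp P n).
       (\<forall>p. f n (hcomp (Sp P n) p x) = hcomp (Sp Q n) p (f n x)) \<and>
       f n (dif (Sp P n) x) = dif (Sp Q n) (f n x) \<and>
       (\<forall>\<sigma>. \<sigma> permutes {1..n} \<longrightarrow> f n (act P n x \<sigma>) = act Q n (f n x) \<sigma>)) \<and>
    (\<forall>m\<ge>1. \<forall>n\<ge>1. \<forall>i\<in>{1..m}. \<forall>x\<in>carrier (Sp P m). \<forall>y\<in>carrier (Sp P n).
       f (m + n - 1) (pcomp P m n i x y) = pcomp Q m n i (f m x) (f n y)) \<and>
    f 1 (ounit P) = ounit Q"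


section \<open>Homotopy of operad maps\<close>

text \<open>
  \<open>tensor_D P\<close> is $P \otimes \mathbf{k}[z,dz]$: a finitely supported family \<open>a\<close> stands for
  $\sum_k a_{0,k} \otimes z^k + \sum_k a_{1,k} \otimes z^k dz$. The Koszul rule gives
  $d(x \otimes \omega) = dx \otimes \omega + (-1)^{|x|} x \otimes d\omega$ and
  $(x \otimes \omega) \circ_i (y \otimes \eta) = (-1)^{|\omega||y|} (x \circ_i y) \otimes \omega\eta$.
\<close>

definition tensor_D_space :: "('k::field_char_0, 'a) dg_space \<Rightarrow> ('k, bit \<Rightarrow> nat \<Rightarrow> 'a) dg_space" where
  "tensor_D_space M = mk_dg_space
    {a. (\<forall>e k. a e k \<in> carrier M) \<and> finite {k. \<exists>e. a e k \<noteq> \<zero>\<^bsub>M\<^esub>}}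
    (\<lambda>e k. \<zero>\<^bsub>M\<^esub>)
    (\<lambda>a b e k. a e k \<oplus>\<^bsub>M\<^esub> b e k)
    (\<lambda>c a e k. c \<odot>\<^bsub>M\<^esub> a e k)
    (\<lambda>p a e k. hcomp M (p + e) (a e k))
    (\<lambda>a e k. if e = 0 then dif M (a 0 k)
             else dif M (a 1 k) \<oplus>\<^bsub>M\<^esub> of_nat (Suc k) \<odot>\<^bsub>M\<^esub> gsign M (a 0 (Suc k)))"

definition tensor_D :: "('k::field_char_0, 'a) operad \<Rightarrow> ('k, bit \<Rightarrow> nat \<Rightarrow> 'a) operad" where
  "tensor_D P =
    \<lparr>Sp = (\<lambda>n. tensor_D_space (Sp P n)),
     act = (\<lambda>n a \<sigma> e k. act P n (a e k) \<sigma>),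
     pcomp = (\<lambda>m n i a b e k.
       if e = 0 then \<Oplus>\<^bsub>Sp P (m + n - 1)\<^esub>j\<in>{..k}. pcomp P m n i (a 0 j) (b 0 (k - j))
       else \<Oplus>\<^bsub>Sp P (m + n - 1)\<^esub>j\<in>{..k}.
              pcomp P m n i (a 0 j) (b 1 (k - j))
                \<oplus>\<^bsub>Sp P (m + n - 1)\<^esub> pcomp P m n i (a 1 j) (gsign (Sp P n) (b 0 (k - j)))),
     ounit = (\<lambda>e k. if e = 0 \<and> k = 0 then ounit P else \<zero>\<^bsub>Sp P 1\<^esub>)\<rparr>"

text \<open>\<open>ev_D P c\<close> is $\mathrm{id} \otimes \mathrm{ev}_c$, i.e. $z \mapsto c$, $dz \mapsto 0$.\<close>

definition ev_D :: "('k::field_char_0, 'a) operad \<Rightarrow> 'k \<Rightarrow> nat \<Rightarrow> (bit \<Rightarrow> nat \<Rightarrow> 'a) \<Rightarrow> 'a" where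
  "ev_D P c n a = (\<Oplus>\<^bsub>Sp P n\<^esub>k\<in>{k. a 0 k \<noteq> \<zero>\<^bsub>Sp P n\<^esub>}. c ^ k \<odot>\<^bsub>Sp P n\<^esub> a 0 k)"

definition homotopic ::
  "('k::field_char_0, 'a) operad \<Rightarrow> ('k, 'b) operad \<Rightarrow> (nat \<Rightarrow> 'a \<Rightarrow> 'b) \<Rightarrow> (nat \<Rightarrow> 'a \<Rightarrow> 'b) \<Rightarrow> bool" where
  "homotopic P Q f0 f1 \<longleftrightarrow> operad_map P Q f0 \<and> operad_map P Q f1 \<and>
    (\<exists>F. operad_map P (tensor_D Q) F \<and>
      (\<forall>n\<ge>1. \<forall>x\<in>carrier (Sp P n). ev_D Q 0 n (F n x) = f0 n x \<and> ev_D Q 1 n (F n x) = f1 n x))"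


section \<open>Dg vector spaces, endomorphism operads, Hodge decompositions\<close>

text \<open>The underlying space of a dg vector space \<open>V\<close> is a whole type.\<close>

record ('k, 'v) dg_vect =
  vscale :: "'k \<Rightarrow> 'v \<Rightarrow> 'v"
  vhcomp :: "bit \<Rightarrow> 'v \<Rightarrow> 'v"
  vdif :: "'v \<Rightarrow> 'v"

abbreviation vlinear :: "('k::field, 'v::ab_group_add) dg_vect \<Rightarrow> ('v \<Rightarrow> 'v) \<Rightarrow> bool" where
  "vlinear V g \<equiv> Vector_Spaces.linear (vscale V) (vscale V) g"

definition dg_vector_space :: "('k::field_char_0, 'v::ab_group_add) dg_vect \<Rightarrow> bool" where
  "dg_vector_space V \<longleftrightarrow>
    vector_space (vscale V) \<and>
    (\<forall>p. vlinear V (vhcomp V p)) \<and>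
    (\<forall>p q v. vhcomp V p (vhcomp V q v) = (if p = q then vhcomp V p v else 0)) \<and>
    (\<forall>v. vhcomp V 0 v + vhcomp V 1 v = v) \<and>
    vlinear V (vdif V) \<and>
    (\<forall>p v. vhcomp V (p + 1) (vdif V v) = vdif V (vhcomp V p v)) \<and>
    (\<forall>v. vdif V (vdif V v) = 0)"

definition vsign :: "('k, 'v::ab_group_add) dg_vect \<Rightarrow> 'v \<Rightarrow> 'v" where
  "vsign V v = vhcomp V 0 v - vhcomp V 1 v"

text \<open>
  $\mathrm{Hom}(V^{\otimes n}, V)$ is the space of multilinear maps in \<open>n\<close> arguments, given as
  functions on lists that vanish on lists of any other length. Below, a map of parity \<open>p\<close>
  satisfies \<open>end_sign V \<phi> = (-1)^p \<phi>\<close>, whence the formula for its homogeneous components.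
\<close>

definition multilinear :: "('k::field, 'v::ab_group_add) dg_vect \<Rightarrow> nat \<Rightarrow> ('v list \<Rightarrow> 'v) set" where
  "multilinear V n = {\<phi>. (\<forall>vs. length vs \<noteq> n \<longrightarrow> \<phi> vs = 0) \<and>
     (\<forall>vs j. length vs = n \<and> j < n \<longrightarrow> vlinear V (\<lambda>v. \<phi> (vs[j := v])))}"

definition end_sign :: "('k, 'v::ab_group_add) dg_vect \<Rightarrow> ('v list \<Rightarrow> 'v) \<Rightarrow> 'v list \<Rightarrow> 'v" where
  "end_sign V \<phi> vs = vsign V (\<phi> (map (vsign V) vs))"

definition end_hcomp ::
  "('k::field_char_0, 'v::ab_group_add) dg_vect \<Rightarrow> bit \<Rightarrow> ('v list \<Rightarrow> 'v) \<Rightarrow> 'v list \<Rightarrow> 'v" where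
  "end_hcomp V p \<phi> vs = vscale V (1 / 2)
     (if p = 0 then \<phi> vs + end_sign V \<phi> vs else \<phi> vs - end_sign V \<phi> vs)"

text \<open>
  $(d\phi)(v_1,\dots,v_n) = d(\phi(v_1,\dots,v_n))
    - (-1)^{|\phi|} \sum_j (-1)^{|v_1|+\dots+|v_{j-1}|} \phi(v_1,\dots,dv_j,\dots,v_n)$
\<close>

definition end_dif :: "('k, 'v::ab_group_add) dg_vect \<Rightarrow> ('v list \<Rightarrow> 'v) \<Rightarrow> 'v list \<Rightarrow> 'v" where
  "end_dif V \<phi> vs = vdif V (\<phi> vs) -
     (\<Sum>j<length vs. end_sign V \<phi> (map (vsign V) (take j vs) @ vdif V (vs ! j) # drop (Suc j) vs))"

text \<open>
  $(\phi \circ_i \psi)(v_1,\dots,v_{m+n-1}) = (-1)^{|\psi|(|v_1|+\dots+|v_{i-1}|)}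
     \phi(v_1,\dots,v_{i-1},\psi(v_i,\dots,v_{i+n-1}),v_{i+n},\dots,v_{m+n-1})$
\<close>

definition end_pcomp ::
  "('k::field_char_0, 'v::ab_group_add) dg_vect \<Rightarrow> nat \<Rightarrow> nat \<Rightarrow> nat \<Rightarrow>
    ('v list \<Rightarrow> 'v) \<Rightarrow> ('v list \<Rightarrow> 'v) \<Rightarrow> 'v list \<Rightarrow> 'v" where
  "end_pcomp V m n i \<phi> \<psi> vs =
    (if length vs = m + n - 1 then
       (let us = take (i - 1) vs; xs = take n (drop (i - 1) vs); ws = drop (i - 1 + n) vs
        in \<phi> (us @ end_hcomp V 0 \<psi> xs # ws) + \<phi> (map (vsign V) us @ end_hcomp V 1 \<psi> xs # ws))
     else 0)"

text \<open>
  $(\phi\sigma)(v_1,\dots,v_n) = \pm \phi(v_{\sigma^{-1}(1)},\dots,v_{\sigma^{-1}(n)})$ for homogeneous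
  $v_j$ of parity \<open>ps ! (j - 1)\<close>, with the Koszul sign contributed by the inversions of $\sigma$.
\<close>

definition perm_sign :: "nat \<Rightarrow> (nat \<Rightarrow> nat) \<Rightarrow> bit list \<Rightarrow> 'k::field" where
  "perm_sign n \<sigma> ps =
    (\<Prod>(a, b)\<in>{(a, b). 1 \<le> a \<and> a < b \<and> b \<le> n \<and> \<sigma> b < \<sigma> a}. ksign (ps ! (a - 1)) (ps ! (b - 1)))"

definition end_act ::
  "('k::field_char_0, 'v::ab_group_add) dg_vect \<Rightarrow> nat \<Rightarrow> ('v list \<Rightarrow> 'v) \<Rightarrow> (nat \<Rightarrow> nat) \<Rightarrow> 'v list \<Rightarrow> 'v" where
  "end_act V n \<phi> \<sigma> vs =
    (if length vs = n then
       \<Sum>ps\<in>{ps. length ps = n}. vscale V (perm_sign n \<sigma> ps)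
         (let \<rho> = inv_into UNIV \<sigma> in
            \<phi> (map (\<lambda>j. vhcomp V (ps ! (\<rho> j - 1)) (vs ! (\<rho> j - 1))) [1..<n + 1]))
     else 0)"

definition unary :: "('v \<Rightarrow> 'v) \<Rightarrow> 'v list \<Rightarrow> 'v::zero" where
  "unary g vs = (if length vs = 1 then g (hd vs) else 0)"

definition End_operad :: "('k::field_char_0, 'v::ab_group_add) dg_vect \<Rightarrow> ('k, 'v list \<Rightarrow> 'v) operad" where
  "End_operad V =
    \<lparr>Sp = (\<lambda>n. mk_dg_space (multilinear V n) (\<lambda>vs. 0) (\<lambda>\<phi> \<psi> vs. \<phi> vs + \<psi> vs)
             (\<lambda>c \<phi> vs. vscale V c (\<phi> vs)) (end_hcomp V) (end_dif V)),
     act = end_act V,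
     pcomp = end_pcomp V,
     ounit = unary id\<rparr>"

definition algebra_structure ::
  "('k::field_char_0, 'a) operad \<Rightarrow> ('k, 'v::ab_group_add) dg_vect \<Rightarrow> (nat \<Rightarrow> 'a \<Rightarrow> 'v list \<Rightarrow> 'v) \<Rightarrow> bool" where
  "algebra_structure P V f \<longleftrightarrow> operad_map P (End_operad V) f"

definition homotopy_equivalent ::
  "('k::field_char_0, 'a) operad \<Rightarrow> ('k, 'v::ab_group_add) dg_vect \<Rightarrow>
    (nat \<Rightarrow> 'a \<Rightarrow> 'v list \<Rightarrow> 'v) \<Rightarrow> (nat \<Rightarrow> 'a \<Rightarrow> 'v list \<Rightarrow> 'v) \<Rightarrow> bool" where
  "homotopy_equivalent P V f g \<longleftrightarrow> homotopic P (End_operad V) f g"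

definition hodge_decomposition ::
  "('k::field_char_0, 'v::ab_group_add) dg_vect \<Rightarrow> ('v \<Rightarrow> 'v) \<Rightarrow> ('v \<Rightarrow> 'v) \<Rightarrow> bool" where
  "hodge_decomposition V s t \<longleftrightarrow>
    vlinear V s \<and> (\<forall>p v. vhcomp V (p + 1) (s v) = s (vhcomp V p v)) \<and>
    vlinear V t \<and> (\<forall>p v. vhcomp V p (t v) = t (vhcomp V p v)) \<and>
    (\<forall>v. s (s v) = 0) \<and> (\<forall>v. t (t v) = t v) \<and> (\<forall>v. vdif V (t v) = t (vdif V v)) \<and>
    (\<forall>v. s (t v) = 0) \<and> (\<forall>v. t (s v) = 0) \<and>
    (\<forall>v. vdif V (s v) + s (vdif V v) = v - t v)"

definition canonical_hodge ::
  "('k::field_char_0, 'v::ab_group_add) dg_vect \<Rightarrow> ('v \<Rightarrow> 'v) \<Rightarrow> ('v \<Rightarrow> 'v) \<Rightarrow> bool" where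
  "canonical_hodge V s t \<longleftrightarrow> hodge_decomposition V s t \<and> (\<forall>v. vdif V (t v) = 0)"


section \<open>The operads \<open>BV\<close> and \<open>bv\<close>\<close>

text \<open>
  \<open>BV P\<close> is built as operad terms over \<open>P\<close> and the generators $s$, $t$, modulo the smallest
  operadic congruence that makes \<open>Gen\<close> a map of graded operads and imposes the four relations
  between $s$ and $t$. The zero of arity \<open>n\<close> is \<open>Gen n 0\<close>, and the unit is the unit of \<open>P\<close>.
\<close>

datatype ('k, 'a) bv_term =
    Gen nat 'a
  | GenS
  | GenT
  | Add "('k, 'a) bv_term" "('k, 'a) bv_term"
  | Scale 'k "('k, 'a) bv_term"
  | Act "('k, 'a) bv_term" "nat \<Rightarrow> nat"
  | Comp "('k, 'a) bv_term" nat "('k, 'a) bv_term"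

primrec bv_arity :: "('k, 'a) bv_term \<Rightarrow> nat" where
  "bv_arity (Gen n x) = n"
| "bv_arity GenS = 1"
| "bv_arity GenT = 1"
| "bv_arity (Add u v) = bv_arity u"
| "bv_arity (Scale c u) = bv_arity u"
| "bv_arity (Act u \<sigma>) = bv_arity u"
| "bv_arity (Comp u i v) = bv_arity u + bv_arity v - 1"

primrec bv_wf :: "('k, 'a) operad \<Rightarrow> ('k, 'a) bv_term \<Rightarrow> bool" where
  "bv_wf P (Gen n x) \<longleftrightarrow> n \<ge> 1 \<and> x \<in> carrier (Sp P n)"
| "bv_wf P GenS \<longleftrightarrow> True"
| "bv_wf P GenT \<longleftrightarrow> True"
| "bv_wf P (Add u v) \<longleftrightarrow> bv_wf P u \<and> bv_wf P v \<and> bv_arity u = bv_arity v"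
| "bv_wf P (Scale c u) \<longleftrightarrow> bv_wf P u"
| "bv_wf P (Act u \<sigma>) \<longleftrightarrow> bv_wf P u \<and> \<sigma> permutes {1..bv_arity u}"
| "bv_wf P (Comp u i v) \<longleftrightarrow> bv_wf P u \<and> bv_wf P v \<and> i \<in> {1..bv_arity u}"

abbreviation bv_zero :: "('k, 'a) operad \<Rightarrow> nat \<Rightarrow> ('k, 'a) bv_term" where
  "bv_zero P n \<equiv> Gen n \<zero>\<^bsub>Sp P n\<^esub>"

abbreviation bv_one :: "('k, 'a) operad \<Rightarrow> ('k, 'a) bv_term" where
  "bv_one P \<equiv> Gen 1 (ounit P)"

primrec bv_hcomp :: "('k, 'a) operad \<Rightarrow> bit \<Rightarrow> ('k, 'a) bv_term \<Rightarrow> ('k, 'a) bv_term" where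
  "bv_hcomp P p (Gen n x) = Gen n (hcomp (Sp P n) p x)"
| "bv_hcomp P p GenS = (if p = 1 then GenS else bv_zero P 1)"
| "bv_hcomp P p GenT = (if p = 0 then GenT else bv_zero P 1)"
| "bv_hcomp P p (Add u v) = Add (bv_hcomp P p u) (bv_hcomp P p v)"
| "bv_hcomp P p (Scale c u) = Scale c (bv_hcomp P p u)"
| "bv_hcomp P p (Act u \<sigma>) = Act (bv_hcomp P p u) \<sigma>"
| "bv_hcomp P p (Comp u i v) =
     Add (Comp (bv_hcomp P 0 u) i (bv_hcomp P p v)) (Comp (bv_hcomp P 1 u) i (bv_hcomp P (p + 1) v))"

primrec bv_dif :: "('k::field, 'a) operad \<Rightarrow> ('k, 'a) bv_term \<Rightarrow> ('k, 'a) bv_term" where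
  "bv_dif P (Gen n x) = Gen n (dif (Sp P n) x)"
| "bv_dif P GenS = Add (bv_one P) (Scale (- 1) GenT)"
| "bv_dif P GenT = bv_zero P 1"
| "bv_dif P (Add u v) = Add (bv_dif P u) (bv_dif P v)"
| "bv_dif P (Scale c u) = Scale c (bv_dif P u)"
| "bv_dif P (Act u \<sigma>) = Act (bv_dif P u) \<sigma>"
| "bv_dif P (Comp u i v) =
     Add (Comp (bv_dif P u) i v)
         (Comp (Add (bv_hcomp P 0 u) (Scale (- 1) (bv_hcomp P 1 u))) i (bv_dif P v))"

inductive bv_eq :: "('k::field, 'a) operad \<Rightarrow> ('k, 'a) bv_term \<Rightarrow> ('k, 'a) bv_term \<Rightarrow> bool"
  for P :: "('k, 'a) operad" where
  refl: "bv_wf P u \<Longrightarrow> bv_eq P u u"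
| sym: "bv_eq P u v \<Longrightarrow> bv_eq P v u"
| trans: "bv_eq P u v \<Longrightarrow> bv_eq P v w \<Longrightarrow> bv_eq P u w"
| cong_add: "bv_eq P u u' \<Longrightarrow> bv_eq P v v' \<Longrightarrow> bv_wf P (Add u v) \<Longrightarrow> bv_eq P (Add u v) (Add u' v')"
| cong_scale: "bv_eq P u u' \<Longrightarrow> bv_eq P (Scale c u) (Scale c u')"
| cong_act: "bv_eq P u u' \<Longrightarrow> bv_wf P (Act u \<sigma>) \<Longrightarrow> bv_eq P (Act u \<sigma>) (Act u' \<sigma>)"
| cong_comp: "bv_eq P u u' \<Longrightarrow> bv_eq P v v' \<Longrightarrow> bv_wf P (Comp u i v) \<Longrightarrow>
    bv_eq P (Comp u i v) (Comp u' i v')"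
| add_assoc: "bv_wf P (Add (Add u v) w) \<Longrightarrow> bv_eq P (Add (Add u v) w) (Add u (Add v w))"
| add_comm: "bv_wf P (Add u v) \<Longrightarrow> bv_eq P (Add u v) (Add v u)"
| add_zero: "bv_wf P u \<Longrightarrow> bv_eq P (Add u (bv_zero P (bv_arity u))) u"
| add_neg: "bv_wf P u \<Longrightarrow> bv_eq P (Add u (Scale (- 1) u)) (bv_zero P (bv_arity u))"
| scale_add: "bv_wf P (Add u v) \<Longrightarrow> bv_eq P (Scale c (Add u v)) (Add (Scale c u) (Scale c v))"
| add_scale: "bv_wf P u \<Longrightarrow> bv_eq P (Scale (a + b) u) (Add (Scale a u) (Scale b u))"
| scale_scale: "bv_wf P u \<Longrightarrow> bv_eq P (Scale (a * b) u) (Scale a (Scale b u))"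
| scale_one: "bv_wf P u \<Longrightarrow> bv_eq P (Scale 1 u) u"
| act_add: "bv_wf P (Act (Add u v) \<sigma>) \<Longrightarrow> bv_eq P (Act (Add u v) \<sigma>) (Add (Act u \<sigma>) (Act v \<sigma>))"
| act_scale: "bv_wf P (Act u \<sigma>) \<Longrightarrow> bv_eq P (Act (Scale c u) \<sigma>) (Scale c (Act u \<sigma>))"
| act_id: "bv_wf P u \<Longrightarrow> bv_eq P (Act u id) u"
| act_act: "bv_wf P (Act u \<sigma>) \<Longrightarrow> bv_wf P (Act u \<tau>) \<Longrightarrow> bv_eq P (Act u (\<sigma> \<circ> \<tau>)) (Act (Act u \<sigma>) \<tau>)"
| comp_add_left: "bv_wf P (Comp (Add u v) i w) \<Longrightarrow>
    bv_eq P (Comp (Add u v) i w) (Add (Comp u i w) (Comp v i w))"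
| comp_scale_left: "bv_wf P (Comp u i v) \<Longrightarrow> bv_eq P (Comp (Scale c u) i v) (Scale c (Comp u i v))"
| comp_add_right: "bv_wf P (Comp u i (Add v w)) \<Longrightarrow>
    bv_eq P (Comp u i (Add v w)) (Add (Comp u i v) (Comp u i w))"
| comp_scale_right: "bv_wf P (Comp u i v) \<Longrightarrow> bv_eq P (Comp u i (Scale c v)) (Scale c (Comp u i v))"
| comp_sequential: "bv_wf P (Comp u i (Comp v j w)) \<Longrightarrow>
    bv_eq P (Comp (Comp u i v) (i + j - 1) w) (Comp u i (Comp v j w))"
| comp_parallel: "bv_wf P u \<Longrightarrow> bv_wf P v \<Longrightarrow> bv_wf P w \<Longrightarrow> 1 \<le> i \<Longrightarrow> i < j \<Longrightarrow> j \<le> bv_arity u \<Longrightarrow>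
    bv_eq P (Comp (Comp u i (bv_hcomp P p v)) (j + bv_arity v - 1) (bv_hcomp P q w))
      (Scale (ksign p q) (Comp (Comp u j (bv_hcomp P q w)) i (bv_hcomp P p v)))"
| comp_outer: "bv_wf P (Comp (Act u \<sigma>) i v) \<Longrightarrow>
    bv_eq P (Comp (Act u \<sigma>) i v) (Act (Comp u (\<sigma> i) v) (outer_perm (bv_arity v) i \<sigma>))"
| comp_inner: "bv_wf P (Comp u i (Act v \<tau>)) \<Longrightarrow>
    bv_eq P (Comp u i (Act v \<tau>)) (Act (Comp u i v) (inner_perm (bv_arity v) i \<tau>))"
| unit_left: "bv_wf P u \<Longrightarrow> bv_eq P (Comp (bv_one P) 1 u) u"
| unit_right: "bv_wf P u \<Longrightarrow> i \<in> {1..bv_arity u} \<Longrightarrow> bv_eq P (Comp u i (bv_one P)) u"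
| gen_add: "n \<ge> 1 \<Longrightarrow> x \<in> carrier (Sp P n) \<Longrightarrow> y \<in> carrier (Sp P n) \<Longrightarrow>
    bv_eq P (Gen n (x \<oplus>\<^bsub>Sp P n\<^esub> y)) (Add (Gen n x) (Gen n y))"
| gen_scale: "n \<ge> 1 \<Longrightarrow> x \<in> carrier (Sp P n) \<Longrightarrow> bv_eq P (Gen n (c \<odot>\<^bsub>Sp P n\<^esub> x)) (Scale c (Gen n x))"
| gen_act: "n \<ge> 1 \<Longrightarrow> x \<in> carrier (Sp P n) \<Longrightarrow> \<sigma> permutes {1..n} \<Longrightarrow>
    bv_eq P (Gen n (act P n x \<sigma>)) (Act (Gen n x) \<sigma>)"
| gen_comp: "n \<ge> 1 \<Longrightarrow> i \<in> {1..m} \<Longrightarrow> x \<in> carrier (Sp P m) \<Longrightarrow> y \<in> carrier (Sp P n) \<Longrightarrow>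
    bv_eq P (Gen (m + n - 1) (pcomp P m n i x y)) (Comp (Gen m x) i (Gen n y))"
| rel_ss: "bv_eq P (Comp GenS 1 GenS) (bv_zero P 1)"
| rel_tt: "bv_eq P (Comp GenT 1 GenT) GenT"
| rel_st: "bv_eq P (Comp GenS 1 GenT) (bv_zero P 1)"
| rel_ts: "bv_eq P (Comp GenT 1 GenS) (bv_zero P 1)"

definition bv_class :: "('k::field, 'a) operad \<Rightarrow> ('k, 'a) bv_term \<Rightarrow> ('k, 'a) bv_term set" where
  "bv_class P u = {v. bv_eq P u v}"

definition BV :: "('k::field, 'a) operad \<Rightarrow> ('k, ('k, 'a) bv_term set) operad" where
  "BV P =
    \<lparr>Sp = (\<lambda>n. mk_dg_space
       (bv_class P ` {u. bv_wf P u \<and> bv_arity u = n})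
       (bv_class P (bv_zero P n))
       (\<lambda>A B. \<Union>u\<in>A. \<Union>v\<in>B. bv_class P (Add u v))
       (\<lambda>c A. \<Union>u\<in>A. bv_class P (Scale c u))
       (\<lambda>p A. \<Union>u\<in>A. bv_class P (bv_hcomp P p u))
       (\<lambda>A. \<Union>u\<in>A. bv_class P (bv_dif P u))),
     act = (\<lambda>n A \<sigma>. \<Union>u\<in>A. bv_class P (Act u \<sigma>)),
     pcomp = (\<lambda>m n i A B. \<Union>u\<in>A. \<Union>v\<in>B. bv_class P (Comp u i v)),
     ounit = bv_class P (bv_one P)\<rparr>"

abbreviation BV_t :: "('k::field, 'a) operad \<Rightarrow> ('k, 'a) bv_term set" where
  "BV_t P \<equiv> bv_class P GenT"

definition sandwich :: "('k, 'a) operad \<Rightarrow> nat \<Rightarrow> 'a \<Rightarrow> 'a \<Rightarrow> 'a" where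
  "sandwich P n t x = foldl (\<lambda>y j. pcomp P n 1 j y t) (pcomp P 1 n 1 t x) [1..<n + 1]"

definition bv :: "('k::field, 'a) operad \<Rightarrow> ('k, ('k, 'a) bv_term set) operad" where
  "bv P =
    \<lparr>Sp = (\<lambda>n. (Sp (BV P) n)\<lparr>carrier := sandwich (BV P) n (BV_t P) ` carrier (Sp (BV P) n)\<rparr>),
     act = act (BV P),
     pcomp = pcomp (BV P),
     ounit = BV_t P\<rparr>"

text \<open>
  For a map \<open>f\<close> from \<open>P\<close> to \<open>Q\<close> and unary operations \<open>s\<close>, \<open>t\<close> of \<open>Q\<close> satisfying the relations,
  \<open>bv_extend Q f s t\<close> is the map from \<open>BV P\<close> to \<open>Q\<close> that equals \<open>f\<close> on \<open>P\<close> and sends the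
  generators to \<open>s\<close> and \<open>t\<close>: all representatives of a class have the same value.
\<close>

primrec bv_eval ::
  "('k, 'b) operad \<Rightarrow> (nat \<Rightarrow> 'a \<Rightarrow> 'b) \<Rightarrow> 'b \<Rightarrow> 'b \<Rightarrow> ('k, 'a) bv_term \<Rightarrow> 'b" where
  "bv_eval Q f s t (Gen n x) = f n x"
| "bv_eval Q f s t GenS = s"
| "bv_eval Q f s t GenT = t"
| "bv_eval Q f s t (Add u v) = bv_eval Q f s t u \<oplus>\<^bsub>Sp Q (bv_arity u)\<^esub> bv_eval Q f s t v"
| "bv_eval Q f s t (Scale c u) = c \<odot>\<^bsub>Sp Q (bv_arity u)\<^esub> bv_eval Q f s t u"
| "bv_eval Q f s t (Act u \<sigma>) = act Q (bv_arity u) (bv_eval Q f s t u) \<sigma>"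
| "bv_eval Q f s t (Comp u i v) =
     pcomp Q (bv_arity u) (bv_arity v) i (bv_eval Q f s t u) (bv_eval Q f s t v)"

definition bv_extend ::
  "('k, 'b) operad \<Rightarrow> (nat \<Rightarrow> 'a \<Rightarrow> 'b) \<Rightarrow> 'b \<Rightarrow> 'b \<Rightarrow> nat \<Rightarrow> ('k, 'a) bv_term set \<Rightarrow> 'b" where
  "bv_extend Q f s t n A = the_elem (bv_eval Q f s t ` A)"

definition BV_q :: "('k, 'a) operad \<Rightarrow> nat \<Rightarrow> ('k, 'a) bv_term set \<Rightarrow> 'a" where
  "BV_q P = bv_extend P (\<lambda>n x. x) \<zero>\<^bsub>Sp P 1\<^esub> (ounit P)"

definition bv_incl :: "nat \<Rightarrow> ('k, 'a) bv_term set \<Rightarrow> ('k, 'a) bv_term set" where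
  "bv_incl n A = A"

definition bv_p :: "('k, 'a) operad \<Rightarrow> nat \<Rightarrow> ('k, 'a) bv_term set \<Rightarrow> 'a" where
  "bv_p P n A = BV_q P n (bv_incl n A)"

definition bv_splitting ::
  "('k::field_char_0, 'a) operad \<Rightarrow> (nat \<Rightarrow> 'a \<Rightarrow> ('k, 'a) bv_term set) \<Rightarrow> bool" where
  "bv_splitting P k \<longleftrightarrow> operad_map P (bv P) k \<and> (\<forall>n\<ge>1. \<forall>x\<in>carrier (Sp P n). bv_p P n (k n x) = x)"


section \<open>Minimal models\<close>

definition hodge_extend ::
  "('k::field_char_0, 'v::ab_group_add) dg_vect \<Rightarrow> (nat \<Rightarrow> 'a \<Rightarrow> 'v list \<Rightarrow> 'v) \<Rightarrow> ('v \<Rightarrow> 'v) \<Rightarrow> ('v \<Rightarrow> 'v)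
    \<Rightarrow> nat \<Rightarrow> ('k, 'a) bv_term set \<Rightarrow> 'v list \<Rightarrow> 'v" where
  "hodge_extend V f s t = bv_extend (End_operad V) f (unary s) (unary t)"

text \<open>In arity 1, where $\mathcal{O}(1) = \mathbf{k}\mathbf{1}$, the unit acts as the identity of \<open>V\<close>
  (whereas $h \circ i \circ k$ would send it to $t$).\<close>

definition minimal_model ::
  "('k::field_char_0, 'a) operad \<Rightarrow> ('k, 'v::ab_group_add) dg_vect \<Rightarrow> (nat \<Rightarrow> 'a \<Rightarrow> 'v list \<Rightarrow> 'v) \<Rightarrow>
    ('v \<Rightarrow> 'v) \<Rightarrow> ('v \<Rightarrow> 'v) \<Rightarrow> (nat \<Rightarrow> 'a \<Rightarrow> ('k, 'a) bv_term set) \<Rightarrow> nat \<Rightarrow> 'a \<Rightarrow> 'v list \<Rightarrow> 'v" where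
  "minimal_model P V f s t k n x =
    (if n = 1 then (THE c. x = c \<odot>\<^bsub>Sp P 1\<^esub> ounit P) \<odot>\<^bsub>Sp (End_operad V) 1\<^esub> unary id
     else hodge_extend V f s t n (bv_incl n (k n x)))"

end

theory Submission
  imports Defs "HOL-Library.Product_Plus"
begin

text \<open>
  Write $\mathcal O$ for the operad \<open>P\<close>. An element of $\mathsf{bv}\mathcal O$ is a combination of trees
  with vertices in $\mathcal O$ and edges marked by $1$, $s$ or $t$, and the minimal model evaluates the trees of
  $k(x)$ with $f$ at the vertices and the Hodge operators along the edges. With $s = 0$, $t = \mathrm{id}$ the
  same evaluation returns $f(p(k(x))) = f(x)$. So a homotopy from $f$ to $\tilde f$ should come from the path
  $\sigma = z s$ of odd operators, together with $\tau = \mathrm{id} - d\sigma$, where $d\sigma$ is the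
  differential of $\sigma$ in $\mathcal E(V) \otimes \mathbf k[z,dz]$. The obstacle is that
  $\tau^2 \ne \tau$ and $\sigma\tau \ne 0$ between the endpoints, so that $s \mapsto \sigma$,
  $t \mapsto \tau$ does not respect the relations of $\mathsf{BV}\mathcal O$.

  The remedy is to replace $V$ by the cylinder $U = V \oplus V \oplus V[1]$, whose differential is that of the
  summands plus the identity from the third summand to the second one. The projection $t_U$ to the first summand and the map $s_U$ from the
  second summand to the third one satisfy all the relations strictly and do not depend on $z$. The path is stored
  in two even cycles $\iota : V \to U$ and $\pi : U \to V$ (both with coefficients in $\mathbf k[z,dz]$),
  built from $\sigma$ such that
  \[ \pi\iota = \mathrm{id}, \qquad \pi t_U \iota = \tau^2, \qquad \pi s_U \iota = \sigma + \sigma\tau, \]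
  which is consistent with $d(\sigma + \sigma\tau) = \mathrm{id} - \tau^2$. By the first identity
  $x \mapsto \iota \circ f(x) \circ \pi^{\otimes n}$ is compatible with compositions, so it extends to a map
  from $\mathsf{BV}\mathcal O$ to $\mathcal E(U) \otimes \mathbf k[z,dz]$ that sends the generators to $s_U$
  and $t_U$ (locale \<open>cylinder_map\<close>). On $\mathsf{bv}\mathcal O$ its values have inputs and output in the
  first summand, which is a copy of $V$; composition with $k$ is the homotopy (locale \<open>algebra_deformation\<close>).

  At a value of $z$ where $\sigma$ is part of a Hodge decomposition $(s, t)$ one has $\tau = t$, and the
  evaluation in $U$ is intertwined with the evaluation in $V$ by a projection from $U$ to $V$; this gives the
  value $\tilde f$ at $z = 1$, and $f$ at $z = 0$, where $\sigma = 0$ (lemma \<open>F_endpoint\<close>). The construction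
  works for any map from $\mathcal O$ to $\mathcal E(V) \otimes \mathbf k[z,dz]$ instead of the constant map $f$.
  A second minimal model is therefore reached by feeding in the homotopy from $f$ to it, with
  $\sigma = (1 - z) s$.

  The construction needs that $\mathcal E(V)$ and $\mathcal O \otimes \mathbf k[z,dz]$ are dg operads
  (\<open>dg_operad_End\<close> and \<open>dg_operad_tensor_D\<close>), and that a map of operads with values for $s$ and $t$ that
  satisfy the relations extends to $\mathsf{BV}\mathcal O$ (locale \<open>BV_target\<close>).
\<close>

section \<open>Koszul signs of permutations\<close>

lemma bit_cases: "(p :: bit) = 0 \<or> p = 1"
  by (cases p) auto

lemma ksign_simps [simp]:
  "ksign 0 q = (1 :: 'k::field)" "ksign p 0 = (1 :: 'k::field)" "ksign 1 1 = (-1 :: 'k::field)"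
  by (auto simp: ksign_def)

lemma ksign_commute: "ksign p q = (ksign q p :: 'k::field)"
  by (auto simp: ksign_def)

lemma ksign_square [simp]: "ksign p q * ksign p q = (1 :: 'k::field)"
  by (auto simp: ksign_def)

lemma ksign_square_left [simp]: "ksign p q * (ksign p q * c) = (c :: 'k::field)"
  by (auto simp: ksign_def)

lemma ksign_add_left: "ksign (p + p') q = (ksign p q * ksign p' q :: 'k::field)"
  using bit_cases[of p] bit_cases[of p'] bit_cases[of q] by (auto simp: ksign_def)

lemma ksign_add_right: "ksign q (p + p') = (ksign q p * ksign q p' :: 'k::field)"
  using bit_cases[of p] bit_cases[of p'] bit_cases[of q] by (auto simp: ksign_def)

lemma ksign_sum_left: "ksign (\<Sum>a\<in>A. p a) q = (\<Prod>a\<in>A. ksign (p a) q :: 'k::field)"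
  by (induction A rule: infinite_finite_induct) (simp_all add: ksign_add_left del: add_bit_eq_xor)

lemma ksign_sum_right: "ksign q (\<Sum>a\<in>A. p a) = (\<Prod>a\<in>A. ksign q (p a) :: 'k::field)"
  by (induction A rule: infinite_finite_induct) (simp_all add: ksign_add_right del: add_bit_eq_xor)

lemma prod_ksign_square: "(\<Prod>a\<in>A. ksign (p a) (q a)) * (\<Prod>a\<in>A. ksign (p a) (q a)) = (1 :: 'k::field)"
  by (simp flip: prod.distrib)

definition inversions :: "nat \<Rightarrow> (nat \<Rightarrow> nat) \<Rightarrow> (nat \<times> nat) set" where
  "inversions n \<sigma> = {(a, b). 1 \<le> a \<and> a < b \<and> b \<le> n \<and> \<sigma> b < \<sigma> a}"

definition inversion_sign :: "nat \<Rightarrow> (nat \<Rightarrow> nat) \<Rightarrow> (nat \<Rightarrow> bit) \<Rightarrow> 'k::field" where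
  "inversion_sign n \<sigma> P = (\<Prod>(a, b)\<in>inversions n \<sigma>. ksign (P a) (P b))"

lemma perm_sign_eq: "perm_sign n \<sigma> ps = inversion_sign n \<sigma> (\<lambda>a. ps ! (a - 1))"
  by (simp add: perm_sign_def inversion_sign_def inversions_def)

lemma finite_inversions [simp]: "finite (inversions n \<sigma>)"
  by (rule finite_subset[of _ "{1..n} \<times> {1..n}"]) (auto simp: inversions_def)

lemma inversion_sign_cong:
  "(\<And>a. a \<in> {1..n} \<Longrightarrow> P a = Q a) \<Longrightarrow> inversion_sign n \<sigma> P = inversion_sign n \<sigma> Q"
  unfolding inversion_sign_def by (rule prod.cong) (auto simp: inversions_def)

lemma inversion_sign_id [simp]: "inversion_sign n id P = 1"
proof -
  have "inversions n id = {}" by (auto simp: inversions_def)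
  then show ?thesis by (simp add: inversion_sign_def)
qed

lemma inversion_sign_all_pairs:
  "inversion_sign n \<sigma> P =
    (\<Prod>(a, b)\<in>{(a, b). 1 \<le> a \<and> a < b \<and> b \<le> n}. if \<sigma> b < \<sigma> a then ksign (P a) (P b) else 1)"
proof -
  have fin: "finite {(a, b). 1 \<le> a \<and> a < b \<and> b \<le> n}"
    by (rule finite_subset[of _ "{1..n} \<times> {1..n}"]) auto
  show ?thesis
    unfolding inversion_sign_def
    by (rule prod.mono_neutral_cong_left[OF fin]) (auto simp: inversions_def split: if_splits)
qed

text \<open>
  The Koszul sign is a cocycle: each unordered pair of inputs contributes its sign to \<open>\<sigma> \<circ> \<tau>\<close> iff exactly one
  of the two permutations inverts it. The right-hand side is reindexed along \<open>\<tau>\<close> to compare pair by pair.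
\<close>

lemma inversion_sign_comp:
  assumes \<sigma>: "\<sigma> permutes {1..n}" and \<tau>: "\<tau> permutes {1..n}"
    and Q: "\<And>a. a \<in> {1..n} \<Longrightarrow> Q (\<tau> a) = P a"
  shows "inversion_sign n (\<sigma> \<circ> \<tau>) P = (inversion_sign n \<tau> P * inversion_sign n \<sigma> Q :: 'k::field)"
proof -
  let ?X = "{(a, b). 1 \<le> a \<and> a < b \<and> b \<le> n}"
  let ?\<tau>' = "inv_into UNIV \<tau>"
  have \<tau>': "?\<tau>' permutes {1..n}" using \<tau> by (rule permutes_inv)
  have r: "\<tau> (?\<tau>' a) = a" "?\<tau>' (\<tau> a) = a" for a
    using permutes_inverses[OF \<tau>] by auto
  have m1: "1 \<le> \<tau> a \<and> \<tau> a \<le> n" if "1 \<le> a" "a \<le> n" for a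
    using that permutes_in_image[OF \<tau>, of a] by auto
  have m2: "1 \<le> ?\<tau>' a \<and> ?\<tau>' a \<le> n" if "1 \<le> a" "a \<le> n" for a
    using that permutes_in_image[OF \<tau>', of a] by auto
  have neq: "\<tau> a \<noteq> \<tau> b" "?\<tau>' a \<noteq> ?\<tau>' b" if "a < b" for a b
    using that r by (metis less_irrefl)+
  have s: "\<sigma> a \<noteq> \<sigma> b" if "a \<noteq> b" for a b
    using permutes_inj[OF \<sigma>] that by (auto dest: injD)
  have reindex: "inversion_sign n \<sigma> Q =
    (\<Prod>(a, b)\<in>?X. if (if \<tau> a < \<tau> b then \<sigma> (\<tau> b) < \<sigma> (\<tau> a) else \<sigma> (\<tau> a) < \<sigma> (\<tau> b))
                    then ksign (P a) (P b) else (1 :: 'k))"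
    unfolding inversion_sign_all_pairs
  proof (rule prod.reindex_bij_witness[where
        i = "\<lambda>(a, b). (min (\<tau> a) (\<tau> b), max (\<tau> a) (\<tau> b))" and
        j = "\<lambda>(a, b). (min (?\<tau>' a) (?\<tau>' b), max (?\<tau>' a) (?\<tau>' b))"], goal_cases)
    case (1 x) then show ?case using r neq[of "fst x" "snd x"]
      by (auto simp: min_def max_def)
  next
    case (2 x) then show ?case
      using m2[of "fst x"] m2[of "snd x"] neq[of "fst x" "snd x"]
      by (auto simp: min_def max_def)
  next
    case (3 x) then show ?case using r neq[of "fst x" "snd x"]
      by (auto simp: min_def max_def)
  next
    case (4 x) then show ?case
      using m1[of "fst x"] m1[of "snd x"] neq[of "fst x" "snd x"]
      by (auto simp: min_def max_def)
  next
    case (5 x)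
    obtain a b where x: "x = (a, b)" by force
    have ab: "1 \<le> a" "a < b" "b \<le> n" using 5 x by auto
    have "Q a = P (?\<tau>' a)" "Q b = P (?\<tau>' b)"
      using Q[of "?\<tau>' a"] Q[of "?\<tau>' b"] m2[of a] m2[of b] ab r by auto
    then show ?case
      using ab r neq(2)[of a b] unfolding x by (auto simp: min_def max_def ksign_commute)
  qed
  show ?thesis
    unfolding reindex
    unfolding inversion_sign_all_pairs prod.distrib[symmetric]
  proof (rule prod.cong, goal_cases)
    case (2 x)
    obtain a b where x: "x = (a, b)" by force
    have "\<tau> a \<noteq> \<tau> b" using neq 2 x by auto
    then show ?case using s[of "\<tau> a" "\<tau> b"] unfolding x by auto
  qed simp
qed

text \<open>
  How the Koszul sign changes when the input \<open>j\<close> changes its parity, as happens when the differential is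
  applied to it. The two products are the signs for moving the differential to the input \<open>j\<close> before and after
  permuting; inversions that involve \<open>j\<close> account for the difference.
\<close>

lemma inversion_sign_update:
  fixes q :: bit
  assumes \<sigma>: "\<sigma> permutes {1..n}" and j: "j \<in> {1..n}"
  shows "(\<Prod>a\<in>{1..<j}. ksign q (P a)) * inversion_sign n \<sigma> (P(j := P j + q)) =
    (inversion_sign n \<sigma> P * (\<Prod>a\<in>{a \<in> {1..n}. \<sigma> a < \<sigma> j}. ksign q (P a)) :: 'k::field)"
proof -
  have s: "\<sigma> a \<noteq> \<sigma> b" if "a \<noteq> b" for a b
    using permutes_inj[OF \<sigma>] that by (auto dest: injD)
  let ?A1 = "{a \<in> {1..n}. a < j \<and> \<sigma> a < \<sigma> j}" and ?A2 = "{a \<in> {1..n}. a < j \<and> \<sigma> j < \<sigma> a}"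
    and ?A3 = "{a \<in> {1..n}. j < a \<and> \<sigma> a < \<sigma> j}"
  let ?k = "\<lambda>a. ksign q (P a) :: 'k"
  have cmp: "\<sigma> a < \<sigma> j \<or> \<sigma> j < \<sigma> a" if "a \<noteq> j" for a
    using s[OF that] by linarith
  have e1: "{1..<j} = ?A1 \<union> ?A2"
  proof (intro Set.set_eqI)
    fix x show "x \<in> {1..<j} \<longleftrightarrow> x \<in> ?A1 \<union> ?A2" using j cmp[of x] by auto
  qed
  have e2: "{a \<in> {1..n}. \<sigma> a < \<sigma> j} = ?A1 \<union> ?A3"
  proof (intro Set.set_eqI)
    fix x show "x \<in> {a \<in> {1..n}. \<sigma> a < \<sigma> j} \<longleftrightarrow> x \<in> ?A1 \<union> ?A3" by (cases x j rule: linorder_cases) auto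
  qed
  have p1: "prod ?k {1..<j} = prod ?k ?A1 * prod ?k ?A2"
    unfolding e1 by (rule prod.union_disjoint) auto
  have p2: "prod ?k {a \<in> {1..n}. \<sigma> a < \<sigma> j} = prod ?k ?A1 * prod ?k ?A3"
    unfolding e2 by (rule prod.union_disjoint) auto
  have img: "(\<lambda>a. (a, j)) ` ?A2 = {x \<in> inversions n \<sigma>. snd x = j}"
    "(\<lambda>a. (j, a)) ` ?A3 = {x \<in> inversions n \<sigma>. fst x = j}"
    using j by (auto simp: inversions_def image_iff)
  let ?f = "\<lambda>x. (if snd x = j then ?k (fst x) else 1) * (if fst x = j then ?k (snd x) else 1)"
  have "inversion_sign n \<sigma> (P(j := P j + q)) =
    (\<Prod>x\<in>inversions n \<sigma>. ksign (P (fst x)) (P (snd x)) * ?f x)"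
    unfolding inversion_sign_def
  proof (rule prod.cong)
    fix x assume "x \<in> inversions n \<sigma>"
    then obtain a b where x: "x = (a, b)" "a < b" by (auto simp: inversions_def)
    have "ksign (P a) (P j + q) = (ksign (P a) (P j) * ksign q (P a) :: 'k)"
      unfolding ksign_add_right by (simp only: ksign_commute)
    then show "(case x of (a, b) \<Rightarrow> ksign ((P(j := P j + q)) a) ((P(j := P j + q)) b)) =
      ksign (P (fst x)) (P (snd x)) * ?f x"
      using x ksign_add_left[of "P j" q "P b", where 'k = 'k] by (simp del: add_bit_eq_xor)
  qed simp
  also have "\<dots> = inversion_sign n \<sigma> P *
      ((\<Prod>x\<in>inversions n \<sigma>. if snd x = j then ?k (fst x) else 1) *
       (\<Prod>x\<in>inversions n \<sigma>. if fst x = j then ?k (snd x) else 1))"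
    by (simp add: inversion_sign_def prod.distrib case_prod_beta)
  also have "(\<Prod>x\<in>inversions n \<sigma>. if snd x = j then ?k (fst x) else 1) = prod ?k ?A2"
    by (simp add: prod.inter_filter[symmetric] img(1)[symmetric] prod.reindex inj_on_def)
  also have "(\<Prod>x\<in>inversions n \<sigma>. if fst x = j then ?k (snd x) else 1) = prod ?k ?A3"
    by (simp add: prod.inter_filter[symmetric] img(2)[symmetric] prod.reindex inj_on_def)
  finally have u: "inversion_sign n \<sigma> (P(j := P j + q)) =
    inversion_sign n \<sigma> P * (prod ?k ?A2 * prod ?k ?A3)" .
  have "prod ?k ?A2 * prod ?k ?A2 = 1" by (rule prod_ksign_square)
  moreover have "x * y * (z * (y * w)) = (y * y) * (z * (x * w))" for x y z w :: 'k
    by (simp only: mult_ac)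
  ultimately show ?thesis unfolding u p1 p2 by simp
qed

lemma permutes_leD: "\<sigma> permutes {1..n} \<Longrightarrow> 1 \<le> a \<Longrightarrow> a \<le> n \<Longrightarrow> 1 \<le> \<sigma> a \<and> \<sigma> a \<le> (n::nat)"
  using permutes_in_image[of \<sigma> "{1..n}" a] by auto

lemma permutes_by_inverse:
  fixes \<sigma> :: "nat \<Rightarrow> nat"
  assumes "\<And>a. a \<in> {1..n} \<Longrightarrow> \<sigma> a \<in> {1..n}" "\<And>a. a \<notin> {1..n} \<Longrightarrow> \<sigma> a = a"
    "\<And>a b. a \<in> {1..n} \<Longrightarrow> b \<in> {1..n} \<Longrightarrow> \<sigma> a = \<sigma> b \<Longrightarrow> a = b"
  shows "\<sigma> permutes {1..n}"
  by (metis assms bij_betw_def bij_imp_permutes finite_atLeastAtMost endo_inj_surj image_subsetI inj_onI)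

lemma inner_perm_block:
  "1 \<le> x \<Longrightarrow> x \<le> n \<Longrightarrow> inner_perm n (Suc l) \<tau> (l + x) = l + \<tau> x"
  by (auto simp: inner_perm_def)

lemma inner_perm_outside:
  "\<not> (l < a \<and> a \<le> l + n) \<Longrightarrow> inner_perm n (Suc l) \<tau> a = a"
  by (auto simp: inner_perm_def)

lemma block_cases:
  obtains (block) x where "1 \<le> x" "x \<le> n" "(a::nat) = l + x" | (outside) "\<not> (l < a \<and> a \<le> l + n)"
proof (cases "l < a \<and> a \<le> l + n")
  case True
  then show ?thesis using that(1)[of "a - l"] by auto
qed (use that in auto)

lemma inner_perm_permutes:
  assumes \<tau>: "\<tau> permutes {1..n}" and i: "i \<in> {1..m}" and n: "n \<ge> 1"
  shows "inner_perm n i \<tau> permutes {1..m + n - 1}"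
proof -
  obtain l where l: "i = Suc l" "l < m" using i by (cases i) auto
  let ?\<pi> = "inner_perm n (Suc l) \<tau>"
  note pD = permutes_leD[OF \<tau>]
  have "?\<pi> permutes {1..m + n - 1}"
  proof (rule permutes_by_inverse)
    fix a assume a: "a \<in> {1..m + n - 1}"
    show "?\<pi> a \<in> {1..m + n - 1}"
    proof (cases rule: block_cases[where a = a and n = n and l = l])
      case (block x)
      have "?\<pi> a = l + \<tau> x" unfolding block(3) by (rule inner_perm_block[OF block(1,2)])
      moreover have "1 \<le> l + \<tau> x" "l + \<tau> x \<le> m + n - 1" using pD[OF block(1,2)] l(2) by linarith+
      ultimately show ?thesis by simp
    next
      case outside
      then show ?thesis using a inner_perm_outside[OF outside, of \<tau>] by simp
    qed
  next
    fix a assume "a \<notin> {1..m + n - 1}"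
    then have "\<not> (l < a \<and> a \<le> l + n)" using l by auto
    then show "?\<pi> a = a" by (rule inner_perm_outside)
  next
    fix a b assume eq: "?\<pi> a = ?\<pi> b"
    have inj: "x = y" if "\<tau> x = \<tau> y" for x y using permutes_inj[OF \<tau>] that by (auto dest: injD)
    show "a = b"
    proof (cases rule: block_cases[where a = a and n = n and l = l])
      case (block x)
      note x = this pD[OF block(1,2)]
      have ax: "?\<pi> a = l + \<tau> x" unfolding block(3) by (rule inner_perm_block[OF block(1,2)])
      show ?thesis
      proof (cases rule: block_cases[where a = b and n = n and l = l])
        case (block y)
        have "?\<pi> b = l + \<tau> y" unfolding block(3) by (rule inner_perm_block[OF block(1,2)])
        then have "\<tau> x = \<tau> y" using ax eq by simp
        then have "x = y" by (rule inj)
        then show ?thesis using x block by simp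
      next
        case outside
        then show ?thesis using x ax eq inner_perm_outside[OF outside, of \<tau>] by linarith
      qed
    next
      case outside
      note x = this inner_perm_outside[OF outside, of \<tau>]
      show ?thesis
      proof (cases rule: block_cases[where a = b and n = n and l = l])
        case (block y)
        have "?\<pi> b = l + \<tau> y" unfolding block(3) by (rule inner_perm_block[OF block(1,2)])
        then show ?thesis using x pD[OF block(1,2)] eq by linarith
      next
        case outside
        then show ?thesis using x eq inner_perm_outside[OF outside, of \<tau>] by linarith
      qed
    qed
  qed
  then show ?thesis using l by simp
qed

text \<open>
  Only the block of inputs of the inner operation can be inverted, so the sign is that of \<open>\<tau>\<close> alone.
\<close>

lemma inversion_sign_inner:
  assumes \<tau>: "\<tau> permutes {1..n}" and l: "l < m" and n: "n \<ge> 1"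
  shows "inversion_sign (m + n - 1) (inner_perm n (Suc l) \<tau>) P =
    (inversion_sign n \<tau> (\<lambda>x. P (l + x)) :: 'k::field)"
proof -
  let ?\<pi> = "inner_perm n (Suc l) \<tau>"
  note pD = permutes_leD[OF \<tau>]
  have "inversions (m + n - 1) ?\<pi> = (\<lambda>(x, y). (l + x, l + y)) ` inversions n \<tau>"
  proof (intro Set.set_eqI iffI)
    fix p assume p: "p \<in> inversions (m + n - 1) ?\<pi>"
    obtain a b where ab: "p = (a, b)" by force
    have lt: "1 \<le> a" "a < b" "b \<le> m + n - 1" "?\<pi> b < ?\<pi> a"
      using p unfolding ab inversions_def by simp_all
    show "p \<in> (\<lambda>(x, y). (l + x, l + y)) ` inversions n \<tau>"
    proof (cases rule: block_cases[where a = a and n = n and l = l])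
      case (block x)
      note x = this pD[OF block(1,2)]
      have ax: "?\<pi> a = l + \<tau> x" unfolding block(3) by (rule inner_perm_block[OF block(1,2)])
      show ?thesis
      proof (cases rule: block_cases[where a = b and n = n and l = l])
        case (block y)
        have "?\<pi> b = l + \<tau> y" unfolding block(3) by (rule inner_perm_block[OF block(1,2)])
        then have "(x, y) \<in> inversions n \<tau>"
          using ax x(1-3) block lt unfolding inversions_def by simp
        then show ?thesis unfolding ab using x(3) block(3) by (auto intro!: image_eqI[of _ _ "(x, y)"])
      next
        case outside
        then show ?thesis using x ax lt inner_perm_outside[OF outside, of \<tau>] by linarith
      qed
    next
      case outside
      note x = this inner_perm_outside[OF outside, of \<tau>]
      show ?thesis
      proof (cases rule: block_cases[where a = b and n = n and l = l])
        case (block y)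
        have "?\<pi> b = l + \<tau> y" unfolding block(3) by (rule inner_perm_block[OF block(1,2)])
        then show ?thesis using x pD[OF block(1,2)] lt block by linarith
      next
        case outside
        then show ?thesis using x lt inner_perm_outside[OF outside, of \<tau>] by linarith
      qed
    qed
  next
    fix p assume "p \<in> (\<lambda>(x, y). (l + x, l + y)) ` inversions n \<tau>"
    then obtain x y where p: "p = (l + x, l + y)" and xy: "(x, y) \<in> inversions n \<tau>" by auto
    then have *: "1 \<le> x" "x < y" "y \<le> n" "\<tau> y < \<tau> x" by (auto simp: inversions_def)
    then have "x \<le> n" "1 \<le> y" by auto
    then have "?\<pi> (l + y) < ?\<pi> (l + x)"
      using * by (simp add: inner_perm_block)
    then show "p \<in> inversions (m + n - 1) ?\<pi>"
      using * l unfolding p inversions_def by simp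
  qed
  moreover have "inj_on (\<lambda>x. (l + fst x, l + snd x)) (inversions n \<tau>)"
    by (auto simp: inj_on_def)
  ultimately show ?thesis
    unfolding inversion_sign_def by (simp add: prod.reindex case_prod_beta)
qed

text \<open>The slot of \<open>x\<close> in which the \<open>a\<close>-th input of $x \circ_i y$ ends up.\<close>

definition outer_slot :: "nat \<Rightarrow> nat \<Rightarrow> nat \<Rightarrow> nat" where
  "outer_slot n i a = (if a < i then a else if a < i + n then i else a + 1 - n)"

lemma outer_slot_range:
  "i \<in> {1..m} \<Longrightarrow> n \<ge> 1 \<Longrightarrow> a \<in> {1..m + n - 1} \<Longrightarrow> outer_slot n i a \<in> {1..m}"
  by (auto simp: outer_slot_def)

lemma outer_slot_less:
  "n \<ge> 1 \<Longrightarrow> outer_slot n i a \<noteq> outer_slot n i b \<Longrightarrow> a < b \<longleftrightarrow> outer_slot n i a < outer_slot n i b"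
  by (auto simp: outer_slot_def split: if_splits)

lemma outer_perm_cases:
  assumes "\<sigma> permutes {1..m}" "i \<in> {1..m}" "n \<ge> 1"
  shows "outer_perm n i \<sigma> a =
    (if outer_slot n i a = i then \<sigma> i + (a - i)
     else if \<sigma> (outer_slot n i a) < \<sigma> i then \<sigma> (outer_slot n i a) else \<sigma> (outer_slot n i a) + n - 1)"
  using assms by (auto simp: outer_perm_def outer_slot_def Let_def)

lemma outer_perm_less:
  assumes "\<sigma> permutes {1..m}" "i \<in> {1..m}" "n \<ge> 1" "outer_slot n i a \<noteq> outer_slot n i b"
  shows "outer_perm n i \<sigma> a < outer_perm n i \<sigma> b \<longleftrightarrow> \<sigma> (outer_slot n i a) < \<sigma> (outer_slot n i b)"
proof -
  have s: "\<sigma> x = \<sigma> y \<longleftrightarrow> x = y" for x y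
    using permutes_inj[OF assms(1)] by (auto dest: injD)
  have bl: "i \<le> x \<and> x < i + n" if "outer_slot n i x = i" for x
    using that assms(3) by (auto simp: outer_slot_def split: if_splits)
  show ?thesis
    unfolding outer_perm_cases[OF assms(1-3)]
    using assms(3,4) bl[of a] bl[of b] s[of "outer_slot n i a" i] s[of "outer_slot n i b" i]
      s[of "outer_slot n i a" "outer_slot n i b"]
    by (auto split: if_splits)
qed

lemma outer_perm_permutes:
  assumes "\<sigma> permutes {1..m}" "i \<in> {1..m}" "n \<ge> 1"
  shows "outer_perm n i \<sigma> permutes {1..m + n - 1}"
proof (rule permutes_by_inverse)
  fix a assume a: "a \<in> {1..m + n - 1}"
  have "outer_slot n i a \<in> {1..m}" using assms a outer_slot_range by blast
  then show "outer_perm n i \<sigma> a \<in> {1..m + n - 1}"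
    unfolding outer_perm_cases[OF assms]
    using assms permutes_leD[OF assms(1), of "outer_slot n i a"] permutes_leD[OF assms(1), of i]
    by (auto simp: outer_slot_def split: if_splits)
next
  fix a assume a: "a \<notin> {1..m + n - 1}"
  show "outer_perm n i \<sigma> a = a"
  proof (cases "a = 0")
    case True
    then show ?thesis using assms permutes_not_in[OF assms(1), of 0] permutes_leD[OF assms(1), of i]
      by (auto simp: outer_perm_def Let_def)
  next
    case False
    then have "a > m + n - 1" using a by auto
    then have "\<not> a < i" "\<not> a < i + n" "\<sigma> (a + 1 - n) = a + 1 - n" "\<sigma> i \<le> m"
      using assms permutes_leD[OF assms(1), of i] by (auto intro!: permutes_not_in[of \<sigma> "{Suc 0..m}"])
    then show ?thesis using \<open>a > m + n - 1\<close> assms(3)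
      by (auto simp: outer_perm_def Let_def)
  qed
next
  fix a b assume eq: "outer_perm n i \<sigma> a = outer_perm n i \<sigma> b"
  show "a = b"
  proof (cases "outer_slot n i a = outer_slot n i b")
    case True
    then show ?thesis
      using eq assms(2,3) unfolding outer_perm_cases[OF assms] by (auto simp: outer_slot_def split: if_splits)
  next
    case False
    then show ?thesis
      using eq outer_perm_less[OF assms False] outer_perm_less[OF assms, of b a] permutes_inj[OF assms(1)]
      by (metis injD less_irrefl linorder_neqE_nat)
  qed
qed

text \<open>
  The block of inputs of the inner operation moves as a whole and so counts as one input, whose parity is the
  sum of the parities in the block.
\<close>

lemma inversion_sign_outer:
  assumes "\<sigma> permutes {1..m}" "i \<in> {1..m}" "n \<ge> 1"
    and Q: "\<And>c. c \<in> {1..m} \<Longrightarrow> Q c = (\<Sum>a\<in>{a \<in> {1..m + n - 1}. outer_slot n i a = c}. P a)"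
  shows "inversion_sign (m + n - 1) (outer_perm n i \<sigma>) P = (inversion_sign m \<sigma> Q :: 'k::field)"
proof -
  let ?g = "\<lambda>(a, b). (outer_slot n i a, outer_slot n i b)"
  let ?F = "\<lambda>c. {a \<in> {1..m + n - 1}. outer_slot n i a = c}"
  have slot: "outer_slot n i a \<noteq> outer_slot n i b"
    if "(a, b) \<in> inversions (m + n - 1) (outer_perm n i \<sigma>)" for a b
    using that assms(2,3) unfolding inversions_def outer_perm_cases[OF assms(1-3)]
    by (auto simp: outer_slot_def split: if_splits)
  have sub: "?g ` inversions (m + n - 1) (outer_perm n i \<sigma>) \<subseteq> inversions m \<sigma>"
  proof (rule image_subsetI)
    fix x assume x: "x \<in> inversions (m + n - 1) (outer_perm n i \<sigma>)"
    obtain a b where xab: "x = (a, b)" by force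
    have ab: "(a, b) \<in> inversions (m + n - 1) (outer_perm n i \<sigma>)" using x xab by simp
    have ne: "outer_slot n i a \<noteq> outer_slot n i b" using slot ab .
    have "a \<in> {1..m + n - 1}" "b \<in> {1..m + n - 1}" using ab by (auto simp: inversions_def)
    then have "outer_slot n i a \<in> {1..m}" "outer_slot n i b \<in> {1..m}"
      using outer_slot_range assms by blast+
    then show "?g x \<in> inversions m \<sigma>"
      unfolding xab using ab outer_slot_less[OF assms(3) ne] outer_perm_less[OF assms(1-3) ne[symmetric]]
      by (auto simp: inversions_def)
  qed
  have fib: "{x \<in> inversions (m + n - 1) (outer_perm n i \<sigma>). ?g x = (c, d)} = ?F c \<times> ?F d"
    if cd: "(c, d) \<in> inversions m \<sigma>" for c d
  proof (intro Set.set_eqI iffI)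
    fix x assume "x \<in> ?F c \<times> ?F d"
    then obtain a b where x: "x = (a, b)" "a \<in> {1..m + n - 1}" "b \<in> {1..m + n - 1}"
      "outer_slot n i a = c" "outer_slot n i b = d" by auto
    have "outer_slot n i a \<noteq> outer_slot n i b" using x cd by (auto simp: inversions_def)
    then show "x \<in> {x \<in> inversions (m + n - 1) (outer_perm n i \<sigma>). ?g x = (c, d)}"
      using x cd outer_slot_less[OF assms(3), of i a b] outer_perm_less[OF assms(1-3), of b a]
      by (auto simp: inversions_def)
  qed (auto simp: inversions_def)
  have "inversion_sign (m + n - 1) (outer_perm n i \<sigma>) P =
    (\<Prod>y\<in>inversions m \<sigma>. \<Prod>x\<in>{x \<in> inversions (m + n - 1) (outer_perm n i \<sigma>). ?g x = y}.
       ksign (P (fst x)) (P (snd x)))"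
    unfolding inversion_sign_def case_prod_beta
    by (rule prod.group[symmetric]) (use sub in \<open>auto simp: case_prod_beta\<close>)
  also have "\<dots> = inversion_sign m \<sigma> Q"
    unfolding inversion_sign_def
  proof (rule prod.cong, simp, clarify)
    fix c d assume cd: "(c, d) \<in> inversions m \<sigma>"
    then have c: "c \<in> {1..m}" and d: "d \<in> {1..m}" by (auto simp: inversions_def)
    show "(\<Prod>x\<in>{x \<in> inversions (m + n - 1) (outer_perm n i \<sigma>). ?g x = (c, d)}.
       ksign (P (fst x)) (P (snd x))) = ksign (Q c) (Q d)"
      unfolding fib[OF cd] Q[OF c] Q[OF d]
      by (subst ksign_sum_left, subst ksign_sum_right) (simp add: prod.cartesian_product case_prod_beta)
  qed
  finally show ?thesis .
qed

section \<open>Multilinear maps\<close>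

locale dg_vect_space =
  fixes V :: "('k::field_char_0, 'v::ab_group_add) dg_vect"
  assumes dg: "dg_vector_space V"
begin

sublocale vs: vector_space "vscale V"
  using dg by (simp add: dg_vector_space_def)

abbreviation scl (infixr "\<cdot>" 75) where "scl \<equiv> vscale V"
abbreviation S where "S \<equiv> vsign V"
abbreviation d where "d \<equiv> vdif V"
abbreviation h where "h \<equiv> vhcomp V"

lemma vlinear_simps:
  assumes "vlinear V f"
  shows "f (x + y) = f x + f y" "f (c \<cdot> x) = c \<cdot> f x" "f 0 = 0" "f (- x) = - f x"
    "f (x - y) = f x - f y" "f (sum g A) = (\<Sum>a\<in>A. f (g a))"
proof -
  interpret f: Vector_Spaces.linear "vscale V" "vscale V" f by fact
  show "f (x + y) = f x + f y" "f (c \<cdot> x) = c \<cdot> f x" "f 0 = 0" "f (- x) = - f x"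
    "f (x - y) = f x - f y" "f (sum g A) = (\<Sum>a\<in>A. f (g a))"
    by (rule f.add f.scale f.zero f.neg f.diff f.sum)+
qed

lemma vlinearI:
  "(\<And>x y. f (x + y) = f x + f y) \<Longrightarrow> (\<And>c x. f (c \<cdot> x) = c \<cdot> f x) \<Longrightarrow> vlinear V f"
  by (simp add: Vector_Spaces.linear_iff vs.vector_space_axioms)

lemma h_linear: "vlinear V (h p)" and d_linear: "vlinear V d"
  using dg by (auto simp: dg_vector_space_def)

lemma S_linear: "vlinear V S"
  by (rule vlinearI)
    (simp_all add: vsign_def vlinear_simps[OF h_linear] vs.scale_right_diff_distrib)

lemmas h_simps [simp] = vlinear_simps[OF h_linear]
lemmas d_simps [simp] = vlinear_simps[OF d_linear]
lemmas S_simps [simp] = vlinear_simps[OF S_linear]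

lemma h_h [simp]: "h p (h q v) = (if p = q then h p v else 0)"
  and h_sum: "h 0 v + h 1 v = v"
  and h_d: "h (p + 1) (d v) = d (h p v)"
  and d_d [simp]: "d (d v) = 0"
  using dg by (auto simp: dg_vector_space_def)

lemma S_S [simp]: "S (S v) = v"
  using h_sum[of v] by (simp add: vsign_def)

lemma S_d: "S (d v) = - d (S v)"
  using h_d[of 1 v] h_d[of 0 v] by (simp add: vsign_def)

lemma S_h [simp]: "S (h p v) = ksign 1 p \<cdot> h p v"
  using bit_cases[of p] by (auto simp: vsign_def)

lemma h_S: "h p (S v) = S (h p v)"
  using bit_cases[of p] by (auto simp: vsign_def)

lemma two_halves [simp]: "(1 / 2) \<cdot> v + (1 / 2) \<cdot> v = v"
  by (simp flip: vs.scale_left_distrib)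

lemma homogeneous_iff_S: "h p v = v \<longleftrightarrow> S v = ksign 1 p \<cdot> v"
proof
  assume "S v = ksign 1 p \<cdot> v"
  moreover have "h 0 v + h 1 v + S v = h 0 v + h 0 v" "h 0 v + h 1 v - S v = h 1 v + h 1 v"
    by (simp_all add: vsign_def)
  then have "h 0 v = (1 / 2) \<cdot> (v + S v)" "h 1 v = (1 / 2) \<cdot> (v - S v)"
    by (simp_all only: h_sum vs.scale_right_distrib two_halves)
  ultimately show "h p v = v"
    using bit_cases[of p] by (auto simp: vs.scale_right_distrib)
qed (metis S_h)

text \<open>
  The Koszul rule for moving an operator of parity \<open>p\<close> past a vector.
\<close>

definition Spow :: "bit \<Rightarrow> 'v \<Rightarrow> 'v" where
  "Spow p v = (if p = 1 then S v else v)"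

lemma Spow_0 [simp]: "Spow 0 v = v" and Spow_1 [simp]: "Spow 1 v = S v"
  by (simp_all add: Spow_def)

lemma Spow_linear: "vlinear V (Spow p)"
  using bit_cases[of p] by (auto intro: vlinearI)

lemmas Spow_simps [simp] = vlinear_simps[OF Spow_linear]

lemma Spow_Spow: "Spow p (Spow q v) = Spow (p + q) v"
  using bit_cases[of p] bit_cases[of q] by auto

lemma Spow_S: "Spow p (S v) = S (Spow p v)"
  using bit_cases[of p] by auto

lemma Spow_homogeneous: "h q v = v \<Longrightarrow> Spow p v = ksign p q \<cdot> v"
  using bit_cases[of p] homogeneous_iff_S[of q v] by auto

lemma map_Spow_0 [simp]: "map (Spow 0) vs = vs"
  by (simp add: map_idI)

lemma map_Spow_map_Spow: "map (Spow p) (map (Spow q) vs) = map (Spow (p + q)) vs"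
  by (simp add: Spow_Spow)

subsection \<open>Slotwise linearity\<close>

definition slotwise_linear :: "nat \<Rightarrow> ('v list \<Rightarrow> 'v) \<Rightarrow> bool" where
  "slotwise_linear n F \<longleftrightarrow> (\<forall>us ws. Suc (length us + length ws) = n \<longrightarrow> vlinear V (\<lambda>v. F (us @ v # ws)))"

lemma multilinear_iff:
  "\<phi> \<in> multilinear V n \<longleftrightarrow> slotwise_linear n \<phi> \<and> (\<forall>vs. length vs \<noteq> n \<longrightarrow> \<phi> vs = 0)"
proof -
  have "(\<forall>vs j. length vs = n \<and> j < n \<longrightarrow> vlinear V (\<lambda>v. \<phi> (vs[j := v]))) \<longleftrightarrow> slotwise_linear n \<phi>"
  proof (intro iffI allI impI)
    fix vs :: "'v list" and j assume *: "slotwise_linear n \<phi>" "length vs = n \<and> j < n"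
    then show "vlinear V (\<lambda>v. \<phi> (vs[j := v]))"
      by (simp add: upd_conv_take_nth_drop slotwise_linear_def)
  next
    assume *: "\<forall>vs j. length vs = n \<and> j < n \<longrightarrow> vlinear V (\<lambda>v. \<phi> (vs[j := v]))"
    show "slotwise_linear n \<phi>"
      unfolding slotwise_linear_def
    proof (intro allI impI)
      fix us ws :: "'v list" assume "Suc (length us + length ws) = n"
      then show "vlinear V (\<lambda>v. \<phi> (us @ v # ws))"
        using *[rule_format, of "us @ 0 # ws" "length us"] by simp
    qed
  qed
  then show ?thesis by (auto simp: multilinear_def)
qed

lemma slotwise_linear_slot:
  "slotwise_linear n F \<Longrightarrow> Suc (length us + length ws) = n \<Longrightarrow> vlinear V (\<lambda>v. F (us @ v # ws))"
  by (simp add: slotwise_linear_def)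

lemmas slot_simps = slotwise_linear_slot[THEN vlinear_simps(1)] slotwise_linear_slot[THEN vlinear_simps(2)]
  slotwise_linear_slot[THEN vlinear_simps(3)] slotwise_linear_slot[THEN vlinear_simps(4)]
  slotwise_linear_slot[THEN vlinear_simps(5)] slotwise_linear_slot[THEN vlinear_simps(6)]

lemma slotwise_linearI:
  assumes "\<And>us ws x y. Suc (length us + length ws) = n \<Longrightarrow> F (us @ (x + y) # ws) = F (us @ x # ws) + F (us @ y # ws)"
    and "\<And>us ws c x. Suc (length us + length ws) = n \<Longrightarrow> F (us @ (c \<cdot> x) # ws) = c \<cdot> F (us @ x # ws)"
  shows "slotwise_linear n F"
  unfolding slotwise_linear_def by (auto intro!: vlinearI simp: assms)

lemma slotwise_linear_part:
  "slotwise_linear n F \<Longrightarrow> length us + k + length ws = n \<Longrightarrow> slotwise_linear k (\<lambda>l. F (us @ l @ ws))"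
  by (rule slotwise_linearI) (use slot_simps(1,2)[of n F "us @ _" "_ @ ws"] in auto)

lemma slotwise_linear_left:
  "slotwise_linear n F \<Longrightarrow> k + length ws = n \<Longrightarrow> slotwise_linear k (\<lambda>l. F (l @ ws))"
  using slotwise_linear_part[of n F "[]" k ws] by simp

lemma slotwise_linear_Cons:
  "slotwise_linear (Suc n) F \<Longrightarrow> slotwise_linear n (\<lambda>l. F (v # l))"
  using slotwise_linear_part[of "Suc n" F "[v]" n "[]"] by simp

lemma slotwise_linear_map:
  "slotwise_linear n F \<Longrightarrow> vlinear V g \<Longrightarrow> slotwise_linear n (\<lambda>l. F (map g l))"
  by (rule slotwise_linearI) (simp_all add: vlinear_simps slot_simps)

lemma slotwise_linear_compose:
  "slotwise_linear n F \<Longrightarrow> vlinear V g \<Longrightarrow> slotwise_linear n (\<lambda>l. g (F l))"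
  by (rule slotwise_linearI) (simp_all add: vlinear_simps slot_simps)

lemma slotwise_linear_add:
  "slotwise_linear n F \<Longrightarrow> slotwise_linear n G \<Longrightarrow> slotwise_linear n (\<lambda>l. F l + G l)"
  by (rule slotwise_linearI) (simp_all add: slot_simps vs.scale_right_distrib)

lemma slotwise_linear_scale: "slotwise_linear n F \<Longrightarrow> slotwise_linear n (\<lambda>l. c \<cdot> F l)"
  by (rule slotwise_linearI) (simp_all add: slot_simps vs.scale_right_distrib mult.commute)

lemma slotwise_linear_zero: "slotwise_linear n (\<lambda>l. 0)"
  by (rule slotwise_linearI) simp_all

abbreviation homogeneous_list :: "bit list \<Rightarrow> 'v list \<Rightarrow> bool" where
  "homogeneous_list \<equiv> list_all2 (\<lambda>p v. h p v = v)"

text \<open>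
  Multilinear maps are determined by their values on homogeneous vectors, where Koszul signs become scalars.
\<close>

lemma slotwise_linear_eqI:
  assumes F: "slotwise_linear n F" and G: "slotwise_linear n G"
    and eq: "\<And>ps vs. length vs = n \<Longrightarrow> homogeneous_list ps vs \<Longrightarrow> F vs = G vs"
    and vs: "length vs = n"
  shows "F vs = G vs"
proof -
  have "F (us @ ws) = G (us @ ws)" if "homogeneous_list ps ws" "length us + length ws = n" for us ps ws
    using that
  proof (induction us arbitrary: ps ws rule: rev_induct)
    case (snoc u us)
    have hom: "homogeneous_list (q # ps) (h q u # ws)" for q using snoc by simp
    have "F (us @ h q u # ws) = G (us @ h q u # ws)" for q
      using snoc.IH[OF hom] snoc.prems by simp
    then have "F (us @ (h 0 u + h 1 u) # ws) = G (us @ (h 0 u + h 1 u) # ws)"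
      using snoc.prems by (simp only: slot_simps[OF F] slot_simps[OF G] length_append list.size)
    then show ?case unfolding h_sum by simp
  qed (use eq in auto)
  from this[of "[]" "[]" vs] show ?thesis using vs by simp
qed

lemma slotwise_Spow_homogeneous:
  assumes F: "slotwise_linear n F" and "homogeneous_list ps us" "length l + length us + length r = n"
  shows "F (l @ map (Spow q) us @ r) = ksign q (sum_list ps) \<cdot> F (l @ us @ r)"
  using assms(2,3)
proof (induction ps us arbitrary: l rule: list_all2_induct)
  case (Cons p ps u us)
  have "F (l @ map (Spow q) (u # us) @ r) = F ((l @ [ksign q p \<cdot> u]) @ map (Spow q) us @ r)"
    using Cons by (simp add: Spow_homogeneous)
  also have "\<dots> = ksign q (sum_list ps) \<cdot> F (l @ (ksign q p \<cdot> u) # us @ r)"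
    using Cons.IH[of "l @ [ksign q p \<cdot> u]"] Cons.prems by simp
  also have "\<dots> = ksign q (sum_list (p # ps)) \<cdot> F (l @ u # us @ r)"
    using Cons.prems by (simp add: slot_simps[OF F] ksign_add_right mult.commute del: add_bit_eq_xor)
  finally show ?case by simp
qed simp

subsection \<open>The sum over the slots in the differential\<close>

text \<open>
  The differential of a tensor $v_1 \otimes \dots \otimes v_n$, followed by \<open>F\<close>.
\<close>

definition dsum :: "('v list \<Rightarrow> 'v) \<Rightarrow> 'v list \<Rightarrow> 'v" where
  "dsum F vs = (\<Sum>j<length vs. F (map S (take j vs) @ d (vs ! j) # drop (Suc j) vs))"

lemma dsum_Nil [simp]: "dsum F [] = 0"
  by (simp add: dsum_def)

lemma dsum_Cons [simp]: "dsum F (v # vs) = F (d v # vs) + dsum (\<lambda>l. F (S v # l)) vs"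
  by (simp add: dsum_def sum.lessThan_Suc_shift del: sum.lessThan_Suc)

lemma dsum_append: "dsum F (us @ ws) = dsum (\<lambda>l. F (l @ ws)) us + dsum (\<lambda>l. F (map S us @ l)) ws"
  by (induction us arbitrary: F) (simp_all add: add.assoc)

lemma dsum_cong: "(\<And>l. length l = length vs \<Longrightarrow> F l = G l) \<Longrightarrow> dsum F vs = dsum G vs"
  by (simp add: dsum_def)

lemma dsum_add: "dsum (\<lambda>l. F l + G l) vs = dsum F vs + dsum G vs"
  by (simp add: dsum_def sum.distrib)

lemma dsum_diff: "dsum (\<lambda>l. F l - G l) vs = dsum F vs - dsum G vs"
  by (simp add: dsum_def sum_subtractf)

lemma dsum_linear: "vlinear V g \<Longrightarrow> dsum (\<lambda>l. g (F l)) vs = g (dsum F vs)"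
  by (simp add: dsum_def vlinear_simps)

lemma scale_linear: "vlinear V (\<lambda>v. c \<cdot> v)"
  by (rule vlinearI) (simp_all add: vs.scale_right_distrib mult.commute)

lemma uminus_linear: "vlinear V uminus"
  by (rule vlinearI) simp_all

lemmas dsum_scale = dsum_linear[OF scale_linear]
lemmas dsum_neg = dsum_linear[OF uminus_linear]

lemma dsum_map_S:
  assumes F: "slotwise_linear (length vs) F"
  shows "dsum F (map S vs) = - dsum (\<lambda>l. F (map S l)) vs"
proof -
  have "F (map S (take j (map S vs)) @ d (map S vs ! j) # drop (Suc j) (map S vs)) =
    - F (map S (map S (take j vs) @ d (vs ! j) # drop (Suc j) vs))" if "j < length vs" for j
    using that by (simp add: take_map drop_map S_d slot_simps[OF F])
  then show ?thesis by (simp add: dsum_def sum_negf)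
qed

lemma dsum_map_Spow:
  assumes F: "slotwise_linear (length vs) F"
  shows "dsum F (map (Spow p) vs) = ksign 1 p \<cdot> dsum (\<lambda>l. F (map (Spow p) l)) vs"
  using bit_cases[of p] dsum_map_S[OF F] by (auto cong: map_cong)

text \<open>
  The differential of a tensor product squares to zero: the two orders of applying $d$ in different slots
  differ by a sign.
\<close>

lemma dsum_dsum:
  "slotwise_linear (length vs) F \<Longrightarrow> dsum (dsum F) vs = 0"
proof (induction vs arbitrary: F)
  case (Cons v vs)
  have F: "slotwise_linear (Suc (length vs)) F" using Cons.prems by simp
  have neg: "F (S (d v) # l) = - F (d (S v) # l)" if "length l = length vs" for l
    using slot_simps(4)[OF F, of "[]" l "d (S v)"] that by (simp add: S_d)
  have "dsum (\<lambda>l. F (S (d v) # l)) vs = - dsum (\<lambda>l. F (d (S v) # l)) vs"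
    by (subst dsum_neg[symmetric]) (rule dsum_cong, rule neg)
  moreover have "F (0 # vs) = 0" using slot_simps(3)[OF F, of "[]" vs] by simp
  moreover have "dsum (dsum (\<lambda>l'. F (v # l'))) vs = 0"
    by (rule Cons.IH[OF slotwise_linear_Cons[OF F]])
  ultimately show ?case by (simp add: dsum_add)
qed simp

lemma slotwise_linear_dsum:
  assumes F: "slotwise_linear n F"
  shows "slotwise_linear n (dsum F)"
proof (rule slotwise_linearI)
  fix us ws :: "'v list" and x y :: 'v assume n: "Suc (length us + length ws) = n"
  have 1: "dsum (\<lambda>l. F (l @ (x + y) # ws)) us = dsum (\<lambda>l. F (l @ x # ws)) us + dsum (\<lambda>l. F (l @ y # ws)) us"
    unfolding dsum_add[symmetric] by (rule dsum_cong) (use n in \<open>simp add: slot_simps[OF F]\<close>)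
  have 2: "dsum (\<lambda>l. F (map S us @ S (x + y) # l)) ws =
    dsum (\<lambda>l. F (map S us @ S x # l)) ws + dsum (\<lambda>l. F (map S us @ S y # l)) ws"
    unfolding dsum_add[symmetric] by (rule dsum_cong) (use n in \<open>simp add: slot_simps[OF F]\<close>)
  show "dsum F (us @ (x + y) # ws) = dsum F (us @ x # ws) + dsum F (us @ y # ws)"
    unfolding dsum_append dsum_Cons 1 2 using n by (simp add: slot_simps[OF F])
next
  fix us ws :: "'v list" and x :: 'v and c assume n: "Suc (length us + length ws) = n"
  have 1: "dsum (\<lambda>l. F (l @ (c \<cdot> x) # ws)) us = c \<cdot> dsum (\<lambda>l. F (l @ x # ws)) us"
    unfolding dsum_scale[symmetric] by (rule dsum_cong) (use n in \<open>simp add: slot_simps[OF F]\<close>)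
  have 2: "dsum (\<lambda>l. F (map S us @ S (c \<cdot> x) # l)) ws = c \<cdot> dsum (\<lambda>l. F (map S us @ S x # l)) ws"
    unfolding dsum_scale[symmetric] by (rule dsum_cong) (use n in \<open>simp add: slot_simps[OF F]\<close>)
  show "dsum F (us @ (c \<cdot> x) # ws) = c \<cdot> dsum F (us @ x # ws)"
    unfolding dsum_append dsum_Cons 1 2 using n by (simp add: slot_simps[OF F] vs.scale_right_distrib)
qed

lemma end_dif_eq: "end_dif V \<phi> vs = d (\<phi> vs) - dsum (end_sign V \<phi>) vs"
  by (simp add: end_dif_def dsum_def)

section \<open>The endomorphism operad is a dg operad\<close>

subsection \<open>The spaces of operations\<close>

lemma multilinearD: "\<phi> \<in> multilinear V n \<Longrightarrow> slotwise_linear n \<phi>"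
  and multilinear_length: "\<phi> \<in> multilinear V n \<Longrightarrow> length vs \<noteq> n \<Longrightarrow> \<phi> vs = 0"
  by (auto simp: multilinear_iff)

lemma multilinearI:
  "slotwise_linear n \<phi> \<Longrightarrow> (\<And>vs. length vs \<noteq> n \<Longrightarrow> \<phi> vs = 0) \<Longrightarrow> \<phi> \<in> multilinear V n"
  by (auto simp: multilinear_iff)

lemma multilinear_eqI:
  assumes "\<phi> \<in> multilinear V n" "\<psi> \<in> multilinear V n"
    and "\<And>ps vs. length vs = n \<Longrightarrow> homogeneous_list ps vs \<Longrightarrow> \<phi> vs = \<psi> vs"
  shows "\<phi> = \<psi>"
proof
  fix vs show "\<phi> vs = \<psi> vs"
    using slotwise_linear_eqI[OF multilinearD[OF assms(1)] multilinearD[OF assms(2)] assms(3)]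
      multilinear_length[OF assms(1)] multilinear_length[OF assms(2)]
    by (cases "length vs = n") auto
qed

lemma multilinear_zero: "(\<lambda>vs. 0) \<in> multilinear V n"
  by (auto intro!: multilinearI slotwise_linear_zero)

lemma multilinear_add:
  "\<phi> \<in> multilinear V n \<Longrightarrow> \<psi> \<in> multilinear V n \<Longrightarrow> (\<lambda>vs. \<phi> vs + \<psi> vs) \<in> multilinear V n"
  by (auto intro!: multilinearI slotwise_linear_add dest: multilinearD simp: multilinear_length[of _ n])

lemma multilinear_scale: "\<phi> \<in> multilinear V n \<Longrightarrow> (\<lambda>vs. c \<cdot> \<phi> vs) \<in> multilinear V n"
  by (auto intro!: multilinearI slotwise_linear_scale dest: multilinearD simp: multilinear_length[of _ n])

lemma multilinear_sign: "\<phi> \<in> multilinear V n \<Longrightarrow> end_sign V \<phi> \<in> multilinear V n"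
  unfolding end_sign_def[abs_def]
  by (auto intro!: multilinearI slotwise_linear_compose[OF _ S_linear] slotwise_linear_map[OF _ S_linear]
      dest: multilinearD simp: multilinear_length[of _ n])

lemma end_sign_end_sign [simp]: "end_sign V (end_sign V \<phi>) = \<phi>"
  by (simp add: end_sign_def fun_eq_iff o_def)

lemma end_sign_add: "end_sign V (\<lambda>vs. \<phi> vs + \<psi> vs) = (\<lambda>vs. end_sign V \<phi> vs + end_sign V \<psi> vs)"
  and end_sign_scale: "end_sign V (\<lambda>vs. c \<cdot> \<phi> vs) = (\<lambda>vs. c \<cdot> end_sign V \<phi> vs)"
  by (simp_all add: end_sign_def fun_eq_iff)

lemma end_hcomp_eq: "end_hcomp V p \<phi> vs = (1 / 2) \<cdot> (\<phi> vs + ksign 1 p \<cdot> end_sign V \<phi> vs)"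
  using bit_cases[of p] by (auto simp: end_hcomp_def)

lemma multilinear_hcomp: "\<phi> \<in> multilinear V n \<Longrightarrow> end_hcomp V p \<phi> \<in> multilinear V n"
  unfolding end_hcomp_eq[abs_def] by (intro multilinear_scale multilinear_add multilinear_sign)

lemma multilinear_dif:
  assumes "\<phi> \<in> multilinear V n"
  shows "end_dif V \<phi> \<in> multilinear V n"
proof (rule multilinearI)
  have "slotwise_linear n (\<lambda>vs. d (\<phi> vs) + (-1) \<cdot> dsum (end_sign V \<phi>) vs)"
    using assms by (intro slotwise_linear_add slotwise_linear_scale slotwise_linear_dsum
        slotwise_linear_compose[OF _ d_linear] multilinearD multilinear_sign)
  then show "slotwise_linear n (end_dif V \<phi>)"
    by (simp add: end_dif_eq[abs_def])
next
  fix vs :: "'v list" assume vs: "length vs \<noteq> n"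
  have "dsum (end_sign V \<phi>) vs = dsum (\<lambda>l. 0) vs"
    using multilinear_length[OF multilinear_sign[OF assms]] vs by (intro dsum_cong) simp
  then show "end_dif V \<phi> vs = 0"
    using multilinear_length[OF assms vs] by (simp add: end_dif_eq dsum_def)
qed

lemma end_sign_dif:
  assumes "\<phi> \<in> multilinear V n"
  shows "end_sign V (end_dif V \<phi>) = (\<lambda>vs. - end_dif V (end_sign V \<phi>) vs)"
proof
  fix vs
  show "end_sign V (end_dif V \<phi>) vs = - end_dif V (end_sign V \<phi>) vs"
  proof (cases "length vs = n")
    case True
    have "slotwise_linear (length vs) (end_sign V \<phi>)"
      using multilinearD[OF multilinear_sign[OF assms]] True by simp
    note ds = dsum_map_S[OF this]
    have "S (dsum (\<lambda>l. end_sign V \<phi> (map S l)) vs) = dsum \<phi> vs"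
      by (subst dsum_linear[OF S_linear, symmetric]) (simp add: end_sign_def o_def)
    then show ?thesis
      unfolding end_sign_def[of V "end_dif V \<phi>"] end_dif_eq ds
      by (simp add: S_d end_sign_def[of V \<phi> vs])
  next
    case False
    then show ?thesis
      using multilinear_length[OF multilinear_dif[OF multilinear_sign[OF assms]]]
        multilinear_length[OF multilinear_sign[OF multilinear_dif[OF assms]]] by simp
  qed
qed

lemma end_dif_dif:
  assumes "\<phi> \<in> multilinear V n"
  shows "end_dif V (end_dif V \<phi>) = (\<lambda>vs. 0)"
proof
  fix vs
  show "end_dif V (end_dif V \<phi>) vs = 0"
  proof (cases "length vs = n")
    case True
    have "dsum (end_sign V (end_dif V \<phi>)) vs =
      dsum (\<lambda>l. - d (end_sign V \<phi> l) + dsum \<phi> l) vs"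
      by (simp add: end_sign_dif[OF assms] end_dif_eq)
    also have "\<dots> = - d (dsum (end_sign V \<phi>) vs)"
      using dsum_dsum[of vs \<phi>] multilinearD[OF assms] True
      by (simp add: dsum_diff dsum_linear[OF d_linear])
    finally show ?thesis by (simp add: end_dif_eq[of "end_dif V \<phi>"]) (simp add: end_dif_eq)
  next
    case False
    then show ?thesis by (rule multilinear_length[OF multilinear_dif[OF multilinear_dif[OF assms]]])
  qed
qed

lemma end_dif_add: "end_dif V (\<lambda>vs. \<phi> vs + \<psi> vs) = (\<lambda>vs. end_dif V \<phi> vs + end_dif V \<psi> vs)"
  by (simp add: fun_eq_iff end_dif_eq end_sign_add dsum_add)

lemma end_dif_scale: "end_dif V (\<lambda>vs. c \<cdot> \<phi> vs) = (\<lambda>vs. c \<cdot> end_dif V \<phi> vs)"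
  by (simp add: fun_eq_iff end_dif_eq end_sign_scale dsum_scale vs.scale_right_diff_distrib)

lemma Sp_End [simp]:
  "carrier (Sp (End_operad V) n) = multilinear V n"
  "zero (Sp (End_operad V) n) = (\<lambda>vs. 0)"
  "add (Sp (End_operad V) n) \<phi> \<psi> = (\<lambda>vs. \<phi> vs + \<psi> vs)"
  "c \<odot>\<^bsub>Sp (End_operad V) n\<^esub> \<phi> = (\<lambda>vs. c \<cdot> \<phi> vs)"
  "hcomp (Sp (End_operad V) n) = end_hcomp V"
  "dif (Sp (End_operad V) n) = end_dif V"
  "act (End_operad V) = end_act V"
  "pcomp (End_operad V) = end_pcomp V"
  "ounit (End_operad V) = unary id"
  by (simp_all add: End_operad_def mk_dg_space_def)

text \<open>\<open>parity p \<phi>\<close> is homogeneity of degree \<open>p\<close>, expressed through the sign operator.\<close>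

definition parity :: "bit \<Rightarrow> ('v list \<Rightarrow> 'v) \<Rightarrow> bool" where
  "parity p \<phi> \<longleftrightarrow> end_sign V \<phi> = (\<lambda>vs. ksign 1 p \<cdot> \<phi> vs)"

lemma end_hcomp_sum: "end_hcomp V 0 \<phi> vs + end_hcomp V 1 \<phi> vs = \<phi> vs"
  by (simp add: end_hcomp_eq flip: vs.scale_right_distrib) (simp add: vs.scale_right_distrib)

lemma end_hcomp_parity: "parity p \<phi> \<Longrightarrow> end_hcomp V q \<phi> = (if p = q then \<phi> else (\<lambda>vs. 0))"
  using bit_cases[of p] bit_cases[of q] by (auto simp: fun_eq_iff end_hcomp_eq parity_def vs.scale_right_distrib)

lemma parity_end_hcomp: "parity p (end_hcomp V p \<phi>)"
  using bit_cases[of p]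
  by (auto simp: parity_def end_hcomp_eq[abs_def] end_sign_scale end_sign_add fun_eq_iff
      vs.scale_right_distrib vs.scale_right_diff_distrib end_sign_def o_def)

lemma homogeneous_End:
  "\<phi> \<in> homogeneous (Sp (End_operad V) n) p \<longleftrightarrow> \<phi> \<in> multilinear V n \<and> parity p \<phi>"
  using end_hcomp_parity[of p \<phi> p] parity_end_hcomp[of p \<phi>] by (auto simp: homogeneous_def)

lemma gsign_End [simp]: "gsign (Sp (End_operad V) n) \<phi> = end_sign V \<phi>"
proof
  fix vs
  have "(1 / 2) \<cdot> (x + y) - (1 / 2) \<cdot> (x - y) = y" for x y
    by (simp add: vs.scale_right_distrib vs.scale_right_diff_distrib)
  then show "gsign (Sp (End_operad V) n) \<phi> vs = end_sign V \<phi> vs"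
    by (simp add: gsign_def end_hcomp_eq)
qed

lemma multilinear_homogeneous_induct [consumes 1, case_names homogeneous add]:
  assumes "\<phi> \<in> multilinear V n"
    and hom: "\<And>p \<psi>. \<psi> \<in> multilinear V n \<Longrightarrow> parity p \<psi> \<Longrightarrow> Q \<psi>"
    and add: "\<And>\<psi> \<chi>. \<psi> \<in> multilinear V n \<Longrightarrow> \<chi> \<in> multilinear V n \<Longrightarrow> Q \<psi> \<Longrightarrow> Q \<chi> \<Longrightarrow> Q (\<lambda>vs. \<psi> vs + \<chi> vs)"
  shows "Q \<phi>"
proof -
  have "Q (\<lambda>vs. end_hcomp V 0 \<phi> vs + end_hcomp V 1 \<phi> vs)"
    by (intro add hom[OF _ parity_end_hcomp] multilinear_hcomp assms(1))
  then show ?thesis by (simp add: end_hcomp_sum)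
qed

lemma module_End: "Module.module (ring_of_type_algebra :: 'k ring) (Sp (End_operad V) n)"
proof (rule moduleI)
  show "cring (ring_of_type_algebra :: 'k ring)" by (rule cring_from_type_algebra)
  show "abelian_group (Sp (End_operad V) n)"
  proof (rule abelian_groupI)
    fix \<phi> assume \<phi>: "\<phi> \<in> carrier (Sp (End_operad V) n)"
    show "\<exists>\<psi>\<in>carrier (Sp (End_operad V) n). \<psi> \<oplus>\<^bsub>Sp (End_operad V) n\<^esub> \<phi> = \<zero>\<^bsub>Sp (End_operad V) n\<^esub>"
      using \<phi> by (intro bexI[of _ "\<lambda>vs. - \<phi> vs"]) (auto dest: multilinear_scale[of _ _ "-1"])
  qed (auto intro: multilinear_add multilinear_zero simp: add_ac)
qed (auto intro: multilinear_scale simp: ring_of_type_algebra_def vs.scale_right_distrib vs.scale_left_distrib)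

lemma dg_space_End: "dg_space (Sp (End_operad V) n)"
proof (intro dg_space.intro dg_space_axioms.intro module_End)
  fix p show "linear_map (Sp (End_operad V) n) (Sp (End_operad V) n) (hcomp (Sp (End_operad V) n) p)"
    by (auto simp: linear_map_def multilinear_hcomp fun_eq_iff end_hcomp_eq end_sign_add end_sign_scale
        vs.scale_right_distrib mult_ac)
next
  show "linear_map (Sp (End_operad V) n) (Sp (End_operad V) n) (dif (Sp (End_operad V) n))"
    by (auto simp: linear_map_def multilinear_dif end_dif_add end_dif_scale)
next
  fix x p q assume "x \<in> carrier (Sp (End_operad V) n)"
  show "hcomp (Sp (End_operad V) n) p (hcomp (Sp (End_operad V) n) q x) =
    (if p = q then hcomp (Sp (End_operad V) n) p x else \<zero>\<^bsub>Sp (End_operad V) n\<^esub>)"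
    using end_hcomp_parity[OF parity_end_hcomp[of q x], of p] by auto
next
  fix x p assume x: "x \<in> carrier (Sp (End_operad V) n)"
  show "hcomp (Sp (End_operad V) n) (p + 1) (dif (Sp (End_operad V) n) x) =
    dif (Sp (End_operad V) n) (hcomp (Sp (End_operad V) n) p x)"
    using x bit_cases[of p]
    by (auto simp: fun_eq_iff end_hcomp_eq[abs_def] end_sign_dif end_dif_add end_dif_scale)
qed (auto simp: end_hcomp_sum end_dif_dif)

end

subsection \<open>Partial compositions\<close>

context dg_vect_space
begin

lemma block_split:
  assumes "length vs = m + n - 1" "l < m" "n \<ge> 1"
  obtains us xs ws where "vs = us @ xs @ ws" "length us = l" "length xs = n" "Suc (l + length ws) = m"
proof
  show "vs = take l vs @ take n (drop l vs) @ drop n (drop l vs)" by (simp del: drop_drop)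
qed (use assms in auto)

lemma end_pcomp_block:
  assumes "length us = l" "length xs = n" "Suc (l + length ws) = m"
  shows "end_pcomp V m n (Suc l) \<phi> \<psi> (us @ xs @ ws) =
    \<phi> (us @ end_hcomp V 0 \<psi> xs # ws) + \<phi> (map S us @ end_hcomp V 1 \<psi> xs # ws)"
  using assms by (auto simp: end_pcomp_def Let_def)

text \<open>
  For homogeneous \<open>\<psi>\<close> only one of the two summands of the composition survives, and its sign is the one for
  moving \<open>\<psi>\<close> past the inputs to its left.
\<close>

lemma end_pcomp_parity:
  assumes \<phi>: "slotwise_linear m \<phi>" and \<psi>: "parity p \<psi>"
    and l: "length us = l" "length xs = n" "Suc (l + length ws) = m"
  shows "end_pcomp V m n (Suc l) \<phi> \<psi> (us @ xs @ ws) = \<phi> (map (Spow p) us @ \<psi> xs # ws)"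
  using l bit_cases[of p] unfolding end_pcomp_block[OF l] end_hcomp_parity[OF \<psi>]
  by (auto simp: slot_simps[OF \<phi>] cong: map_cong)

lemma end_pcomp_length: "length vs \<noteq> m + n - 1 \<Longrightarrow> end_pcomp V m n i \<phi> \<psi> vs = 0"
  by (simp add: end_pcomp_def)

lemma end_hcomp_add: "end_hcomp V p (\<lambda>vs. \<phi> vs + \<psi> vs) vs = end_hcomp V p \<phi> vs + end_hcomp V p \<psi> vs"
  and end_hcomp_scale: "end_hcomp V p (\<lambda>vs. c \<cdot> \<phi> vs) vs = c \<cdot> end_hcomp V p \<phi> vs"
  by (simp_all add: end_hcomp_eq end_sign_add end_sign_scale vs.scale_right_distrib mult_ac)

lemma end_pcomp_add_left:
  "end_pcomp V m n i (\<lambda>vs. \<phi> vs + \<phi>' vs) \<psi> = (\<lambda>vs. end_pcomp V m n i \<phi> \<psi> vs + end_pcomp V m n i \<phi>' \<psi> vs)"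
  and end_pcomp_scale_left:
  "end_pcomp V m n i (\<lambda>vs. c \<cdot> \<phi> vs) \<psi> = (\<lambda>vs. c \<cdot> end_pcomp V m n i \<phi> \<psi> vs)"
  by (auto simp: fun_eq_iff end_pcomp_def Let_def vs.scale_right_distrib)

lemma end_pcomp_eqI:
  assumes "n \<ge> 1" "l < m"
    and "\<And>vs. length vs \<noteq> m + n - 1 \<Longrightarrow> F vs = 0" "\<And>vs. length vs \<noteq> m + n - 1 \<Longrightarrow> G vs = (0 :: 'v)"
    and "\<And>us xs ws. length us = l \<Longrightarrow> length xs = n \<Longrightarrow> Suc (l + length ws) = m \<Longrightarrow>
      F (us @ xs @ ws) = G (us @ xs @ ws)"
  shows "F = G"
proof
  fix vs show "F vs = G vs"
  proof (cases "length vs = m + n - 1")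
    case True
    then show ?thesis using block_split[OF True assms(2,1)] assms(5) by metis
  qed (use assms(3,4) in auto)
qed

lemma end_pcomp_add_right:
  assumes \<phi>: "slotwise_linear m \<phi>" and "n \<ge> 1" "l < m"
  shows "end_pcomp V m n (Suc l) \<phi> (\<lambda>vs. \<psi> vs + \<psi>' vs) =
    (\<lambda>vs. end_pcomp V m n (Suc l) \<phi> \<psi> vs + end_pcomp V m n (Suc l) \<phi> \<psi>' vs)"
  by (rule end_pcomp_eqI[OF assms(2,3)])
    (auto simp: end_pcomp_length end_pcomp_block end_hcomp_add slot_simps[OF \<phi>])

lemma end_pcomp_scale_right:
  assumes \<phi>: "slotwise_linear m \<phi>" and "n \<ge> 1" "l < m"
  shows "end_pcomp V m n (Suc l) \<phi> (\<lambda>vs. c \<cdot> \<psi> vs) = (\<lambda>vs. c \<cdot> end_pcomp V m n (Suc l) \<phi> \<psi> vs)"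
  by (rule end_pcomp_eqI[OF assms(2,3)])
    (auto simp: end_pcomp_length end_pcomp_block end_hcomp_scale slot_simps[OF \<phi>] vs.scale_right_distrib)

lemma vlinear_compose: "vlinear V f \<Longrightarrow> vlinear V g \<Longrightarrow> vlinear V (\<lambda>v. f (g v))"
  by (rule vlinearI) (simp_all add: vlinear_simps)

lemma multilinear_pcomp:
  assumes \<phi>: "\<phi> \<in> multilinear V m" and \<psi>: "\<psi> \<in> multilinear V n" and "n \<ge> 1" "l < m"
  shows "end_pcomp V m n (Suc l) \<phi> \<psi> \<in> multilinear V (m + n - 1)"
  using \<psi>
proof (induction rule: multilinear_homogeneous_induct)
  case (homogeneous p \<psi>)
  note \<phi>' = multilinearD[OF \<phi>] and \<psi>' = multilinearD[OF homogeneous(1)]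
  note blk = end_pcomp_parity[OF \<phi>' homogeneous(2)]
  have "slotwise_linear (m + n - 1) (end_pcomp V m n (Suc l) \<phi> \<psi>)"
    unfolding slotwise_linear_def
  proof (intro allI impI)
    fix A B :: "'v list" assume AB: "Suc (length A + length B) = m + n - 1"
    consider "length A < l" | "l \<le> length A" "length A < l + n" | "l + n \<le> length A" by linarith
    then show "vlinear V (\<lambda>v. end_pcomp V m n (Suc l) \<phi> \<psi> (A @ v # B))"
    proof cases
      case 1
      define B1 xs ws where "B1 = take (l - length A - 1) B"
        and "xs = take n (drop (l - length A - 1) B)" and "ws = drop n (drop (l - length A - 1) B)"
      have B: "B = B1 @ xs @ ws" by (simp add: B1_def xs_def ws_def del: drop_drop)
      have len: "Suc (length A + length B1) = l" "length xs = n" "Suc (l + length ws) = m"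
        using 1 AB assms(3,4) by (auto simp: B1_def xs_def ws_def)
      have "end_pcomp V m n (Suc l) \<phi> \<psi> (A @ v # B) =
          \<phi> (map (Spow p) A @ Spow p v # (map (Spow p) B1 @ \<psi> xs # ws))" for v
        using blk[of "A @ v # B1" l xs n ws] len by (simp add: B)
      then show ?thesis
        using len by (simp add: vlinear_compose[OF slotwise_linear_slot[OF \<phi>'] Spow_linear])
    next
      case 2
      define us A1 B1 ws where "us = take l A" and "A1 = drop l A"
        and "B1 = take (l + n - length A - 1) B" and "ws = drop (l + n - length A - 1) B"
      have A: "A = us @ A1" and B: "B = B1 @ ws" by (simp_all add: us_def A1_def B1_def ws_def)
      have len: "length us = l" "Suc (length A1 + length B1) = n" "Suc (l + length ws) = m"
        using 2 AB assms(3,4) by (auto simp: us_def A1_def B1_def ws_def)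
      have "end_pcomp V m n (Suc l) \<phi> \<psi> (A @ v # B) = \<phi> (map (Spow p) us @ \<psi> (A1 @ v # B1) # ws)" for v
        using blk[of us l "A1 @ v # B1" n ws] len by (simp add: A B)
      then show ?thesis
        using len by (simp add: vlinear_compose[OF slotwise_linear_slot[OF \<phi>'] slotwise_linear_slot[OF \<psi>']])
    next
      case 3
      define us xs A1 where "us = take l A" and "xs = take n (drop l A)" and "A1 = drop n (drop l A)"
      have A: "A = us @ xs @ A1" by (simp add: us_def A1_def xs_def del: drop_drop)
      have len: "length us = l" "length xs = n" "Suc (Suc (l + length A1 + length B)) = m"
        using 3 AB assms(3,4) by (auto simp: us_def A1_def xs_def)
      have "end_pcomp V m n (Suc l) \<phi> \<psi> (A @ v # B) = \<phi> ((map (Spow p) us @ \<psi> xs # A1) @ v # B)" for v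
        using blk[of us l xs n "A1 @ v # B"] len by (simp add: A)
      then show ?thesis
        using len by (simp only:) (rule slotwise_linear_slot[OF \<phi>'], simp)
    qed
  qed
  then show ?case by (rule multilinearI) (rule end_pcomp_length)
next
  case (add \<psi> \<chi>)
  then show ?case
    unfolding end_pcomp_add_right[OF multilinearD[OF \<phi>] assms(3,4)] by (intro multilinear_add)
qed

lemma Spow_comp: "Spow p \<circ> Spow q = Spow (p + q)" and Spow_comp_S: "Spow p \<circ> S = Spow (p + 1)"
  using Spow_Spow[of p 1] by (auto simp: Spow_Spow fun_eq_iff simp del: add_bit_eq_xor)

lemma parity_apply: "parity p \<psi> \<Longrightarrow> \<psi> (map S xs) = ksign 1 p \<cdot> S (\<psi> xs)"
  using bit_cases[of p] unfolding parity_def end_sign_def fun_eq_iff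
  by (metis S_S S_simps(2))

lemma end_sign_pcomp:
  assumes \<phi>: "\<phi> \<in> multilinear V m" and \<psi>: "\<psi> \<in> multilinear V n" "parity q \<psi>" and "n \<ge> 1" "l < m"
  shows "end_sign V (end_pcomp V m n (Suc l) \<phi> \<psi>) =
    (\<lambda>vs. ksign 1 q \<cdot> end_pcomp V m n (Suc l) (end_sign V \<phi>) \<psi> vs)"
proof (rule end_pcomp_eqI[OF assms(4,5)])
  fix us xs ws :: "'v list" assume len: "length us = l" "length xs = n" "Suc (l + length ws) = m"
  note \<phi>' = multilinearD[OF \<phi>]
  have "end_sign V (end_pcomp V m n (Suc l) \<phi> \<psi>) (us @ xs @ ws) =
      S (\<phi> (map (Spow q) (map S us) @ \<psi> (map S xs) # map S ws))"
    unfolding end_sign_def map_append using len by (subst end_pcomp_parity[OF \<phi>' \<psi>(2)]) simp_all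
  also have "\<dots> = ksign 1 q \<cdot> end_sign V \<phi> (map (Spow q) us @ \<psi> xs # ws)"
    using len by (simp add: parity_apply[OF \<psi>(2)] slot_simps[OF \<phi>'] end_sign_def Spow_S o_def)
  also have "\<dots> = ksign 1 q \<cdot> end_pcomp V m n (Suc l) (end_sign V \<phi>) \<psi> (us @ xs @ ws)"
    by (subst end_pcomp_parity[OF multilinearD[OF multilinear_sign[OF \<phi>]] \<psi>(2) len]) simp
  finally show "end_sign V (end_pcomp V m n (Suc l) \<phi> \<psi>) (us @ xs @ ws) =
    ksign 1 q \<cdot> end_pcomp V m n (Suc l) (end_sign V \<phi>) \<psi> (us @ xs @ ws)" .
qed (auto simp: end_sign_def end_pcomp_length)

lemma parity_pcomp:
  assumes "\<phi> \<in> multilinear V m" "parity p \<phi>" "\<psi> \<in> multilinear V n" "parity q \<psi>" "n \<ge> 1" "l < m"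
  shows "parity (p + q) (end_pcomp V m n (Suc l) \<phi> \<psi>)"
  unfolding parity_def end_sign_pcomp[OF assms(1,3,4,5,6)]
  by (simp only: assms(2)[unfolded parity_def] end_pcomp_scale_left ksign_add_right vs.scale_scale mult.commute)

lemma parity_dif:
  assumes "\<psi> \<in> multilinear V n" "parity p \<psi>"
  shows "parity (p + 1) (end_dif V \<psi>)"
  unfolding parity_def end_sign_dif[OF assms(1)] assms(2)[unfolded parity_def] end_dif_scale
  by (simp add: ksign_add_right del: add_bit_eq_xor)

lemma end_pcomp_sequential:
  assumes \<phi>: "\<phi> \<in> multilinear V m" and \<psi>: "\<psi> \<in> multilinear V n" and \<chi>: "\<chi> \<in> multilinear V r"
    and l: "l < m" and k: "k < n" and r: "r \<ge> 1"
  shows "end_pcomp V (m + n - 1) r (Suc (l + k)) (end_pcomp V m n (Suc l) \<phi> \<psi>) \<chi> =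
    end_pcomp V m (n + r - 1) (Suc l) \<phi> (end_pcomp V n r (Suc k) \<psi> \<chi>)"
proof -
  note \<phi>' = multilinearD[OF \<phi>]
  have n: "n \<ge> 1" and lk: "l + k < m + n - 1" and nr: "n + r - 1 \<ge> 1" using l k r by auto
  have hom: "end_pcomp V (m + n - 1) r (Suc (l + k)) (end_pcomp V m n (Suc l) \<phi> \<psi>) \<chi> =
      end_pcomp V m (n + r - 1) (Suc l) \<phi> (end_pcomp V n r (Suc k) \<psi> \<chi>)"
    if \<psi>: "\<psi> \<in> multilinear V n" "parity p \<psi>" and \<chi>: "\<chi> \<in> multilinear V r" "parity q \<chi>" for p q \<psi> \<chi>
  proof (rule end_pcomp_eqI[OF nr l])
    fix us ys ws :: "'v list"
    assume len: "length us = l" "length ys = n + r - 1" "Suc (l + length ws) = m"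
    obtain xs zs xs' where ys: "ys = xs @ zs @ xs'" "length xs = k" "length zs = r" "Suc (k + length xs') = n"
      using block_split[OF len(2) k r] .
    have "end_pcomp V (m + n - 1) r (Suc (l + k)) (end_pcomp V m n (Suc l) \<phi> \<psi>) \<chi> ((us @ xs) @ zs @ (xs' @ ws)) =
      end_pcomp V m n (Suc l) \<phi> \<psi> (map (Spow q) (us @ xs) @ \<chi> zs # (xs' @ ws))"
      by (rule end_pcomp_parity[OF multilinearD[OF multilinear_pcomp[OF \<phi> \<psi>(1) n l]] \<chi>(2)])
        (use len ys r in auto)
    also have "\<dots> = end_pcomp V m n (Suc l) \<phi> \<psi> (map (Spow q) us @ (map (Spow q) xs @ \<chi> zs # xs') @ ws)"
      by simp
    also have "\<dots> = \<phi> (map (Spow p) (map (Spow q) us) @ \<psi> (map (Spow q) xs @ \<chi> zs # xs') # ws)"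
      by (rule end_pcomp_parity[OF \<phi>' \<psi>(2)]) (use len ys in auto)
    also have "\<psi> (map (Spow q) xs @ \<chi> zs # xs') = end_pcomp V n r (Suc k) \<psi> \<chi> ys"
      unfolding ys(1) by (rule end_pcomp_parity[OF multilinearD[OF \<psi>(1)] \<chi>(2), symmetric]) (use ys in auto)
    also have "\<phi> (map (Spow p) (map (Spow q) us) @ end_pcomp V n r (Suc k) \<psi> \<chi> ys # ws) =
        end_pcomp V m (n + r - 1) (Suc l) \<phi> (end_pcomp V n r (Suc k) \<psi> \<chi>) (us @ ys @ ws)"
      unfolding map_Spow_map_Spow
      by (rule end_pcomp_parity[OF \<phi>' parity_pcomp[OF \<psi> \<chi> r k] len, symmetric])
    finally show "end_pcomp V (m + n - 1) r (Suc (l + k)) (end_pcomp V m n (Suc l) \<phi> \<psi>) \<chi> (us @ ys @ ws) =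
        end_pcomp V m (n + r - 1) (Suc l) \<phi> (end_pcomp V n r (Suc k) \<psi> \<chi>) (us @ ys @ ws)"
      by (simp add: ys(1))
  qed (use l k r in \<open>auto simp: end_pcomp_length\<close>)
  show ?thesis
    using \<psi>
  proof (induction rule: multilinear_homogeneous_induct)
    case (homogeneous p \<psi>)
    note \<psi>h = homogeneous
    show ?case
      using \<chi>
    proof (induction rule: multilinear_homogeneous_induct)
      case (homogeneous q \<chi>)
      then show ?case by (rule hom[OF \<psi>h])
    next
      case (add \<chi> \<chi>')
      have mp: "slotwise_linear (m + n - 1) (end_pcomp V m n (Suc l) \<phi> \<psi>)"
        by (rule multilinearD[OF multilinear_pcomp[OF \<phi> \<psi>h(1) n l]])
      show ?case
        unfolding end_pcomp_add_right[OF mp r lk] end_pcomp_add_right[OF multilinearD[OF \<psi>h(1)] r k]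
          end_pcomp_add_right[OF \<phi>' nr l] add.IH by simp
    qed
  next
    case (add \<psi> \<psi>')
    show ?case
      unfolding end_pcomp_add_right[OF \<phi>' n l] end_pcomp_add_left
        end_pcomp_add_right[OF \<phi>' nr l] add.IH by simp
  qed
qed

lemma end_pcomp_parallel:
  assumes \<phi>: "\<phi> \<in> multilinear V m" and \<psi>: "\<psi> \<in> multilinear V n" "parity p \<psi>"
    and \<chi>: "\<chi> \<in> multilinear V r" "parity q \<chi>"
    and l: "l < k" and k: "k < m" and n: "n \<ge> 1" and r: "r \<ge> 1"
  shows "end_pcomp V (m + n - 1) r (Suc k + n - 1) (end_pcomp V m n (Suc l) \<phi> \<psi>) \<chi> =
    (\<lambda>vs. ksign p q \<cdot> end_pcomp V (m + r - 1) n (Suc l) (end_pcomp V m r (Suc k) \<phi> \<chi>) \<psi> vs)"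
proof -
  note \<phi>' = multilinearD[OF \<phi>]
  have lm: "l < m" using l k by simp
  have sk: "Suc k + n - 1 = Suc (k + n - 1)" using n by simp
  have kn: "k + n - 1 < m + n - 1" using k n by linarith
  have \<phi>\<psi>: "slotwise_linear (m + n - 1) (end_pcomp V m n (Suc l) \<phi> \<psi>)"
    by (rule multilinearD[OF multilinear_pcomp[OF \<phi> \<psi>(1) n lm]])
  have \<phi>\<chi>: "slotwise_linear (m + r - 1) (end_pcomp V m r (Suc k) \<phi> \<chi>)"
    by (rule multilinearD[OF multilinear_pcomp[OF \<phi> \<chi>(1) r k]])
  show ?thesis
    unfolding sk
  proof (rule end_pcomp_eqI[OF r kn])
    fix ys zs ws :: "'v list"
    assume len: "length ys = k + n - 1" "length zs = r" "Suc (k + n - 1 + length ws) = m + n - 1"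
    have lk: "length ys = k + n - 1" "l < k" using len l by auto
    obtain us xs mid where ys: "ys = us @ xs @ mid" "length us = l" "length xs = n" "Suc (l + length mid) = k"
      using block_split[OF lk n] .
    have "end_pcomp V (m + n - 1) r (Suc (k + n - 1)) (end_pcomp V m n (Suc l) \<phi> \<psi>) \<chi> (ys @ zs @ ws) =
        end_pcomp V m n (Suc l) \<phi> \<psi> (map (Spow q) ys @ \<chi> zs # ws)"
      by (rule end_pcomp_parity[OF \<phi>\<psi> \<chi>(2) len])
    also have "\<dots> = end_pcomp V m n (Suc l) \<phi> \<psi> (map (Spow q) us @ map (Spow q) xs @ (map (Spow q) mid @ \<chi> zs # ws))"
      by (simp add: ys)
    also have "\<dots> = \<phi> (map (Spow p) (map (Spow q) us) @ \<psi> (map (Spow q) xs) # (map (Spow q) mid @ \<chi> zs # ws))"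
      by (rule end_pcomp_parity[OF \<phi>' \<psi>(2)]) (use len ys n in auto)
    also have "\<psi> (map (Spow q) xs) = ksign p q \<cdot> Spow q (\<psi> xs)"
      using bit_cases[of q] parity_apply[OF \<psi>(2), of xs] ksign_commute[of 1 p] by (auto cong: map_cong)
    also have "\<phi> (map (Spow p) (map (Spow q) us) @ (ksign p q \<cdot> Spow q (\<psi> xs)) # (map (Spow q) mid @ \<chi> zs # ws)) =
        ksign p q \<cdot> \<phi> (map (Spow p) (map (Spow q) us) @ (Spow q (\<psi> xs)) # (map (Spow q) mid @ \<chi> zs # ws))"
      by (rule slot_simps(2)[OF \<phi>']) (use len ys n in auto)
    also have "\<phi> (map (Spow p) (map (Spow q) us) @ (Spow q (\<psi> xs)) # (map (Spow q) mid @ \<chi> zs # ws)) =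
        \<phi> (map (Spow q) (map (Spow p) us @ \<psi> xs # mid) @ \<chi> zs # ws)"
      by (simp add: Spow_comp add.commute del: add_bit_eq_xor)
    also have "\<dots> = end_pcomp V m r (Suc k) \<phi> \<chi> ((map (Spow p) us @ \<psi> xs # mid) @ zs @ ws)"
      by (rule end_pcomp_parity[OF \<phi>' \<chi>(2), symmetric]) (use len ys n in auto)
    also have "\<dots> = end_pcomp V m r (Suc k) \<phi> \<chi> (map (Spow p) us @ \<psi> xs # (mid @ zs @ ws))"
      by simp
    also have "\<dots> = end_pcomp V (m + r - 1) n (Suc l) (end_pcomp V m r (Suc k) \<phi> \<chi>) \<psi> (us @ xs @ (mid @ zs @ ws))"
      by (rule end_pcomp_parity[OF \<phi>\<chi> \<psi>(2), symmetric]) (use len ys n in auto)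
    finally show "end_pcomp V (m + n - 1) r (Suc (k + n - 1)) (end_pcomp V m n (Suc l) \<phi> \<psi>) \<chi> (ys @ zs @ ws) =
        ksign p q \<cdot> end_pcomp V (m + r - 1) n (Suc l) (end_pcomp V m r (Suc k) \<phi> \<chi>) \<psi> (ys @ zs @ ws)"
      by (simp add: ys)
  qed (use k l n r in \<open>auto simp: end_pcomp_length\<close>)
qed

text \<open>
  The sum over the slots in the differential splits into the inputs before, inside and after the block of \<open>\<psi>\<close>.
  The middle part, together with the term where $d$ is applied to the value of \<open>\<psi>\<close>, is the differential of \<open>\<psi>\<close>.
\<close>

lemma end_dif_pcomp_homogeneous:
  assumes \<phi>: "\<phi> \<in> multilinear V m" and \<psi>: "\<psi> \<in> multilinear V n" "parity p \<psi>" and n: "n \<ge> 1" and l: "l < m"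
  shows "end_dif V (end_pcomp V m n (Suc l) \<phi> \<psi>) =
    (\<lambda>vs. end_pcomp V m n (Suc l) (end_dif V \<phi>) \<psi> vs +
          end_pcomp V m n (Suc l) (end_sign V \<phi>) (end_dif V \<psi>) vs)"
proof (rule end_pcomp_eqI[OF n l])
  fix us xs ws :: "'v list" assume len: "length us = l" "length xs = n" "Suc (l + length ws) = m"
  let ?\<phi>s = "end_sign V \<phi>" and ?c = "ksign 1 p :: 'k"
  note \<phi>' = multilinearD[OF \<phi>] and \<phi>s = multilinearD[OF multilinear_sign[OF \<phi>]]
  have blk: "end_pcomp V m n (Suc l) ?\<phi>s \<psi> (us @ xs @ ws) = ?\<phi>s (map (Spow p) us @ \<psi> xs # ws)"
    if "length us = l" "length xs = n" "Suc (l + length ws) = m" for us xs ws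
    by (rule end_pcomp_parity[OF \<phi>s \<psi>(2) that])
  have head: "dsum (\<lambda>a. ?\<phi>s (a @ \<psi> xs # ws)) (map (Spow p) us) =
      ?c \<cdot> dsum (\<lambda>a. end_pcomp V m n (Suc l) ?\<phi>s \<psi> (a @ xs @ ws)) us"
  proof -
    have "slotwise_linear (length us) (\<lambda>a. ?\<phi>s (a @ \<psi> xs # ws))"
      by (rule slotwise_linear_left[OF \<phi>s]) (use len in simp)
    then have "dsum (\<lambda>a. ?\<phi>s (a @ \<psi> xs # ws)) (map (Spow p) us) =
        ?c \<cdot> dsum (\<lambda>a. ?\<phi>s (map (Spow p) a @ \<psi> xs # ws)) us"
      by (rule dsum_map_Spow)
    also have "dsum (\<lambda>a. ?\<phi>s (map (Spow p) a @ \<psi> xs # ws)) us =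
        dsum (\<lambda>a. end_pcomp V m n (Suc l) ?\<phi>s \<psi> (a @ xs @ ws)) us"
      by (rule dsum_cong) (use len in \<open>simp add: blk\<close>)
    finally show ?thesis .
  qed
  have mid: "?\<phi>s (map (Spow (p + 1)) us @ dsum (end_sign V \<psi>) xs # ws) =
      ?c \<cdot> dsum (\<lambda>a. end_pcomp V m n (Suc l) ?\<phi>s \<psi> (map S us @ a @ ws)) xs"
  proof -
    have lin: "vlinear V (\<lambda>v. ?\<phi>s (map (Spow (p + 1)) us @ v # ws))"
      by (rule slotwise_linear_slot[OF \<phi>s]) (use len in simp)
    have "dsum (end_sign V \<psi>) xs = ?c \<cdot> dsum \<psi> xs"
      using \<psi>(2) by (simp add: parity_def dsum_scale)
    then have "?\<phi>s (map (Spow (p + 1)) us @ dsum (end_sign V \<psi>) xs # ws) =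
        ?c \<cdot> dsum (\<lambda>a. ?\<phi>s (map (Spow (p + 1)) us @ \<psi> a # ws)) xs"
      by (simp only: vlinear_simps(2)[OF lin] dsum_linear[OF lin])
    also have "dsum (\<lambda>a. ?\<phi>s (map (Spow (p + 1)) us @ \<psi> a # ws)) xs =
        dsum (\<lambda>a. end_pcomp V m n (Suc l) ?\<phi>s \<psi> (map S us @ a @ ws)) xs"
      by (rule dsum_cong) (use len in \<open>simp add: blk Spow_comp_S del: add_bit_eq_xor\<close>)
    finally show ?thesis .
  qed
  have tail: "dsum (\<lambda>a. ?\<phi>s (map S (map (Spow p) us) @ S (\<psi> xs) # a)) ws =
      ?c \<cdot> dsum (\<lambda>a. end_pcomp V m n (Suc l) ?\<phi>s \<psi> (map S us @ map S xs @ a)) ws"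
  proof -
    have "dsum (\<lambda>a. ?\<phi>s (map S (map (Spow p) us) @ S (\<psi> xs) # a)) ws =
        dsum (\<lambda>a. ?c \<cdot> end_pcomp V m n (Suc l) ?\<phi>s \<psi> (map S us @ map S xs @ a)) ws"
    proof (rule dsum_cong)
      fix a :: "'v list" assume a: "length a = length ws"
      show "?\<phi>s (map S (map (Spow p) us) @ S (\<psi> xs) # a) =
          ?c \<cdot> end_pcomp V m n (Suc l) ?\<phi>s \<psi> (map S us @ map S xs @ a)"
        using len a by (simp add: blk parity_apply[OF \<psi>(2)] slot_simps[OF \<phi>s] Spow_S o_def)
    qed
    then show ?thesis by (simp only: dsum_scale)
  qed
  have "end_dif V (end_pcomp V m n (Suc l) \<phi> \<psi>) (us @ xs @ ws) =
      d (\<phi> (map (Spow p) us @ \<psi> xs # ws)) - ?c \<cdot> dsum (end_pcomp V m n (Suc l) ?\<phi>s \<psi>) (us @ xs @ ws)"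
    unfolding end_dif_eq end_sign_pcomp[OF \<phi> \<psi> n l] dsum_scale
    by (subst end_pcomp_parity[OF \<phi>' \<psi>(2) len]) simp
  also have "dsum (end_pcomp V m n (Suc l) ?\<phi>s \<psi>) (us @ xs @ ws) =
      dsum (\<lambda>a. end_pcomp V m n (Suc l) ?\<phi>s \<psi> (a @ xs @ ws)) us +
      (dsum (\<lambda>a. end_pcomp V m n (Suc l) ?\<phi>s \<psi> (map S us @ a @ ws)) xs +
       dsum (\<lambda>a. end_pcomp V m n (Suc l) ?\<phi>s \<psi> (map S us @ map S xs @ a)) ws)"
    by (simp only: dsum_append)
  finally have lhs: "end_dif V (end_pcomp V m n (Suc l) \<phi> \<psi>) (us @ xs @ ws) =
      d (\<phi> (map (Spow p) us @ \<psi> xs # ws)) -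
      (dsum (\<lambda>a. ?\<phi>s (a @ \<psi> xs # ws)) (map (Spow p) us) +
       ?\<phi>s (map (Spow (p + 1)) us @ dsum (end_sign V \<psi>) xs # ws) +
       dsum (\<lambda>a. ?\<phi>s (map S (map (Spow p) us) @ S (\<psi> xs) # a)) ws)"
    unfolding head mid tail by (simp only: vs.scale_right_distrib add.assoc)
  have r1: "end_pcomp V m n (Suc l) (end_dif V \<phi>) \<psi> (us @ xs @ ws) =
      d (\<phi> (map (Spow p) us @ \<psi> xs # ws)) -
      (dsum (\<lambda>a. ?\<phi>s (a @ \<psi> xs # ws)) (map (Spow p) us) +
       (?\<phi>s (map S (map (Spow p) us) @ d (\<psi> xs) # ws) +
        dsum (\<lambda>a. ?\<phi>s (map S (map (Spow p) us) @ S (\<psi> xs) # a)) ws))"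
    by (subst end_pcomp_parity[OF multilinearD[OF multilinear_dif[OF \<phi>]] \<psi>(2) len])
      (simp only: end_dif_eq dsum_append dsum_Cons)
  have r2: "end_pcomp V m n (Suc l) ?\<phi>s (end_dif V \<psi>) (us @ xs @ ws) =
      ?\<phi>s (map (Spow (p + 1)) us @ d (\<psi> xs) # ws) - ?\<phi>s (map (Spow (p + 1)) us @ dsum (end_sign V \<psi>) xs # ws)"
    using len by (subst end_pcomp_parity[OF \<phi>s parity_dif[OF \<psi>] len]) (simp add: end_dif_eq slot_simps[OF \<phi>s] del: add_bit_eq_xor)
  have eq: "map S (map (Spow p) us) = map (Spow (p + 1)) us"
    using map_Spow_map_Spow[of 1 p us] by (simp add: add.commute del: add_bit_eq_xor)
  show "end_dif V (end_pcomp V m n (Suc l) \<phi> \<psi>) (us @ xs @ ws) =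
      end_pcomp V m n (Suc l) (end_dif V \<phi>) \<psi> (us @ xs @ ws) +
      end_pcomp V m n (Suc l) (end_sign V \<phi>) (end_dif V \<psi>) (us @ xs @ ws)"
    unfolding lhs r1 r2 eq by simp
next
  fix vs :: "'v list" assume "length vs \<noteq> m + n - 1"
  then show "end_dif V (end_pcomp V m n (Suc l) \<phi> \<psi>) vs = 0"
    by (rule multilinear_length[OF multilinear_dif[OF multilinear_pcomp[OF \<phi> \<psi>(1) n l]]])
qed (auto simp: end_pcomp_length)

lemma end_dif_pcomp:
  assumes \<phi>: "\<phi> \<in> multilinear V m" and \<psi>: "\<psi> \<in> multilinear V n" and n: "n \<ge> 1" and l: "l < m"
  shows "end_dif V (end_pcomp V m n (Suc l) \<phi> \<psi>) =
    (\<lambda>vs. end_pcomp V m n (Suc l) (end_dif V \<phi>) \<psi> vs +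
          end_pcomp V m n (Suc l) (end_sign V \<phi>) (end_dif V \<psi>) vs)"
  using \<psi>
proof (induction rule: multilinear_homogeneous_induct)
  case (homogeneous p \<psi>)
  then show ?case by (rule end_dif_pcomp_homogeneous[OF \<phi> _ _ n l])
next
  case (add \<psi> \<psi>')
  note R = end_pcomp_add_right[OF multilinearD n l]
  show ?case
    unfolding R[OF \<phi>] R[OF multilinear_dif[OF \<phi>]] end_dif_add R[OF multilinear_sign[OF \<phi>]] add.IH
    by (simp add: add_ac)
qed

lemma multilinear_unary: "vlinear V g \<Longrightarrow> unary g \<in> multilinear V 1"
  by (rule multilinearI) (auto simp: slotwise_linear_def unary_def)

lemma parity_unary: "vlinear V g \<Longrightarrow> (\<And>v. S (g v) = ksign 1 p \<cdot> g (S v)) \<Longrightarrow> parity p (unary g)"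
  by (auto simp: parity_def end_sign_def unary_def fun_eq_iff hd_map length_Suc_conv)

lemma id_linear: "vlinear V id" by (rule vlinearI) auto

lemma end_pcomp_unary:
  assumes "slotwise_linear m \<phi>" "parity 0 (unary g)" "l < m" "length vs = m"
  shows "end_pcomp V m 1 (Suc l) \<phi> (unary g) vs = \<phi> (vs[l := g (vs ! l)])"
proof -
  have vs: "vs = take l vs @ [vs ! l] @ drop (Suc l) vs"
    using assms by (simp add: id_take_nth_drop)
  have "end_pcomp V m 1 (Suc l) \<phi> (unary g) (take l vs @ [vs ! l] @ drop (Suc l) vs) =
      \<phi> (map (Spow 0) (take l vs) @ unary g [vs ! l] # drop (Suc l) vs)"
    by (rule end_pcomp_parity[OF assms(1,2)]) (use assms in auto)
  then show ?thesis
    using assms vs by (simp add: unary_def upd_conv_take_nth_drop)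
qed

lemma end_pcomp_unary_left:
  assumes "vlinear V g" "n \<ge> 1" "\<psi> \<in> multilinear V n"
  shows "end_pcomp V 1 n 1 (unary g) \<psi> = (\<lambda>vs. g (\<psi> vs))"
proof
  fix vs
  show "end_pcomp V 1 n 1 (unary g) \<psi> vs = g (\<psi> vs)"
  proof (cases "length vs = n")
    case True
    then show ?thesis
      using end_pcomp_block[of "[]" 0 vs n "[]" 1 "unary g" \<psi>]
      by (simp add: unary_def end_hcomp_sum flip: vlinear_simps(1)[OF assms(1)])
  next
    case False
    then show ?thesis
      using multilinear_length[OF assms(3) False] by (simp add: end_pcomp_def vlinear_simps[OF assms(1)])
  qed
qed

lemma end_pcomp_unit_right:
  assumes "\<phi> \<in> multilinear V m" "l < m"
  shows "end_pcomp V m 1 (Suc l) \<phi> (unary id) = \<phi>"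
proof
  have "parity 0 (unary id)" by (rule parity_unary[OF id_linear]) simp
  note unary = end_pcomp_unary[OF multilinearD[OF assms(1)] this assms(2)]
  fix vs show "end_pcomp V m 1 (Suc l) \<phi> (unary id) vs = \<phi> vs"
    using unary[of vs]
      multilinear_length[OF assms(1), of vs]
    by (cases "length vs = m") (auto simp: end_pcomp_length)
qed

end

subsection \<open>Action of the symmetric groups\<close>

definition act_list :: "(nat \<Rightarrow> nat) \<Rightarrow> 'v list \<Rightarrow> 'v list" where
  "act_list \<sigma> vs = map (\<lambda>j. vs ! (inv_into UNIV \<sigma> j - 1)) [1..<length vs + 1]"

lemma length_act_list [simp]: "length (act_list \<sigma> vs) = length vs"
  by (simp add: act_list_def del: upt_Suc)

lemma act_list_map: "\<sigma> permutes {1..length vs} \<Longrightarrow> act_list \<sigma> (map f vs) = map f (act_list \<sigma> vs)"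
  using permutes_leD[OF permutes_inv] by (fastforce simp: act_list_def)

lemma permutes_Suc_less:
  "\<sigma> permutes {1..n} \<Longrightarrow> a < n \<Longrightarrow> \<sigma> (Suc a) - 1 < n" and
  permutes_Suc_pos: "\<sigma> permutes {1..n} \<Longrightarrow> a < n \<Longrightarrow> Suc (\<sigma> (Suc a) - 1) = \<sigma> (Suc a)"
  using permutes_leD[of \<sigma> n "Suc a"] by auto

lemma nth_act_list:
  assumes "\<sigma> permutes {1..length vs}" "a < length vs"
  shows "act_list \<sigma> vs ! (\<sigma> (Suc a) - 1) = vs ! a"
  using permutes_Suc_less[OF assms] permutes_Suc_pos[OF assms] permutes_inverses[OF assms(1)]
  by (simp add: act_list_def nth_map_upt del: upt_Suc)

lemma act_list_eqI:
  assumes \<sigma>: "\<sigma> permutes {1..length vs}" and len: "length L = length vs"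
    and eq: "\<And>a. a < length vs \<Longrightarrow> L ! (\<sigma> (Suc a) - 1) = vs ! a"
  shows "act_list \<sigma> vs = L"
proof (rule nth_equalityI)
  fix j assume j: "j < length (act_list \<sigma> vs)"
  let ?a = "inv_into UNIV \<sigma> (Suc j)"
  have a: "1 \<le> ?a \<and> ?a \<le> length vs" using permutes_leD[OF permutes_inv[OF \<sigma>], of "Suc j"] j by simp
  then have "Suc (?a - 1) = ?a" by simp
  then have "\<sigma> (Suc (?a - 1)) = Suc j" using permutes_inverses[OF \<sigma>] by simp
  moreover have "?a - 1 < length vs" using a by linarith
  ultimately show "act_list \<sigma> vs ! j = L ! j"
    using eq[of "?a - 1"] nth_act_list[OF \<sigma>, of "?a - 1"] by simp
qed (use len in simp)

lemma act_list_id [simp]: "act_list id vs = vs"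
  by (rule act_list_eqI) (auto simp: permutes_id)

lemma act_list_comp:
  assumes \<sigma>: "\<sigma> permutes {1..length vs}" and \<tau>: "\<tau> permutes {1..length vs}"
  shows "act_list (\<sigma> \<circ> \<tau>) vs = act_list \<sigma> (act_list \<tau> vs)"
proof (rule act_list_eqI)
  show "\<sigma> \<circ> \<tau> permutes {1..length vs}" by (rule permutes_compose[OF \<tau> \<sigma>])
  fix a assume a: "a < length vs"
  have "\<tau> (Suc a) - 1 < length vs" by (rule permutes_Suc_less[OF \<tau> a])
  then have "act_list \<sigma> (act_list \<tau> vs) ! (\<sigma> (Suc (\<tau> (Suc a) - 1)) - 1) = act_list \<tau> vs ! (\<tau> (Suc a) - 1)"
    by (intro nth_act_list) (use \<sigma> in auto)
  then show "act_list \<sigma> (act_list \<tau> vs) ! ((\<sigma> \<circ> \<tau>) (Suc a) - 1) = vs ! a"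
    using nth_act_list[OF \<tau> a] permutes_Suc_pos[OF \<tau> a] by simp
qed simp

lemma act_list_update:
  assumes \<sigma>: "\<sigma> permutes {1..length vs}" and b: "b < length vs"
  shows "act_list \<sigma> (vs[b := x]) = (act_list \<sigma> vs)[\<sigma> (Suc b) - 1 := x]"
proof (rule act_list_eqI)
  fix a assume a: "a < length (vs[b := x])"
  then have a': "a < length vs" by simp
  have "\<sigma> (Suc b) - 1 = \<sigma> (Suc a) - 1 \<longleftrightarrow> b = a"
    using permutes_Suc_pos[OF \<sigma> a'] permutes_Suc_pos[OF \<sigma> b] permutes_inj[OF \<sigma>]
    by (metis injD nat.inject)
  then show "(act_list \<sigma> vs)[\<sigma> (Suc b) - 1 := x] ! (\<sigma> (Suc a) - 1) = vs[b := x] ! a"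
    using nth_act_list[OF \<sigma> a'] permutes_Suc_less[OF \<sigma> b] permutes_Suc_less[OF \<sigma> a'] a' b
    by (simp add: nth_list_update)
qed (use \<sigma> in auto)

lemma set_act_list: "\<sigma> permutes {1..length vs} \<Longrightarrow> set (act_list \<sigma> vs) = set vs"
proof -
  assume \<sigma>: "\<sigma> permutes {1..length vs}"
  have "x \<in> set (act_list \<sigma> vs)" if x: "x \<in> set vs" for x
    using x nth_act_list[OF \<sigma>] permutes_Suc_less[OF \<sigma>] by (metis in_set_conv_nth length_act_list)
  moreover have "set (act_list \<sigma> vs) \<subseteq> set vs"
    using permutes_leD[OF permutes_inv[OF \<sigma>]] by (fastforce simp: act_list_def)
  ultimately show ?thesis by blast
qed

lemma list_all2_act_list:
  assumes "list_all2 R ps vs" and \<sigma>: "\<sigma> permutes {1..length vs}"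
  shows "list_all2 R (act_list \<sigma> ps) (act_list \<sigma> vs)"
proof -
  have len: "length ps = length vs" using assms(1) by (rule list_all2_lengthD)
  have "R (ps ! (inv_into UNIV \<sigma> j - 1)) (vs ! (inv_into UNIV \<sigma> j - 1))" if "1 \<le> j" "j \<le> length vs" for j
  proof -
    have "inv_into UNIV \<sigma> j - 1 < length ps"
      using permutes_leD[OF permutes_inv[OF \<sigma>] that] unfolding len by linarith
    then show ?thesis by (rule list_all2_nthD[OF assms(1)])
  qed
  then show ?thesis
    unfolding act_list_def len list_all2_map1 list_all2_map2
    by (simp add: list_all2_same del: upt_Suc)
qed

lemma ksign_sum_take:
  assumes "j \<le> length ps"
  shows "ksign q (sum_list (take j ps)) = (\<Prod>a\<in>{1..<Suc j}. ksign q (ps ! (a - 1)) :: 'k::field)"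
proof -
  have "ksign q (sum_list (take j ps)) = (\<Prod>a\<in>{0..<j}. ksign q (ps ! a) :: 'k)"
    using assms by (simp add: sum_list_sum_nth ksign_sum_right min_absorb2)
  also have "\<dots> = (\<Prod>a\<in>{Suc 0..<Suc j}. ksign q (ps ! (a - 1)))"
    by (subst prod.shift_bounds_Suc_ivl) simp
  finally show ?thesis by simp
qed

lemma ksign_sum_take_act:
  assumes \<sigma>: "\<sigma> permutes {1..length ps}" and j: "j < length ps"
  shows "ksign q (sum_list (take (\<sigma> (Suc j) - 1) (act_list \<sigma> ps))) =
    (\<Prod>a\<in>{a \<in> {1..length ps}. \<sigma> a < \<sigma> (Suc j)}. ksign q (ps ! (a - 1)) :: 'k::field)"
proof -
  let ?\<rho> = "inv_into UNIV \<sigma>"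
  note inv = permutes_inverses[OF \<sigma>] and \<rho> = permutes_leD[OF permutes_inv[OF \<sigma>]]
  have sj: "\<sigma> (Suc j) \<le> length ps" "1 \<le> \<sigma> (Suc j)" using permutes_leD[OF \<sigma>, of "Suc j"] j by auto
  have "ksign q (sum_list (take (\<sigma> (Suc j) - 1) (act_list \<sigma> ps))) =
      (\<Prod>b\<in>{1..<\<sigma> (Suc j)}. ksign q (act_list \<sigma> ps ! (b - 1)) :: 'k)"
    by (subst ksign_sum_take) (use sj in auto)
  also have "\<dots> = (\<Prod>a\<in>{a \<in> {1..length ps}. \<sigma> a < \<sigma> (Suc j)}. ksign q (ps ! (a - 1)))"
  proof (rule prod.reindex_bij_witness[where i = \<sigma> and j = ?\<rho>])
    fix b assume b: "b \<in> {1..<\<sigma> (Suc j)}"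
    then have b': "1 \<le> b" "b \<le> length ps" using sj by auto
    show "\<sigma> (?\<rho> b) = b" using inv by simp
    show "?\<rho> b \<in> {a \<in> {1..length ps}. \<sigma> a < \<sigma> (Suc j)}" using \<rho>[OF b'] inv b by auto
    have "act_list \<sigma> ps ! (\<sigma> (Suc (?\<rho> b - 1)) - 1) = ps ! (?\<rho> b - 1)"
      by (rule nth_act_list[OF \<sigma>]) (use \<rho>[OF b'] in auto)
    then show "ksign q (ps ! (?\<rho> b - 1)) = (ksign q (act_list \<sigma> ps ! (b - 1)) :: 'k)"
      using \<rho>[OF b'] inv by simp
  next
    fix a assume "a \<in> {a \<in> {1..length ps}. \<sigma> a < \<sigma> (Suc j)}"
    then show "?\<rho> (\<sigma> a) = a" "\<sigma> a \<in> {1..<\<sigma> (Suc j)}" using inv permutes_leD[OF \<sigma>, of a] by auto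
  qed
  finally show ?thesis .
qed

lemma perm_sign_update:
  assumes \<sigma>: "\<sigma> permutes {1..length ps}" and j: "j < length ps"
  shows "ksign q (sum_list (take j ps)) * perm_sign (length ps) \<sigma> (ps[j := ps ! j + q]) =
    (perm_sign (length ps) \<sigma> ps * ksign q (sum_list (take (\<sigma> (Suc j) - 1) (act_list \<sigma> ps))) :: 'k::field)"
proof -
  let ?P = "\<lambda>a. ps ! (a - 1)"
  have "perm_sign (length ps) \<sigma> (ps[j := ps ! j + q]) =
      (inversion_sign (length ps) \<sigma> (?P(Suc j := ?P (Suc j) + q)) :: 'k)"
    unfolding perm_sign_eq by (rule inversion_sign_cong) (use j in \<open>auto simp: nth_list_update\<close>)
  then show ?thesis
    using inversion_sign_update[OF \<sigma>, of "Suc j" q ?P, where 'k = 'k] j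
    unfolding ksign_sum_take_act[OF \<sigma> j] by (simp add: ksign_sum_take perm_sign_eq)
qed

context dg_vect_space
begin

lemma finite_parity_lists [simp]: "finite {ps :: bit list. length ps = n}"
proof -
  have "(UNIV :: bit set) = {0, 1}" using bit_cases by auto
  then have "finite (UNIV :: bit set)" by (metis finite.emptyI finite_insert)
  from finite_lists_length_eq[OF this, of n] show ?thesis by simp
qed

lemma end_act_eq:
  assumes \<sigma>: "\<sigma> permutes {1..n}" and vs: "length vs = n"
  shows "end_act V n \<phi> \<sigma> vs =
    (\<Sum>ps\<in>{ps. length ps = n}. perm_sign n \<sigma> ps \<cdot> \<phi> (act_list \<sigma> (map2 h ps vs)))"
proof -
  have "map (\<lambda>j. h (ps ! (inv_into UNIV \<sigma> j - 1)) (vs ! (inv_into UNIV \<sigma> j - 1))) [1..<n + 1] =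
    act_list \<sigma> (map2 h ps vs)" if ps: "length ps = n" for ps
  proof -
    have "inv_into UNIV \<sigma> j - 1 < n" if "1 \<le> j" "j \<le> n" for j
      using permutes_leD[OF permutes_inv[OF \<sigma>] that] by auto
    then show ?thesis using ps vs by (auto simp: act_list_def)
  qed
  then show ?thesis using vs by (simp add: end_act_def Let_def)
qed

lemma slotwise_zero_entry:
  assumes "slotwise_linear n \<phi>" "length L = n" "0 \<in> set L"
  shows "\<phi> L = 0"
  using split_list[OF assms(3)] slot_simps(3)[OF assms(1)] assms(2) by auto

lemma homogeneous_list_map2: "homogeneous_list ps vs \<Longrightarrow> map2 h ps vs = vs"
  by (induction rule: list_all2_induct) auto

text \<open>
  On homogeneous vectors the sum over all parities that defines the action has a single nonzero summand.
\<close>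

lemma end_act_homogeneous:
  assumes \<phi>: "slotwise_linear n \<phi>" and \<sigma>: "\<sigma> permutes {1..n}"
    and vs: "length vs = n" and hom: "homogeneous_list ps vs"
  shows "end_act V n \<phi> \<sigma> vs = perm_sign n \<sigma> ps \<cdot> \<phi> (act_list \<sigma> vs)"
proof -
  have ps: "length ps = n" using hom vs list_all2_lengthD by force
  have zero: "\<phi> (act_list \<sigma> (map2 h ps' vs)) = 0" if ps': "length ps' = n" "ps' \<noteq> ps" for ps'
  proof -
    obtain i where i: "i < n" "ps' ! i \<noteq> ps ! i" using ps ps' nth_equalityI by metis
    have "h (ps' ! i) (vs ! i) = h (ps' ! i) (h (ps ! i) (vs ! i))"
      using list_all2_nthD2[OF hom, of i] i vs by simp
    also have "\<dots> = 0" using i by simp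
    finally have "map2 h ps' vs ! i = 0" using i ps' vs by simp
    then have "0 \<in> set (map2 h ps' vs)" using i ps' vs by (metis (no_types, lifting) length_map length_zip min.idem nth_mem)
    then have "0 \<in> set (act_list \<sigma> (map2 h ps' vs))"
      using set_act_list[of \<sigma> "map2 h ps' vs"] \<sigma> ps' vs by simp
    then show ?thesis using slotwise_zero_entry[OF \<phi>] ps' vs by simp
  qed
  have "end_act V n \<phi> \<sigma> vs = (\<Sum>ps'\<in>{ps}. perm_sign n \<sigma> ps' \<cdot> \<phi> (act_list \<sigma> (map2 h ps' vs)))"
    unfolding end_act_eq[OF \<sigma> vs]
    by (rule sum.mono_neutral_right) (use ps zero in auto)
  then show ?thesis by (simp add: homogeneous_list_map2[OF hom])
qed

lemma end_act_length: "length vs \<noteq> n \<Longrightarrow> end_act V n \<phi> \<sigma> vs = 0"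
  by (simp add: end_act_def)

lemma vlinear_sum: "(\<And>a. a \<in> A \<Longrightarrow> vlinear V (f a)) \<Longrightarrow> vlinear V (\<lambda>v. \<Sum>a\<in>A. f a v)"
  by (rule vlinearI) (simp_all add: vlinear_simps sum.distrib vs.scale_sum_right)

lemma multilinear_act:
  assumes \<phi>: "\<phi> \<in> multilinear V n" and \<sigma>: "\<sigma> permutes {1..n}"
  shows "end_act V n \<phi> \<sigma> \<in> multilinear V n"
proof -
  have "vlinear V (\<lambda>v. end_act V n \<phi> \<sigma> (vs[j := v]))" if vs: "length vs = n" and j: "j < n" for vs j
  proof -
    have "vlinear V (\<lambda>v. perm_sign n \<sigma> ps \<cdot> \<phi> (act_list \<sigma> (map2 h ps (vs[j := v]))))" if ps: "length ps = n" for ps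
    proof -
      have "map2 h ps (vs[j := v]) = (map2 h ps vs)[j := h (ps ! j) v]" for v
        using ps vs j by (auto intro!: nth_equalityI simp: nth_list_update)
      then have "act_list \<sigma> (map2 h ps (vs[j := v])) =
          (act_list \<sigma> (map2 h ps vs))[\<sigma> (Suc j) - 1 := h (ps ! j) v]" for v
        using act_list_update[of \<sigma> "map2 h ps vs" j] \<sigma> ps vs j by simp
      moreover have "vlinear V (\<lambda>v. \<phi> ((act_list \<sigma> (map2 h ps vs))[\<sigma> (Suc j) - 1 := v]))"
        using \<phi> permutes_Suc_less[OF \<sigma> j] ps vs by (auto simp: multilinear_def)
      ultimately show ?thesis
        by (simp only:) (rule vlinear_compose[OF scale_linear vlinear_compose[OF _ h_linear]])
    qed
    then have "vlinear V (\<lambda>v. \<Sum>ps\<in>{ps. length ps = n}. perm_sign n \<sigma> ps \<cdot> \<phi> (act_list \<sigma> (map2 h ps (vs[j := v]))))"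
      by (intro vlinear_sum) simp
    then show ?thesis using vs by (simp add: end_act_eq[OF \<sigma>])
  qed
  then show ?thesis by (auto simp: multilinear_def end_act_length)
qed

lemma end_act_add: "end_act V n (\<lambda>vs. \<phi> vs + \<psi> vs) \<sigma> = (\<lambda>vs. end_act V n \<phi> \<sigma> vs + end_act V n \<psi> \<sigma> vs)"
  and end_act_scale: "end_act V n (\<lambda>vs. c \<cdot> \<phi> vs) \<sigma> = (\<lambda>vs. c \<cdot> end_act V n \<phi> \<sigma> vs)"
  by (auto simp: fun_eq_iff end_act_def Let_def vs.scale_right_distrib sum.distrib vs.scale_sum_right mult_ac)

lemma end_sign_act:
  assumes \<sigma>: "\<sigma> permutes {1..n}"
  shows "end_sign V (end_act V n \<phi> \<sigma>) = end_act V n (end_sign V \<phi>) \<sigma>"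
proof
  fix vs
  show "end_sign V (end_act V n \<phi> \<sigma>) vs = end_act V n (end_sign V \<phi>) \<sigma> vs"
  proof (cases "length vs = n")
    case True
    have "act_list \<sigma> (map2 h ps (map S vs)) = map S (act_list \<sigma> (map2 h ps vs))" if "length ps = n" for ps
    proof -
      have "map2 h ps (map S vs) = map S (map2 h ps vs)"
        using that True by (auto intro!: nth_equalityI simp: h_S)
      then show ?thesis using act_list_map[of \<sigma> "map2 h ps vs" S] \<sigma> that True by simp
    qed
    then show ?thesis using True
      by (simp add: end_sign_def end_act_eq[OF \<sigma>])
  qed (simp add: end_sign_def end_act_length)
qed

lemma end_hcomp_act:
  assumes \<sigma>: "\<sigma> permutes {1..n}"
  shows "end_hcomp V p (end_act V n \<phi> \<sigma>) = end_act V n (end_hcomp V p \<phi>) \<sigma>"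
  by (simp add: fun_eq_iff end_hcomp_eq[abs_def] end_act_scale end_act_add end_sign_act[OF \<sigma>])

lemma end_act_id: "\<phi> \<in> multilinear V n \<Longrightarrow> end_act V n \<phi> id = \<phi>"
  by (rule multilinear_eqI[of _ n])
    (auto simp: multilinear_act permutes_id end_act_homogeneous[OF multilinearD] perm_sign_eq)

lemma end_act_act:
  assumes \<phi>: "\<phi> \<in> multilinear V n" and \<sigma>: "\<sigma> permutes {1..n}" and \<tau>: "\<tau> permutes {1..n}"
  shows "end_act V n \<phi> (\<sigma> \<circ> \<tau>) = end_act V n (end_act V n \<phi> \<sigma>) \<tau>"
proof (rule multilinear_eqI)
  fix ps vs assume vs: "length vs = n" and hom: "homogeneous_list ps vs"
  have ps: "length ps = n" using hom vs list_all2_lengthD by force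
  have "perm_sign n (\<sigma> \<circ> \<tau>) ps = (perm_sign n \<tau> ps * perm_sign n \<sigma> (act_list \<tau> ps) :: 'k)"
    unfolding perm_sign_eq
  proof (rule inversion_sign_comp[OF \<sigma> \<tau>])
    fix a assume "a \<in> {1..n}"
    then show "act_list \<tau> ps ! (\<tau> a - 1) = ps ! (a - 1)"
      using nth_act_list[of \<tau> ps "a - 1"] \<tau> ps by auto
  qed
  then show "end_act V n \<phi> (\<sigma> \<circ> \<tau>) vs = end_act V n (end_act V n \<phi> \<sigma>) \<tau> vs"
    using end_act_homogeneous[OF multilinearD[OF \<phi>] permutes_compose[OF \<tau> \<sigma>] vs hom]
      end_act_homogeneous[OF multilinearD[OF multilinear_act[OF \<phi> \<sigma>]] \<tau> vs hom]
      end_act_homogeneous[OF multilinearD[OF \<phi>] \<sigma> _ list_all2_act_list[OF hom]] \<sigma> \<tau> vs act_list_comp[of \<sigma> vs \<tau>]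
    by simp
qed (use assms in \<open>auto intro!: multilinear_act permutes_compose\<close>)

text \<open>
  Both sides are compared on homogeneous vectors. Applying $d$ to one input changes the Koszul sign of the
  permutation by exactly the difference of the signs for reaching that input, by \<open>perm_sign_update\<close>.
\<close>

lemma end_dif_act:
  assumes \<phi>: "\<phi> \<in> multilinear V n" and \<sigma>: "\<sigma> permutes {1..n}"
  shows "end_dif V (end_act V n \<phi> \<sigma>) = end_act V n (end_dif V \<phi>) \<sigma>"
proof (rule multilinear_eqI)
  fix ps vs assume vs: "length vs = n" and hom: "homogeneous_list ps vs"
  have ps: "length ps = n" using hom vs list_all2_lengthD by force
  let ?vs = "act_list \<sigma> vs" and ?ps = "act_list \<sigma> ps" and ?F = "end_sign V \<phi>"
  have F: "slotwise_linear n ?F" by (rule multilinearD[OF multilinear_sign[OF \<phi>]])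
  have hom': "homogeneous_list ?ps ?vs" by (rule list_all2_act_list[OF hom]) (use vs \<sigma> in simp)
  have slot: "G (map S (take j vs) @ x # drop (Suc j) vs) = ksign 1 (sum_list (take j ps)) \<cdot> G (vs[j := x])"
    if "slotwise_linear n G" "homogeneous_list ps vs" "length vs = n" "j < n" for G j x ps vs
    using slotwise_Spow_homogeneous[OF that(1) list_all2_takeI[OF that(2), of j], of "[]" "x # drop (Suc j) vs" 1] that(3,4)
    by (simp add: upd_conv_take_nth_drop cong: map_cong)
  have "dsum (end_act V n ?F \<sigma>) vs = (\<Sum>j<n. (ksign 1 (sum_list (take j ps)) * perm_sign n \<sigma> (ps[j := ps ! j + 1])) \<cdot>
      ?F (act_list \<sigma> (vs[j := d (vs ! j)])))"
    unfolding dsum_def vs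
  proof (rule sum.cong[OF HOL.refl])
    fix j assume "j \<in> {..<n}"
    then have j: "j < n" by simp
    have "h (ps ! j) (vs ! j) = vs ! j" using list_all2_nthD2[OF hom, of j] j vs by simp
    then have "h (ps ! j + 1) (d (vs ! j)) = d (vs ! j)" by (simp only: h_d)
    then have hu: "homogeneous_list (ps[j := ps ! j + 1]) (vs[j := d (vs ! j)])"
      by (intro list_all2_update_cong[OF hom])
    have "end_act V n ?F \<sigma> (vs[j := d (vs ! j)]) =
        perm_sign n \<sigma> (ps[j := ps ! j + 1]) \<cdot> ?F (act_list \<sigma> (vs[j := d (vs ! j)]))"
      by (rule end_act_homogeneous[OF F \<sigma> _ hu]) (use vs in simp)
    then show "end_act V n ?F \<sigma> (map S (take j vs) @ d (vs ! j) # drop (Suc j) vs) =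
        (ksign 1 (sum_list (take j ps)) * perm_sign n \<sigma> (ps[j := ps ! j + 1])) \<cdot> ?F (act_list \<sigma> (vs[j := d (vs ! j)]))"
      using slot[OF multilinearD[OF multilinear_act[OF multilinear_sign[OF \<phi>] \<sigma>]] hom vs j] by simp
  qed
  also have "\<dots> = (\<Sum>j<n. (perm_sign n \<sigma> ps * ksign 1 (sum_list (take (\<sigma> (Suc j) - 1) ?ps))) \<cdot>
      ?F (?vs[\<sigma> (Suc j) - 1 := d (?vs ! (\<sigma> (Suc j) - 1))]))"
  proof (rule sum.cong[OF HOL.refl])
    fix j assume "j \<in> {..<n}"
    then have j: "j < length ps" "j < length vs" using ps vs by auto
    have \<sigma>': "\<sigma> permutes {1..length ps}" "\<sigma> permutes {1..length vs}" using \<sigma> ps vs by auto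
    show "(ksign 1 (sum_list (take j ps)) * perm_sign n \<sigma> (ps[j := ps ! j + 1])) \<cdot> ?F (act_list \<sigma> (vs[j := d (vs ! j)])) =
      (perm_sign n \<sigma> ps * ksign 1 (sum_list (take (\<sigma> (Suc j) - 1) ?ps))) \<cdot>
      ?F (?vs[\<sigma> (Suc j) - 1 := d (?vs ! (\<sigma> (Suc j) - 1))])"
      unfolding perm_sign_update[OF \<sigma>'(1) j(1), of 1, where 'k = 'k, unfolded ps] act_list_update[OF \<sigma>'(2) j(2)]
        nth_act_list[OF \<sigma>'(2) j(2)] ..
  qed
  also have "\<dots> = (\<Sum>j<n. (perm_sign n \<sigma> ps * ksign 1 (sum_list (take j ?ps))) \<cdot> ?F (?vs[j := d (?vs ! j)]))"
  proof (rule sum.reindex_bij_witness[where i = "\<lambda>j. inv_into UNIV \<sigma> (Suc j) - 1" and j = "\<lambda>j. \<sigma> (Suc j) - 1"])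
    note \<rho> = permutes_inv[OF \<sigma>]
    fix j assume "j \<in> {..<n}"
    then have j: "j < n" by simp
    show "inv_into UNIV \<sigma> (Suc (\<sigma> (Suc j) - 1)) - 1 = j" "\<sigma> (Suc j) - 1 \<in> {..<n}"
      using permutes_Suc_pos[OF \<sigma> j] permutes_Suc_less[OF \<sigma> j] permutes_inverses[OF \<sigma>] by auto
    show "\<sigma> (Suc (inv_into UNIV \<sigma> (Suc j) - 1)) - 1 = j" "inv_into UNIV \<sigma> (Suc j) - 1 \<in> {..<n}"
      using permutes_Suc_pos[OF \<rho> j] permutes_Suc_less[OF \<rho> j] permutes_inverses[OF \<sigma>] by auto
  qed simp
  also have "\<dots> = perm_sign n \<sigma> ps \<cdot> dsum ?F ?vs"
    unfolding dsum_def vs.scale_sum_right length_act_list vs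
    by (rule sum.cong) (use slot[OF F hom'] vs in auto)
  finally have ds: "dsum (end_act V n ?F \<sigma>) vs = perm_sign n \<sigma> ps \<cdot> dsum ?F ?vs" .
  show "end_dif V (end_act V n \<phi> \<sigma>) vs = end_act V n (end_dif V \<phi>) \<sigma> vs"
    unfolding end_act_homogeneous[OF multilinearD[OF multilinear_dif[OF \<phi>]] \<sigma> vs hom]
    by (simp add: end_dif_eq end_sign_act[OF \<sigma>] ds end_act_homogeneous[OF multilinearD[OF \<phi>] \<sigma> vs hom]
        vs.scale_right_diff_distrib)
qed (use assms in \<open>auto intro!: multilinear_act multilinear_dif\<close>)

lemma homogeneous_apply:
  assumes \<psi>: "slotwise_linear (length xs) \<psi>" "parity q \<psi>" and hom: "homogeneous_list px xs"
  shows "h (q + sum_list px) (\<psi> xs) = \<psi> xs"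
proof -
  have "\<psi> (map S xs) = ksign 1 (sum_list px) \<cdot> \<psi> xs"
    using slotwise_Spow_homogeneous[OF \<psi>(1) hom, of "[]" "[]" 1] by (simp cong: map_cong)
  then have "S (\<psi> xs) = ksign 1 q \<cdot> ksign 1 (sum_list px) \<cdot> \<psi> xs"
    using parity_apply[OF \<psi>(2), of xs] by (metis ksign_square vs.scale_one vs.scale_scale)
  then show ?thesis
    unfolding homogeneous_iff_S by (simp add: ksign_add_right del: add_bit_eq_xor)
qed

lemma homogeneous_list_split:
  assumes "homogeneous_list ps (us @ xs @ ws)"
  obtains pu px pw where "ps = pu @ px @ pw" "homogeneous_list pu us" "homogeneous_list px xs" "homogeneous_list pw ws"
  using assms by (auto simp: list_all2_append2)

lemma end_pcomp_inner:
  assumes \<phi>: "\<phi> \<in> multilinear V m" and \<psi>: "\<psi> \<in> multilinear V n" and \<tau>: "\<tau> permutes {1..n}"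
    and n: "n \<ge> 1" and l: "l < m"
  shows "end_pcomp V m n (Suc l) \<phi> (end_act V n \<psi> \<tau>) =
    end_act V (m + n - 1) (end_pcomp V m n (Suc l) \<phi> \<psi>) (inner_perm n (Suc l) \<tau>)"
  using \<psi>
proof (induction rule: multilinear_homogeneous_induct)
  case (homogeneous q \<psi>)
  let ?\<pi> = "inner_perm n (Suc l) \<tau>" and ?N = "m + n - 1"
  have \<pi>: "?\<pi> permutes {1..?N}" by (rule inner_perm_permutes[OF \<tau> _ n]) (use l in auto)
  note comp = multilinear_pcomp[OF \<phi> homogeneous(1) n l] and \<phi>' = multilinearD[OF \<phi>]
  show ?case
  proof (rule multilinear_eqI[OF multilinear_pcomp[OF \<phi> multilinear_act[OF homogeneous(1) \<tau>] n l] multilinear_act[OF comp \<pi>]])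
    fix ps vs assume len: "length vs = ?N" and hom: "homogeneous_list ps vs"
    obtain us xs ws where vs: "vs = us @ xs @ ws" "length us = l" "length xs = n" "Suc (l + length ws) = m"
      using block_split[OF len l n] .
    obtain pu px pw where ps: "ps = pu @ px @ pw" "homogeneous_list pu us" "homogeneous_list px xs" "homogeneous_list pw ws"
      using homogeneous_list_split hom vs(1) by blast
    have lp: "length pu = l" "length px = n" using ps vs list_all2_lengthD by metis+
    have par: "parity q (end_act V n \<psi> \<tau>)"
      using homogeneous(2) unfolding parity_def end_sign_act[OF \<tau>] by (simp add: end_act_scale)
    have act: "act_list ?\<pi> vs = us @ act_list \<tau> xs @ ws"
    proof (rule act_list_eqI)
      fix a assume a: "a < length vs"
      show "(us @ act_list \<tau> xs @ ws) ! (?\<pi> (Suc a) - 1) = vs ! a"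
      proof (cases rule: block_cases[where a = "Suc a" and n = n and l = l])
        case (block x)
        have "?\<pi> (Suc a) = l + \<tau> x" unfolding block(3) by (rule inner_perm_block[OF block(1,2)])
        moreover have "act_list \<tau> xs ! (\<tau> (Suc (x - 1)) - 1) = xs ! (x - 1)"
          by (rule nth_act_list) (use vs \<tau> block in auto)
        moreover have "a = l + (x - 1)" using block by linarith
        ultimately show ?thesis
          using block(1,2) vs permutes_leD[OF \<tau> block(1,2)] by (auto simp: nth_append)
      next
        case outside
        then show ?thesis using inner_perm_outside[OF outside, of \<tau>] vs by (auto simp: nth_append)
      qed
    qed (use \<pi> len vs in auto)
    have sgn: "perm_sign ?N ?\<pi> ps = (perm_sign n \<tau> px :: 'k)"
      unfolding perm_sign_eq inversion_sign_inner[OF \<tau> l n]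
      by (rule inversion_sign_cong) (use lp ps in \<open>auto simp: nth_append\<close>)
    have "end_pcomp V m n (Suc l) \<phi> (end_act V n \<psi> \<tau>) vs = \<phi> (map (Spow q) us @ end_act V n \<psi> \<tau> xs # ws)"
      unfolding vs(1) by (rule end_pcomp_parity[OF \<phi>' par vs(2-4)])
    also have "\<dots> = perm_sign n \<tau> px \<cdot> \<phi> (map (Spow q) us @ \<psi> (act_list \<tau> xs) # ws)"
      unfolding end_act_homogeneous[OF multilinearD[OF homogeneous(1)] \<tau> vs(3) ps(3)]
      by (rule slot_simps(2)[OF \<phi>']) (use vs in simp)
    also have "\<dots> = perm_sign ?N ?\<pi> ps \<cdot> end_pcomp V m n (Suc l) \<phi> \<psi> (act_list ?\<pi> vs)"
      unfolding sgn act by (subst end_pcomp_parity[OF \<phi>' homogeneous(2) vs(2) _ vs(4)]) (use vs in simp_all)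
    finally show "end_pcomp V m n (Suc l) \<phi> (end_act V n \<psi> \<tau>) vs = end_act V ?N (end_pcomp V m n (Suc l) \<phi> \<psi>) ?\<pi> vs"
      unfolding end_act_homogeneous[OF multilinearD[OF comp] \<pi> len hom] .
  qed
next
  case (add \<psi> \<psi>')
  note R = end_pcomp_add_right[OF multilinearD[OF \<phi>] n l]
  show ?case unfolding end_act_add R add.IH by simp
qed

lemma end_pcomp_outer:
  assumes \<phi>: "\<phi> \<in> multilinear V m" and \<psi>: "\<psi> \<in> multilinear V n" and \<sigma>: "\<sigma> permutes {1..m}"
    and n: "n \<ge> 1" and l: "l < m"
  shows "end_pcomp V m n (Suc l) (end_act V m \<phi> \<sigma>) \<psi> =
    end_act V (m + n - 1) (end_pcomp V m n (\<sigma> (Suc l)) \<phi> \<psi>) (outer_perm n (Suc l) \<sigma>)"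
proof -
  define l' where "l' = \<sigma> (Suc l) - 1"
  have \<sigma>l: "\<sigma> (Suc l) = Suc l'" and l': "l' < m"
    using permutes_Suc_pos[OF \<sigma> l] permutes_Suc_less[OF \<sigma> l] by (auto simp: l'_def)
  let ?\<pi> = "outer_perm n (Suc l) \<sigma>" and ?N = "m + n - 1"
  have il: "Suc l \<in> {1..m}" using l by auto
  have \<pi>: "?\<pi> permutes {1..?N}" by (rule outer_perm_permutes[OF \<sigma> il n])
  note \<phi>' = multilinearD[OF \<phi>]
  show ?thesis
    unfolding \<sigma>l using \<psi>
  proof (induction rule: multilinear_homogeneous_induct)
    case (homogeneous q \<psi>)
    note comp = multilinear_pcomp[OF \<phi> homogeneous(1) n l']
    show ?case
    proof (rule multilinear_eqI[OF multilinear_pcomp[OF multilinear_act[OF \<phi> \<sigma>] homogeneous(1) n l] multilinear_act[OF comp \<pi>]])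
      fix ps vs assume len: "length vs = ?N" and hom: "homogeneous_list ps vs"
      obtain us xs ws where vs: "vs = us @ xs @ ws" "length us = l" "length xs = n" "Suc (l + length ws) = m"
        using block_split[OF len l n] .
      obtain pu px pw where ps: "ps = pu @ px @ pw" "homogeneous_list pu us" "homogeneous_list px xs" "homogeneous_list pw ws"
        using homogeneous_list_split hom vs(1) by blast
      have lp: "length pu = l" "length px = n" "Suc (l + length pw) = m" using ps vs list_all2_lengthD by metis+
      define y where "y = \<psi> xs"
      define P where "P = pu @ sum_list px # pw"
      let ?L = "us @ y # ws" and ?Q = "P[l := P ! l + q]"
      have Q: "?Q = pu @ (q + sum_list px) # pw" unfolding P_def lp(1)[symmetric] by (simp add: add.commute del: add_bit_eq_xor)
      have lP: "length P = m" "length ?L = m" using lp vs by (auto simp: P_def)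
      have hy: "h (q + sum_list px) y = y"
        unfolding y_def by (rule homogeneous_apply[OF _ homogeneous(2) ps(3)]) (use vs(3) multilinearD[OF homogeneous(1)] in simp)
      have homL: "homogeneous_list ?Q ?L" unfolding Q using ps hy by (simp add: list_all2_appendI del: add_bit_eq_xor)
      have \<sigma>P: "\<sigma> permutes {1..length P}" "\<sigma> permutes {1..length ?L}" using \<sigma> lP by auto
      define L' where "L' = act_list \<sigma> ?L"
      have lL': "length L' = m" using lP by (simp add: L'_def)
      have L'y: "L' ! l' = y"
        unfolding L'_def l'_def using nth_act_list[OF \<sigma>P(2), of l] l lP(2) nth_append_length[of us y ws] vs(2)
        by metis
      define us' ws' where "us' = take l' L'" and "ws' = drop (Suc l') L'"
      have L': "L' = us' @ y # ws'" using l' lL' L'y unfolding us'_def ws'_def by (metis id_take_nth_drop)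
      have len': "length us' = l'" "Suc (l' + length ws') = m" using l' lL' by (auto simp: us'_def ws'_def)
      have nthL': "(us' @ xs @ ws') ! (t - 1) = L' ! (t - 1)" if "t < Suc l'" "1 \<le> t" for t
        using that len' by (auto simp: L' nth_append)
      have nthL'2: "(us' @ xs @ ws') ! (t + n - 1 - 1) = L' ! (t - 1)" if "Suc l' < t" "t \<le> m" for t
      proof -
        define k where "k = t - l' - 2"
        have t: "t = Suc (Suc (l' + k))" using that(1) by (simp add: k_def)
        show ?thesis using n len' vs(3) unfolding t L' by (auto simp: nth_append)
      qed
      have act: "act_list ?\<pi> vs = us' @ xs @ ws'"
      proof (rule act_list_eqI)
        fix a assume a: "a < length vs"
        let ?c = "outer_slot n (Suc l) (Suc a)"
        have c: "1 \<le> ?c" "?c \<le> m" using outer_slot_range[OF il n, of "Suc a"] a len by auto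
        have \<sigma>c: "1 \<le> \<sigma> ?c" "\<sigma> ?c \<le> m" using permutes_leD[OF \<sigma> c] by auto
        show "(us' @ xs @ ws') ! (?\<pi> (Suc a) - 1) = vs ! a"
        proof (cases "?c = Suc l")
          case True
          then have al: "l \<le> a" "a < l + n" using n by (auto simp: outer_slot_def split: if_splits)
          have "?\<pi> (Suc a) - 1 = l' + (a - l)"
            unfolding outer_perm_cases[OF \<sigma> il n] using True \<sigma>l by simp
          then show ?thesis using al len' vs by (auto simp: nth_append)
        next
          case False
          have neq: "\<sigma> ?c \<noteq> Suc l'" using False permutes_inj[OF \<sigma>] \<sigma>l by (metis injD)
          have "(us' @ xs @ ws') ! (?\<pi> (Suc a) - 1) = L' ! (\<sigma> ?c - 1)"
          proof (cases "\<sigma> ?c < Suc l'")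
            case True
            then have "?\<pi> (Suc a) = \<sigma> ?c" unfolding outer_perm_cases[OF \<sigma> il n] using False \<sigma>l by simp
            then show ?thesis using nthL'[OF True \<sigma>c(1)] by simp
          next
            case nless: False
            then have "?\<pi> (Suc a) = \<sigma> ?c + n - 1" unfolding outer_perm_cases[OF \<sigma> il n] using False \<sigma>l by simp
            then show ?thesis using nthL'2[of "\<sigma> ?c"] nless neq \<sigma>c(2) by simp
          qed
          also have "\<dots> = ?L ! (?c - 1)"
            unfolding L'_def using nth_act_list[OF \<sigma>P(2), of "?c - 1"] c lP by simp
          also have "\<dots> = vs ! a"
            using False a vs n unfolding vs(1) by (auto simp: outer_slot_def nth_append add.commute split: if_splits)
          finally show ?thesis .
        qed
      qed (use \<pi> len vs len' in auto)
      have "perm_sign ?N ?\<pi> ps = (perm_sign m \<sigma> P :: 'k)"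
        unfolding perm_sign_eq
      proof (rule inversion_sign_outer[OF \<sigma> il n])
        fix c assume c: "c \<in> {1..m}"
        consider "c < Suc l" | "c = Suc l" | "Suc l < c" by linarith
        then show "P ! (c - 1) = (\<Sum>a\<in>{a \<in> {1..?N}. outer_slot n (Suc l) a = c}. ps ! (a - 1))"
        proof cases
          case 1
          then have "{a \<in> {1..?N}. outer_slot n (Suc l) a = c} = {c}"
            using c n by (auto simp: outer_slot_def split: if_splits)
          moreover have "c - 1 < l" using 1 c by auto
          ultimately show ?thesis using lp by (simp add: P_def ps(1) nth_append)
        next
          case 2
          then have fib: "{a \<in> {1..?N}. outer_slot n (Suc l) a = c} = {0 + Suc l..<n + Suc l}"
            using c n l by (auto simp: outer_slot_def split: if_splits)
          have "(\<Sum>a\<in>{a \<in> {1..?N}. outer_slot n (Suc l) a = c}. ps ! (a - 1)) = (\<Sum>b\<in>{0..<n}. px ! b)"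
            unfolding fib sum.shift_bounds_nat_ivl using lp by (simp add: ps(1) nth_append)
          then show ?thesis using 2 lp by (simp add: P_def nth_append sum_list_sum_nth)
        next
          case 3
          then have "{a \<in> {1..?N}. outer_slot n (Suc l) a = c} = {c + n - 1}"
            using c n by (auto simp: outer_slot_def split: if_splits)
          moreover define k where "k = c - l - 2"
          then have "c = Suc (Suc (l + k))" using 3 by simp
          ultimately show ?thesis using lp n by (simp add: P_def ps(1) nth_append)
        qed
      qed
      moreover have "ksign q (sum_list (take l P)) * perm_sign m \<sigma> ?Q =
          (perm_sign m \<sigma> P * ksign q (sum_list (take l' (act_list \<sigma> P))) :: 'k)"
        using perm_sign_update[OF \<sigma>P(1), of l q, where 'k = 'k] l lP by (simp add: l'_def)
      moreover have "take l P = pu" using lp by (simp add: P_def)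
      moreover have "take l' (act_list \<sigma> P) = take l' (act_list \<sigma> ?Q)"
        using act_list_update[OF \<sigma>P(1), of l "P ! l + q"] l lP by (simp add: l'_def)
      ultimately have sgn: "ksign q (sum_list pu) * perm_sign m \<sigma> ?Q =
          (perm_sign ?N ?\<pi> ps * ksign q (sum_list (take l' (act_list \<sigma> ?Q))) :: 'k)" by simp
      have hom': "homogeneous_list (take l' (act_list \<sigma> ?Q)) us'"
        unfolding us'_def L'_def by (rule list_all2_takeI[OF list_all2_act_list[OF homL \<sigma>P(2)]])
      have "end_pcomp V m n (Suc l) (end_act V m \<phi> \<sigma>) \<psi> vs = end_act V m \<phi> \<sigma> (map (Spow q) us @ y # ws)"
        unfolding vs(1) y_def by (rule end_pcomp_parity[OF multilinearD[OF multilinear_act[OF \<phi> \<sigma>]] homogeneous(2) vs(2-4)])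
      also have "\<dots> = ksign q (sum_list pu) \<cdot> end_act V m \<phi> \<sigma> ?L"
        using slotwise_Spow_homogeneous[OF multilinearD[OF multilinear_act[OF \<phi> \<sigma>]] ps(2), of "[]" "y # ws" q] vs by simp
      also have "\<dots> = (ksign q (sum_list pu) * perm_sign m \<sigma> ?Q) \<cdot> \<phi> L'"
        unfolding end_act_homogeneous[OF \<phi>' \<sigma> lP(2) homL] L'_def by simp
      also have "\<dots> = perm_sign ?N ?\<pi> ps \<cdot> ksign q (sum_list (take l' (act_list \<sigma> ?Q))) \<cdot> \<phi> (us' @ y # ws')"
        unfolding sgn L' by simp
      also have "ksign q (sum_list (take l' (act_list \<sigma> ?Q))) \<cdot> \<phi> (us' @ y # ws') = \<phi> (map (Spow q) us' @ y # ws')"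
        using slotwise_Spow_homogeneous[OF \<phi>' hom', of "[]" "y # ws'" q] len' by simp
      also have "\<dots> = end_pcomp V m n (Suc l') \<phi> \<psi> (act_list ?\<pi> vs)"
        unfolding act y_def by (rule end_pcomp_parity[OF \<phi>' homogeneous(2) len'(1) vs(3) len'(2), symmetric])
      finally show "end_pcomp V m n (Suc l) (end_act V m \<phi> \<sigma>) \<psi> vs =
          end_act V ?N (end_pcomp V m n (Suc l') \<phi> \<psi>) ?\<pi> vs"
        unfolding end_act_homogeneous[OF multilinearD[OF comp] \<pi> len hom] .
    qed
  next
    case (add \<psi> \<psi>')
    have R: "slotwise_linear m (end_act V m \<phi> \<sigma>)" by (rule multilinearD[OF multilinear_act[OF \<phi> \<sigma>]])
    show ?case unfolding end_pcomp_add_right[OF R n l] end_pcomp_add_right[OF \<phi>' n l'] end_act_add add.IH by simp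
  qed
qed

lemma dg_operad_End: "dg_operad (End_operad V)"
proof (rule dg_operad.intro, goal_cases)
  case (1 n) show ?case by (rule dg_space_End)
next
  case (2 n \<sigma>) then show ?case by (auto simp: linear_map_def multilinear_act end_act_add end_act_scale)
next
  case (3 n \<sigma> x p) then show ?case by (simp add: end_hcomp_act)
next
  case (4 n \<sigma> x) then show ?case by (simp add: end_dif_act)
next
  case (5 n x) then show ?case by (simp add: end_act_id)
next
  case (6 n \<sigma> \<tau> x) then show ?case by (simp add: end_act_act)
next
  case (7 n i m y)
  then obtain l where "i = Suc l" "l < m" by (cases i) auto
  with 7 show ?case by (auto simp: linear_map_def multilinear_pcomp[simplified] end_pcomp_add_left end_pcomp_scale_left)
next
  case (8 n i m x)
  then obtain l where "i = Suc l" "l < m" by (cases i) auto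
  with 8 show ?case
    by (auto simp: linear_map_def multilinear_pcomp[simplified] end_pcomp_add_right[OF multilinearD] end_pcomp_scale_right[OF multilinearD])
next
  case (9 n i m x p y q)
  then obtain l where "i = Suc l" "l < m" by (cases i) auto
  with 9 show ?case by (simp add: homogeneous_End multilinear_pcomp[simplified] parity_pcomp del: add_bit_eq_xor)
next
  case (10 n i m x y)
  then obtain l where "i = Suc l" "l < m" by (cases i) auto
  with 10 show ?case by (simp add: end_dif_pcomp)
next
  case (11 r i m j n x y z)
  then obtain l k where "i = Suc l" "l < m" "j = Suc k" "k < n" by (cases i; cases j) auto
  with 11 show ?case using end_pcomp_sequential[of x m y n z r l k] by simp
next
  case (12 n r i j m x y p z q)
  then obtain l k where "i = Suc l" "j = Suc k" "l < k" "k < m" by (cases i; cases j) auto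
  with 12 show ?case using end_pcomp_parallel[of x m y n p z r q l k] by (simp add: homogeneous_End)
next
  case (13 n i m \<sigma> x y)
  then obtain l where "i = Suc l" "l < m" by (cases i) auto
  with 13 show ?case by (simp add: end_pcomp_outer)
next
  case (14 n i m \<tau> x y)
  then obtain l where "i = Suc l" "l < m" by (cases i) auto
  with 14 show ?case by (simp add: end_pcomp_inner)
next
  case 15
  show ?case unfolding homogeneous_End using multilinear_unary[OF id_linear] parity_unary[OF id_linear, of 0] by simp
next
  case (16 n x) then show ?case using end_pcomp_unary_left[OF id_linear, of n x] by simp
next
  case (17 i n x)
  then obtain l where "i = Suc l" "l < n" by (cases i) auto
  with 17 show ?case using end_pcomp_unit_right[of x n l] by simp
qed

end

declare One_nat_def [simp del]

section \<open>Calculations in dg spaces and dg operads\<close>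

subsection \<open>Iterated sums\<close>

context abelian_monoid
begin

lemma finsum_Sigma:
  assumes "finite I" "\<And>i. i \<in> I \<Longrightarrow> finite (B i)" "\<And>i j. i \<in> I \<Longrightarrow> j \<in> B i \<Longrightarrow> g i j \<in> carrier G"
  shows "(\<Oplus>i\<in>I. \<Oplus>j\<in>B i. g i j) = (\<Oplus>x\<in>Sigma I B. g (fst x) (snd x))"
  using assms
proof (induction I rule: finite_induct)
  case (insert i F)
  have closed: "(\<lambda>x. g (fst x) (snd x)) \<in> Pair i ` B i \<rightarrow> carrier G"
    "(\<lambda>x. g (fst x) (snd x)) \<in> Sigma F B \<rightarrow> carrier G" using insert.prems by auto
  have "(\<Oplus>x\<in>Sigma (insert i F) B. g (fst x) (snd x)) =
      (\<Oplus>x\<in>Pair i ` B i. g (fst x) (snd x)) \<oplus> (\<Oplus>x\<in>Sigma F B. g (fst x) (snd x))"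
  proof -
    have "Sigma (insert i F) B = Pair i ` B i \<union> Sigma F B" by auto
    then show ?thesis
      using insert closed by (simp add: finsum_Un_disjoint disjoint_iff image_iff)
  qed
  also have "(\<Oplus>x\<in>Pair i ` B i. g (fst x) (snd x)) = (\<Oplus>j\<in>B i. g i j)"
    by (subst finsum_reindex[OF closed(1)]) (auto simp: inj_on_def)
  also have "(\<Oplus>x\<in>Sigma F B. g (fst x) (snd x)) = (\<Oplus>i\<in>F. \<Oplus>j\<in>B i. g i j)"
    using insert by simp
  finally show ?case
    using insert by (subst finsum_insert) (auto intro!: finsum_closed)
qed simp

lemma finsum_Sigma_reindex:
  assumes fin: "finite I" "\<And>i. i \<in> I \<Longrightarrow> finite (B i)" "finite I'" "\<And>i. i \<in> I' \<Longrightarrow> finite (B' i)"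
    and cl: "\<And>i j. i \<in> I \<Longrightarrow> j \<in> B i \<Longrightarrow> g i j \<in> carrier G"
    and bij: "bij_betw h (Sigma I' B') (Sigma I B)"
    and eq: "\<And>i j. i \<in> I' \<Longrightarrow> j \<in> B' i \<Longrightarrow> g' i j = g (fst (h (i, j))) (snd (h (i, j)))"
  shows "(\<Oplus>i\<in>I. \<Oplus>j\<in>B i. g i j) = (\<Oplus>i\<in>I'. \<Oplus>j\<in>B' i. g' i j)"
proof -
  have h: "h (i, j) \<in> Sigma I B" if "i \<in> I'" "j \<in> B' i" for i j
    using bij_betwE[OF bij] that by auto
  have cl': "g' i j \<in> carrier G" if "i \<in> I'" "j \<in> B' i" for i j
    using h[OF that] eq[OF that] cl by (auto simp: mem_Times_iff)
  have "(\<Oplus>i\<in>I. \<Oplus>j\<in>B i. g i j) = (\<Oplus>x\<in>Sigma I B. g (fst x) (snd x))"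
    by (rule finsum_Sigma) (use fin cl in auto)
  also have "Sigma I B = h ` Sigma I' B'" using bij by (simp add: bij_betw_def)
  also have "(\<Oplus>x\<in>h ` Sigma I' B'. g (fst x) (snd x)) = (\<Oplus>x\<in>Sigma I' B'. g (fst (h x)) (snd (h x)))"
    by (rule finsum_reindex) (use bij h cl in \<open>auto simp: bij_betw_def mem_Times_iff\<close>)
  also have "\<dots> = (\<Oplus>x\<in>Sigma I' B'. g' (fst x) (snd x))"
    by (rule finsum_cong') (use eq cl' in auto)
  also have "\<dots> = (\<Oplus>i\<in>I'. \<Oplus>j\<in>B' i. g' i j)"
    by (rule finsum_Sigma[symmetric]) (use fin cl' in auto)
  finally show ?thesis .
qed

text \<open>
  The coefficients of a product of polynomials are convolutions; these lemmas transfer the laws of multiplication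
  of polynomials to sums in an abelian monoid.
\<close>

lemma convolution_assoc:
  fixes k :: nat
  assumes "\<And>a b c. f a b c \<in> carrier G"
  shows "(\<Oplus>j\<in>{..k}. \<Oplus>l\<in>{..j}. f l (j - l) (k - j)) = (\<Oplus>j\<in>{..k}. \<Oplus>l\<in>{..k - j}. f j l (k - j - l))"
  by (rule finsum_Sigma_reindex[where h = "\<lambda>(j, l). (j + l, j)"])
    (use assms in \<open>auto intro!: bij_betw_byWitness[where f' = "\<lambda>(j, l). (l, j - l)"]\<close>)

lemma convolution_swap:
  fixes k :: nat
  assumes "\<And>a b c. f a b c \<in> carrier G"
  shows "(\<Oplus>j\<in>{..k}. \<Oplus>l\<in>{..j}. f l (j - l) (k - j)) = (\<Oplus>j\<in>{..k}. \<Oplus>l\<in>{..j}. f l (k - j) (j - l))"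
  by (rule finsum_Sigma_reindex[where h = "\<lambda>(j, l). (k - j + l, l)"])
    (use assms in \<open>auto intro!: bij_betw_byWitness[where f' = "\<lambda>(j, l). (k - j + l, l)"]\<close>)

lemma convolution_square:
  fixes N M :: nat
  assumes cl: "\<And>a b. f a b \<in> carrier G" and zero: "\<And>a b. N < a \<or> M < b \<Longrightarrow> f a b = \<zero>"
  shows "(\<Oplus>k\<in>{..N + M}. \<Oplus>j\<in>{..k}. f j (k - j)) = (\<Oplus>j\<in>{..N}. \<Oplus>l\<in>{..M}. f j l)"
proof -
  have "(\<Oplus>k\<in>{..N + M}. \<Oplus>j\<in>{..k}. f j (k - j)) = (\<Oplus>j\<in>{..N + M}. \<Oplus>l\<in>{..N + M - j}. f j l)"
    by (rule finsum_Sigma_reindex[where h = "\<lambda>(j, l). (j + l, j)"])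
      (use cl in \<open>auto intro!: bij_betw_byWitness[where f' = "\<lambda>(j, l). (l, j - l)"]\<close>)
  also have "\<dots> = (\<Oplus>j\<in>{..N}. \<Oplus>l\<in>{..N + M - j}. f j l)"
    by (rule add.finprod_mono_neutral_cong_left[symmetric])
      (use cl zero in \<open>auto intro!: finsum_closed add.finprod_one_eqI\<close>)
  also have "\<dots> = (\<Oplus>j\<in>{..N}. \<Oplus>l\<in>{..M}. f j l)"
  proof (rule finsum_cong')
    fix j assume "j \<in> {..N}"
    then have "M \<le> N + M - j" by simp
    then show "(\<Oplus>l\<in>{..N + M - j}. f j l) = (\<Oplus>l\<in>{..M}. f j l)"
      by (intro add.finprod_mono_neutral_cong_left[symmetric]) (use cl zero in auto)
  qed (use cl in auto)
  finally show ?thesis .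
qed

end

subsection \<open>Linear maps\<close>

lemma ring_of_type_algebra_simps [simp]:
  "carrier (ring_of_type_algebra :: 'k::field ring) = UNIV"
  "a \<oplus>\<^bsub>ring_of_type_algebra\<^esub> b = (a + b :: 'k)"
  "a \<otimes>\<^bsub>ring_of_type_algebra\<^esub> b = (a * b :: 'k)"
  "\<one>\<^bsub>ring_of_type_algebra\<^esub> = (1 :: 'k)"
  "\<zero>\<^bsub>ring_of_type_algebra\<^esub> = (0 :: 'k)"
  by (simp_all add: ring_of_type_algebra_def)

context dg_space
begin

lemma scale_closed [simp, intro]: "x \<in> carrier M \<Longrightarrow> c \<odot> x \<in> carrier M"
  and scale_left_distrib: "x \<in> carrier M \<Longrightarrow> (a + b) \<odot> x = a \<odot> x \<oplus> b \<odot> x"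
  and scale_right_distrib: "x \<in> carrier M \<Longrightarrow> y \<in> carrier M \<Longrightarrow> c \<odot> (x \<oplus> y) = c \<odot> x \<oplus> c \<odot> y"
  and scale_scale: "x \<in> carrier M \<Longrightarrow> a \<odot> (b \<odot> x) = (a * b) \<odot> x"
  and scale_1 [simp]: "x \<in> carrier M \<Longrightarrow> 1 \<odot> x = x"
  and scale_0 [simp]: "x \<in> carrier M \<Longrightarrow> 0 \<odot> x = \<zero>"
  and scale_zero [simp]: "c \<odot> \<zero> = \<zero>"
  using smult_closed[of c x] smult_l_distr[of a b x] smult_r_distr[of c x y] smult_assoc1[of a b x]
    smult_one[of x] smult_l_null[of x] smult_r_null[of c]
  by auto

lemma add_minus_scale: "x \<in> carrier M \<Longrightarrow> x \<oplus> (-1) \<odot> x = \<zero>"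
  using scale_left_distrib[of x 1 "-1"] by simp

end

lemma linear_mapD:
  assumes "linear_map M N f"
  shows "x \<in> carrier M \<Longrightarrow> f x \<in> carrier N"
    and "x \<in> carrier M \<Longrightarrow> y \<in> carrier M \<Longrightarrow> f (x \<oplus>\<^bsub>M\<^esub> y) = f x \<oplus>\<^bsub>N\<^esub> f y"
    and "x \<in> carrier M \<Longrightarrow> f (c \<odot>\<^bsub>M\<^esub> x) = c \<odot>\<^bsub>N\<^esub> f x"
  using assms by (auto simp: linear_map_def)

lemma linear_map_zero:
  assumes "dg_space M" "dg_space N" "linear_map M N f"
  shows "f \<zero>\<^bsub>M\<^esub> = \<zero>\<^bsub>N\<^esub>"
proof -
  interpret M: dg_space M by fact
  interpret N: dg_space N by fact
  have "f (0 \<odot>\<^bsub>M\<^esub> \<zero>\<^bsub>M\<^esub>) = 0 \<odot>\<^bsub>N\<^esub> f \<zero>\<^bsub>M\<^esub>"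
    by (rule linear_mapD(3)[OF assms(3)]) simp
  then show ?thesis using linear_mapD(1)[OF assms(3), of "\<zero>\<^bsub>M\<^esub>"] by simp
qed

lemma linear_map_finsum:
  assumes "dg_space M" "dg_space N" "linear_map M N f" "g \<in> A \<rightarrow> carrier M"
  shows "f (\<Oplus>\<^bsub>M\<^esub>a\<in>A. g a) = (\<Oplus>\<^bsub>N\<^esub>a\<in>A. f (g a))"
proof -
  interpret M: dg_space M by fact
  interpret N: dg_space N by fact
  show ?thesis
    using assms(4)
  proof (induction A rule: infinite_finite_induct)
    case (insert a A)
    then show ?case
      using linear_mapD[OF assms(3)]
      by (subst M.finsum_insert, simp_all, subst N.finsum_insert) (auto simp: Pi_iff)
  qed (simp_all add: linear_map_zero[OF assms(1-3)])
qed

lemma linear_map_comp: "linear_map M N f \<Longrightarrow> linear_map N L g \<Longrightarrow> linear_map M L (\<lambda>x. g (f x))"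
  by (auto simp: linear_map_def Pi_iff)

context dg_space
begin

lemma linear_map_scale: "linear_map M M (\<lambda>x. c \<odot> x)"
  by (auto simp: linear_map_def scale_right_distrib scale_scale mult.commute)

lemma linear_map_add: "linear_map L M f \<Longrightarrow> linear_map L M g \<Longrightarrow> linear_map L M (\<lambda>x. f x \<oplus> g x)"
  by (auto simp: linear_map_def Pi_iff scale_right_distrib M.a_ac)

lemmas hcomp_closed [simp, intro] = linear_mapD(1)[OF hcomp_linear]
  and hcomp_add = linear_mapD(2)[OF hcomp_linear]
  and hcomp_scale = linear_mapD(3)[OF hcomp_linear]
lemmas dif_closed [simp, intro] = linear_mapD(1)[OF dif_linear]
  and dif_add = linear_mapD(2)[OF dif_linear]
  and dif_scale = linear_mapD(3)[OF dif_linear]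

lemma gsign_linear: "linear_map M M (gsign M)"
  unfolding gsign_def[abs_def]
  by (intro linear_map_add linear_map_comp[OF hcomp_linear linear_map_scale] hcomp_linear)

lemmas gsign_closed [simp, intro] = linear_mapD(1)[OF gsign_linear]
  and gsign_add = linear_mapD(2)[OF gsign_linear]
  and gsign_scale = linear_mapD(3)[OF gsign_linear]

lemma map_zero [simp]: "hcomp M p \<zero> = \<zero>" "dif M \<zero> = \<zero>" "gsign M \<zero> = \<zero>"
  using linear_map_zero[OF dg_space_axioms dg_space_axioms] hcomp_linear dif_linear gsign_linear by auto

lemma gsign_homogeneous: "x \<in> homogeneous M p \<Longrightarrow> gsign M x = ksign 1 p \<odot> x"
  using bit_cases[of p] hcomp_hcomp[of x 0 1] hcomp_hcomp[of x 1 0]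
  by (auto simp: homogeneous_def gsign_def)

lemma homogeneousI: "x \<in> carrier M \<Longrightarrow> hcomp M p x \<in> homogeneous M p"
  by (simp add: homogeneous_def hcomp_hcomp)

lemma homogeneousD: "x \<in> homogeneous M p \<Longrightarrow> x \<in> carrier M"
  by (simp add: homogeneous_def)

lemma hcomp_homogeneous: "x \<in> homogeneous M q \<Longrightarrow> hcomp M p x = (if p = q then x else \<zero>)"
  using hcomp_hcomp[of x p q] by (auto simp: homogeneous_def)

lemma homogeneous_zero: "\<zero> \<in> homogeneous M p"
  by (simp add: homogeneous_def)

lemma gsign_hcomp: "x \<in> carrier M \<Longrightarrow> gsign M (hcomp M p x) = ksign 1 p \<odot> hcomp M p x"
  by (rule gsign_homogeneous[OF homogeneousI])

lemma hcomp_gsign: "x \<in> carrier M \<Longrightarrow> hcomp M p (gsign M x) = ksign 1 p \<odot> hcomp M p x"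
  using bit_cases[of p] by (auto simp: gsign_def hcomp_add hcomp_scale hcomp_hcomp)

lemma homogeneous_decomp:
  assumes "x \<in> carrier M"
  obtains x0 x1 where "x = x0 \<oplus> x1" "x0 \<in> homogeneous M 0" "x1 \<in> homogeneous M 1"
  using hcomp_sum[OF assms] homogeneousI[OF assms] by metis

lemma gsign_gsign [simp]: "x \<in> carrier M \<Longrightarrow> gsign M (gsign M x) = x"
  unfolding gsign_def[of M "gsign M x"] by (simp add: hcomp_gsign scale_scale hcomp_sum)

lemma dif_homogeneous: "x \<in> homogeneous M p \<Longrightarrow> dif M x \<in> homogeneous M (p + 1)"
  using dif_odd[of x p] by (auto simp: homogeneous_def)

lemma gsign_dif: "x \<in> carrier M \<Longrightarrow> gsign M (dif M x) = (-1) \<odot> dif M (gsign M x)"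
proof -
  assume x: "x \<in> carrier M"
  obtain x0 x1 where *: "x = x0 \<oplus> x1" "x0 \<in> homogeneous M 0" "x1 \<in> homogeneous M 1"
    using homogeneous_decomp[OF x] .
  have "gsign M (dif M x0) = (-1) \<odot> dif M (gsign M x0)" "gsign M (dif M x1) = (-1) \<odot> dif M (gsign M x1)"
    using gsign_homogeneous[OF dif_homogeneous[OF *(2)]] gsign_homogeneous[OF dif_homogeneous[OF *(3)]]
      gsign_homogeneous[OF *(2)] gsign_homogeneous[OF *(3)] homogeneousD[OF *(2)] homogeneousD[OF *(3)]
    by (simp_all add: dif_scale scale_scale)
  then show ?thesis
    using homogeneousD[OF *(2)] homogeneousD[OF *(3)] unfolding *(1)
    by (simp add: dif_add gsign_add scale_right_distrib)
qed

text \<open>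
  Identities that are additive in an argument only need to be checked for homogeneous arguments.
\<close>

lemma homogeneous_induct [consumes 1, case_names homogeneous add]:
  assumes "x \<in> carrier M" and hom: "\<And>p y. y \<in> homogeneous M p \<Longrightarrow> Q y"
    and add: "\<And>y z. y \<in> carrier M \<Longrightarrow> z \<in> carrier M \<Longrightarrow> Q y \<Longrightarrow> Q z \<Longrightarrow> Q (y \<oplus> z)"
  shows "Q x"
  using homogeneous_decomp[OF assms(1)] hom add homogeneousD by metis

lemma homogeneous_scale: "x \<in> homogeneous M p \<Longrightarrow> c \<odot> x \<in> homogeneous M p"
  by (auto simp: homogeneous_def hcomp_scale)

lemma homogeneous_add: "x \<in> homogeneous M p \<Longrightarrow> y \<in> homogeneous M p \<Longrightarrow> x \<oplus> y \<in> homogeneous M p"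
  by (auto simp: homogeneous_def hcomp_add)

end

subsection \<open>Composition, parity and sign\<close>

context dg_operad
begin

lemma pcomp_closed [simp, intro]:
  assumes "n \<ge> 1" "i \<in> {1..m}" "x \<in> carrier (Sp P m)" "y \<in> carrier (Sp P n)"
  shows "pcomp P m n i x y \<in> carrier (Sp P (m + n - 1))"
  by (rule linear_mapD(1)[OF pcomp_linear_left]) (use assms in auto)

lemmas pcomp_add_left = linear_mapD(2)[OF pcomp_linear_left]
  and pcomp_scale_left = linear_mapD(3)[OF pcomp_linear_left]
  and pcomp_add_right = linear_mapD(2)[OF pcomp_linear_right]
  and pcomp_scale_right = linear_mapD(3)[OF pcomp_linear_right]
  and act_closed [simp, intro] = linear_mapD(1)[OF act_linear]
  and act_add = linear_mapD(2)[OF act_linear]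
  and act_scale = linear_mapD(3)[OF act_linear]

lemma act_zero: "n \<ge> 1 \<Longrightarrow> \<sigma> permutes {1..n} \<Longrightarrow> act P n \<zero>\<^bsub>Sp P n\<^esub> \<sigma> = \<zero>\<^bsub>Sp P n\<^esub>"
  by (rule linear_map_zero[OF space space act_linear])

lemma pcomp_zero_left:
  "n \<ge> 1 \<Longrightarrow> i \<in> {1..m} \<Longrightarrow> y \<in> carrier (Sp P n) \<Longrightarrow> pcomp P m n i \<zero>\<^bsub>Sp P m\<^esub> y = \<zero>\<^bsub>Sp P (m + n - 1)\<^esub>"
  by (rule linear_map_zero[OF space space pcomp_linear_left]) auto

lemma pcomp_zero_right:
  "n \<ge> 1 \<Longrightarrow> i \<in> {1..m} \<Longrightarrow> x \<in> carrier (Sp P m) \<Longrightarrow> pcomp P m n i x \<zero>\<^bsub>Sp P n\<^esub> = \<zero>\<^bsub>Sp P (m + n - 1)\<^esub>"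
  by (rule linear_map_zero[OF space space pcomp_linear_right]) auto

lemma pcomp_finsum_left:
  "n \<ge> 1 \<Longrightarrow> i \<in> {1..m} \<Longrightarrow> y \<in> carrier (Sp P n) \<Longrightarrow> g \<in> A \<rightarrow> carrier (Sp P m) \<Longrightarrow>
    pcomp P m n i (\<Oplus>\<^bsub>Sp P m\<^esub>a\<in>A. g a) y = (\<Oplus>\<^bsub>Sp P (m + n - 1)\<^esub>a\<in>A. pcomp P m n i (g a) y)"
  by (rule linear_map_finsum[OF space space pcomp_linear_left]) auto

lemma pcomp_finsum_right:
  "n \<ge> 1 \<Longrightarrow> i \<in> {1..m} \<Longrightarrow> x \<in> carrier (Sp P m) \<Longrightarrow> g \<in> A \<rightarrow> carrier (Sp P n) \<Longrightarrow>
    pcomp P m n i x (\<Oplus>\<^bsub>Sp P n\<^esub>a\<in>A. g a) = (\<Oplus>\<^bsub>Sp P (m + n - 1)\<^esub>a\<in>A. pcomp P m n i x (g a))"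
  by (rule linear_map_finsum[OF space space pcomp_linear_right]) auto

lemma homogeneous_closed: "n \<ge> 1 \<Longrightarrow> x \<in> homogeneous (Sp P n) p \<Longrightarrow> x \<in> carrier (Sp P n)"
  by (simp add: homogeneous_def)

text \<open>
  The sign operator is multiplicative, since parities add under composition.
\<close>

lemma gsign_pcomp:
  assumes n: "n \<ge> 1" and i: "i \<in> {1..m}" and x: "x \<in> carrier (Sp P m)" and y: "y \<in> carrier (Sp P n)"
  shows "gsign (Sp P (m + n - 1)) (pcomp P m n i x y) = pcomp P m n i (gsign (Sp P m) x) (gsign (Sp P n) y)"
proof -
  have m: "m \<ge> 1" using i by auto
  interpret M: dg_space "Sp P m" using space m by simp
  interpret N: dg_space "Sp P n" using space n by simp
  interpret L: dg_space "Sp P (m + n - 1)" using space n m by simp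
  show ?thesis
    using x
  proof (induction rule: M.homogeneous_induct)
    case (homogeneous p x)
    note x = homogeneous M.homogeneousD[OF homogeneous]
    show ?case
      using y
    proof (induction rule: N.homogeneous_induct)
      case (homogeneous q y)
      then show ?case
        using x L.gsign_homogeneous[OF pcomp_degree[OF n i x(1) homogeneous]]
          M.gsign_homogeneous[OF x(1)] N.gsign_homogeneous[OF homogeneous] N.homogeneousD[OF homogeneous] n i
        by (simp add: pcomp_scale_left pcomp_scale_right L.scale_scale ksign_add_right mult.commute del: add_bit_eq_xor)
    next
      case (add y z)
      then show ?case using x n i by (simp add: pcomp_add_right L.gsign_add N.gsign_add)
    qed
  next
    case (add x z)
    then show ?case using y n i by (simp add: pcomp_add_left L.gsign_add M.gsign_add)
  qed
qed

lemma hcomp_pcomp: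
  assumes n: "n \<ge> 1" and i: "i \<in> {1..m}" and x: "x \<in> carrier (Sp P m)" and y: "y \<in> carrier (Sp P n)"
  shows "hcomp (Sp P (m + n - 1)) p (pcomp P m n i x y) =
    pcomp P m n i (hcomp (Sp P m) 0 x) (hcomp (Sp P n) p y) \<oplus>\<^bsub>Sp P (m + n - 1)\<^esub>
    pcomp P m n i (hcomp (Sp P m) 1 x) (hcomp (Sp P n) (p + 1) y)"
proof -
  have m: "m \<ge> 1" using i by auto
  interpret M: dg_space "Sp P m" using space m by simp
  interpret N: dg_space "Sp P n" using space n by simp
  interpret L: dg_space "Sp P (m + n - 1)" using space n m by simp
  show ?thesis
    using x
  proof (induction rule: M.homogeneous_induct)
    case (homogeneous r x)
    note x = homogeneous M.homogeneousD[OF homogeneous]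
    show ?case
      using y
    proof (induction rule: N.homogeneous_induct)
      case (homogeneous q y)
      note y = homogeneous N.homogeneousD[OF homogeneous]
      show ?case
        using x y n i bit_cases[of p] bit_cases[of q] bit_cases[of r]
        by (auto simp: M.hcomp_homogeneous[OF x(1)] N.hcomp_homogeneous[OF y(1)]
            L.hcomp_homogeneous[OF pcomp_degree[OF n i x(1) y(1)]] pcomp_zero_left pcomp_zero_right
            pcomp_closed)
    next
      case (add y z)
      then show ?case using x n i
        by (simp add: pcomp_add_right L.hcomp_add N.hcomp_add L.M.a_ac pcomp_closed)
    qed
  next
    case (add x z)
    then show ?case using y n i
      by (simp add: pcomp_add_left L.hcomp_add M.hcomp_add L.M.a_ac pcomp_closed)
  qed
qed

lemma gsign_act:
  assumes "n \<ge> 1" "\<sigma> permutes {1..n}" "x \<in> carrier (Sp P n)"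
  shows "gsign (Sp P n) (act P n x \<sigma>) = act P n (gsign (Sp P n) x) \<sigma>"
proof -
  interpret N: dg_space "Sp P n" using space assms(1) by simp
  show ?thesis using assms by (simp add: gsign_def act_hcomp act_add act_scale)
qed

lemma unit_closed [simp, intro]: "ounit P \<in> carrier (Sp P 1)"
  using unit_even by (simp add: homogeneous_def)

lemma dif_unit: "dif (Sp P 1) (ounit P) = \<zero>\<^bsub>Sp P 1\<^esub>"
proof -
  interpret N: dg_space "Sp P 1" by (rule space) simp
  let ?d = "dif (Sp P 1) (ounit P)"
  have d: "?d \<in> carrier (Sp P 1)" by simp
  have one: "1 + 1 - 1 = (1 :: nat)" by arith
  have "?d = dif (Sp P 1) (pcomp P 1 1 1 (ounit P) (ounit P))"
    using unit_left[of 1 "ounit P"] by simp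
  also have "\<dots> = ?d \<oplus>\<^bsub>Sp P 1\<^esub> ?d"
    using pcomp_dif[of 1 1 1 "ounit P" "ounit P", unfolded one] N.gsign_homogeneous[OF unit_even] d
    by (simp add: unit_left unit_right)
  finally show ?thesis using d N.M.add.l_cancel_one' by metis
qed

end

section \<open>The operad of polynomial forms with values in a dg operad\<close>

subsection \<open>Polynomial forms with values in a dg space\<close>

lemma tensor_D_space_simps [simp]:
  "zero (tensor_D_space M) = (\<lambda>e k. \<zero>\<^bsub>M\<^esub>)"
  "a \<oplus>\<^bsub>tensor_D_space M\<^esub> b = (\<lambda>e k. a e k \<oplus>\<^bsub>M\<^esub> b e k)"
  "c \<odot>\<^bsub>tensor_D_space M\<^esub> a = (\<lambda>e k. c \<odot>\<^bsub>M\<^esub> a e k)"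
  "hcomp (tensor_D_space M) p a = (\<lambda>e k. hcomp M (p + e) (a e k))"
  by (simp_all add: tensor_D_space_def mk_dg_space_def fun_eq_iff)

lemma dif_tensor_D_space:
  "dif (tensor_D_space M) a e k = (if e = 0 then dif M (a 0 k)
    else dif M (a 1 k) \<oplus>\<^bsub>M\<^esub> of_nat (Suc k) \<odot>\<^bsub>M\<^esub> gsign M (a 0 (Suc k)))"
  by (simp add: tensor_D_space_def mk_dg_space_def)

lemma tensor_D_space_carrier:
  "a \<in> carrier (tensor_D_space M) \<longleftrightarrow>
    (\<forall>e k. a e k \<in> carrier M) \<and> (\<exists>N. \<forall>e k. N < k \<longrightarrow> a e k = \<zero>\<^bsub>M\<^esub>)"
proof -
  have "finite {k. \<exists>e. a e k \<noteq> \<zero>\<^bsub>M\<^esub>} \<longleftrightarrow> (\<exists>N. \<forall>e k. N < k \<longrightarrow> a e k = \<zero>\<^bsub>M\<^esub>)"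
    unfolding finite_nat_set_iff_bounded_le by (auto simp: not_less[symmetric])
  then show ?thesis by (simp add: tensor_D_space_def mk_dg_space_def)
qed

lemma tensor_D_coeff: "a \<in> carrier (tensor_D_space M) \<Longrightarrow> a e k \<in> carrier M"
  by (simp add: tensor_D_space_carrier)

context dg_space
begin

lemma tensor_D_closed:
  assumes "\<And>e k. a e k \<in> carrier M" "\<And>e k. N < k \<Longrightarrow> a e k = \<zero>"
  shows "a \<in> carrier (tensor_D_space M)"
  using assms unfolding tensor_D_space_carrier by blast

lemma gsign_tensor_D:
  assumes "a \<in> carrier (tensor_D_space M)"
  shows "gsign (tensor_D_space M) a = (\<lambda>e k. ksign 1 e \<odot> gsign M (a e k))"
proof (intro ext)
  fix e k
  show "gsign (tensor_D_space M) a e k = ksign 1 e \<odot> gsign M (a e k)"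
    using bit_cases[of e] tensor_D_coeff[OF assms, of e k]
    by (auto simp: gsign_def scale_right_distrib scale_scale M.a_comm)
qed

lemma homogeneous_tensor_D:
  "a \<in> homogeneous (tensor_D_space M) p \<longleftrightarrow>
    a \<in> carrier (tensor_D_space M) \<and> (\<forall>e k. a e k \<in> homogeneous M (p + e))"
  by (auto simp: homogeneous_def fun_eq_iff tensor_D_coeff)

lemma linear_map_coeffwise:
  assumes "\<And>e. linear_map M M (f e)"
  shows "linear_map (tensor_D_space M) (tensor_D_space M) (\<lambda>a e k. f e (a e k))"
proof -
  have z: "f e \<zero> = \<zero>" for e by (rule linear_map_zero[OF dg_space_axioms dg_space_axioms assms])
  show ?thesis
    unfolding linear_map_def
    by (auto simp: tensor_D_space_carrier z linear_mapD[OF assms]) (metis z)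
qed

lemma linear_map_dif_tensor_D:
  "linear_map (tensor_D_space M) (tensor_D_space M) (dif (tensor_D_space M))"
  unfolding linear_map_def
proof (intro conjI ballI allI)
  show "dif (tensor_D_space M) \<in> carrier (tensor_D_space M) \<rightarrow> carrier (tensor_D_space M)"
  proof
    fix a assume a: "a \<in> carrier (tensor_D_space M)"
    then obtain N where N: "\<And>e k. N < k \<Longrightarrow> a e k = \<zero>" by (auto simp: tensor_D_space_carrier)
    show "dif (tensor_D_space M) a \<in> carrier (tensor_D_space M)"
      by (rule tensor_D_closed[of _ N])
        (use tensor_D_coeff[OF a] N in \<open>auto simp: dif_tensor_D_space\<close>)
  qed
next
  fix a b assume a: "a \<in> carrier (tensor_D_space M)" and b: "b \<in> carrier (tensor_D_space M)"
  show "dif (tensor_D_space M) (a \<oplus>\<^bsub>tensor_D_space M\<^esub> b) =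
      dif (tensor_D_space M) a \<oplus>\<^bsub>tensor_D_space M\<^esub> dif (tensor_D_space M) b"
    using tensor_D_coeff[OF a] tensor_D_coeff[OF b]
    by (simp add: fun_eq_iff dif_tensor_D_space dif_add gsign_add scale_right_distrib M.a_ac)
next
  fix a c assume a: "a \<in> carrier (tensor_D_space M)"
  show "dif (tensor_D_space M) (c \<odot>\<^bsub>tensor_D_space M\<^esub> a) = c \<odot>\<^bsub>tensor_D_space M\<^esub> dif (tensor_D_space M) a"
    using tensor_D_coeff[OF a]
    by (simp add: fun_eq_iff dif_tensor_D_space dif_scale gsign_scale scale_right_distrib scale_scale mult.commute)
qed

text \<open>
  The square of the differential vanishes since the two mixed terms, the differential of the coefficient
  followed by the derivative in $z$ and conversely, have opposite signs.
\<close>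

lemma dg_space_tensor_D: "dg_space (tensor_D_space M)"
proof (intro dg_space.intro dg_space_axioms.intro)
  show "Module.module (ring_of_type_algebra :: 'k ring) (tensor_D_space M)"
  proof (rule moduleI)
    show "cring (ring_of_type_algebra :: 'k ring)" by (rule cring_from_type_algebra)
    show "abelian_group (tensor_D_space M)"
    proof (rule abelian_groupI)
      fix a b assume a: "a \<in> carrier (tensor_D_space M)" and b: "b \<in> carrier (tensor_D_space M)"
      obtain N1 N2 where "\<And>e k. N1 < k \<Longrightarrow> a e k = \<zero>" "\<And>e k. N2 < k \<Longrightarrow> b e k = \<zero>"
        using a b by (auto simp: tensor_D_space_carrier)
      then show "a \<oplus>\<^bsub>tensor_D_space M\<^esub> b \<in> carrier (tensor_D_space M)"
        by (intro tensor_D_closed[of _ "max N1 N2"]) (use tensor_D_coeff[OF a] tensor_D_coeff[OF b] in auto)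
      show "a \<oplus>\<^bsub>tensor_D_space M\<^esub> b = b \<oplus>\<^bsub>tensor_D_space M\<^esub> a"
        using tensor_D_coeff[OF a] tensor_D_coeff[OF b] by (simp add: fun_eq_iff M.a_comm)
      fix c assume c: "c \<in> carrier (tensor_D_space M)"
      show "a \<oplus>\<^bsub>tensor_D_space M\<^esub> b \<oplus>\<^bsub>tensor_D_space M\<^esub> c = a \<oplus>\<^bsub>tensor_D_space M\<^esub> (b \<oplus>\<^bsub>tensor_D_space M\<^esub> c)"
        using tensor_D_coeff[OF a] tensor_D_coeff[OF b] tensor_D_coeff[OF c] by (simp add: fun_eq_iff M.a_assoc)
    next
      fix a assume a: "a \<in> carrier (tensor_D_space M)"
      show "\<zero>\<^bsub>tensor_D_space M\<^esub> \<oplus>\<^bsub>tensor_D_space M\<^esub> a = a"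
        using tensor_D_coeff[OF a] by (simp add: fun_eq_iff)
      have "(\<lambda>e k. (-1) \<odot> a e k) \<in> carrier (tensor_D_space M)"
        using linear_mapD(1)[OF linear_map_coeffwise[OF linear_map_scale] a] .
      moreover have "(\<lambda>e k. (-1) \<odot> a e k) \<oplus>\<^bsub>tensor_D_space M\<^esub> a = \<zero>\<^bsub>tensor_D_space M\<^esub>"
        using tensor_D_coeff[OF a] add_minus_scale by (simp add: fun_eq_iff M.a_comm)
      ultimately show "\<exists>b\<in>carrier (tensor_D_space M). b \<oplus>\<^bsub>tensor_D_space M\<^esub> a = \<zero>\<^bsub>tensor_D_space M\<^esub>" by blast
    qed (auto intro: tensor_D_closed)
  next
    fix c a assume "a \<in> carrier (tensor_D_space M)"
    then show "c \<odot>\<^bsub>tensor_D_space M\<^esub> a \<in> carrier (tensor_D_space M)"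
      using linear_mapD(1)[OF linear_map_coeffwise[where f = "\<lambda>e x. c \<odot> x", OF linear_map_scale]] by simp
  qed (simp_all add: fun_eq_iff tensor_D_coeff scale_left_distrib scale_right_distrib scale_scale)
next
  fix p :: bit
  have "hcomp (tensor_D_space M) p = (\<lambda>a e k. hcomp M (p + e) (a e k))" by (intro ext) simp
  then show "linear_map (tensor_D_space M) (tensor_D_space M) (hcomp (tensor_D_space M) p)"
    using linear_map_coeffwise[where f = "\<lambda>e. hcomp M (p + e)", OF hcomp_linear] by simp
next
  fix a and p q :: bit assume a: "a \<in> carrier (tensor_D_space M)"
  show "hcomp (tensor_D_space M) p (hcomp (tensor_D_space M) q a) =
      (if p = q then hcomp (tensor_D_space M) p a else \<zero>\<^bsub>tensor_D_space M\<^esub>)"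
    using tensor_D_coeff[OF a] by (auto simp: fun_eq_iff hcomp_hcomp)
next
  fix a assume a: "a \<in> carrier (tensor_D_space M)"
  show "hcomp (tensor_D_space M) 0 a \<oplus>\<^bsub>tensor_D_space M\<^esub> hcomp (tensor_D_space M) 1 a = a"
  proof (intro ext)
    fix e k
    show "(hcomp (tensor_D_space M) 0 a \<oplus>\<^bsub>tensor_D_space M\<^esub> hcomp (tensor_D_space M) 1 a) e k = a e k"
      using tensor_D_coeff[OF a, of e k] hcomp_sum[of "a e k"] bit_cases[of e] by (auto simp: M.a_comm)
  qed
next
  show "linear_map (tensor_D_space M) (tensor_D_space M) (dif (tensor_D_space M))"
    by (rule linear_map_dif_tensor_D)
next
  fix a and p :: bit assume a: "a \<in> carrier (tensor_D_space M)"
  have o: "p + 1 + 1 = p" using bit_cases[of p] by auto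
  show "hcomp (tensor_D_space M) (p + 1) (dif (tensor_D_space M) a) =
      dif (tensor_D_space M) (hcomp (tensor_D_space M) p a)"
  proof (intro ext)
    fix e k
    have "hcomp M p (dif M (a 1 k)) = dif M (hcomp M (p + 1) (a 1 k))"
      using dif_odd[OF tensor_D_coeff[OF a], of "p + 1" 1 k] unfolding o .
    then show "hcomp (tensor_D_space M) (p + 1) (dif (tensor_D_space M) a) e k =
        dif (tensor_D_space M) (hcomp (tensor_D_space M) p a) e k"
      using tensor_D_coeff[OF a] bit_cases[of e] o
      by (auto simp: dif_tensor_D_space dif_odd hcomp_add hcomp_scale hcomp_gsign gsign_hcomp simp del: add_bit_eq_xor)
  qed
next
  fix a assume a: "a \<in> carrier (tensor_D_space M)"
  show "dif (tensor_D_space M) (dif (tensor_D_space M) a) = \<zero>\<^bsub>tensor_D_space M\<^esub>"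
  proof (intro ext)
    fix e k
    let ?x = "of_nat (Suc k) \<odot> dif M (gsign M (a 0 (Suc k)))"
    have "?x \<oplus> of_nat (Suc k) \<odot> gsign M (dif M (a 0 (Suc k))) = ?x \<oplus> (-1) \<odot> ?x"
      using tensor_D_coeff[OF a] by (simp add: gsign_dif scale_scale)
    also have "\<dots> = \<zero>" by (rule add_minus_scale) (use tensor_D_coeff[OF a] in auto)
    finally show "dif (tensor_D_space M) (dif (tensor_D_space M) a) e k = \<zero>\<^bsub>tensor_D_space M\<^esub> e k"
      using tensor_D_coeff[OF a]
      by (simp add: dif_tensor_D_space dif_dif dif_add dif_scale del: of_nat_Suc)
  qed
qed

end

subsection \<open>The dg operad structure\<close>

lemma tensor_D_simps [simp]:
  "Sp (tensor_D P) n = tensor_D_space (Sp P n)"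
  "act (tensor_D P) n a \<sigma> = (\<lambda>e k. act P n (a e k) \<sigma>)"
  "ounit (tensor_D P) = (\<lambda>e k. if e = 0 \<and> k = 0 then ounit P else \<zero>\<^bsub>Sp P 1\<^esub>)"
  by (simp_all add: tensor_D_def)

text \<open>The composition of $x_0 + x_1\,\varepsilon$ and $y_0 + y_1\,\varepsilon$ for an odd
  parameter $\varepsilon$ (later \<open>dz\<close>) of square zero.\<close>

definition form_comp :: "('k::field, 'a) operad \<Rightarrow> nat \<Rightarrow> nat \<Rightarrow> nat \<Rightarrow> bit \<Rightarrow> (bit \<Rightarrow> 'a) \<Rightarrow> (bit \<Rightarrow> 'a) \<Rightarrow> 'a" where
  "form_comp P m n i e x y =
    (if e = 0 then pcomp P m n i (x 0) (y 0)
     else pcomp P m n i (x 0) (y 1) \<oplus>\<^bsub>Sp P (m + n - 1)\<^esub> pcomp P m n i (x 1) (gsign (Sp P n) (y 0)))"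

lemma pcomp_tensor_D:
  "pcomp (tensor_D P) m n i a b e k =
    (\<Oplus>\<^bsub>Sp P (m + n - 1)\<^esub>j\<in>{..k}. form_comp P m n i e (\<lambda>e. a e j) (\<lambda>e. b e (k - j)))"
  by (simp add: tensor_D_def form_comp_def)

context dg_operad
begin

lemma space_comp: "n \<ge> 1 \<Longrightarrow> i \<in> {1..m} \<Longrightarrow> dg_space (Sp P (m + n - 1))"
  by (rule space) auto

lemma form_comp_closed [simp, intro]:
  assumes "n \<ge> 1" "i \<in> {1..m}" "\<And>e. x e \<in> carrier (Sp P m)" "\<And>e. y e \<in> carrier (Sp P n)"
  shows "form_comp P m n i e x y \<in> carrier (Sp P (m + n - 1))"
proof -
  interpret N: dg_space "Sp P n" using space assms by simp
  interpret L: dg_space "Sp P (m + n - 1)" by (rule space_comp[OF assms(1,2)])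
  show ?thesis using assms by (simp add: form_comp_def)
qed

lemma form_comp_add_left:
  assumes n: "n \<ge> 1" and i: "i \<in> {1..m}"
    and y: "\<And>e. y e \<in> carrier (Sp P n)"
    and x: "\<And>e. x e \<in> carrier (Sp P m)" "\<And>e. x' e \<in> carrier (Sp P m)"
  shows "form_comp P m n i e (\<lambda>e. x e \<oplus>\<^bsub>Sp P m\<^esub> x' e) y =
      form_comp P m n i e x y \<oplus>\<^bsub>Sp P (m + n - 1)\<^esub> form_comp P m n i e x' y"
proof -
  interpret N: dg_space "Sp P n" using space n by simp
  interpret L: dg_space "Sp P (m + n - 1)" by (rule space_comp[OF n i])
  show ?thesis using assms by (simp add: form_comp_def pcomp_add_left L.M.a_ac)
qed

lemma form_comp_scale_left:
  assumes n: "n \<ge> 1" and i: "i \<in> {1..m}"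
    and y: "\<And>e. y e \<in> carrier (Sp P n)"
    and x: "\<And>e. x e \<in> carrier (Sp P m)"
  shows "form_comp P m n i e (\<lambda>e. c \<odot>\<^bsub>Sp P m\<^esub> x e) y = c \<odot>\<^bsub>Sp P (m + n - 1)\<^esub> form_comp P m n i e x y"
proof -
  interpret N: dg_space "Sp P n" using space n by simp
  interpret L: dg_space "Sp P (m + n - 1)" by (rule space_comp[OF n i])
  show ?thesis using assms by (simp add: form_comp_def pcomp_scale_left L.scale_right_distrib)
qed

lemma form_comp_add_right:
  assumes n: "n \<ge> 1" and i: "i \<in> {1..m}"
    and x: "\<And>e. x e \<in> carrier (Sp P m)"
    and y: "\<And>e. y e \<in> carrier (Sp P n)" "\<And>e. y' e \<in> carrier (Sp P n)"
  shows "form_comp P m n i e x (\<lambda>e. y e \<oplus>\<^bsub>Sp P n\<^esub> y' e) =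
      form_comp P m n i e x y \<oplus>\<^bsub>Sp P (m + n - 1)\<^esub> form_comp P m n i e x y'"
proof -
  interpret N: dg_space "Sp P n" using space n by simp
  interpret L: dg_space "Sp P (m + n - 1)" by (rule space_comp[OF n i])
  show ?thesis using assms by (simp add: form_comp_def pcomp_add_right L.M.a_ac N.gsign_add)
qed

lemma form_comp_scale_right:
  assumes n: "n \<ge> 1" and i: "i \<in> {1..m}"
    and x: "\<And>e. x e \<in> carrier (Sp P m)"
    and y: "\<And>e. y e \<in> carrier (Sp P n)"
  shows "form_comp P m n i e x (\<lambda>e. c \<odot>\<^bsub>Sp P n\<^esub> y e) = c \<odot>\<^bsub>Sp P (m + n - 1)\<^esub> form_comp P m n i e x y"
proof -
  interpret N: dg_space "Sp P n" using space n by simp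
  interpret L: dg_space "Sp P (m + n - 1)" by (rule space_comp[OF n i])
  show ?thesis using assms by (simp add: form_comp_def pcomp_scale_right L.scale_right_distrib N.gsign_scale)
qed

lemma form_comp_zero:
  assumes n: "n \<ge> 1" and i: "i \<in> {1..m}"
  shows "(\<And>e. y e \<in> carrier (Sp P n)) \<Longrightarrow> form_comp P m n i e (\<lambda>e. \<zero>\<^bsub>Sp P m\<^esub>) y = \<zero>\<^bsub>Sp P (m + n - 1)\<^esub>"
    and "(\<And>e. x e \<in> carrier (Sp P m)) \<Longrightarrow> form_comp P m n i e x (\<lambda>e. \<zero>\<^bsub>Sp P n\<^esub>) = \<zero>\<^bsub>Sp P (m + n - 1)\<^esub>"
proof -
  interpret N: dg_space "Sp P n" using space n by simp
  interpret L: dg_space "Sp P (m + n - 1)" by (rule space_comp[OF n i])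
  show "(\<And>e. y e \<in> carrier (Sp P n)) \<Longrightarrow> form_comp P m n i e (\<lambda>e. \<zero>\<^bsub>Sp P m\<^esub>) y = \<zero>\<^bsub>Sp P (m + n - 1)\<^esub>"
    "(\<And>e. x e \<in> carrier (Sp P m)) \<Longrightarrow> form_comp P m n i e x (\<lambda>e. \<zero>\<^bsub>Sp P n\<^esub>) = \<zero>\<^bsub>Sp P (m + n - 1)\<^esub>"
    using assms by (simp_all add: form_comp_def pcomp_zero_left pcomp_zero_right)
qed

lemma form_comp_finsum_left:
  assumes n: "n \<ge> 1" and i: "i \<in> {1..m}" and y: "\<And>e. y e \<in> carrier (Sp P n)"
    and x: "\<And>e a. a \<in> A \<Longrightarrow> x e a \<in> carrier (Sp P m)"
  shows "form_comp P m n i e (\<lambda>e. \<Oplus>\<^bsub>Sp P m\<^esub>a\<in>A. x e a) y =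
    (\<Oplus>\<^bsub>Sp P (m + n - 1)\<^esub>a\<in>A. form_comp P m n i e (\<lambda>e. x e a) y)"
proof -
  interpret M: dg_space "Sp P m" by (rule space) (use i in auto)
  interpret L: dg_space "Sp P (m + n - 1)" by (rule space_comp[OF n i])
  show ?thesis
    using x
  proof (induction A rule: infinite_finite_induct)
    case (insert a A)
    then show ?case
      using form_comp_add_left[OF n i y, of "\<lambda>e. x e a" "\<lambda>e. \<Oplus>\<^bsub>Sp P m\<^esub>a\<in>A. x e a"] form_comp_closed[OF n i _ y]
      by (simp add: M.finsum_insert L.finsum_insert Pi_iff)
  qed (use form_comp_zero(1)[OF n i y] in auto)
qed

lemma form_comp_finsum_right:
  assumes n: "n \<ge> 1" and i: "i \<in> {1..m}" and x: "\<And>e. x e \<in> carrier (Sp P m)"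
    and y: "\<And>e a. a \<in> A \<Longrightarrow> y e a \<in> carrier (Sp P n)"
  shows "form_comp P m n i e x (\<lambda>e. \<Oplus>\<^bsub>Sp P n\<^esub>a\<in>A. y e a) =
    (\<Oplus>\<^bsub>Sp P (m + n - 1)\<^esub>a\<in>A. form_comp P m n i e x (\<lambda>e. y e a))"
proof -
  interpret N: dg_space "Sp P n" using space n by simp
  interpret L: dg_space "Sp P (m + n - 1)" by (rule space_comp[OF n i])
  show ?thesis
    using y
  proof (induction A rule: infinite_finite_induct)
    case (insert a A)
    then show ?case
      using form_comp_add_right[OF n i x, of "\<lambda>e. y e a" "\<lambda>e. \<Oplus>\<^bsub>Sp P n\<^esub>a\<in>A. y e a"] form_comp_closed[OF n i x]
      by (simp add: N.finsum_insert L.finsum_insert Pi_iff)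
  qed (use form_comp_zero(2)[OF n i x] in auto)
qed

lemma form_comp_sequential:
  assumes r: "r \<ge> 1" and i: "i \<in> {1..m}" and j: "j \<in> {1..n}"
    and x: "\<And>e. x e \<in> carrier (Sp P m)" and y: "\<And>e. y e \<in> carrier (Sp P n)" and z: "\<And>e. z e \<in> carrier (Sp P r)"
  shows "form_comp P (m + n - 1) r (i + j - 1) e (\<lambda>e. form_comp P m n i e x y) z =
    form_comp P m (n + r - 1) i e x (\<lambda>e. form_comp P n r j e y z)"
proof -
  have n: "n \<ge> 1" and nr: "n + r - 1 \<ge> 1" and ij: "i + j - 1 \<in> {1..m + n - 1}" and eq: "m + n - 1 + r - 1 = m + (n + r - 1) - 1"
    using i j r by auto
  interpret R: dg_space "Sp P r" using space r by simp
  interpret N: dg_space "Sp P n" using space n by simp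
  interpret MN: dg_space "Sp P (m + n - 1)" by (rule space_comp[OF n i])
  interpret NR: dg_space "Sp P (n + r - 1)" using space nr by simp
  interpret L: dg_space "Sp P (m + (n + r - 1) - 1)" by (rule space_comp[OF nr i])
  note seq = pcomp_sequential[OF r i j x y]
  have cl: "pcomp P m (n + r - 1) i a b \<in> carrier (Sp P (m + (n + r - 1) - 1))"
    if "a \<in> carrier (Sp P m)" "b \<in> carrier (Sp P (n + r - 1))" for a b
    using that pcomp_closed[OF nr i] by simp
  note pal = pcomp_add_left[OF r ij, unfolded eq] and par = pcomp_add_right[OF nr i]
  have c1: "pcomp P m n i a b \<in> carrier (Sp P (m + n - 1))" if "a \<in> carrier (Sp P m)" "b \<in> carrier (Sp P n)" for a b
    using that pcomp_closed[OF n i] by simp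
  have c2: "pcomp P n r j a b \<in> carrier (Sp P (n + r - 1))" if "a \<in> carrier (Sp P n)" "b \<in> carrier (Sp P r)" for a b
    using that pcomp_closed[OF r j] by simp
  show ?thesis
    unfolding form_comp_def eq
    using x y z
    by (simp add: pcomp_sequential[OF r i j] pal par c1 c2 cl gsign_pcomp[OF r j] L.M.a_ac)
qed

text \<open>
  The sign $(-1)^{(p+e)(q+e')}$ of the coefficients combines with the signs for moving \<open>dz\<close> to the right into
  $(-1)^{pq}$, because $dz\,dz = 0$ leaves at most one factor \<open>dz\<close>.
\<close>

lemma form_comp_parallel:
  assumes n: "n \<ge> 1" and r: "r \<ge> 1" and ij: "1 \<le> i" "i < j" "j \<le> m"
    and x: "\<And>e. x e \<in> carrier (Sp P m)" and y: "\<And>e. y e \<in> homogeneous (Sp P n) (p + e)"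
    and z: "\<And>e. z e \<in> homogeneous (Sp P r) (q + e)"
  shows "form_comp P (m + n - 1) r (j + n - 1) e (\<lambda>e. form_comp P m n i e x y) z =
    ksign p q \<odot>\<^bsub>Sp P (m + n + r - 2)\<^esub> form_comp P (m + r - 1) n i e (\<lambda>e. form_comp P m r j e x z) y"
proof -
  have i: "i \<in> {1..m}" and j: "j \<in> {1..m}" and jn: "j + n - 1 \<in> {1..m + n - 1}" and i': "i \<in> {1..m + r - 1}"
    and e1: "m + n - 1 + r - 1 = m + n + r - 2" and e2: "m + r - 1 + n - 1 = m + n + r - 2"
    using n r ij by auto
  interpret R: dg_space "Sp P r" using space r by simp
  interpret N: dg_space "Sp P n" using space n by simp
  interpret MN: dg_space "Sp P (m + n - 1)" by (rule space_comp[OF n i])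
  interpret MR: dg_space "Sp P (m + r - 1)" by (rule space_comp[OF r i])
  interpret L: dg_space "Sp P (m + n + r - 2)" by (rule space) (use n r ij in auto)
  have yc: "y e \<in> carrier (Sp P n)" and zc: "z e \<in> carrier (Sp P r)" for e
    using y[of e] z[of e] by (auto simp: homogeneous_def)
  have gy: "gsign (Sp P n) (y 0) = ksign 1 p \<odot>\<^bsub>Sp P n\<^esub> y 0" and gz: "gsign (Sp P r) (z 0) = ksign 1 q \<odot>\<^bsub>Sp P r\<^esub> z 0"
    using N.gsign_homogeneous[OF y[of 0]] R.gsign_homogeneous[OF z[of 0]] by simp_all
  note pal = pcomp_add_left[OF r jn, unfolded e1] pcomp_add_left[OF n i', unfolded e2]
    and psl = pcomp_scale_left[OF r jn, unfolded e1] pcomp_scale_left[OF n i', unfolded e2]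
      pcomp_scale_left[OF n i] pcomp_scale_left[OF r j]
    and psr = pcomp_scale_right[OF r jn, unfolded e1] pcomp_scale_right[OF n i', unfolded e2]
      pcomp_scale_right[OF n i] pcomp_scale_right[OF r j]
  have c: "pcomp P m n i a b \<in> carrier (Sp P (m + n - 1))" if "a \<in> carrier (Sp P m)" "b \<in> carrier (Sp P n)" for a b
    using that pcomp_closed[OF n i] by simp
  have c': "pcomp P m r j a b \<in> carrier (Sp P (m + r - 1))" if "a \<in> carrier (Sp P m)" "b \<in> carrier (Sp P r)" for a b
    using that pcomp_closed[OF r j] by simp
  have c2: "pcomp P (m + r - 1) n i a b \<in> carrier (Sp P (m + n + r - 2))"
    if "a \<in> carrier (Sp P (m + r - 1))" "b \<in> carrier (Sp P n)" for a b
    using that pcomp_closed[OF n i'] unfolding e2 by simp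
  have par: "pcomp P (m + n - 1) r (j + n - 1) (pcomp P m n i (x a) (y b)) (z c) =
    ksign (p + b) (q + c) \<odot>\<^bsub>Sp P (m + n + r - 2)\<^esub> pcomp P (m + r - 1) n i (pcomp P m r j (x a) (z c)) (y b)" for a b c
    by (rule pcomp_parallel[OF n r ij x y z])
  show ?thesis
    unfolding form_comp_def gy gz e1 e2
    using bit_cases[of p] bit_cases[of q] par x yc zc
    by (auto simp: pal psl psr c c' c2 L.scale_scale L.scale_right_distrib L.M.a_ac)
qed

lemma form_comp_outer:
  assumes n: "n \<ge> 1" and i: "i \<in> {1..m}" and \<sigma>: "\<sigma> permutes {1..m}"
    and x: "\<And>e. x e \<in> carrier (Sp P m)" and y: "\<And>e. y e \<in> carrier (Sp P n)"
  shows "form_comp P m n i e (\<lambda>e. act P m (x e) \<sigma>) y =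
    act P (m + n - 1) (form_comp P m n (\<sigma> i) e x y) (outer_perm n i \<sigma>)"
proof -
  interpret N: dg_space "Sp P n" using space n by simp
  have \<pi>: "outer_perm n i \<sigma> permutes {1..m + n - 1}" by (rule outer_perm_permutes[OF \<sigma> i n])
  have \<sigma>i: "\<sigma> i \<in> {1..m}" using permutes_leD[OF \<sigma>, of i] i by auto
  have mn: "m + n - 1 \<ge> 1" using n i by auto
  show ?thesis
    using x y n i \<sigma> \<sigma>i by (simp add: form_comp_def pcomp_outer act_add[OF mn \<pi>])
qed

lemma form_comp_inner:
  assumes n: "n \<ge> 1" and i: "i \<in> {1..m}" and \<tau>: "\<tau> permutes {1..n}"
    and x: "\<And>e. x e \<in> carrier (Sp P m)" and y: "\<And>e. y e \<in> carrier (Sp P n)"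
  shows "form_comp P m n i e x (\<lambda>e. act P n (y e) \<tau>) =
    act P (m + n - 1) (form_comp P m n i e x y) (inner_perm n i \<tau>)"
proof -
  interpret N: dg_space "Sp P n" using space n by simp
  have \<pi>: "inner_perm n i \<tau> permutes {1..m + n - 1}" by (rule inner_perm_permutes[OF \<tau> i n])
  have mn: "m + n - 1 \<ge> 1" using n i by auto
  show ?thesis
    using x y n i \<tau> by (simp add: form_comp_def pcomp_inner act_add[OF mn \<pi>] gsign_act)
qed

lemma form_comp_homogeneous:
  assumes n: "n \<ge> 1" and i: "i \<in> {1..m}"
    and x: "\<And>e. x e \<in> homogeneous (Sp P m) (p + e)" and y: "\<And>e. y e \<in> homogeneous (Sp P n) (q + e)"
  shows "form_comp P m n i e x y \<in> homogeneous (Sp P (m + n - 1)) (p + q + e)"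
proof -
  interpret N: dg_space "Sp P n" using space n by simp
  interpret L: dg_space "Sp P (m + n - 1)" by (rule space_comp[OF n i])
  have gy: "gsign (Sp P n) (y 0) \<in> homogeneous (Sp P n) q"
    using N.gsign_homogeneous[OF y[of 0]] N.homogeneous_scale[OF y[of 0]] by (simp del: add_bit_eq_xor)
  have "pcomp P m n i (x 0) (y 0) \<in> homogeneous (Sp P (m + n - 1)) (p + q)"
    "pcomp P m n i (x 0) (y 1) \<in> homogeneous (Sp P (m + n - 1)) (p + q + 1)"
    "pcomp P m n i (x 1) (gsign (Sp P n) (y 0)) \<in> homogeneous (Sp P (m + n - 1)) (p + q + 1)"
    using pcomp_degree[OF n i x[of 0] y[of 0]] pcomp_degree[OF n i x[of 0] y[of 1]] pcomp_degree[OF n i x[of 1] gy]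
    by (simp_all add: ac_simps del: add_bit_eq_xor)
  then show ?thesis
    using bit_cases[of e] by (auto simp: form_comp_def L.homogeneous_add simp del: add_bit_eq_xor)
qed

end

context dg_space
begin

lemma scale_finsum: "g \<in> A \<rightarrow> carrier M \<Longrightarrow> c \<odot> (\<Oplus>a\<in>A. g a) = (\<Oplus>a\<in>A. c \<odot> g a)"
  by (rule linear_map_finsum[OF dg_space_axioms dg_space_axioms linear_map_scale])

lemma hcomp_finsum: "g \<in> A \<rightarrow> carrier M \<Longrightarrow> hcomp M p (\<Oplus>a\<in>A. g a) = (\<Oplus>a\<in>A. hcomp M p (g a))"
  by (rule linear_map_finsum[OF dg_space_axioms dg_space_axioms hcomp_linear])

lemma dif_finsum: "g \<in> A \<rightarrow> carrier M \<Longrightarrow> dif M (\<Oplus>a\<in>A. g a) = (\<Oplus>a\<in>A. dif M (g a))"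
  by (rule linear_map_finsum[OF dg_space_axioms dg_space_axioms dif_linear])

lemma gsign_finsum: "g \<in> A \<rightarrow> carrier M \<Longrightarrow> gsign M (\<Oplus>a\<in>A. g a) = (\<Oplus>a\<in>A. gsign M (g a))"
  by (rule linear_map_finsum[OF dg_space_axioms dg_space_axioms gsign_linear])

lemma homogeneous_finsum:
  assumes "\<And>a. a \<in> A \<Longrightarrow> g a \<in> homogeneous M p"
  shows "(\<Oplus>a\<in>A. g a) \<in> homogeneous M p"
proof -
  have "g \<in> A \<rightarrow> carrier M" using assms homogeneousD by auto
  moreover have "(\<Oplus>a\<in>A. hcomp M p (g a)) = (\<Oplus>a\<in>A. g a)"
    by (rule M.finsum_cong') (use assms in \<open>auto simp: homogeneous_def\<close>)
  ultimately show ?thesis by (simp add: homogeneous_def hcomp_finsum)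
qed

lemma finsum_single:
  assumes "finite A" "a \<in> A" "g a \<in> carrier M" "\<And>b. b \<in> A \<Longrightarrow> b \<noteq> a \<Longrightarrow> g b = \<zero>"
  shows "(\<Oplus>b\<in>A. g b) = g a"
proof -
  have "(\<Oplus>b\<in>{a}. g b) = (\<Oplus>b\<in>A. g b)"
    using assms by (intro M.add.finprod_mono_neutral_cong_left) (auto, metis M.zero_closed)
  then show ?thesis using assms by simp
qed

text \<open>
  The Leibniz rule for $d/dz$ on coefficients: $k + 1 = j + (k + 1 - j)$ distributes the exponent over the
  factors, after which the summand with exponent $0$ drops out of each part.
\<close>

lemma derivative_product_rule:
  assumes "\<And>j l. g j l \<in> carrier M"
  shows "of_nat (Suc k) \<odot> (\<Oplus>j\<in>{..Suc k}. g j (Suc k - j)) =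
    (\<Oplus>j\<in>{..k}. of_nat (Suc j) \<odot> g (Suc j) (k - j)) \<oplus> (\<Oplus>j\<in>{..k}. of_nat (Suc (k - j)) \<odot> g j (Suc (k - j)))"
proof -
  have "of_nat (Suc k) \<odot> (\<Oplus>j\<in>{..Suc k}. g j (Suc k - j)) =
      (\<Oplus>j\<in>{..Suc k}. of_nat j \<odot> g j (Suc k - j) \<oplus> of_nat (Suc k - j) \<odot> g j (Suc k - j))"
  proof (subst scale_finsum)
    show "(\<Oplus>j\<in>{..Suc k}. of_nat (Suc k) \<odot> g j (Suc k - j)) =
      (\<Oplus>j\<in>{..Suc k}. of_nat j \<odot> g j (Suc k - j) \<oplus> of_nat (Suc k - j) \<odot> g j (Suc k - j))"
      by (rule M.finsum_cong')
        (use assms in \<open>auto simp flip: scale_left_distrib of_nat_add simp del: of_nat_Suc\<close>)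
  qed (use assms in auto)
  also have "\<dots> = (\<Oplus>j\<in>{..Suc k}. of_nat j \<odot> g j (Suc k - j)) \<oplus> (\<Oplus>j\<in>{..Suc k}. of_nat (Suc k - j) \<odot> g j (Suc k - j))"
    using assms by (intro M.finsum_addf) auto
  also have "(\<Oplus>j\<in>{..Suc k}. of_nat j \<odot> g j (Suc k - j)) = (\<Oplus>j\<in>{..k}. of_nat (Suc j) \<odot> g (Suc j) (k - j))"
    using assms by (subst M.finsum_Suc2) (auto simp del: of_nat_Suc)
  also have "(\<Oplus>j\<in>{..Suc k}. of_nat (Suc k - j) \<odot> g j (Suc k - j)) = (\<Oplus>j\<in>{..k}. of_nat (Suc k - j) \<odot> g j (Suc k - j))"
    using assms by (subst M.finsum_Suc) (auto simp del: of_nat_Suc intro!: M.l_zero M.finsum_closed)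
  also have "\<dots> = (\<Oplus>j\<in>{..k}. of_nat (Suc (k - j)) \<odot> g j (Suc (k - j)))"
    by (rule M.finsum_cong') (use assms in \<open>auto simp: Suc_diff_le simp del: of_nat_Suc\<close>)
  finally show ?thesis .
qed

end

context dg_operad
begin

lemma form_comp_coeff_closed:
  assumes "n \<ge> 1" "i \<in> {1..m}" "a \<in> carrier (tensor_D_space (Sp P m))" "b \<in> carrier (tensor_D_space (Sp P n))"
  shows "form_comp P m n i e (\<lambda>e. a e j) (\<lambda>e. b e l) \<in> carrier (Sp P (m + n - 1))"
  using assms by (intro form_comp_closed) (auto intro: tensor_D_coeff)

lemma pcomp_tensor_D_closed:
  assumes n: "n \<ge> 1" and i: "i \<in> {1..m}"
    and a: "a \<in> carrier (tensor_D_space (Sp P m))" and b: "b \<in> carrier (tensor_D_space (Sp P n))"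
  shows "pcomp (tensor_D P) m n i a b \<in> carrier (tensor_D_space (Sp P (m + n - 1)))"
proof -
  interpret L: dg_space "Sp P (m + n - 1)" by (rule space_comp[OF n i])
  obtain N where N: "\<And>e k. N < k \<Longrightarrow> a e k = \<zero>\<^bsub>Sp P m\<^esub>" using a by (auto simp: tensor_D_space_carrier)
  obtain N' where N': "\<And>e k. N' < k \<Longrightarrow> b e k = \<zero>\<^bsub>Sp P n\<^esub>" using b by (auto simp: tensor_D_space_carrier)
  show ?thesis
  proof (rule L.tensor_D_closed)
    show "pcomp (tensor_D P) m n i a b e k \<in> carrier (Sp P (m + n - 1))" for e k
      unfolding pcomp_tensor_D by (rule L.M.finsum_closed) (use form_comp_coeff_closed[OF n i a b] in auto)
    fix e k assume k: "N + N' < k"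
    show "pcomp (tensor_D P) m n i a b e k = \<zero>\<^bsub>Sp P (m + n - 1)\<^esub>"
      unfolding pcomp_tensor_D
    proof (rule L.M.add.finprod_one_eqI)
      fix j assume "j \<in> {..k}"
      then consider "N < j" | "N' < k - j" using k by fastforce
      then show "form_comp P m n i e (\<lambda>e. a e j) (\<lambda>e. b e (k - j)) = \<zero>\<^bsub>Sp P (m + n - 1)\<^esub>"
        using form_comp_zero[OF n i] tensor_D_coeff[OF a] tensor_D_coeff[OF b] by cases (simp_all add: N N')
    qed
  qed
qed

lemma form_comp_dif:
  assumes n: "n \<ge> 1" and i: "i \<in> {1..m}"
    and x: "\<And>e. x e \<in> carrier (Sp P m)" and y: "\<And>e. y e \<in> carrier (Sp P n)"
  shows "dif (Sp P (m + n - 1)) (form_comp P m n i e x y) =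
    form_comp P m n i e (\<lambda>e. dif (Sp P m) (x e)) y \<oplus>\<^bsub>Sp P (m + n - 1)\<^esub>
    form_comp P m n i e (\<lambda>e. ksign 1 e \<odot>\<^bsub>Sp P m\<^esub> gsign (Sp P m) (x e)) (\<lambda>e. dif (Sp P n) (y e))"
proof -
  interpret M: dg_space "Sp P m" by (rule space) (use i in auto)
  interpret N: dg_space "Sp P n" using space n by simp
  interpret L: dg_space "Sp P (m + n - 1)" by (rule space_comp[OF n i])
  show ?thesis
    using x y n i
    by (simp add: form_comp_def pcomp_dif L.dif_add L.M.a_ac N.gsign_dif pcomp_scale_left pcomp_scale_right L.scale_scale)
qed

text \<open>
  The coefficients of $dz$ combine the Leibniz rule of \<open>P\<close> with the product rule for $d/dz$.
\<close>

lemma dif_pcomp_tensor_D: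
  assumes n: "n \<ge> 1" and i: "i \<in> {1..m}"
    and a: "a \<in> carrier (tensor_D_space (Sp P m))" and b: "b \<in> carrier (tensor_D_space (Sp P n))"
  shows "dif (tensor_D_space (Sp P (m + n - 1))) (pcomp (tensor_D P) m n i a b) =
    pcomp (tensor_D P) m n i (dif (tensor_D_space (Sp P m)) a) b \<oplus>\<^bsub>tensor_D_space (Sp P (m + n - 1))\<^esub>
    pcomp (tensor_D P) m n i (gsign (tensor_D_space (Sp P m)) a) (dif (tensor_D_space (Sp P n)) b)"
proof (intro ext)
  fix e k
  interpret M: dg_space "Sp P m" by (rule space) (use i in auto)
  interpret N: dg_space "Sp P n" using space n by simp
  interpret L: dg_space "Sp P (m + n - 1)" by (rule space_comp[OF n i])
  note ac = tensor_D_coeff[OF a] and bc = tensor_D_coeff[OF b]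
  note fc = form_comp_closed[OF n i]
  let ?da = "\<lambda>j e. dif (Sp P m) (a e j)" and ?db = "\<lambda>j e. dif (Sp P n) (b e j)"
  let ?ga = "\<lambda>j e. ksign 1 e \<odot>\<^bsub>Sp P m\<^esub> gsign (Sp P m) (a e j)"
  let ?X = "\<lambda>j l. pcomp P m n i (gsign (Sp P m) (a 0 j)) (gsign (Sp P n) (b 0 l))"
  let ?d0 = "\<lambda>k. \<Oplus>\<^bsub>Sp P (m + n - 1)\<^esub>j\<in>{..k}. form_comp P m n i e (?da j) (\<lambda>e. b e (k - j))"
    and ?d1 = "\<lambda>k. \<Oplus>\<^bsub>Sp P (m + n - 1)\<^esub>j\<in>{..k}. form_comp P m n i e (?ga j) (?db (k - j))"
  let ?s0 = "if e = 0 then \<zero>\<^bsub>Sp P (m + n - 1)\<^esub> else (\<Oplus>\<^bsub>Sp P (m + n - 1)\<^esub>j\<in>{..k}. of_nat (Suc j) \<odot>\<^bsub>Sp P (m + n - 1)\<^esub> ?X (Suc j) (k - j))"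
  let ?s1 = "if e = 0 then \<zero>\<^bsub>Sp P (m + n - 1)\<^esub> else (\<Oplus>\<^bsub>Sp P (m + n - 1)\<^esub>j\<in>{..k}. of_nat (Suc (k - j)) \<odot>\<^bsub>Sp P (m + n - 1)\<^esub> ?X j (Suc (k - j)))"
  have Xc: "?X j l \<in> carrier (Sp P (m + n - 1))" for j l using ac bc n i by simp
  have d0c: "?d0 k \<in> carrier (Sp P (m + n - 1))" "?d1 k \<in> carrier (Sp P (m + n - 1))"
    using ac bc fc by (auto intro!: L.M.finsum_closed)
  have s0c: "?s0 \<in> carrier (Sp P (m + n - 1))" "?s1 \<in> carrier (Sp P (m + n - 1))"
    using Xc by (auto intro!: L.M.finsum_closed)
  have base: "dif (Sp P (m + n - 1)) (pcomp (tensor_D P) m n i a b e k) = ?d0 k \<oplus>\<^bsub>Sp P (m + n - 1)\<^esub> ?d1 k"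
  proof -
    have "dif (Sp P (m + n - 1)) (pcomp (tensor_D P) m n i a b e k) =
      (\<Oplus>\<^bsub>Sp P (m + n - 1)\<^esub>j\<in>{..k}. form_comp P m n i e (?da j) (\<lambda>e. b e (k - j)) \<oplus>\<^bsub>Sp P (m + n - 1)\<^esub>
         form_comp P m n i e (?ga j) (?db (k - j)))"
      unfolding pcomp_tensor_D
      by (subst L.dif_finsum) (use ac bc fc in \<open>auto simp: form_comp_dif[OF n i]\<close>)
    also have "\<dots> = ?d0 k \<oplus>\<^bsub>Sp P (m + n - 1)\<^esub> ?d1 k"
      by (rule L.M.finsum_addf) (use ac bc fc in auto)
    finally show ?thesis .
  qed
  have lhs: "dif (tensor_D_space (Sp P (m + n - 1))) (pcomp (tensor_D P) m n i a b) e k =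
    (?d0 k \<oplus>\<^bsub>Sp P (m + n - 1)\<^esub> ?d1 k) \<oplus>\<^bsub>Sp P (m + n - 1)\<^esub> (?s0 \<oplus>\<^bsub>Sp P (m + n - 1)\<^esub> ?s1)"
  proof (cases "e = 0")
    case True
    then show ?thesis using base d0c by (simp add: dif_tensor_D_space)
  next
    case False
    then have e: "e = 1" using bit_cases[of e] by simp
    have "gsign (Sp P (m + n - 1)) (pcomp (tensor_D P) m n i a b 0 (Suc k)) = (\<Oplus>\<^bsub>Sp P (m + n - 1)\<^esub>j\<in>{..Suc k}. ?X j (Suc k - j))"
      unfolding pcomp_tensor_D form_comp_def
      by (subst L.gsign_finsum) (use ac bc n i in \<open>auto simp: gsign_pcomp simp del: L.M.finsum_Suc\<close>)
    then show ?thesis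
      using base L.derivative_product_rule[of ?X k] Xc e by (simp add: dif_tensor_D_space del: of_nat_Suc)
  qed
  have r0: "pcomp (tensor_D P) m n i (dif (tensor_D_space (Sp P m)) a) b e k = ?d0 k \<oplus>\<^bsub>Sp P (m + n - 1)\<^esub> ?s0"
  proof (cases "e = 0")
    case True
    then show ?thesis
      unfolding pcomp_tensor_D using d0c by (simp add: form_comp_def dif_tensor_D_space)
  next
    case False
    then have e: "e = 1" using bit_cases[of e] by simp
    have "pcomp (tensor_D P) m n i (dif (tensor_D_space (Sp P m)) a) b e k =
      (\<Oplus>\<^bsub>Sp P (m + n - 1)\<^esub>j\<in>{..k}. form_comp P m n i e (?da j) (\<lambda>e. b e (k - j)) \<oplus>\<^bsub>Sp P (m + n - 1)\<^esub>
        of_nat (Suc j) \<odot>\<^bsub>Sp P (m + n - 1)\<^esub> ?X (Suc j) (k - j))"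
      unfolding pcomp_tensor_D
      by (rule L.M.finsum_cong')
        (use ac bc fc Xc n i e in \<open>auto simp: form_comp_def dif_tensor_D_space pcomp_add_left pcomp_scale_left L.M.a_ac simp del: of_nat_Suc\<close>)
    also have "\<dots> = ?d0 k \<oplus>\<^bsub>Sp P (m + n - 1)\<^esub> ?s0"
      using e by (subst L.M.finsum_addf) (use ac bc fc Xc in auto)
    finally show ?thesis .
  qed
  have r1: "pcomp (tensor_D P) m n i (gsign (tensor_D_space (Sp P m)) a) (dif (tensor_D_space (Sp P n)) b) e k =
      ?d1 k \<oplus>\<^bsub>Sp P (m + n - 1)\<^esub> ?s1"
  proof (cases "e = 0")
    case True
    then show ?thesis
      unfolding pcomp_tensor_D M.gsign_tensor_D[OF a] using d0c by (simp add: form_comp_def dif_tensor_D_space)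
  next
    case False
    then have e: "e = 1" using bit_cases[of e] by simp
    have "pcomp (tensor_D P) m n i (gsign (tensor_D_space (Sp P m)) a) (dif (tensor_D_space (Sp P n)) b) e k =
      (\<Oplus>\<^bsub>Sp P (m + n - 1)\<^esub>j\<in>{..k}. form_comp P m n i e (?ga j) (?db (k - j)) \<oplus>\<^bsub>Sp P (m + n - 1)\<^esub>
        of_nat (Suc (k - j)) \<odot>\<^bsub>Sp P (m + n - 1)\<^esub> ?X j (Suc (k - j)))"
      unfolding pcomp_tensor_D M.gsign_tensor_D[OF a]
      by (rule L.M.finsum_cong')
        (use ac bc fc Xc n i e in \<open>auto simp: form_comp_def dif_tensor_D_space pcomp_add_right pcomp_scale_right L.M.a_ac simp del: of_nat_Suc\<close>)
    also have "\<dots> = ?d1 k \<oplus>\<^bsub>Sp P (m + n - 1)\<^esub> ?s1"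
      using e by (subst L.M.finsum_addf) (use ac bc fc Xc in auto)
    finally show ?thesis .
  qed
  show "dif (tensor_D_space (Sp P (m + n - 1))) (pcomp (tensor_D P) m n i a b) e k =
    (pcomp (tensor_D P) m n i (dif (tensor_D_space (Sp P m)) a) b \<oplus>\<^bsub>tensor_D_space (Sp P (m + n - 1))\<^esub>
     pcomp (tensor_D P) m n i (gsign (tensor_D_space (Sp P m)) a) (dif (tensor_D_space (Sp P n)) b)) e k"
    unfolding lhs tensor_D_space_simps r0 r1 using d0c s0c by (simp only: L.M.a_ac L.M.a_closed)
qed

lemma pcomp_tensor_D_sequential:
  assumes r: "r \<ge> 1" and i: "i \<in> {1..m}" and j: "j \<in> {1..n}"
    and a: "a \<in> carrier (tensor_D_space (Sp P m))" and b: "b \<in> carrier (tensor_D_space (Sp P n))"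
    and c: "c \<in> carrier (tensor_D_space (Sp P r))"
  shows "pcomp (tensor_D P) (m + n - 1) r (i + j - 1) (pcomp (tensor_D P) m n i a b) c =
    pcomp (tensor_D P) m (n + r - 1) i a (pcomp (tensor_D P) n r j b c)"
proof (intro ext)
  fix e k
  have n: "n \<ge> 1" and nr: "n + r - 1 \<ge> 1" and ij: "i + j - 1 \<in> {1..m + n - 1}" and eq: "m + n - 1 + r - 1 = m + (n + r - 1) - 1"
    using i j r by auto
  interpret L: dg_space "Sp P (m + (n + r - 1) - 1)" by (rule space_comp[OF nr i])
  note ac = tensor_D_coeff[OF a] and bc = tensor_D_coeff[OF b] and cc = tensor_D_coeff[OF c]
  have fab: "form_comp P m n i e (\<lambda>e. a e u) (\<lambda>e. b e v) \<in> carrier (Sp P (m + n - 1))" for e u v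
    by (rule form_comp_closed[OF n i]) (use ac bc in auto)
  have fbc: "form_comp P n r j e (\<lambda>e. b e u) (\<lambda>e. c e v) \<in> carrier (Sp P (n + r - 1))" for e u v
    by (rule form_comp_closed[OF r j]) (use bc cc in auto)
  let ?f = "\<lambda>u v w. form_comp P m (n + r - 1) i e (\<lambda>e. a e u) (\<lambda>e. form_comp P n r j e (\<lambda>e. b e v) (\<lambda>e. c e w))"
  have fcl: "?f u v w \<in> carrier (Sp P (m + (n + r - 1) - 1))" for u v w
    by (rule form_comp_closed[OF nr i]) (use ac fbc in auto)
  have "pcomp (tensor_D P) (m + n - 1) r (i + j - 1) (pcomp (tensor_D P) m n i a b) c e k =
      (\<Oplus>\<^bsub>Sp P (m + (n + r - 1) - 1)\<^esub>u\<in>{..k}. \<Oplus>\<^bsub>Sp P (m + (n + r - 1) - 1)\<^esub>v\<in>{..u}. ?f v (u - v) (k - u))"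
    unfolding pcomp_tensor_D eq
  proof (rule L.M.finsum_cong')
    fix u assume "u \<in> {..k}"
    have "form_comp P (m + n - 1) r (i + j - 1) e
          (\<lambda>e. \<Oplus>\<^bsub>Sp P (m + n - 1)\<^esub>v\<in>{..u}. form_comp P m n i e (\<lambda>e. a e v) (\<lambda>e. b e (u - v))) (\<lambda>e. c e (k - u)) =
        (\<Oplus>\<^bsub>Sp P (m + n - 1 + r - 1)\<^esub>v\<in>{..u}. form_comp P (m + n - 1) r (i + j - 1) e
          (\<lambda>e. form_comp P m n i e (\<lambda>e. a e v) (\<lambda>e. b e (u - v))) (\<lambda>e. c e (k - u)))"
      by (rule form_comp_finsum_left[OF r ij]) (use cc fab in auto)
    also have "\<dots> = (\<Oplus>\<^bsub>Sp P (m + (n + r - 1) - 1)\<^esub>v\<in>{..u}. ?f v (u - v) (k - u))"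
      unfolding eq
      by (rule L.M.finsum_cong'[OF HOL.refl]) (use fcl ac bc cc in \<open>auto intro!: form_comp_sequential[OF r i j]\<close>)
    finally show "form_comp P (m + n - 1) r (i + j - 1) e
          (\<lambda>e. \<Oplus>\<^bsub>Sp P (m + n - 1)\<^esub>v\<in>{..u}. form_comp P m n i e (\<lambda>e. a e v) (\<lambda>e. b e (u - v))) (\<lambda>e. c e (k - u)) =
        (\<Oplus>\<^bsub>Sp P (m + (n + r - 1) - 1)\<^esub>v\<in>{..u}. ?f v (u - v) (k - u))" .
  qed (use fcl in \<open>auto intro!: L.M.finsum_closed\<close>)
  also have "\<dots> = (\<Oplus>\<^bsub>Sp P (m + (n + r - 1) - 1)\<^esub>u\<in>{..k}. \<Oplus>\<^bsub>Sp P (m + (n + r - 1) - 1)\<^esub>v\<in>{..k - u}. ?f u v (k - u - v))"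
    by (rule L.M.convolution_assoc[OF fcl])
  also have "\<dots> = pcomp (tensor_D P) m (n + r - 1) i a (pcomp (tensor_D P) n r j b c) e k"
    unfolding pcomp_tensor_D
  proof (rule L.M.finsum_cong'[OF HOL.refl])
    interpret NR: dg_space "Sp P (n + r - 1)" by (rule space[OF nr])
    show "(\<lambda>u. form_comp P m (n + r - 1) i e (\<lambda>e. a e u)
        (\<lambda>e. \<Oplus>\<^bsub>Sp P (n + r - 1)\<^esub>v\<in>{..k - u}. form_comp P n r j e (\<lambda>e. b e v) (\<lambda>e. c e (k - u - v))))
      \<in> {..k} \<rightarrow> carrier (Sp P (m + (n + r - 1) - 1))"
      by (intro Pi_I form_comp_closed[OF nr i] ac NR.M.finsum_closed fbc)
    fix u assume "u \<in> {..k}"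
    show "(\<Oplus>\<^bsub>Sp P (m + (n + r - 1) - 1)\<^esub>v\<in>{..k - u}. ?f u v (k - u - v)) =
      form_comp P m (n + r - 1) i e (\<lambda>e. a e u)
        (\<lambda>e. \<Oplus>\<^bsub>Sp P (n + r - 1)\<^esub>v\<in>{..k - u}. form_comp P n r j e (\<lambda>e. b e v) (\<lambda>e. c e (k - u - v)))"
      by (rule form_comp_finsum_right[OF nr i, symmetric]) (use ac fbc in auto)
  qed
  finally show "pcomp (tensor_D P) (m + n - 1) r (i + j - 1) (pcomp (tensor_D P) m n i a b) c e k =
    pcomp (tensor_D P) m (n + r - 1) i a (pcomp (tensor_D P) n r j b c) e k" .
qed

lemma pcomp_tensor_D_parallel:
  assumes n: "n \<ge> 1" and r: "r \<ge> 1" and ij: "1 \<le> i" "i < j" "j \<le> m"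
    and a: "a \<in> carrier (tensor_D_space (Sp P m))" and b: "b \<in> homogeneous (tensor_D_space (Sp P n)) p"
    and c: "c \<in> homogeneous (tensor_D_space (Sp P r)) q"
  shows "pcomp (tensor_D P) (m + n - 1) r (j + n - 1) (pcomp (tensor_D P) m n i a b) c =
    ksign p q \<odot>\<^bsub>tensor_D_space (Sp P (m + n + r - 2))\<^esub>
    pcomp (tensor_D P) (m + r - 1) n i (pcomp (tensor_D P) m r j a c) b"
proof (intro ext)
  fix e k
  have i: "i \<in> {1..m}" and j: "j \<in> {1..m}" and jn: "j + n - 1 \<in> {1..m + n - 1}" and i': "i \<in> {1..m + r - 1}"
    and e1: "m + n - 1 + r - 1 = m + n + r - 2" and e2: "m + r - 1 + n - 1 = m + n + r - 2"
    using n r ij by auto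
  interpret N: dg_space "Sp P n" using space n by simp
  interpret R: dg_space "Sp P r" using space r by simp
  interpret L: dg_space "Sp P (m + n + r - 2)" by (rule space) (use n r ij in auto)
  have bh: "b e k \<in> homogeneous (Sp P n) (p + e)" and ch: "c e k \<in> homogeneous (Sp P r) (q + e)" for e k
    using b c by (auto simp: N.homogeneous_tensor_D R.homogeneous_tensor_D)
  note ac = tensor_D_coeff[OF a] and bc = N.homogeneousD[OF bh] and cc = R.homogeneousD[OF ch]
  have fab: "form_comp P m n i e (\<lambda>e. a e u) (\<lambda>e. b e v) \<in> carrier (Sp P (m + n - 1))" for e u v
    by (rule form_comp_closed[OF n i]) (use ac bc in auto)
  have fac: "form_comp P m r j e (\<lambda>e. a e u) (\<lambda>e. c e v) \<in> carrier (Sp P (m + r - 1))" for e u v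
    by (rule form_comp_closed[OF r j]) (use ac cc in auto)
  let ?f = "\<lambda>u v w. form_comp P (m + r - 1) n i e (\<lambda>e. form_comp P m r j e (\<lambda>e. a e u) (\<lambda>e. c e w)) (\<lambda>e. b e v)"
  let ?g = "\<lambda>u v w. ksign p q \<odot>\<^bsub>Sp P (m + n + r - 2)\<^esub> ?f u v w"
  have fcl: "?f u v w \<in> carrier (Sp P (m + n + r - 2))" for u v w
    using form_comp_closed[OF n i', of "\<lambda>e. form_comp P m r j e (\<lambda>e. a e u) (\<lambda>e. c e w)" "\<lambda>e. b e v" e] fac bc
    unfolding e2 by auto
  have gcl: "?g u v w \<in> carrier (Sp P (m + n + r - 2))" for u v w using fcl by auto
  have "pcomp (tensor_D P) (m + n - 1) r (j + n - 1) (pcomp (tensor_D P) m n i a b) c e k =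
      (\<Oplus>\<^bsub>Sp P (m + n + r - 2)\<^esub>u\<in>{..k}. \<Oplus>\<^bsub>Sp P (m + n + r - 2)\<^esub>v\<in>{..u}. ?g v (u - v) (k - u))"
    unfolding pcomp_tensor_D e1
  proof (rule L.M.finsum_cong')
    fix u assume "u \<in> {..k}"
    have "form_comp P (m + n - 1) r (j + n - 1) e
          (\<lambda>e. \<Oplus>\<^bsub>Sp P (m + n - 1)\<^esub>v\<in>{..u}. form_comp P m n i e (\<lambda>e. a e v) (\<lambda>e. b e (u - v))) (\<lambda>e. c e (k - u)) =
        (\<Oplus>\<^bsub>Sp P (m + n - 1 + r - 1)\<^esub>v\<in>{..u}. form_comp P (m + n - 1) r (j + n - 1) e
          (\<lambda>e. form_comp P m n i e (\<lambda>e. a e v) (\<lambda>e. b e (u - v))) (\<lambda>e. c e (k - u)))"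
      by (rule form_comp_finsum_left[OF r jn]) (use cc fab in auto)
    also have "\<dots> = (\<Oplus>\<^bsub>Sp P (m + n + r - 2)\<^esub>v\<in>{..u}. ?g v (u - v) (k - u))"
      unfolding e1
      by (rule L.M.finsum_cong'[OF HOL.refl]) (use gcl ac bh ch in \<open>auto intro!: form_comp_parallel[OF n r ij] simp del: add_bit_eq_xor\<close>)
    finally show "form_comp P (m + n - 1) r (j + n - 1) e
          (\<lambda>e. \<Oplus>\<^bsub>Sp P (m + n - 1)\<^esub>v\<in>{..u}. form_comp P m n i e (\<lambda>e. a e v) (\<lambda>e. b e (u - v))) (\<lambda>e. c e (k - u)) =
        (\<Oplus>\<^bsub>Sp P (m + n + r - 2)\<^esub>v\<in>{..u}. ?g v (u - v) (k - u))" .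
  qed (use gcl in \<open>auto intro!: L.M.finsum_closed\<close>)
  also have "\<dots> = (\<Oplus>\<^bsub>Sp P (m + n + r - 2)\<^esub>u\<in>{..k}. \<Oplus>\<^bsub>Sp P (m + n + r - 2)\<^esub>v\<in>{..u}. ?g v (k - u) (u - v))"
    by (rule L.M.convolution_swap[OF gcl])
  also have "\<dots> = (\<Oplus>\<^bsub>Sp P (m + n + r - 2)\<^esub>u\<in>{..k}. ksign p q \<odot>\<^bsub>Sp P (m + n + r - 2)\<^esub>
      (\<Oplus>\<^bsub>Sp P (m + n + r - 2)\<^esub>v\<in>{..u}. ?f v (k - u) (u - v)))"
    by (rule L.M.finsum_cong'[OF HOL.refl]) (use fcl in \<open>auto intro!: L.M.finsum_closed L.scale_finsum[symmetric]\<close>)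
  also have "\<dots> = ksign p q \<odot>\<^bsub>Sp P (m + n + r - 2)\<^esub>
      (\<Oplus>\<^bsub>Sp P (m + n + r - 2)\<^esub>u\<in>{..k}. \<Oplus>\<^bsub>Sp P (m + n + r - 2)\<^esub>v\<in>{..u}. ?f v (k - u) (u - v))"
    by (rule L.scale_finsum[symmetric]) (use fcl in \<open>auto intro!: L.M.finsum_closed\<close>)
  also have "(\<Oplus>\<^bsub>Sp P (m + n + r - 2)\<^esub>u\<in>{..k}. \<Oplus>\<^bsub>Sp P (m + n + r - 2)\<^esub>v\<in>{..u}. ?f v (k - u) (u - v)) =
      pcomp (tensor_D P) (m + r - 1) n i (pcomp (tensor_D P) m r j a c) b e k"
    unfolding pcomp_tensor_D e2
  proof (rule L.M.finsum_cong'[OF HOL.refl])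
    fix u assume "u \<in> {..k}"
    show "(\<Oplus>\<^bsub>Sp P (m + n + r - 2)\<^esub>v\<in>{..u}. ?f v (k - u) (u - v)) =
      form_comp P (m + r - 1) n i e (\<lambda>e. \<Oplus>\<^bsub>Sp P (m + r - 1)\<^esub>v\<in>{..u}. form_comp P m r j e (\<lambda>e. a e v) (\<lambda>e. c e (u - v))) (\<lambda>e. b e (k - u))"
      by (subst form_comp_finsum_left[OF n i', unfolded e2]) (use bc fac in auto)
  next
    interpret MR: dg_space "Sp P (m + r - 1)" by (rule space_comp[OF r j])
    show "(\<lambda>u. form_comp P (m + r - 1) n i e (\<lambda>e. \<Oplus>\<^bsub>Sp P (m + r - 1)\<^esub>v\<in>{..u}. form_comp P m r j e (\<lambda>e. a e v) (\<lambda>e. c e (u - v))) (\<lambda>e. b e (k - u)))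
       \<in> {..k} \<rightarrow> carrier (Sp P (m + n + r - 2))"
      using form_comp_closed[OF n i', unfolded e2] fac bc by (auto intro!: MR.M.finsum_closed)
  qed
  finally show "pcomp (tensor_D P) (m + n - 1) r (j + n - 1) (pcomp (tensor_D P) m n i a b) c e k =
    (ksign p q \<odot>\<^bsub>tensor_D_space (Sp P (m + n + r - 2))\<^esub>
    pcomp (tensor_D P) (m + r - 1) n i (pcomp (tensor_D P) m r j a c) b) e k"
    by simp
qed

end

context dg_operad
begin

lemma act_tensor_D_closed:
  assumes n: "n \<ge> 1" and \<sigma>: "\<sigma> permutes {1..n}" and a: "a \<in> carrier (tensor_D_space (Sp P n))"
  shows "(\<lambda>e k. act P n (a e k) \<sigma>) \<in> carrier (tensor_D_space (Sp P n))"
  using a act_zero[OF n \<sigma>] act_closed[OF n \<sigma>] unfolding tensor_D_space_carrier by metis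

lemma act_finsum:
  assumes n: "n \<ge> 1" and \<sigma>: "\<sigma> permutes {1..n}" and g: "g \<in> A \<rightarrow> carrier (Sp P n)"
  shows "act P n (\<Oplus>\<^bsub>Sp P n\<^esub>a\<in>A. g a) \<sigma> = (\<Oplus>\<^bsub>Sp P n\<^esub>a\<in>A. act P n (g a) \<sigma>)"
  by (rule linear_map_finsum[OF space space act_linear]) (use assms in auto)

lemma gsign_unit [simp]: "gsign (Sp P 1) (ounit P) = ounit P"
proof -
  interpret N: dg_space "Sp P 1" by (rule space) simp
  show ?thesis using N.gsign_homogeneous[OF unit_even] by simp
qed

lemma dg_operad_tensor_D: "dg_operad (tensor_D P)"
proof (rule dg_operad.intro, unfold tensor_D_simps, goal_cases)
  case (1 n) then show ?case by (rule dg_space.dg_space_tensor_D[OF space])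
next
  case (2 n \<sigma>)
  then show ?case
    using act_tensor_D_closed[OF 2] by (auto simp: linear_map_def act_add act_scale tensor_D_coeff fun_eq_iff)
next
  case (3 n \<sigma> x p) then show ?case by (simp add: act_hcomp tensor_D_coeff)
next
  case (4 n \<sigma> x)
  then interpret N: dg_space "Sp P n" by (intro space)
  show ?case
  proof (intro ext)
    fix e k
    show "dif (tensor_D_space (Sp P n)) (\<lambda>e k. act P n (x e k) \<sigma>) e k =
      act P n (dif (tensor_D_space (Sp P n)) x e k) \<sigma>"
      using 4 by (simp add: dif_tensor_D_space act_dif act_add act_scale gsign_act tensor_D_coeff del: of_nat_Suc)
  qed
next
  case (5 n x) then show ?case by (simp add: act_id tensor_D_coeff)
next
  case (6 n \<sigma> \<tau> x) then show ?case by (simp add: act_act tensor_D_coeff)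
next
  case (7 n i m y)
  interpret L: dg_space "Sp P (m + n - 1)" by (rule space_comp[OF 7(1,2)])
  note yc = tensor_D_coeff[OF 7(3)]
  show ?case
    unfolding linear_map_def
  proof (intro conjI ballI allI)
    show "(\<lambda>x. pcomp (tensor_D P) m n i x y) \<in> carrier (tensor_D_space (Sp P m)) \<rightarrow> carrier (tensor_D_space (Sp P (m + n - 1)))"
      using pcomp_tensor_D_closed[OF 7(1,2) _ 7(3)] by auto
  next
    fix a b assume a: "a \<in> carrier (tensor_D_space (Sp P m))" and b: "b \<in> carrier (tensor_D_space (Sp P m))"
    note ac = tensor_D_coeff[OF a] and bc = tensor_D_coeff[OF b]
    show "pcomp (tensor_D P) m n i (a \<oplus>\<^bsub>tensor_D_space (Sp P m)\<^esub> b) y =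
      pcomp (tensor_D P) m n i a y \<oplus>\<^bsub>tensor_D_space (Sp P (m + n - 1))\<^esub> pcomp (tensor_D P) m n i b y"
    proof (intro ext)
      fix e k
      show "pcomp (tensor_D P) m n i (a \<oplus>\<^bsub>tensor_D_space (Sp P m)\<^esub> b) y e k =
        (pcomp (tensor_D P) m n i a y \<oplus>\<^bsub>tensor_D_space (Sp P (m + n - 1))\<^esub> pcomp (tensor_D P) m n i b y) e k"
        unfolding pcomp_tensor_D tensor_D_space_simps
        by (subst L.M.finsum_addf[symmetric])
          (use ac bc yc form_comp_closed[OF 7(1,2)] in \<open>auto simp: form_comp_add_left[OF 7(1,2)] form_comp_scale_left[OF 7(1,2)]\<close>)
    qed
  next
    fix a c assume a: "a \<in> carrier (tensor_D_space (Sp P m))"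
    note ac = tensor_D_coeff[OF a]
    show "pcomp (tensor_D P) m n i (c \<odot>\<^bsub>tensor_D_space (Sp P m)\<^esub> a) y =
      c \<odot>\<^bsub>tensor_D_space (Sp P (m + n - 1))\<^esub> pcomp (tensor_D P) m n i a y"
    proof (intro ext)
      fix e k
      show "pcomp (tensor_D P) m n i (c \<odot>\<^bsub>tensor_D_space (Sp P m)\<^esub> a) y e k =
        (c \<odot>\<^bsub>tensor_D_space (Sp P (m + n - 1))\<^esub> pcomp (tensor_D P) m n i a y) e k"
        unfolding pcomp_tensor_D tensor_D_space_simps
        by (subst L.scale_finsum)
          (use ac yc form_comp_closed[OF 7(1,2)] in \<open>auto simp: form_comp_add_left[OF 7(1,2)] form_comp_scale_left[OF 7(1,2)]\<close>)
    qed
  qed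
next
  case (8 n i m x)
  interpret L: dg_space "Sp P (m + n - 1)" by (rule space_comp[OF 8(1,2)])
  note xc = tensor_D_coeff[OF 8(3)]
  show ?case
    unfolding linear_map_def
  proof (intro conjI ballI allI)
    show "(\<lambda>y. pcomp (tensor_D P) m n i x y) \<in> carrier (tensor_D_space (Sp P n)) \<rightarrow> carrier (tensor_D_space (Sp P (m + n - 1)))"
      using pcomp_tensor_D_closed[OF 8(1,2,3)] by auto
  next
    fix a b assume a: "a \<in> carrier (tensor_D_space (Sp P n))" and b: "b \<in> carrier (tensor_D_space (Sp P n))"
    note ac = tensor_D_coeff[OF a] and bc = tensor_D_coeff[OF b]
    show "pcomp (tensor_D P) m n i x (a \<oplus>\<^bsub>tensor_D_space (Sp P n)\<^esub> b) =
      pcomp (tensor_D P) m n i x a \<oplus>\<^bsub>tensor_D_space (Sp P (m + n - 1))\<^esub> pcomp (tensor_D P) m n i x b"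
    proof (intro ext)
      fix e k
      show "pcomp (tensor_D P) m n i x (a \<oplus>\<^bsub>tensor_D_space (Sp P n)\<^esub> b) e k =
        (pcomp (tensor_D P) m n i x a \<oplus>\<^bsub>tensor_D_space (Sp P (m + n - 1))\<^esub> pcomp (tensor_D P) m n i x b) e k"
        unfolding pcomp_tensor_D tensor_D_space_simps
        by (subst L.M.finsum_addf[symmetric])
          (use ac bc xc form_comp_closed[OF 8(1,2)] in \<open>auto simp: form_comp_add_right[OF 8(1,2)] form_comp_scale_right[OF 8(1,2)]\<close>)
    qed
  next
    fix a c assume a: "a \<in> carrier (tensor_D_space (Sp P n))"
    note ac = tensor_D_coeff[OF a]
    show "pcomp (tensor_D P) m n i x (c \<odot>\<^bsub>tensor_D_space (Sp P n)\<^esub> a) =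
      c \<odot>\<^bsub>tensor_D_space (Sp P (m + n - 1))\<^esub> pcomp (tensor_D P) m n i x a"
    proof (intro ext)
      fix e k
      show "pcomp (tensor_D P) m n i x (c \<odot>\<^bsub>tensor_D_space (Sp P n)\<^esub> a) e k =
        (c \<odot>\<^bsub>tensor_D_space (Sp P (m + n - 1))\<^esub> pcomp (tensor_D P) m n i x a) e k"
        unfolding pcomp_tensor_D tensor_D_space_simps
        by (subst L.scale_finsum)
          (use ac xc form_comp_closed[OF 8(1,2)] in \<open>auto simp: form_comp_add_right[OF 8(1,2)] form_comp_scale_right[OF 8(1,2)]\<close>)
    qed
  qed
next
  case (9 n i m x p y q)
  interpret L: dg_space "Sp P (m + n - 1)" by (rule space_comp[OF 9(1,2)])
  interpret M: dg_space "Sp P m" by (rule space) (use 9 in auto)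
  interpret N: dg_space "Sp P n" by (rule space) (use 9 in auto)
  have x: "x \<in> carrier (tensor_D_space (Sp P m))" "x e k \<in> homogeneous (Sp P m) (p + e)"
    and y: "y \<in> carrier (tensor_D_space (Sp P n))" "y e k \<in> homogeneous (Sp P n) (q + e)" for e k
    using 9 by (simp_all add: M.homogeneous_tensor_D N.homogeneous_tensor_D)
  show ?case
    unfolding L.homogeneous_tensor_D
  proof (intro conjI allI)
    show "pcomp (tensor_D P) m n i x y \<in> carrier (tensor_D_space (Sp P (m + n - 1)))"
      by (rule pcomp_tensor_D_closed[OF 9(1,2) x(1) y(1)])
    show "pcomp (tensor_D P) m n i x y e k \<in> homogeneous (Sp P (m + n - 1)) (p + q + e)" for e k
      unfolding pcomp_tensor_D by (intro L.homogeneous_finsum form_comp_homogeneous[OF 9(1,2) x(2) y(2)])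
  qed
next
  case (10 n i m x y) then show ?case by (rule dif_pcomp_tensor_D)
next
  case (11 r i m j n x y z) then show ?case by (rule pcomp_tensor_D_sequential)
next
  case (12 n r i j m x y p z q) then show ?case by (rule pcomp_tensor_D_parallel)
next
  case (13 n i m \<sigma> x y)
  note xc = tensor_D_coeff[OF 13(4)] and yc = tensor_D_coeff[OF 13(5)]
  have \<pi>: "outer_perm n i \<sigma> permutes {1..m + n - 1}" by (rule outer_perm_permutes[OF 13(3,2,1)])
  have \<sigma>i: "\<sigma> i \<in> {1..m}" using permutes_leD[OF 13(3), of i] 13(2) by auto
  have mn: "m + n - 1 \<ge> 1" using 13 by auto
  show ?case
    unfolding pcomp_tensor_D
    by (intro ext, subst act_finsum[OF mn \<pi>])
      (use xc yc form_comp_closed[OF 13(1) \<sigma>i] in \<open>auto simp: form_comp_outer[OF 13(1-3)]\<close>)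
next
  case (14 n i m \<tau> x y)
  note xc = tensor_D_coeff[OF 14(4)] and yc = tensor_D_coeff[OF 14(5)]
  have \<pi>: "inner_perm n i \<tau> permutes {1..m + n - 1}" by (rule inner_perm_permutes[OF 14(3,2,1)])
  have mn: "m + n - 1 \<ge> 1" using 14 by auto
  show ?case
    unfolding pcomp_tensor_D
    by (intro ext, subst act_finsum[OF mn \<pi>])
      (use xc yc form_comp_closed[OF 14(1,2)] in \<open>auto simp: form_comp_inner[OF 14(1-3)]\<close>)
next
  case 15
  interpret N: dg_space "Sp P 1" by (rule space) simp
  show ?case
    unfolding N.homogeneous_tensor_D
    by (auto intro!: N.tensor_D_closed[of _ 0] N.homogeneous_zero unit_even)
next
  case (16 n x)
  interpret N: dg_space "Sp P n" by (rule space[OF 16(1)])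
  interpret U: dg_space "Sp P 1" by (rule space) simp
  note xc = tensor_D_coeff[OF 16(2)]
  have one: "1 \<in> {1..1::nat}" and eq: "1 + n - 1 = n" by auto
  show ?case
  proof (intro ext)
    fix e k
    let ?u = "\<lambda>e k. if e = 0 \<and> k = (0::nat) then ounit P else \<zero>\<^bsub>Sp P 1\<^esub>"
    have z: "form_comp P 1 n 1 e (\<lambda>e. \<zero>\<^bsub>Sp P 1\<^esub>) (\<lambda>e. x e l) = \<zero>\<^bsub>Sp P n\<^esub>" for l
      using form_comp_zero(1)[OF 16(1) one, of "\<lambda>e. x e l" e] xc unfolding eq by simp
    have o: "form_comp P 1 n 1 e (\<lambda>e. if e = 0 then ounit P else \<zero>\<^bsub>Sp P 1\<^esub>) (\<lambda>e. x e k) = x e k"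
      using xc bit_cases[of e] unit_left[OF 16(1)] pcomp_zero_left[OF 16(1) one] by (auto simp: form_comp_def)
    have "pcomp (tensor_D P) 1 n 1 ?u x e k =
      (\<Oplus>\<^bsub>Sp P n\<^esub>j\<in>{..k}. form_comp P 1 n 1 e (\<lambda>e. ?u e j) (\<lambda>e. x e (k - j)))"
      unfolding pcomp_tensor_D eq ..
    also have "\<dots> = form_comp P 1 n 1 e (\<lambda>e. ?u e 0) (\<lambda>e. x e (k - 0))"
      by (rule N.finsum_single) (use z o xc in auto)
    finally show "pcomp (tensor_D P) 1 n 1 ?u x e k = x e k" using o by simp
  qed
next
  case (17 i n x)
  have n: "1 \<le> n" using 17 by auto
  interpret N: dg_space "Sp P n" by (rule space[OF n])
  interpret U: dg_space "Sp P 1" by (rule space) simp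
  note xc = tensor_D_coeff[OF 17(2)]
  have one: "1 \<le> (1::nat)" and eq: "n + 1 - 1 = n" by auto
  show ?case
  proof (intro ext)
    fix e k
    let ?u = "\<lambda>e k. if e = 0 \<and> k = (0::nat) then ounit P else \<zero>\<^bsub>Sp P 1\<^esub>"
    have z: "form_comp P n 1 i e (\<lambda>e. x e l) (\<lambda>e. \<zero>\<^bsub>Sp P 1\<^esub>) = \<zero>\<^bsub>Sp P n\<^esub>" for l
      using form_comp_zero(2)[OF one 17(1), of "\<lambda>e. x e l" e] xc unfolding eq by simp
    have o: "form_comp P n 1 i e (\<lambda>e. x e k) (\<lambda>e. if e = 0 then ounit P else \<zero>\<^bsub>Sp P 1\<^esub>) = x e k"
      using xc bit_cases[of e] unit_right[OF 17(1)] pcomp_zero_right[OF one 17(1)] by (auto simp: form_comp_def)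
    have "pcomp (tensor_D P) n 1 i x ?u e k =
      (\<Oplus>\<^bsub>Sp P n\<^esub>j\<in>{..k}. form_comp P n 1 i e (\<lambda>e. x e j) (\<lambda>e. ?u e (k - j)))"
      unfolding pcomp_tensor_D eq ..
    also have "\<dots> = form_comp P n 1 i e (\<lambda>e. x e k) (\<lambda>e. ?u e (k - k))"
      by (rule N.finsum_single) (use z o xc in auto)
    finally show "pcomp (tensor_D P) n 1 i x ?u e k = x e k" using o by simp
  qed
qed

subsection \<open>Evaluation at a point and affine families\<close>

lemma ev_D_eq:
  assumes n: "n \<ge> 1" and a: "a \<in> carrier (tensor_D_space (Sp P n))" and N: "\<And>k. N < k \<Longrightarrow> a 0 k = \<zero>\<^bsub>Sp P n\<^esub>"
  shows "ev_D P c n a = (\<Oplus>\<^bsub>Sp P n\<^esub>k\<in>{..N}. c ^ k \<odot>\<^bsub>Sp P n\<^esub> a 0 k)"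
proof -
  interpret N: dg_space "Sp P n" by (rule space[OF n])
  have "{k. a 0 k \<noteq> \<zero>\<^bsub>Sp P n\<^esub>} \<subseteq> {..N}" using N by (auto simp: not_less[symmetric])
  then show ?thesis
    unfolding ev_D_def using tensor_D_coeff[OF a]
    by (intro N.M.add.finprod_mono_neutral_cong_left) auto
qed

lemma tensor_D_bound:
  assumes "a \<in> carrier (tensor_D_space (Sp P n))"
  obtains N where "\<And>e k. N < k \<Longrightarrow> a e k = \<zero>\<^bsub>Sp P n\<^esub>"
  using assms unfolding tensor_D_space_carrier by blast

text \<open>
  Evaluation is multiplicative: the convolution of the coefficients becomes a product of two sums. Only the parts
  without $dz$ contribute, and they compose without signs.
\<close>

lemma ev_D_pcomp:
  assumes n: "n \<ge> 1" and i: "i \<in> {1..m}" and a: "a \<in> carrier (tensor_D_space (Sp P m))"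
    and b: "b \<in> carrier (tensor_D_space (Sp P n))"
  shows "ev_D P c (m + n - 1) (pcomp (tensor_D P) m n i a b) = pcomp P m n i (ev_D P c m a) (ev_D P c n b)"
proof -
  have m: "m \<ge> 1" using i by auto
  have mn: "m + n - 1 \<ge> 1" using m n by auto
  interpret M: dg_space "Sp P m" by (rule space[OF m])
  interpret N: dg_space "Sp P n" by (rule space[OF n])
  interpret L: dg_space "Sp P (m + n - 1)" by (rule space_comp[OF n i])
  obtain K where K: "\<And>e k. K < k \<Longrightarrow> a e k = \<zero>\<^bsub>Sp P m\<^esub>" using tensor_D_bound[OF a] by blast
  obtain K' where K': "\<And>e k. K' < k \<Longrightarrow> b e k = \<zero>\<^bsub>Sp P n\<^esub>" using tensor_D_bound[OF b] by blast
  note ac = tensor_D_coeff[OF a] and bc = tensor_D_coeff[OF b]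
  let ?f = "\<lambda>j l. (c ^ j * c ^ l) \<odot>\<^bsub>Sp P (m + n - 1)\<^esub> pcomp P m n i (a 0 j) (b 0 l)"
  have fc: "?f j l \<in> carrier (Sp P (m + n - 1))" for j l using ac bc n i by simp
  have pc: "pcomp P m n i (a 0 j) (b 0 l) \<in> carrier (Sp P (m + n - 1))" for j l using ac bc n i by simp
  have comp: "pcomp (tensor_D P) m n i a b 0 k = (\<Oplus>\<^bsub>Sp P (m + n - 1)\<^esub>j\<in>{..k}. pcomp P m n i (a 0 j) (b 0 (k - j)))" for k
    by (simp add: pcomp_tensor_D form_comp_def)
  have f0: "?f j l = \<zero>\<^bsub>Sp P (m + n - 1)\<^esub>" if "K < j \<or> K' < l" for j l
    using that K K' ac bc pcomp_zero_left[OF n i] pcomp_zero_right[OF n i] by auto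
  have ea: "ev_D P c m a = (\<Oplus>\<^bsub>Sp P m\<^esub>k\<in>{..K}. c ^ k \<odot>\<^bsub>Sp P m\<^esub> a 0 k)"
    by (rule ev_D_eq[OF m a]) (rule K)
  have eb: "ev_D P c n b = (\<Oplus>\<^bsub>Sp P n\<^esub>k\<in>{..K'}. c ^ k \<odot>\<^bsub>Sp P n\<^esub> b 0 k)"
    by (rule ev_D_eq[OF n b]) (rule K')
  have evb: "ev_D P c n b \<in> carrier (Sp P n)"
    unfolding eb using bc by (auto intro!: N.M.finsum_closed)
  have z: "pcomp (tensor_D P) m n i a b 0 k = \<zero>\<^bsub>Sp P (m + n - 1)\<^esub>" if k: "K + K' < k" for k
    unfolding comp
  proof (rule L.M.add.finprod_one_eqI)
    fix j assume "j \<in> {..k}"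
    then consider "K < j" | "K' < k - j" using k by fastforce
    then show "pcomp P m n i (a 0 j) (b 0 (k - j)) = \<zero>\<^bsub>Sp P (m + n - 1)\<^esub>"
      using ac bc pcomp_zero_left[OF n i] pcomp_zero_right[OF n i] by cases (simp_all add: K K')
  qed
  have "ev_D P c (m + n - 1) (pcomp (tensor_D P) m n i a b) =
      (\<Oplus>\<^bsub>Sp P (m + n - 1)\<^esub>k\<in>{..K + K'}. c ^ k \<odot>\<^bsub>Sp P (m + n - 1)\<^esub> pcomp (tensor_D P) m n i a b 0 k)"
    by (rule ev_D_eq[OF mn pcomp_tensor_D_closed[OF n i a b] z])
  also have "\<dots> = (\<Oplus>\<^bsub>Sp P (m + n - 1)\<^esub>k\<in>{..K + K'}. \<Oplus>\<^bsub>Sp P (m + n - 1)\<^esub>j\<in>{..k}. ?f j (k - j))"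
  proof (rule L.M.finsum_cong'[OF HOL.refl])
    fix k assume "k \<in> {..K + K'}"
    have "c ^ k \<odot>\<^bsub>Sp P (m + n - 1)\<^esub> pcomp (tensor_D P) m n i a b 0 k =
      (\<Oplus>\<^bsub>Sp P (m + n - 1)\<^esub>j\<in>{..k}. c ^ k \<odot>\<^bsub>Sp P (m + n - 1)\<^esub> pcomp P m n i (a 0 j) (b 0 (k - j)))"
      unfolding comp by (rule L.scale_finsum) (use pc in auto)
    also have "\<dots> = (\<Oplus>\<^bsub>Sp P (m + n - 1)\<^esub>j\<in>{..k}. ?f j (k - j))"
      by (rule L.M.finsum_cong'[OF HOL.refl]) (use fc in \<open>auto simp flip: power_add\<close>)
    finally show "c ^ k \<odot>\<^bsub>Sp P (m + n - 1)\<^esub> pcomp (tensor_D P) m n i a b 0 k = (\<Oplus>\<^bsub>Sp P (m + n - 1)\<^esub>j\<in>{..k}. ?f j (k - j))" .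
  qed (use fc in \<open>auto intro!: L.M.finsum_closed\<close>)
  also have "\<dots> = (\<Oplus>\<^bsub>Sp P (m + n - 1)\<^esub>j\<in>{..K}. \<Oplus>\<^bsub>Sp P (m + n - 1)\<^esub>l\<in>{..K'}. ?f j l)"
    by (rule L.M.convolution_square[OF fc f0])
  also have "\<dots> = (\<Oplus>\<^bsub>Sp P (m + n - 1)\<^esub>j\<in>{..K}. pcomp P m n i (c ^ j \<odot>\<^bsub>Sp P m\<^esub> a 0 j) (ev_D P c n b))"
  proof (rule L.M.finsum_cong'[OF HOL.refl])
    show "(\<lambda>j. pcomp P m n i (c ^ j \<odot>\<^bsub>Sp P m\<^esub> a 0 j) (ev_D P c n b)) \<in> {..K} \<rightarrow> carrier (Sp P (m + n - 1))"
      using ac evb n i by auto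
    fix j assume "j \<in> {..K}"
    show "(\<Oplus>\<^bsub>Sp P (m + n - 1)\<^esub>l\<in>{..K'}. ?f j l) = pcomp P m n i (c ^ j \<odot>\<^bsub>Sp P m\<^esub> a 0 j) (ev_D P c n b)"
      unfolding eb
      by (subst pcomp_finsum_right[OF n i]) (use ac bc n i L.scale_scale in \<open>auto simp: pcomp_scale_left pcomp_scale_right mult.commute\<close>)
  qed
  also have "\<dots> = pcomp P m n i (ev_D P c m a) (ev_D P c n b)"
    unfolding ea
    by (rule pcomp_finsum_left[OF n i, symmetric]) (use ac evb in auto)
  finally show ?thesis .
qed

lemma ev_D_closed:
  assumes "n \<ge> 1" "a \<in> carrier (tensor_D_space (Sp P n))"
  shows "ev_D P c n a \<in> carrier (Sp P n)"
proof -
  interpret N: dg_space "Sp P n" by (rule space[OF assms(1)])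
  show ?thesis unfolding ev_D_def using tensor_D_coeff[OF assms(2)] by (auto intro!: N.M.finsum_closed)
qed

lemma ev_D_linear_map:
  assumes n: "n \<ge> 1" and g: "linear_map (Sp P n) (Sp P n) g" and a: "a \<in> carrier (tensor_D_space (Sp P n))"
    and b: "b \<in> carrier (tensor_D_space (Sp P n))" and ab: "\<And>k. b 0 k = g (a 0 k)"
  shows "ev_D P c n b = g (ev_D P c n a)"
proof -
  interpret N: dg_space "Sp P n" by (rule space[OF n])
  obtain K where K: "\<And>e k. K < k \<Longrightarrow> a e k = \<zero>\<^bsub>Sp P n\<^esub>" using tensor_D_bound[OF a] by blast
  have ea: "ev_D P c n a = (\<Oplus>\<^bsub>Sp P n\<^esub>k\<in>{..K}. c ^ k \<odot>\<^bsub>Sp P n\<^esub> a 0 k)"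
    by (rule ev_D_eq[OF n a]) (rule K)
  have eb: "ev_D P c n b = (\<Oplus>\<^bsub>Sp P n\<^esub>k\<in>{..K}. c ^ k \<odot>\<^bsub>Sp P n\<^esub> g (a 0 k))"
    unfolding ab[symmetric]
    by (rule ev_D_eq[OF n b]) (simp add: ab K linear_map_zero[OF N.dg_space_axioms N.dg_space_axioms g])
  have "g (ev_D P c n a) = (\<Oplus>\<^bsub>Sp P n\<^esub>k\<in>{..K}. g (c ^ k \<odot>\<^bsub>Sp P n\<^esub> a 0 k))"
    unfolding ea
    by (rule linear_map_finsum[OF N.dg_space_axioms N.dg_space_axioms g]) (use tensor_D_coeff[OF a] in auto)
  then show ?thesis
    unfolding eb using linear_mapD(3)[OF g] tensor_D_coeff[OF a] by simp
qed

lemma ev_D_add: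
  assumes n: "n \<ge> 1" and a: "a \<in> carrier (tensor_D_space (Sp P n))" and b: "b \<in> carrier (tensor_D_space (Sp P n))"
  shows "ev_D P c n (a \<oplus>\<^bsub>tensor_D_space (Sp P n)\<^esub> b) = ev_D P c n a \<oplus>\<^bsub>Sp P n\<^esub> ev_D P c n b"
proof -
  interpret N: dg_space "Sp P n" by (rule space[OF n])
  interpret T: dg_space "tensor_D_space (Sp P n)" by (rule N.dg_space_tensor_D)
  obtain K where K: "\<And>e k. K < k \<Longrightarrow> a e k = \<zero>\<^bsub>Sp P n\<^esub>" using tensor_D_bound[OF a] by blast
  obtain K' where K': "\<And>e k. K' < k \<Longrightarrow> b e k = \<zero>\<^bsub>Sp P n\<^esub>" using tensor_D_bound[OF b] by blast
  let ?K = "max K K'"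
  have ea: "ev_D P c n a = (\<Oplus>\<^bsub>Sp P n\<^esub>k\<in>{..?K}. c ^ k \<odot>\<^bsub>Sp P n\<^esub> a 0 k)"
    by (rule ev_D_eq[OF n a]) (simp add: K)
  have eb: "ev_D P c n b = (\<Oplus>\<^bsub>Sp P n\<^esub>k\<in>{..?K}. c ^ k \<odot>\<^bsub>Sp P n\<^esub> b 0 k)"
    by (rule ev_D_eq[OF n b]) (simp add: K')
  have "ev_D P c n (a \<oplus>\<^bsub>tensor_D_space (Sp P n)\<^esub> b) =
      (\<Oplus>\<^bsub>Sp P n\<^esub>k\<in>{..?K}. c ^ k \<odot>\<^bsub>Sp P n\<^esub> (a \<oplus>\<^bsub>tensor_D_space (Sp P n)\<^esub> b) 0 k)"
    by (rule ev_D_eq[OF n T.M.a_closed[OF a b]]) (simp add: K K')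
  also have "\<dots> = (\<Oplus>\<^bsub>Sp P n\<^esub>k\<in>{..?K}. c ^ k \<odot>\<^bsub>Sp P n\<^esub> a 0 k \<oplus>\<^bsub>Sp P n\<^esub> c ^ k \<odot>\<^bsub>Sp P n\<^esub> b 0 k)"
    using tensor_D_coeff[OF a] tensor_D_coeff[OF b] by (simp add: N.scale_right_distrib)
  also have "\<dots> = ev_D P c n a \<oplus>\<^bsub>Sp P n\<^esub> ev_D P c n b"
    unfolding ea eb by (rule N.M.finsum_addf) (use tensor_D_coeff[OF a] tensor_D_coeff[OF b] in auto)
  finally show ?thesis .
qed

lemma operad_map_ev_D: "operad_map (tensor_D P) P (ev_D P c)"
  unfolding operad_map_def tensor_D_simps
proof (intro conjI allI impI ballI)
  fix n :: nat assume n: "1 \<le> n"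
  interpret N: dg_space "Sp P n" by (rule space[OF n])
  interpret T: dg_space "tensor_D_space (Sp P n)" by (rule N.dg_space_tensor_D)
  show "linear_map (tensor_D_space (Sp P n)) (Sp P n) (ev_D P c n)"
    unfolding linear_map_def
  proof (intro conjI ballI allI Pi_I)
    fix a d assume a: "a \<in> carrier (tensor_D_space (Sp P n))"
    show "ev_D P c n (d \<odot>\<^bsub>tensor_D_space (Sp P n)\<^esub> a) = d \<odot>\<^bsub>Sp P n\<^esub> ev_D P c n a"
      by (rule ev_D_linear_map[OF n N.linear_map_scale a T.scale_closed[OF a]]) simp
  qed (simp_all only: ev_D_closed[OF n] ev_D_add[OF n])
next
  fix n a and p :: bit assume n: "1 \<le> n" and a: "a \<in> carrier (tensor_D_space (Sp P n))"
  interpret N: dg_space "Sp P n" by (rule space[OF n])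
  interpret T: dg_space "tensor_D_space (Sp P n)" by (rule N.dg_space_tensor_D)
  show "ev_D P c n (hcomp (tensor_D_space (Sp P n)) p a) = hcomp (Sp P n) p (ev_D P c n a)"
    by (rule ev_D_linear_map[OF n N.hcomp_linear a T.hcomp_closed[OF a]]) simp
  show "ev_D P c n (dif (tensor_D_space (Sp P n)) a) = dif (Sp P n) (ev_D P c n a)"
    by (rule ev_D_linear_map[OF n N.dif_linear a T.dif_closed[OF a]]) (simp add: dif_tensor_D_space)
  fix \<sigma> assume \<sigma>: "\<sigma> permutes {1..n}"
  show "ev_D P c n (\<lambda>e k. act P n (a e k) \<sigma>) = act P n (ev_D P c n a) \<sigma>"
    by (rule ev_D_linear_map[OF n act_linear[OF n \<sigma>] a act_tensor_D_closed[OF n \<sigma> a]]) simp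
next
  fix m n i a b assume "1 \<le> m" "1 \<le> n" "i \<in> {1..m}" "a \<in> carrier (tensor_D_space (Sp P m))" "b \<in> carrier (tensor_D_space (Sp P n))"
  then show "ev_D P c (m + n - 1) (pcomp (tensor_D P) m n i a b) = pcomp P m n i (ev_D P c m a) (ev_D P c n b)"
    by (intro ev_D_pcomp)
next
  interpret U: dg_space "Sp P 1" by (rule space) simp
  have u: "(\<lambda>e k. if e = 0 \<and> k = (0::nat) then ounit P else \<zero>\<^bsub>Sp P 1\<^esub>) \<in> carrier (tensor_D_space (Sp P 1))"
    by (rule U.tensor_D_closed[of _ 0]) auto
  show "ev_D P c 1 (\<lambda>e k. if e = 0 \<and> k = 0 then ounit P else \<zero>\<^bsub>Sp P 1\<^esub>) = ounit P"
    by (subst ev_D_eq[OF _ u, of 0]) (auto simp: U.M.finsum_0)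
qed

end

text \<open>The affine family $x + z y$ of operations.\<close>

definition affine_D :: "('k, 'a) dg_space \<Rightarrow> 'a \<Rightarrow> 'a \<Rightarrow> bit \<Rightarrow> nat \<Rightarrow> 'a" where
  "affine_D M x y = (\<lambda>e k. if e = 0 \<and> k = 0 then x else if e = 0 \<and> k = 1 then y else \<zero>\<^bsub>M\<^esub>)"

context dg_operad
begin

lemma affine_D_closed:
  assumes "n \<ge> 1" "x \<in> carrier (Sp P n)" "y \<in> carrier (Sp P n)"
  shows "affine_D (Sp P n) x y \<in> carrier (tensor_D_space (Sp P n))"
proof -
  interpret N: dg_space "Sp P n" using space assms(1) by simp
  show ?thesis by (rule N.tensor_D_closed[of _ 1]) (use assms in \<open>auto simp: affine_D_def\<close>)
qed

lemma affine_D_homogeneous: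
  assumes "n \<ge> 1" "x \<in> homogeneous (Sp P n) p" "y \<in> homogeneous (Sp P n) p"
  shows "affine_D (Sp P n) x y \<in> homogeneous (tensor_D_space (Sp P n)) p"
proof -
  interpret N: dg_space "Sp P n" using space assms(1) by simp
  show ?thesis
    unfolding N.homogeneous_tensor_D
    using assms affine_D_closed[OF assms(1) N.homogeneousD[OF assms(2)] N.homogeneousD[OF assms(3)]]
    by (auto simp: affine_D_def N.homogeneous_zero)
qed

lemma ev_D_affine:
  assumes "n \<ge> 1" "x \<in> carrier (Sp P n)" "y \<in> carrier (Sp P n)"
  shows "ev_D P c n (affine_D (Sp P n) x y) = x \<oplus>\<^bsub>Sp P n\<^esub> c \<odot>\<^bsub>Sp P n\<^esub> y"
proof -
  interpret N: dg_space "Sp P n" using space assms(1) by simp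
  have "ev_D P c n (affine_D (Sp P n) x y) = (\<Oplus>\<^bsub>Sp P n\<^esub>k\<in>{..Suc 0}. c ^ k \<odot>\<^bsub>Sp P n\<^esub> affine_D (Sp P n) x y 0 k)"
    by (rule ev_D_eq[OF assms(1) affine_D_closed[OF assms]]) (auto simp: affine_D_def)
  also have "\<dots> = x \<oplus>\<^bsub>Sp P n\<^esub> c \<odot>\<^bsub>Sp P n\<^esub> y"
    using assms by (subst N.M.finsum_Suc) (auto simp: affine_D_def N.M.finsum_0 N.M.a_comm One_nat_def)
  finally show ?thesis .
qed

end

text \<open>The constant family; this is the map $x \mapsto x \otimes 1$.\<close>

definition const_D :: "('k, 'a) operad \<Rightarrow> nat \<Rightarrow> 'a \<Rightarrow> bit \<Rightarrow> nat \<Rightarrow> 'a" where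
  "const_D P n x = (\<lambda>e k. if e = 0 \<and> k = 0 then x else \<zero>\<^bsub>Sp P n\<^esub>)"

context dg_operad
begin

lemma const_D_closed:
  assumes "n \<ge> 1" "x \<in> carrier (Sp P n)"
  shows "const_D P n x \<in> carrier (tensor_D_space (Sp P n))"
proof -
  interpret N: dg_space "Sp P n" using space assms(1) by simp
  show ?thesis by (rule N.tensor_D_closed[of _ 0]) (use assms in \<open>auto simp: const_D_def\<close>)
qed

lemma const_D_pcomp_left:
  assumes n: "n \<ge> 1" and i: "i \<in> {1..m}" and x: "x \<in> carrier (Sp P m)" and b: "b \<in> carrier (tensor_D_space (Sp P n))"
  shows "pcomp (tensor_D P) m n i (const_D P m x) b = (\<lambda>e k. pcomp P m n i x (b e k))"
proof (intro ext)
  fix e k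
  interpret L: dg_space "Sp P (m + n - 1)" by (rule space_comp[OF n i])
  interpret N: dg_space "Sp P n" by (rule space[OF n])
  interpret M: dg_space "Sp P m" by (rule space) (use i in auto)
  note bc = tensor_D_coeff[OF b]
  have z: "form_comp P m n i e (\<lambda>e. \<zero>\<^bsub>Sp P m\<^esub>) (\<lambda>e. b e l) = \<zero>\<^bsub>Sp P (m + n - 1)\<^esub>" for l
    by (rule form_comp_zero(1)[OF n i]) (use bc in auto)
  have v: "form_comp P m n i e (\<lambda>e. if e = 0 then x else \<zero>\<^bsub>Sp P m\<^esub>) (\<lambda>e. b e k) = pcomp P m n i x (b e k)"
    using x bc n i bit_cases[of e] by (auto simp: form_comp_def pcomp_zero_left)
  have "pcomp (tensor_D P) m n i (const_D P m x) b e k = form_comp P m n i e (\<lambda>e. const_D P m x e 0) (\<lambda>e. b e (k - 0))"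
    unfolding pcomp_tensor_D
    by (rule L.finsum_single) (use z x bc n i in \<open>auto simp: const_D_def intro!: form_comp_closed\<close>)
  then show "pcomp (tensor_D P) m n i (const_D P m x) b e k = pcomp P m n i x (b e k)"
    using v by (simp add: const_D_def)
qed

text \<open>
  Evenness of \<open>y\<close> is what removes the sign for moving $dz$ past \<open>y\<close>.
\<close>

lemma const_D_pcomp_right:
  assumes n: "n \<ge> 1" and i: "i \<in> {1..m}" and a: "a \<in> carrier (tensor_D_space (Sp P m))" and y: "y \<in> homogeneous (Sp P n) 0"
  shows "pcomp (tensor_D P) m n i a (const_D P n y) = (\<lambda>e k. pcomp P m n i (a e k) y)"
proof (intro ext)
  fix e k
  interpret L: dg_space "Sp P (m + n - 1)" by (rule space_comp[OF n i])
  interpret N: dg_space "Sp P n" by (rule space[OF n])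
  note ac = tensor_D_coeff[OF a] and yc = N.homogeneousD[OF y]
  have z: "form_comp P m n i e (\<lambda>e. a e l) (\<lambda>e. \<zero>\<^bsub>Sp P n\<^esub>) = \<zero>\<^bsub>Sp P (m + n - 1)\<^esub>" for l
    by (rule form_comp_zero(2)[OF n i]) (use ac in auto)
  have v: "form_comp P m n i e (\<lambda>e. a e k) (\<lambda>e. if e = 0 then y else \<zero>\<^bsub>Sp P n\<^esub>) = pcomp P m n i (a e k) y"
    using yc ac n i bit_cases[of e] N.gsign_homogeneous[OF y] by (auto simp: form_comp_def pcomp_zero_right)
  have "pcomp (tensor_D P) m n i a (const_D P n y) e k = form_comp P m n i e (\<lambda>e. a e k) (\<lambda>e. const_D P n y e (k - k))"
    unfolding pcomp_tensor_D
    by (rule L.finsum_single) (use z yc ac n i in \<open>auto simp: const_D_def intro!: form_comp_closed\<close>)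
  then show "pcomp (tensor_D P) m n i a (const_D P n y) e k = pcomp P m n i (a e k) y"
    using v by (simp add: const_D_def)
qed

lemma operad_map_const_D: "operad_map P (tensor_D P) (const_D P)"
  unfolding operad_map_def tensor_D_simps
proof (intro conjI allI impI ballI)
  fix n :: nat assume n: "1 \<le> n"
  interpret N: dg_space "Sp P n" by (rule space[OF n])
  show "linear_map (Sp P n) (tensor_D_space (Sp P n)) (const_D P n)"
    using const_D_closed[OF n] by (auto simp: linear_map_def const_D_def fun_eq_iff)
next
  fix n x and p :: bit assume n: "1 \<le> n" and x: "x \<in> carrier (Sp P n)"
  interpret N: dg_space "Sp P n" by (rule space[OF n])
  show "const_D P n (hcomp (Sp P n) p x) = hcomp (tensor_D_space (Sp P n)) p (const_D P n x)"
    by (auto simp: const_D_def fun_eq_iff)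
  show "const_D P n (dif (Sp P n) x) = dif (tensor_D_space (Sp P n)) (const_D P n x)"
    by (intro ext) (auto simp: const_D_def dif_tensor_D_space)
  fix \<sigma> assume \<sigma>: "\<sigma> permutes {1..n}"
  show "const_D P n (act P n x \<sigma>) = (\<lambda>e k. act P n (const_D P n x e k) \<sigma>)"
    by (auto simp: const_D_def fun_eq_iff act_zero[OF n \<sigma>])
next
  fix m n i x y assume m: "1 \<le> m" and n: "1 \<le> n" and i: "i \<in> {1..m}" and x: "x \<in> carrier (Sp P m)" and y: "y \<in> carrier (Sp P n)"
  interpret L: dg_space "Sp P (m + n - 1)" by (rule space_comp[OF n i])
  interpret M: dg_space "Sp P m" by (rule space[OF m])
  interpret N: dg_space "Sp P n" by (rule space[OF n])
  show "const_D P (m + n - 1) (pcomp P m n i x y) = pcomp (tensor_D P) m n i (const_D P m x) (const_D P n y)"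
    unfolding const_D_pcomp_left[OF n i x const_D_closed[OF n y]]
    using x pcomp_zero_right[OF n i] by (intro ext) (simp add: const_D_def)
next
  show "const_D P 1 (ounit P) = (\<lambda>e k. if e = 0 \<and> k = 0 then ounit P else \<zero>\<^bsub>Sp P 1\<^esub>)"
    by (simp add: const_D_def)
qed

lemma ev_D_const:
  assumes "n \<ge> 1" "x \<in> carrier (Sp P n)"
  shows "ev_D P c n (const_D P n x) = x"
proof -
  interpret N: dg_space "Sp P n" using space assms(1) by simp
  have "ev_D P c n (const_D P n x) = (\<Oplus>\<^bsub>Sp P n\<^esub>k\<in>{..0}. c ^ k \<odot>\<^bsub>Sp P n\<^esub> const_D P n x 0 k)"
    by (rule ev_D_eq[OF assms(1) const_D_closed[OF assms]]) (auto simp: const_D_def)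
  then show ?thesis using assms by (simp add: const_D_def N.M.finsum_0)
qed

end

section \<open>Maps out of BV\<close>

context dg_operad
begin

lemma bv_arity_pos: "bv_wf P u \<Longrightarrow> bv_arity u \<ge> 1"
  by (induction u) auto

lemma zero_closed [simp, intro]: "n \<ge> 1 \<Longrightarrow> \<zero>\<^bsub>Sp P n\<^esub> \<in> carrier (Sp P n)"
proof -
  assume "n \<ge> 1"
  then interpret N: dg_space "Sp P n" by (rule space)
  show ?thesis by simp
qed

lemma bv_hcomp_wf: "bv_wf P u \<Longrightarrow> bv_wf P (bv_hcomp P p u) \<and> bv_arity (bv_hcomp P p u) = bv_arity u"
proof (induction u arbitrary: p)
  case (Gen n x)
  then interpret N: dg_space "Sp P n" by (intro space) simp
  show ?case using Gen by simp
qed auto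

lemma bv_dif_wf: "bv_wf P u \<Longrightarrow> bv_wf P (bv_dif P u) \<and> bv_arity (bv_dif P u) = bv_arity u"
proof (induction u)
  case (Gen n x)
  then interpret N: dg_space "Sp P n" by (intro space) simp
  show ?case using Gen by simp
qed (auto simp: bv_hcomp_wf)

lemma bv_eq_wf: "bv_eq P u v \<Longrightarrow> bv_wf P u \<and> bv_wf P v \<and> bv_arity u = bv_arity v"
proof (induction rule: bv_eq.induct)
  case (act_act u \<sigma> \<tau>)
  then show ?case by (auto intro: permutes_compose)
next
  case (comp_sequential u i v j w)
  then show ?case using bv_arity_pos[of w] by auto
next
  case (comp_parallel u v w i j p q)
  then show ?case using bv_arity_pos[of w] bv_arity_pos[of v] by (auto simp: bv_hcomp_wf)
next
  case (comp_outer u \<sigma> i v)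
  then have v: "bv_arity v \<ge> 1" using bv_arity_pos by auto
  have "\<sigma> i \<in> {1..bv_arity u}" using permutes_leD[of \<sigma> "bv_arity u" i] comp_outer by auto
  then show ?case using comp_outer outer_perm_permutes[of \<sigma> "bv_arity u" i "bv_arity v"] v by auto
next
  case (comp_inner u i v \<tau>)
  then have v: "bv_arity v \<ge> 1" using bv_arity_pos by auto
  then show ?case using comp_inner inner_perm_permutes[of \<tau> "bv_arity v" i "bv_arity u"] by auto
next
  case (gen_add n x y)
  then interpret N: dg_space "Sp P n" by (intro space)
  show ?case using gen_add by simp
next
  case (gen_scale n x c)
  then interpret N: dg_space "Sp P n" by (intro space)
  show ?case using gen_scale by simp
next
  case (gen_comp n i m x y)
  then show ?case by auto
qed (use bv_arity_pos in \<open>auto\<close>)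

lemma bv_class_self: "bv_wf P u \<Longrightarrow> u \<in> bv_class P u"
  by (simp add: bv_class_def bv_eq.refl)

lemma bv_class_cong: "bv_eq P u v \<Longrightarrow> bv_class P u = bv_class P v"
  unfolding bv_class_def by (auto intro: bv_eq.trans bv_eq.sym)

lemma BV_simps:
  "carrier (Sp (BV P) n) = bv_class P ` {u. bv_wf P u \<and> bv_arity u = n}"
  "A \<oplus>\<^bsub>Sp (BV P) n\<^esub> B = (\<Union>u\<in>A. \<Union>v\<in>B. bv_class P (Add u v))"
  "c \<odot>\<^bsub>Sp (BV P) n\<^esub> A = (\<Union>u\<in>A. bv_class P (Scale c u))"
  "hcomp (Sp (BV P) n) p A = (\<Union>u\<in>A. bv_class P (bv_hcomp P p u))"
  "dif (Sp (BV P) n) A = (\<Union>u\<in>A. bv_class P (bv_dif P u))"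
  "act (BV P) n A \<sigma> = (\<Union>u\<in>A. bv_class P (Act u \<sigma>))"
  "pcomp (BV P) m n i A B = (\<Union>u\<in>A. \<Union>v\<in>B. bv_class P (Comp u i v))"
  by (simp_all add: BV_def mk_dg_space_def)

lemma bv_simps:
  "carrier (Sp (bv P) n) = sandwich (BV P) n (BV_t P) ` carrier (Sp (BV P) n)"
  "A \<oplus>\<^bsub>Sp (bv P) n\<^esub> B = A \<oplus>\<^bsub>Sp (BV P) n\<^esub> B"
  "c \<odot>\<^bsub>Sp (bv P) n\<^esub> A = c \<odot>\<^bsub>Sp (BV P) n\<^esub> A"
  "hcomp (Sp (bv P) n) p A = hcomp (Sp (BV P) n) p A"
  "dif (Sp (bv P) n) A = dif (Sp (BV P) n) A"
  "act (bv P) n A \<sigma> = act (BV P) n A \<sigma>"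
  "pcomp (bv P) m n i A B = pcomp (BV P) m n i A B"
  "ounit (bv P) = BV_t P"
  by (simp_all add: bv_def)

lemma pcomp_BV:
  assumes "bv_wf P (Comp u i v)"
  shows "pcomp (BV P) m n i (bv_class P u) (bv_class P v) = bv_class P (Comp u i v)"
proof -
  have "bv_class P (Comp u' i v') = bv_class P (Comp u i v)" if "u' \<in> bv_class P u" "v' \<in> bv_class P v" for u' v'
  proof -
    have "bv_eq P u u'" "bv_eq P v v'" using that by (simp_all add: bv_class_def)
    then have "bv_eq P (Comp u i v) (Comp u' i v')" using assms by (rule bv_eq.cong_comp)
    then show ?thesis by (rule bv_class_cong[symmetric])
  qed
  note key = this
  have "bv_class P u \<noteq> {}" "bv_class P v \<noteq> {}"
    using bv_class_self[of u] bv_class_self[of v] assms by auto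
  moreover have "pcomp (BV P) m n i (bv_class P u) (bv_class P v) =
      (\<Union>u'\<in>bv_class P u. \<Union>v'\<in>bv_class P v. bv_class P (Comp u i v))"
    unfolding BV_simps by (rule SUP_cong[OF HOL.refl], rule SUP_cong[OF HOL.refl], rule key)
  ultimately show ?thesis by simp
qed

text \<open>
  The sandwich of a class with \<open>t\<close> is again the class of a term, so every element of \<open>bv P\<close> can be evaluated
  on a representative.
\<close>

lemma bv_carrier_class:
  assumes n: "n \<ge> 1" and A: "A \<in> carrier (Sp (bv P) n)"
  obtains u where "bv_wf P u" "bv_arity u = n" "A = bv_class P u"
proof -
  obtain w where w: "bv_wf P w" "bv_arity w = n" "A = sandwich (BV P) n (BV_t P) (bv_class P w)"
    using A by (auto simp: bv_simps BV_simps)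
  have "\<exists>u. bv_wf P u \<and> bv_arity u = n \<and> foldl (\<lambda>y j. pcomp (BV P) n 1 j y (BV_t P)) (bv_class P v) js = bv_class P u"
    if "bv_wf P v" "bv_arity v = n" "set js \<subseteq> {1..n}" for v js
    using that
  proof (induction js arbitrary: v)
    case (Cons j js)
    then have "bv_wf P (Comp v j GenT)" "bv_arity (Comp v j GenT) = n" by auto
    then show ?case using Cons pcomp_BV[of v j GenT] by auto
  qed auto
  moreover have "pcomp (BV P) 1 n 1 (BV_t P) (bv_class P w) = bv_class P (Comp GenT 1 w)"
    "bv_wf P (Comp GenT 1 w)" "bv_arity (Comp GenT 1 w) = n"
    using w by (auto intro!: pcomp_BV)
  moreover have "set [1..<n + 1] \<subseteq> {1..n}" by auto
  ultimately have "\<exists>u. bv_wf P u \<and> bv_arity u = n \<and> A = bv_class P u"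
    unfolding w(3) sandwich_def by metis
  then show ?thesis using that by blast
qed

end

text \<open>
  The data of a map out of \<open>BV P\<close>: a map out of \<open>P\<close> and images of the generators that satisfy the relations.
\<close>

locale BV_target = P: dg_operad P + Q: dg_operad Q
  for P :: "('k::field_char_0, 'a) operad" and Q :: "('k, 'b) operad" +
  fixes f :: "nat \<Rightarrow> 'a \<Rightarrow> 'b" and s t :: 'b
  assumes f: "operad_map P Q f"
    and s: "s \<in> homogeneous (Sp Q 1) 1" and t: "t \<in> homogeneous (Sp Q 1) 0"
    and ss: "pcomp Q 1 1 1 s s = \<zero>\<^bsub>Sp Q 1\<^esub>" and tt: "pcomp Q 1 1 1 t t = t"
    and st: "pcomp Q 1 1 1 s t = \<zero>\<^bsub>Sp Q 1\<^esub>" and ts: "pcomp Q 1 1 1 t s = \<zero>\<^bsub>Sp Q 1\<^esub>"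
    and dif_s: "dif (Sp Q 1) s = ounit Q \<oplus>\<^bsub>Sp Q 1\<^esub> (-1) \<odot>\<^bsub>Sp Q 1\<^esub> t"
    and dif_t: "dif (Sp Q 1) t = \<zero>\<^bsub>Sp Q 1\<^esub>"
begin

abbreviation ev where "ev \<equiv> bv_eval Q f s t"

lemma f_linear: "n \<ge> 1 \<Longrightarrow> linear_map (Sp P n) (Sp Q n) (f n)"
  and f_hcomp: "n \<ge> 1 \<Longrightarrow> x \<in> carrier (Sp P n) \<Longrightarrow> f n (hcomp (Sp P n) p x) = hcomp (Sp Q n) p (f n x)"
  and f_dif: "n \<ge> 1 \<Longrightarrow> x \<in> carrier (Sp P n) \<Longrightarrow> f n (dif (Sp P n) x) = dif (Sp Q n) (f n x)"
  and f_act: "n \<ge> 1 \<Longrightarrow> x \<in> carrier (Sp P n) \<Longrightarrow> \<sigma> permutes {1..n} \<Longrightarrow> f n (act P n x \<sigma>) = act Q n (f n x) \<sigma>"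
  and f_pcomp: "n \<ge> 1 \<Longrightarrow> i \<in> {1..m} \<Longrightarrow> x \<in> carrier (Sp P m) \<Longrightarrow> y \<in> carrier (Sp P n) \<Longrightarrow>
    f (m + n - 1) (pcomp P m n i x y) = pcomp Q m n i (f m x) (f n y)"
  and f_unit: "f 1 (ounit P) = ounit Q"
  using f by (auto simp: operad_map_def)

lemmas f_closed = linear_mapD(1)[OF f_linear]
  and f_add = linear_mapD(2)[OF f_linear]
  and f_scale = linear_mapD(3)[OF f_linear]

lemma f_zero: "n \<ge> 1 \<Longrightarrow> f n \<zero>\<^bsub>Sp P n\<^esub> = \<zero>\<^bsub>Sp Q n\<^esub>"
  by (rule linear_map_zero[OF P.space Q.space f_linear])

lemma s_closed [simp]: "s \<in> carrier (Sp Q 1)" and t_closed [simp]: "t \<in> carrier (Sp Q 1)"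
  using s t by (auto simp: homogeneous_def)

lemma ev_closed: "bv_wf P u \<Longrightarrow> ev u \<in> carrier (Sp Q (bv_arity u))"
proof (induction u)
  case (Gen n x) then show ?case by (simp add: f_closed)
next
  case (Add u v)
  define n where "n = bv_arity u"
  have wf: "bv_wf P u" "bv_wf P v" and ar: "bv_arity u = n" "bv_arity v = n" using Add.prems by (auto simp: n_def)
  interpret N: dg_space "Sp Q n" by (rule Q.space) (use P.bv_arity_pos[OF wf(1)] ar in simp)
  show ?case using Add.IH wf by (simp add: ar)
next
  case (Scale c u)
  interpret N: dg_space "Sp Q (bv_arity u)" by (rule Q.space) (use P.bv_arity_pos Scale in auto)
  show ?case using Scale by auto
next
  case (Act u \<sigma>)
  then show ?case using P.bv_arity_pos by auto
next
  case (Comp u i v)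
  then show ?case using P.bv_arity_pos by auto
qed simp_all

lemma ev_hcomp: "bv_wf P u \<Longrightarrow> ev (bv_hcomp P p u) = hcomp (Sp Q (bv_arity u)) p (ev u)"
proof (induction u arbitrary: p)
  case (Gen n x) then show ?case by (simp add: f_hcomp)
next
  case GenS
  interpret N: dg_space "Sp Q 1" by (rule Q.space) simp
  show ?case using N.hcomp_homogeneous[OF s, of p] by (simp add: f_zero)
next
  case GenT
  interpret N: dg_space "Sp Q 1" by (rule Q.space) simp
  show ?case using N.hcomp_homogeneous[OF t, of p] by (simp add: f_zero)
next
  case (Add u v)
  define n where "n = bv_arity u"
  have wf: "bv_wf P u" "bv_wf P v" and ar: "bv_arity u = n" "bv_arity v = n" using Add.prems by (auto simp: n_def)
  interpret N: dg_space "Sp Q n" by (rule Q.space) (use P.bv_arity_pos[OF wf(1)] ar in simp)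
  note cl = ev_closed[OF wf(1), unfolded ar] ev_closed[OF wf(2), unfolded ar]
  show ?case using Add.IH wf cl by (simp add: P.bv_hcomp_wf ar N.hcomp_add)
next
  case (Scale c u)
  interpret N: dg_space "Sp Q (bv_arity u)" by (rule Q.space) (use P.bv_arity_pos Scale in auto)
  show ?case using Scale ev_closed[of u] by (simp add: P.bv_hcomp_wf N.hcomp_scale)
next
  case (Act u \<sigma>)
  then show ?case using P.bv_arity_pos[of u] ev_closed[of u] by (simp add: P.bv_hcomp_wf Q.act_hcomp)
next
  case (Comp u i v)
  then show ?case using P.bv_arity_pos[of v] ev_closed[of u] ev_closed[of v]
    by (simp add: P.bv_hcomp_wf Q.hcomp_pcomp del: add_bit_eq_xor)
qed

lemma ev_gsign:
  assumes "bv_wf P u"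
  shows "ev (Add (bv_hcomp P 0 u) (Scale (- 1) (bv_hcomp P 1 u))) = gsign (Sp Q (bv_arity u)) (ev u)"
  using assms by (simp add: P.bv_hcomp_wf ev_hcomp gsign_def)

lemma ev_dif: "bv_wf P u \<Longrightarrow> ev (bv_dif P u) = dif (Sp Q (bv_arity u)) (ev u)"
proof (induction u)
  case (Gen n x) then show ?case by (simp add: f_dif)
next
  case GenS show ?case by (simp add: f_unit dif_s)
next
  case GenT show ?case by (simp add: f_zero dif_t)
next
  case (Add u v)
  define n where "n = bv_arity u"
  have wf: "bv_wf P u" "bv_wf P v" and ar: "bv_arity u = n" "bv_arity v = n" using Add.prems by (auto simp: n_def)
  interpret N: dg_space "Sp Q n" by (rule Q.space) (use P.bv_arity_pos[OF wf(1)] ar in simp)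
  note cl = ev_closed[OF wf(1), unfolded ar] ev_closed[OF wf(2), unfolded ar]
  show ?case using Add.IH wf cl by (simp add: P.bv_dif_wf ar N.dif_add)
next
  case (Scale c u)
  interpret N: dg_space "Sp Q (bv_arity u)" by (rule Q.space) (use P.bv_arity_pos Scale in auto)
  show ?case using Scale ev_closed[of u] by (simp add: P.bv_dif_wf N.dif_scale)
next
  case (Act u \<sigma>)
  then show ?case using P.bv_arity_pos[of u] ev_closed[of u] by (simp add: P.bv_dif_wf Q.act_dif)
next
  case (Comp u i v)
  have wf: "bv_wf P u" "bv_wf P v" "i \<in> {1..bv_arity u}" using Comp by auto
  show ?case
    using Comp.IH wf P.bv_arity_pos[OF wf(2)] ev_closed[OF wf(1)] ev_closed[OF wf(2)] ev_gsign[OF wf(1)]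
    by (simp add: P.bv_dif_wf P.bv_hcomp_wf Q.pcomp_dif)
qed

text \<open>
  Each rule of the congruence is a law of dg operads, a property of the map \<open>f\<close>, or one of the relations
  between $s$ and $t$; so evaluation is constant on classes.
\<close>

lemma ev_bv_eq: "bv_eq P u v \<Longrightarrow> ev u = ev v"
proof (induction rule: bv_eq.induct)
  case (add_assoc u v w)
  define n where "n = bv_arity u"
  have wf: "bv_wf P u" "bv_wf P v" "bv_wf P w" and ar: "bv_arity u = n" "bv_arity v = n" "bv_arity w = n"
    using add_assoc by (auto simp: n_def)
  interpret N: dg_space "Sp Q n" by (rule Q.space) (use P.bv_arity_pos[OF wf(1)] ar in simp)
  show ?case
    using ev_closed[OF wf(1), unfolded ar] ev_closed[OF wf(2), unfolded ar] ev_closed[OF wf(3), unfolded ar]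
    by (simp add: ar N.M.a_assoc)
next
  case (add_comm u v)
  define n where "n = bv_arity u"
  have wf: "bv_wf P u" "bv_wf P v" and ar: "bv_arity u = n" "bv_arity v = n" using add_comm by (auto simp: n_def)
  interpret N: dg_space "Sp Q n" by (rule Q.space) (use P.bv_arity_pos[OF wf(1)] ar in simp)
  note cl = ev_closed[OF wf(1), unfolded ar] ev_closed[OF wf(2), unfolded ar]
  show ?case using cl by (simp add: ar N.M.a_comm)
next
  case (add_zero u)
  interpret N: dg_space "Sp Q (bv_arity u)" by (rule Q.space) (use P.bv_arity_pos add_zero in auto)
  show ?case using add_zero ev_closed[of u] P.bv_arity_pos[of u] by (simp add: f_zero)
next
  case (add_neg u)
  interpret N: dg_space "Sp Q (bv_arity u)" by (rule Q.space) (use P.bv_arity_pos add_neg in auto)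
  show ?case using add_neg ev_closed[of u] P.bv_arity_pos[of u] by (simp add: f_zero N.add_minus_scale)
next
  case (scale_add u v c)
  define n where "n = bv_arity u"
  have wf: "bv_wf P u" "bv_wf P v" and ar: "bv_arity u = n" "bv_arity v = n" using scale_add by (auto simp: n_def)
  interpret N: dg_space "Sp Q n" by (rule Q.space) (use P.bv_arity_pos[OF wf(1)] ar in simp)
  note cl = ev_closed[OF wf(1), unfolded ar] ev_closed[OF wf(2), unfolded ar]
  show ?case using cl by (simp add: ar N.scale_right_distrib)
next
  case (add_scale u a b)
  interpret N: dg_space "Sp Q (bv_arity u)" by (rule Q.space) (use P.bv_arity_pos add_scale in auto)
  show ?case using add_scale ev_closed[of u] by (simp add: N.scale_left_distrib)
next
  case (scale_scale u a b)
  interpret N: dg_space "Sp Q (bv_arity u)" by (rule Q.space) (use P.bv_arity_pos scale_scale in auto)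
  show ?case using scale_scale ev_closed[of u] by (simp add: N.scale_scale)
next
  case (scale_one u)
  interpret N: dg_space "Sp Q (bv_arity u)" by (rule Q.space) (use P.bv_arity_pos scale_one in auto)
  show ?case using scale_one ev_closed[of u] by simp
next
  case (act_add u v \<sigma>)
  define n where "n = bv_arity u"
  have wf: "bv_wf P u" "bv_wf P v" and ar: "bv_arity u = n" "bv_arity v = n" using act_add by (auto simp: n_def)
  interpret N: dg_space "Sp Q n" by (rule Q.space) (use P.bv_arity_pos[OF wf(1)] ar in simp)
  note cl = ev_closed[OF wf(1), unfolded ar] ev_closed[OF wf(2), unfolded ar]
  have "n \<ge> 1" "\<sigma> permutes {1..n}" using P.bv_arity_pos[OF wf(1)] act_add ar by simp_all
  then show ?case using cl by (simp add: ar Q.act_add)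
next
  case (act_scale u \<sigma> c)
  then show ?case using P.bv_arity_pos[of u] ev_closed[of u] by (simp add: Q.act_scale)
next
  case (act_id u)
  then show ?case using P.bv_arity_pos[of u] ev_closed[of u] by (simp add: Q.act_id)
next
  case (act_act u \<sigma> \<tau>)
  then show ?case using P.bv_arity_pos[of u] ev_closed[of u] by (simp add: Q.act_act)
next
  case (comp_add_left u v i w)
  define n where "n = bv_arity u"
  have wf: "bv_wf P u" "bv_wf P v" and ar: "bv_arity u = n" "bv_arity v = n" using comp_add_left by (auto simp: n_def)
  interpret N: dg_space "Sp Q n" by (rule Q.space) (use P.bv_arity_pos[OF wf(1)] ar in simp)
  note cl = ev_closed[OF wf(1), unfolded ar] ev_closed[OF wf(2), unfolded ar]
  have "i \<in> {1..n}" "bv_wf P w" using comp_add_left ar by simp_all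
  then show ?case using cl ev_closed[of w] P.bv_arity_pos[of w] by (simp add: ar Q.pcomp_add_left)
next
  case (comp_scale_left u i v c)
  then show ?case using P.bv_arity_pos[of v] ev_closed[of u] ev_closed[of v] by (simp add: Q.pcomp_scale_left)
next
  case (comp_add_right u i v w)
  define n where "n = bv_arity v"
  have wf: "bv_wf P u" "bv_wf P v" "bv_wf P w" and ar: "bv_arity v = n" "bv_arity w = n" and i: "i \<in> {1..bv_arity u}"
    using comp_add_right by (auto simp: n_def)
  show ?case
    using i ev_closed[OF wf(1)] ev_closed[OF wf(2), unfolded ar] ev_closed[OF wf(3), unfolded ar] P.bv_arity_pos[OF wf(2), unfolded ar]
    by (simp add: ar Q.pcomp_add_right)
next
  case (comp_scale_right u i v c)
  then show ?case using P.bv_arity_pos[of v] ev_closed[of u] ev_closed[of v] by (simp add: Q.pcomp_scale_right)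
next
  case (comp_sequential u i v j w)
  then show ?case
    using P.bv_arity_pos[of w] ev_closed[of u] ev_closed[of v] ev_closed[of w]
      Q.pcomp_sequential[of "bv_arity w" i "bv_arity u" j "bv_arity v" "ev u" "ev v" "ev w"] by simp
next
  case (comp_parallel u v w i j p q)
  note pos = P.bv_arity_pos[of v] P.bv_arity_pos[of w]
  have h: "hcomp (Sp Q (bv_arity v)) p (ev v) \<in> homogeneous (Sp Q (bv_arity v)) p"
    "hcomp (Sp Q (bv_arity w)) q (ev w) \<in> homogeneous (Sp Q (bv_arity w)) q"
    using comp_parallel pos by (auto intro!: dg_space.homogeneousI[OF Q.space] ev_closed)
  have ar: "bv_arity u + bv_arity w - 1 + bv_arity v - 1 = bv_arity u + bv_arity v + bv_arity w - 2"
    using comp_parallel pos by auto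
  show ?case
    using comp_parallel pos ar ev_closed[of u]
      Q.pcomp_parallel[of "bv_arity v" "bv_arity w" i j "bv_arity u" "ev u" _ p _ q, OF _ _ _ _ _ _ h]
    by (simp add: P.bv_hcomp_wf ev_hcomp)
next
  case (comp_outer u \<sigma> i v)
  then show ?case
    using P.bv_arity_pos[of v] ev_closed[of u] ev_closed[of v]
    by (simp add: Q.pcomp_outer[of "bv_arity v" i "bv_arity u" \<sigma>])
next
  case (comp_inner u i v \<tau>)
  then show ?case
    using P.bv_arity_pos[of v] ev_closed[of u] ev_closed[of v]
    by (simp add: Q.pcomp_inner[of "bv_arity v" i "bv_arity u" \<tau>])
next
  case (unit_left u)
  then show ?case using P.bv_arity_pos[of u] ev_closed[of u] by (simp add: f_unit Q.unit_left)
next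
  case (unit_right u i)
  then show ?case using ev_closed[of u] by (simp add: f_unit Q.unit_right)
next
  case (gen_add n x y) then show ?case by (simp add: f_add)
next
  case (gen_scale n x c) then show ?case by (simp add: f_scale)
next
  case (gen_act n x \<sigma>) then show ?case by (simp add: f_act)
next
  case (gen_comp n i m x y) then show ?case by (simp add: f_pcomp)
next
  case rel_ss show ?case by (simp add: ss f_zero)
next
  case rel_tt show ?case by (simp add: tt)
next
  case rel_st show ?case by (simp add: st f_zero)
next
  case rel_ts show ?case by (simp add: ts f_zero)
next
  case (cong_add u u' v v')
  then show ?case using P.bv_eq_wf by simp
next
  case (cong_scale u u' c)
  then show ?case using P.bv_eq_wf by simp
next
  case (cong_act u u' \<sigma>)
  then show ?case using P.bv_eq_wf by simp
next
  case (cong_comp u u' v v' i)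
  then show ?case using P.bv_eq_wf by simp
qed simp_all

lemma bv_extend_class:
  assumes "bv_wf P u" "v \<in> bv_class P u"
  shows "bv_extend Q f s t n (bv_class P u) = ev v"
proof -
  have "ev ` bv_class P u = {ev v}"
    using assms ev_bv_eq by (auto simp: bv_class_def image_iff) (metis ev_bv_eq)+
  then show ?thesis by (simp add: bv_extend_def)
qed

text \<open>
  The evaluation of $\mathsf{BV}$ composed with a map $k$ into $\mathsf{bv}$. The unit goes to the idempotent \<open>t\<close>, so
  the target is \<open>Q\<close> with \<open>t\<close> as its unit; this need not be a dg operad, but maps into it still make sense.
\<close>

lemma operad_map_splitting:
  assumes k: "operad_map P (bv P) k"
  shows "operad_map P (Q\<lparr>ounit := t\<rparr>) (\<lambda>n x. bv_extend Q f s t n (k n x))"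
proof -
  have k_class: "\<exists>u. bv_wf P u \<and> bv_arity u = n \<and> k n x = bv_class P u"
    if n: "n \<ge> 1" and x: "x \<in> carrier (Sp P n)" for n x
  proof -
    have "k n x \<in> carrier (Sp (bv P) n)"
      using k n x by (auto simp: operad_map_def dest: linear_mapD(1))
    then show ?thesis using P.bv_carrier_class[OF n] by blast
  qed
  have val: "bv_extend Q f s t n (k n x) = ev v" if "n \<ge> 1" "x \<in> carrier (Sp P n)" "v \<in> k n x" for n x v
    using k_class[OF that(1,2)] that(3) bv_extend_class by auto
  note kD = k[unfolded operad_map_def P.bv_simps]
  show ?thesis
    unfolding operad_map_def
  proof (intro conjI allI impI ballI)
    fix n :: nat assume n: "1 \<le> n"
    interpret N: dg_space "Sp P n" by (rule P.space[OF n])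
    show "linear_map (Sp P n) (Sp (Q\<lparr>ounit := t\<rparr>) n) (\<lambda>x. bv_extend Q f s t n (k n x))"
      unfolding linear_map_def
    proof (intro conjI ballI allI)
      show "(\<lambda>x. bv_extend Q f s t n (k n x)) \<in> carrier (Sp P n) \<rightarrow> carrier (Sp (Q\<lparr>ounit := t\<rparr>) n)"
      proof
        fix x assume x: "x \<in> carrier (Sp P n)"
        obtain u where u: "bv_wf P u" "bv_arity u = n" "k n x = bv_class P u" using k_class[OF n x] by blast
        show "bv_extend Q f s t n (k n x) \<in> carrier (Sp (Q\<lparr>ounit := t\<rparr>) n)"
          using val[OF n x, of u] u ev_closed[OF u(1)] P.bv_class_self[OF u(1)] by simp
      qed
    next
      fix x y assume x: "x \<in> carrier (Sp P n)" and y: "y \<in> carrier (Sp P n)"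
      obtain u where u: "bv_wf P u" "bv_arity u = n" "k n x = bv_class P u" using k_class[OF n x] by blast
      obtain v where v: "bv_wf P v" "bv_arity v = n" "k n y = bv_class P v" using k_class[OF n y] by blast
      have "k n (x \<oplus>\<^bsub>Sp P n\<^esub> y) = (\<Union>u\<in>k n x. \<Union>v\<in>k n y. bv_class P (Add u v))"
        using kD n x y by (auto simp: linear_map_def P.bv_simps P.BV_simps)
      moreover have "Add u v \<in> bv_class P (Add u v)" using u v by (intro P.bv_class_self) simp
      ultimately have "Add u v \<in> k n (x \<oplus>\<^bsub>Sp P n\<^esub> y)"
        using u v P.bv_class_self[of u] P.bv_class_self[of v] by blast
      then show "bv_extend Q f s t n (k n (x \<oplus>\<^bsub>Sp P n\<^esub> y)) =
          bv_extend Q f s t n (k n x) \<oplus>\<^bsub>Sp (Q\<lparr>ounit := t\<rparr>) n\<^esub> bv_extend Q f s t n (k n y)"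
        using val[OF n _ , of "x \<oplus>\<^bsub>Sp P n\<^esub> y" "Add u v"] val[OF n x, of u] val[OF n y, of v] x y u v
          P.bv_class_self[of u] P.bv_class_self[of v] by simp
    next
      fix c x assume x: "x \<in> carrier (Sp P n)"
      obtain u where u: "bv_wf P u" "bv_arity u = n" "k n x = bv_class P u" using k_class[OF n x] by blast
      have "k n (c \<odot>\<^bsub>Sp P n\<^esub> x) = (\<Union>u\<in>k n x. bv_class P (Scale c u))"
        using kD n x by (auto simp: linear_map_def P.bv_simps P.BV_simps)
      moreover have "Scale c u \<in> bv_class P (Scale c u)" using u by (intro P.bv_class_self) simp
      ultimately have "Scale c u \<in> k n (c \<odot>\<^bsub>Sp P n\<^esub> x)"
        using u P.bv_class_self[of u] by blast
      then show "bv_extend Q f s t n (k n (c \<odot>\<^bsub>Sp P n\<^esub> x)) =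
          c \<odot>\<^bsub>Sp (Q\<lparr>ounit := t\<rparr>) n\<^esub> bv_extend Q f s t n (k n x)"
        using val[OF n _ , of "c \<odot>\<^bsub>Sp P n\<^esub> x" "Scale c u"] val[OF n x, of u] x u
          P.bv_class_self[of u] by simp
    qed
  next
    fix n :: nat and x and p :: bit assume n: "1 \<le> n" and x: "x \<in> carrier (Sp P n)"
    interpret N: dg_space "Sp P n" by (rule P.space[OF n])
    obtain u where u: "bv_wf P u" "bv_arity u = n" "k n x = bv_class P u" using k_class[OF n x] by blast
    note ux = P.bv_class_self[OF u(1)]
    have "k n (hcomp (Sp P n) p x) = (\<Union>u\<in>k n x. bv_class P (bv_hcomp P p u))"
      using kD n x by (auto simp: P.bv_simps P.BV_simps)
    moreover have "bv_hcomp P p u \<in> bv_class P (bv_hcomp P p u)" using P.bv_hcomp_wf[OF u(1)] by (intro P.bv_class_self) simp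
    ultimately have "bv_hcomp P p u \<in> k n (hcomp (Sp P n) p x)" using u ux by blast
    then show "bv_extend Q f s t n (k n (hcomp (Sp P n) p x)) =
        hcomp (Sp (Q\<lparr>ounit := t\<rparr>) n) p (bv_extend Q f s t n (k n x))"
      using val[OF n _, of "hcomp (Sp P n) p x"] val[OF n x, of u] x u ux by (simp add: ev_hcomp)
    have "k n (dif (Sp P n) x) = (\<Union>u\<in>k n x. bv_class P (bv_dif P u))"
      using kD n x by (auto simp: P.bv_simps P.BV_simps)
    moreover have "bv_dif P u \<in> bv_class P (bv_dif P u)" using P.bv_dif_wf[OF u(1)] by (intro P.bv_class_self) simp
    ultimately have "bv_dif P u \<in> k n (dif (Sp P n) x)" using u ux by blast
    then show "bv_extend Q f s t n (k n (dif (Sp P n) x)) =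
        dif (Sp (Q\<lparr>ounit := t\<rparr>) n) (bv_extend Q f s t n (k n x))"
      using val[OF n _, of "dif (Sp P n) x"] val[OF n x, of u] x u ux by (simp add: ev_dif)
    fix \<sigma> assume \<sigma>: "\<sigma> permutes {1..n}"
    have "k n (act P n x \<sigma>) = (\<Union>u\<in>k n x. bv_class P (Act u \<sigma>))"
      using kD n x \<sigma> by (auto simp: P.bv_simps P.BV_simps)
    moreover have "Act u \<sigma> \<in> bv_class P (Act u \<sigma>)" using u \<sigma> by (intro P.bv_class_self) simp
    ultimately have "Act u \<sigma> \<in> k n (act P n x \<sigma>)" using u ux by blast
    then show "bv_extend Q f s t n (k n (act P n x \<sigma>)) =
        act (Q\<lparr>ounit := t\<rparr>) n (bv_extend Q f s t n (k n x)) \<sigma>"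
      using val[OF n _, of "act P n x \<sigma>"] val[OF n x, of u] x u ux \<sigma> n by simp
  next
    fix m n :: nat and i x y assume m: "1 \<le> m" and n: "1 \<le> n" and i: "i \<in> {1..m}"
      and x: "x \<in> carrier (Sp P m)" and y: "y \<in> carrier (Sp P n)"
    obtain u where u: "bv_wf P u" "bv_arity u = m" "k m x = bv_class P u" using k_class[OF m x] by blast
    obtain v where v: "bv_wf P v" "bv_arity v = n" "k n y = bv_class P v" using k_class[OF n y] by blast
    have "k (m + n - 1) (pcomp P m n i x y) = (\<Union>u\<in>k m x. \<Union>v\<in>k n y. bv_class P (Comp u i v))"
      using kD m n i x y by (auto simp: P.bv_simps P.BV_simps)
    moreover have "Comp u i v \<in> bv_class P (Comp u i v)" using u v i by (intro P.bv_class_self) simp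
    ultimately have mem: "Comp u i v \<in> k (m + n - 1) (pcomp P m n i x y)"
      using u v P.bv_class_self[of u] P.bv_class_self[of v] by blast
    have "bv_extend Q f s t (m + n - 1) (k (m + n - 1) (pcomp P m n i x y)) = ev (Comp u i v)"
      by (rule val[OF _ P.pcomp_closed[OF n i x y] mem]) (use m n in auto)
    then show "bv_extend Q f s t (m + n - 1) (k (m + n - 1) (pcomp P m n i x y)) =
        pcomp (Q\<lparr>ounit := t\<rparr>) m n i (bv_extend Q f s t m (k m x)) (bv_extend Q f s t n (k n y))"
      using val[OF m x, of u] val[OF n y, of v] u v P.bv_class_self[of u] P.bv_class_self[of v] by simp
  next
    have "k 1 (ounit P) = BV_t P" using kD by auto
    then show "bv_extend Q f s t 1 (k 1 (ounit P)) = ounit (Q\<lparr>ounit := t\<rparr>)"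
      using bv_extend_class[of GenT GenT 1] P.bv_class_self[of GenT] by simp
  qed
qed

end

section \<open>Conjugation of operations by unary operations\<close>

lemma slots_eq [simp]: "{1..<n + 1} = {1..n :: nat}"
  by auto

context dg_operad
begin

text \<open>
  An operation with \<open>b\<close> inserted into the slots listed in \<open>js\<close>, one after the other.
\<close>

definition precomp :: "nat \<Rightarrow> 'a \<Rightarrow> nat list \<Rightarrow> 'a \<Rightarrow> 'a" where
  "precomp n b js x = fold (\<lambda>j y. pcomp P n 1 j y b) js x"

lemma precomp_simps [simp]:
  "precomp n b [] x = x" "precomp n b (j # js) x = precomp n b js (pcomp P n 1 j x b)"
  "precomp n b (js @ js') x = precomp n b js' (precomp n b js x)"
  by (simp_all add: precomp_def)

lemma unary_comp_closed:
  assumes "b \<in> carrier (Sp P 1)" "j \<in> {1..n}" "x \<in> carrier (Sp P n)"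
  shows "pcomp P n 1 j x b \<in> carrier (Sp P n)"
  using pcomp_closed[of 1 j n x b] assms by simp

lemma unary_comp_left_closed:
  assumes "a \<in> carrier (Sp P 1)" "n \<ge> 1" "x \<in> carrier (Sp P n)"
  shows "pcomp P 1 n 1 a x \<in> carrier (Sp P n)"
  using pcomp_closed[of n 1 1 a x] assms by simp

lemma precomp_closed:
  assumes b: "b \<in> carrier (Sp P 1)" and "set js \<subseteq> {1..n}" "x \<in> carrier (Sp P n)"
  shows "precomp n b js x \<in> carrier (Sp P n)"
  using assms(2,3) by (induction js arbitrary: x) (simp_all add: unary_comp_closed[OF b])

lemma even_closed: "b \<in> homogeneous (Sp P 1) 0 \<Longrightarrow> b \<in> carrier (Sp P 1)"
  by (simp add: homogeneous_def)

text \<open>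
  An even unary operation commutes without signs with insertions into the other slots.
\<close>

lemma even_comp_parallel:
  assumes b: "b \<in> homogeneous (Sp P 1) 0" and n: "n \<ge> 1" and ij: "1 \<le> i" "i < j" "j \<le> m"
    and x: "x \<in> carrier (Sp P m)" and y: "y \<in> carrier (Sp P n)"
  shows "pcomp P m n j (pcomp P m 1 i x b) y = pcomp P (m + n - 1) 1 i (pcomp P m n j x y) b"
    and "pcomp P m n i (pcomp P m 1 j x b) y = pcomp P (m + n - 1) 1 (j + n - 1) (pcomp P m n i x y) b"
proof -
  have i: "i \<in> {1..m}" and j: "j \<in> {1..m}" and mn: "m + n - 1 \<ge> 1"
    and i': "i \<in> {1..m + n - 1}" and j': "j + n - 1 \<in> {1..m + n - 1}" using ij n by auto
  note bc = even_closed[OF b]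
  interpret N: dg_space "Sp P n" by (rule space[OF n])
  interpret L: dg_space "Sp P (m + n - 1)" by (rule space[OF mn])
  have c: "pcomp P m 1 k x b \<in> carrier (Sp P m)" if "k \<in> {1..m}" for k
    by (rule unary_comp_closed[OF bc that x])
  have pc: "pcomp P m n k x y \<in> carrier (Sp P (m + n - 1))" if "k \<in> {1..m}" "y \<in> carrier (Sp P n)" for k y
    by (rule pcomp_closed[OF n that(1) x that(2)])
  have uc: "pcomp P (m + n - 1) 1 k z b \<in> carrier (Sp P (m + n - 1))"
    if "k \<in> {1..m + n - 1}" "z \<in> carrier (Sp P (m + n - 1))" for k z
    by (rule unary_comp_closed[OF bc that])
  have add: "pcomp P (m + n - 1) 1 k (z \<oplus>\<^bsub>Sp P (m + n - 1)\<^esub> z') b =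
      pcomp P (m + n - 1) 1 k z b \<oplus>\<^bsub>Sp P (m + n - 1)\<^esub> pcomp P (m + n - 1) 1 k z' b"
    if "k \<in> {1..m + n - 1}" "z \<in> carrier (Sp P (m + n - 1))" "z' \<in> carrier (Sp P (m + n - 1))" for k z z'
    using pcomp_add_left[OF _ that(1) bc that(2,3)] by simp
  show "pcomp P m n j (pcomp P m 1 i x b) y = pcomp P (m + n - 1) 1 i (pcomp P m n j x y) b"
    using y
  proof (induction rule: N.homogeneous_induct)
    case (homogeneous q y)
    have e: "m + 1 + n - 2 = m + n - 1" by arith
    have "pcomp P m n j (pcomp P m 1 i x b) y = ksign 0 q \<odot>\<^bsub>Sp P (m + 1 + n - 2)\<^esub> pcomp P (m + n - 1) 1 i (pcomp P m n j x y) b"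
      using pcomp_parallel[OF _ n ij x b homogeneous] by simp
    then show ?case
      unfolding e using uc[OF i' pc[OF j N.homogeneousD[OF homogeneous]]] by simp
  next
    case (add y z)
    then show ?case using pc[OF j] c[OF i] i' by (simp add: pcomp_add_right[OF n j] x \<open>\<And>k z z'. _ \<Longrightarrow> _ \<Longrightarrow> _ \<Longrightarrow> pcomp P (m + n - 1) 1 k (z \<oplus>\<^bsub>Sp P (m + n - 1)\<^esub> z') b = _\<close>)
  qed
  show "pcomp P m n i (pcomp P m 1 j x b) y = pcomp P (m + n - 1) 1 (j + n - 1) (pcomp P m n i x y) b"
    using y
  proof (induction rule: N.homogeneous_induct)
    case (homogeneous q y)
    have e: "m + n + 1 - 2 = m + n - 1" by arith
    have "pcomp P (m + n - 1) 1 (j + n - 1) (pcomp P m n i x y) b =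
        ksign q 0 \<odot>\<^bsub>Sp P (m + n + 1 - 2)\<^esub> pcomp P m n i (pcomp P m 1 j x b) y"
      using pcomp_parallel[OF n _ ij x homogeneous b] by simp
    then show ?case
      unfolding e using pcomp_closed[OF n i c[OF j] N.homogeneousD[OF homogeneous]] by simp
  next
    case (add y z)
    then show ?case using pc[OF i] c[OF j] j' by (simp add: pcomp_add_right[OF n i] x \<open>\<And>k z z'. _ \<Longrightarrow> _ \<Longrightarrow> _ \<Longrightarrow> pcomp P (m + n - 1) 1 k (z \<oplus>\<^bsub>Sp P (m + n - 1)\<^esub> z') b = _\<close>)
  qed
qed

lemma precomp_mset_cong:
  assumes b: "b \<in> homogeneous (Sp P 1) 0" and ms: "mset js = mset js'" and js: "set js \<subseteq> {1..n}"
    and x: "x \<in> carrier (Sp P n)"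
  shows "precomp n b js x = precomp n b js' x"
proof -
  note bc = even_closed[OF b]
  define \<rho> where "\<rho> = (\<lambda>j y. if j \<in> {1..n} \<and> y \<in> carrier (Sp P n) then pcomp P n 1 j y b else y)"
  have eq: "precomp n b ks y = fold \<rho> ks y" if "set ks \<subseteq> {1..n}" "y \<in> carrier (Sp P n)" for ks y
    using that by (induction ks arbitrary: y) (auto simp: \<rho>_def unary_comp_closed[OF bc])
  have comm: "pcomp P n 1 j (pcomp P n 1 i y b) b = pcomp P n 1 i (pcomp P n 1 j y b) b"
    if "1 \<le> i" "i < j" "j \<le> n" "y \<in> carrier (Sp P n)" for i j y
    using even_comp_parallel(1)[OF b _ that(1-3) that(4) bc] by simp
  have "\<rho> i \<circ> \<rho> j = \<rho> j \<circ> \<rho> i" for i j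
  proof
    fix y
    show "(\<rho> i \<circ> \<rho> j) y = (\<rho> j \<circ> \<rho> i) y"
      using comm[of i j y] comm[of j i y]
      by (cases i j rule: linorder_cases) (auto simp: \<rho>_def unary_comp_closed[OF bc])
  qed
  then have "fold \<rho> js = fold \<rho> js'" using ms by (intro fold_multiset_equiv) auto
  moreover have "set js' \<subseteq> {1..n}" using js mset_eq_setD[OF ms] by simp
  ultimately show ?thesis using eq js x by simp
qed

lemma outer_perm_1: "outer_perm 1 i \<sigma> = \<sigma>"
  by (auto simp: fun_eq_iff outer_perm_def Let_def One_nat_def less_Suc_eq)

lemma precomp_act:
  assumes b: "b \<in> carrier (Sp P 1)" and n: "n \<ge> 1" and \<sigma>: "\<sigma> permutes {1..n}"
    and "set js \<subseteq> {1..n}" "x \<in> carrier (Sp P n)"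
  shows "precomp n b js (act P n x \<sigma>) = act P n (precomp n b (map \<sigma> js) x) \<sigma>"
  using assms(4,5)
proof (induction js arbitrary: x)
  case (Cons j js)
  have "\<sigma> j \<in> {1..n}" using permutes_leD[OF \<sigma>, of j] Cons by auto
  then have c: "pcomp P n 1 (\<sigma> j) x b \<in> carrier (Sp P n)" using Cons by (intro unary_comp_closed[OF b]) auto
  have "pcomp P n 1 j (act P n x \<sigma>) b = act P n (pcomp P n 1 (\<sigma> j) x b) \<sigma>"
    using pcomp_outer[of 1 j n \<sigma> x b] Cons b \<sigma> by (simp add: outer_perm_1)
  then show ?case using Cons c by simp
qed simp

text \<open>
  The operation $a \circ x \circ b^{\otimes n}$.
\<close>

definition conj_by :: "nat \<Rightarrow> 'a \<Rightarrow> 'a \<Rightarrow> 'a \<Rightarrow> 'a" where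
  "conj_by n a b x = precomp n b [1..<n + 1] (pcomp P 1 n 1 a x)"

lemma conj_by_closed:
  assumes "a \<in> carrier (Sp P 1)" "b \<in> carrier (Sp P 1)" "n \<ge> 1" "x \<in> carrier (Sp P n)"
  shows "conj_by n a b x \<in> carrier (Sp P n)"
  unfolding conj_by_def by (intro precomp_closed unary_comp_left_closed) (use assms in auto)

lemma mset_map_permutes: "\<sigma> permutes {1..n} \<Longrightarrow> mset (map \<sigma> [1..<n + 1]) = mset [1..<n + 1]"
proof -
  assume \<sigma>: "\<sigma> permutes {1..n}"
  have "set (map \<sigma> [1..<n + 1]) = set [1..<n + 1]"
    using permutes_image[OF \<sigma>] by (simp del: upt_Suc)
  moreover have "distinct (map \<sigma> [1..<n + 1])"
    using inj_on_subset[OF permutes_inj[OF \<sigma>], of "set [1..<n + 1]"] by (simp add: distinct_map del: upt_Suc)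
  ultimately show ?thesis
    using set_eq_iff_mset_eq_distinct[of "map \<sigma> [1..<n + 1]" "[1..<n + 1]"] by (simp del: upt_Suc)
qed

lemma inner_perm_1: "\<sigma> permutes {1..n} \<Longrightarrow> inner_perm n 1 \<sigma> = \<sigma>"
  using permutes_not_in[of \<sigma> "{1..n}"] by (fastforce simp: fun_eq_iff inner_perm_def)

lemma conj_by_act:
  assumes a: "a \<in> carrier (Sp P 1)" and b: "b \<in> homogeneous (Sp P 1) 0" and n: "n \<ge> 1"
    and \<sigma>: "\<sigma> permutes {1..n}" and x: "x \<in> carrier (Sp P n)"
  shows "conj_by n a b (act P n x \<sigma>) = act P n (conj_by n a b x) \<sigma>"
proof -
  have "pcomp P 1 n 1 a (act P n x \<sigma>) = act P n (pcomp P 1 n 1 a x) \<sigma>"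
    using pcomp_inner[of n 1 1 \<sigma> a x] n \<sigma> a x by (simp add: inner_perm_1)
  moreover have "precomp n b (map \<sigma> [1..<n + 1]) (pcomp P 1 n 1 a x) = precomp n b [1..<n + 1] (pcomp P 1 n 1 a x)"
  proof (rule precomp_mset_cong[OF b mset_map_permutes[OF \<sigma>] _ unary_comp_left_closed[OF a n x]])
    show "set (map \<sigma> [1..<n + 1]) \<subseteq> {1..n}" using permutes_leD[OF \<sigma>] by auto
  qed
  ultimately show ?thesis
    unfolding conj_by_def
    by (simp add: precomp_act[OF even_closed[OF b] n \<sigma> _ unary_comp_left_closed[OF a n x]] del: upt_Suc)
qed

lemma precomp_hcomp:
  assumes b: "b \<in> homogeneous (Sp P 1) 0" and n: "n \<ge> 1" and "set js \<subseteq> {1..n}" "x \<in> carrier (Sp P n)"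
  shows "precomp n b js (hcomp (Sp P n) p x) = hcomp (Sp P n) p (precomp n b js x)"
  using assms(3,4)
proof (induction js arbitrary: x)
  case (Cons j js)
  interpret N: dg_space "Sp P n" by (rule space[OF n])
  interpret U: dg_space "Sp P 1" by (rule space) simp
  note bc = even_closed[OF b]
  have j: "j \<in> {1..n}" using Cons by auto
  have c: "pcomp P n 1 j y b \<in> carrier (Sp P n)" if "y \<in> carrier (Sp P n)" for y
    by (rule unary_comp_closed[OF bc j that])
  have "hcomp (Sp P n) p (pcomp P n 1 j x b) = pcomp P n 1 j (hcomp (Sp P n) p x) b"
    using hcomp_pcomp[of 1 j n x b p] pcomp_zero_right[of 1 j n] bit_cases[of p] j Cons.prems bc c
    by (auto simp: U.hcomp_homogeneous[OF b])
  then show ?case using Cons.IH[OF _ c[OF Cons.prems(2)]] Cons.prems by simp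
qed simp

lemma precomp_dif:
  assumes b: "b \<in> carrier (Sp P 1)" "dif (Sp P 1) b = \<zero>\<^bsub>Sp P 1\<^esub>" and n: "n \<ge> 1" and "set js \<subseteq> {1..n}" "x \<in> carrier (Sp P n)"
  shows "precomp n b js (dif (Sp P n) x) = dif (Sp P n) (precomp n b js x)"
  using assms(4,5)
proof (induction js arbitrary: x)
  case (Cons j js)
  interpret N: dg_space "Sp P n" by (rule space[OF n])
  have j: "j \<in> {1..n}" using Cons by auto
  have c: "pcomp P n 1 j y b \<in> carrier (Sp P n)" if "y \<in> carrier (Sp P n)" for y
    by (rule unary_comp_closed[OF b(1) j that])
  have "dif (Sp P n) (pcomp P n 1 j x b) = pcomp P n 1 j (dif (Sp P n) x) b"
    using pcomp_dif[of 1 j n x b] pcomp_zero_right[of 1 j n] j Cons.prems b c by simp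
  then show ?case using Cons.IH[OF _ c[OF Cons.prems(2)]] Cons.prems by simp
qed simp

lemma linear_map_precomp:
  assumes b: "b \<in> carrier (Sp P 1)" and "set js \<subseteq> {1..n}"
  shows "linear_map (Sp P n) (Sp P n) (precomp n b js)"
  using assms(2)
proof (induction js)
  case Nil
  then show ?case by (simp add: linear_map_def)
next
  case (Cons j js)
  have "linear_map (Sp P n) (Sp P n) (\<lambda>x. pcomp P n 1 j x b)"
    using pcomp_linear_left[of 1 j n b] Cons b by simp
  from linear_map_comp[OF this Cons.IH] Cons.prems
  have "linear_map (Sp P n) (Sp P n) (\<lambda>x. precomp n b js (pcomp P n 1 j x b))" by simp
  moreover have "precomp n b (j # js) = (\<lambda>x. precomp n b js (pcomp P n 1 j x b))" by (intro ext) simp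
  ultimately show ?case by simp
qed

lemma linear_map_conj_by:
  assumes "a \<in> carrier (Sp P 1)" "b \<in> carrier (Sp P 1)" "n \<ge> 1"
  shows "linear_map (Sp P n) (Sp P n) (conj_by n a b)"
  unfolding conj_by_def[abs_def]
  by (rule linear_map_comp[OF _ linear_map_precomp[OF assms(2)]]) (use pcomp_linear_right[of n 1 1 a] assms in auto)

lemma conj_by_hcomp:
  assumes a: "a \<in> homogeneous (Sp P 1) 0" and b: "b \<in> homogeneous (Sp P 1) 0" and n: "n \<ge> 1" and x: "x \<in> carrier (Sp P n)"
  shows "conj_by n a b (hcomp (Sp P n) p x) = hcomp (Sp P n) p (conj_by n a b x)"
proof -
  interpret N: dg_space "Sp P n" by (rule space[OF n])
  interpret U: dg_space "Sp P 1" by (rule space) simp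
  note ac = even_closed[OF a]
  have "hcomp (Sp P n) p (pcomp P 1 n 1 a x) = pcomp P 1 n 1 a (hcomp (Sp P n) p x)"
    using hcomp_pcomp[of n 1 1 a x p] pcomp_zero_left[of n 1 1] n x ac unary_comp_left_closed[OF ac n]
    by (simp add: U.hcomp_homogeneous[OF a])
  then show ?thesis
    unfolding conj_by_def using precomp_hcomp[OF b n, of "[1..<n + 1]" "pcomp P 1 n 1 a x" p] unary_comp_left_closed[OF ac n x]
    by (auto simp del: upt_Suc)
qed

lemma conj_by_dif:
  assumes a: "a \<in> homogeneous (Sp P 1) 0" "dif (Sp P 1) a = \<zero>\<^bsub>Sp P 1\<^esub>"
    and b: "b \<in> homogeneous (Sp P 1) 0" "dif (Sp P 1) b = \<zero>\<^bsub>Sp P 1\<^esub>" and n: "n \<ge> 1" and x: "x \<in> carrier (Sp P n)"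
  shows "conj_by n a b (dif (Sp P n) x) = dif (Sp P n) (conj_by n a b x)"
proof -
  interpret N: dg_space "Sp P n" by (rule space[OF n])
  interpret U: dg_space "Sp P 1" by (rule space) simp
  note ac = even_closed[OF a(1)]
  have "dif (Sp P n) (pcomp P 1 n 1 a x) = pcomp P 1 n 1 a (dif (Sp P n) x)"
    using pcomp_dif[of n 1 1 a x] pcomp_zero_left[of n 1 1] n x ac unary_comp_left_closed[OF ac n]
      U.gsign_homogeneous[OF a(1)] a(2) by simp
  then show ?thesis
    unfolding conj_by_def using precomp_dif[OF even_closed[OF b(1)] b(2) n, of "[1..<n + 1]" "pcomp P 1 n 1 a x"] unary_comp_left_closed[OF ac n x]
    by (auto simp del: upt_Suc)
qed

lemma unary_precomp:
  assumes a: "a \<in> carrier (Sp P 1)" and b: "b \<in> carrier (Sp P 1)" and n: "n \<ge> 1"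
    and "set js \<subseteq> {1..n}" "x \<in> carrier (Sp P n)"
  shows "pcomp P 1 n 1 a (precomp n b js x) = precomp n b js (pcomp P 1 n 1 a x)"
  using assms(4,5)
proof (induction js arbitrary: x)
  case (Cons j js)
  have j: "j \<in> {1..n}" using Cons by auto
  have "pcomp P 1 n 1 a (pcomp P n 1 j x b) = pcomp P n 1 j (pcomp P 1 n 1 a x) b"
    using pcomp_sequential[of 1 1 1 j n a x b] a b j Cons.prems by simp
  then show ?case using Cons unary_comp_closed[OF b j] by simp
qed simp

lemma pcomp_precomp_inner:
  assumes b: "b \<in> carrier (Sp P 1)" and n: "n \<ge> 1" and i: "i \<in> {1..m}" and x: "x \<in> carrier (Sp P m)"
    and "set js \<subseteq> {1..n}" "y \<in> carrier (Sp P n)"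
  shows "pcomp P m n i x (precomp n b js y) = precomp (m + n - 1) b (map (\<lambda>j. i + j - 1) js) (pcomp P m n i x y)"
  using assms(5,6)
proof (induction js arbitrary: y)
  case (Cons j js)
  have j: "j \<in> {1..n}" using Cons by auto
  have "pcomp P m n i x (pcomp P n 1 j y b) = pcomp P (m + n - 1) 1 (i + j - 1) (pcomp P m n i x y) b"
    using pcomp_sequential[of 1 i m j n x y b] b i j x Cons.prems by simp
  then show ?case using Cons unary_comp_closed[OF b j] by simp
qed simp

lemma pcomp_precomp_outer:
  assumes b: "b \<in> homogeneous (Sp P 1) 0" and n: "n \<ge> 1" and i: "i \<in> {1..m}" and y: "y \<in> carrier (Sp P n)"
    and "set js \<subseteq> {1..m} - {i}" "x \<in> carrier (Sp P m)"
  shows "pcomp P m n i (precomp m b js x) y =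
    precomp (m + n - 1) b (map (\<lambda>j. if j < i then j else j + n - 1) js) (pcomp P m n i x y)"
  using assms(5,6)
proof (induction js arbitrary: x)
  case (Cons j js)
  have j: "j \<in> {1..m}" "j \<noteq> i" using Cons by auto
  have "pcomp P m n i (pcomp P m 1 j x b) y =
      pcomp P (m + n - 1) 1 (if j < i then j else j + n - 1) (pcomp P m n i x y) b"
    using even_comp_parallel[OF b n _ _ _ _ y] j i Cons.prems by auto
  then show ?case using Cons unary_comp_closed[OF even_closed[OF b] j(1)] by simp
qed simp

text \<open>
  At the composed slot the factor $b a$ appears between \<open>x\<close> and \<open>y\<close>, and it acts as the identity on \<open>y\<close>
  by assumption. So conjugation preserves compositions, although it does not preserve units.
\<close>

lemma conj_by_pcomp:
  assumes a: "a \<in> carrier (Sp P 1)" and b: "b \<in> homogeneous (Sp P 1) 0"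
    and n: "n \<ge> 1" and i: "i \<in> {1..m}" and x: "x \<in> carrier (Sp P m)" and y: "y \<in> carrier (Sp P n)"
    and e: "pcomp P 1 n 1 (pcomp P 1 1 1 b a) y = y"
  shows "pcomp P m n i (conj_by m a b x) (conj_by n a b y) = conj_by (m + n - 1) a b (pcomp P m n i x y)"
proof -
  have m: "m \<ge> 1" using i by auto
  note bc = even_closed[OF b]
  let ?ax = "pcomp P 1 m 1 a x" and ?ay = "pcomp P 1 n 1 a y" and ?N = "m + n - 1"
  have ax: "?ax \<in> carrier (Sp P m)" and ay: "?ay \<in> carrier (Sp P n)"
    using unary_comp_left_closed[OF a m x] unary_comp_left_closed[OF a n y] .
  define others where "others = filter (\<lambda>j. j \<noteq> i) [1..<m + 1]"
  have os: "set others \<subseteq> {1..m} - {i}" "set others = {1..m} - {i}" "distinct others"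
    unfolding others_def by (auto simp del: upt_Suc simp flip: slots_eq)
  have "set [1..<m + 1] = set (others @ [i])"
    unfolding set_append os(2) using i by (simp add: insert_absorb del: upt_Suc)
  moreover have "distinct (others @ [i])" using os(2,3) by simp
  ultimately have ms: "mset [1..<m + 1] = mset (others @ [i])"
    using set_eq_iff_mset_eq_distinct[of "[1..<m + 1]" "others @ [i]"] by (simp del: upt_Suc)
  have cx: "conj_by m a b x = pcomp P m 1 i (precomp m b others ?ax) b"
    unfolding conj_by_def using precomp_mset_cong[OF b ms _ ax] by (simp del: upt_Suc)
  have X': "precomp m b others ?ax \<in> carrier (Sp P m)" by (rule precomp_closed[OF bc _ ax]) (use os in auto)
  have cy: "conj_by n a b y \<in> carrier (Sp P n)" by (rule conj_by_closed[OF a bc n y])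
  have sl: "set [1..<n + 1] \<subseteq> {1..n}" by auto
  have "pcomp P 1 n 1 b ?ay = y"
    using pcomp_sequential[of n 1 1 1 1 b a y, unfolded add_diff_cancel_right' add_diff_cancel_left'] e n a bc y by simp
  then have bcy: "pcomp P 1 n 1 b (conj_by n a b y) = precomp n b [1..<n + 1] y"
    unfolding conj_by_def by (simp add: unary_precomp[OF bc bc n sl ay] del: upt_Suc)
  have "pcomp P m n i (conj_by m a b x) (conj_by n a b y) =
      pcomp P m n i (precomp m b others ?ax) (pcomp P 1 n 1 b (conj_by n a b y))"
    unfolding cx using pcomp_sequential[of n i m 1 1 "precomp m b others ?ax" b "conj_by n a b y"] n i X' bc cy by simp
  also have "\<dots> = precomp ?N b (map (\<lambda>j. i + j - 1) [1..<n + 1]) (pcomp P m n i (precomp m b others ?ax) y)"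
    unfolding bcy by (rule pcomp_precomp_inner[OF bc n i X' sl y])
  also have "pcomp P m n i (precomp m b others ?ax) y =
      precomp ?N b (map (\<lambda>j. if j < i then j else j + n - 1) others) (pcomp P m n i ?ax y)"
    by (rule pcomp_precomp_outer[OF b n i y os(1) ax])
  also have "pcomp P m n i ?ax y = pcomp P 1 ?N 1 a (pcomp P m n i x y)"
    using pcomp_sequential[of n 1 1 i m a x y] n i a x y by simp
  also have "precomp ?N b (map (\<lambda>j. i + j - 1) [1..<n + 1]) (precomp ?N b (map (\<lambda>j. if j < i then j else j + n - 1) others)
      (pcomp P 1 ?N 1 a (pcomp P m n i x y))) =
    precomp ?N b (map (\<lambda>j. if j < i then j else j + n - 1) others @ map (\<lambda>j. i + j - 1) [1..<n + 1])
      (pcomp P 1 ?N 1 a (pcomp P m n i x y))"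
    by simp
  also have "\<dots> = conj_by ?N a b (pcomp P m n i x y)"
    unfolding conj_by_def
  proof (rule precomp_mset_cong[OF b])
    let ?g = "\<lambda>j. if j < i then j else j + n - 1" and ?h = "\<lambda>j. i + j - 1"
    have h: "?h ` {1..n} = {i..<i + n}"
    proof (intro Set.set_eqI iffI)
      fix k assume "k \<in> {i..<i + n}"
      then have "k = ?h (k + 1 - i)" "k + 1 - i \<in> {1..n}" using i by auto
      then show "k \<in> ?h ` {1..n}" by blast
    qed (use i in auto)
    have g: "?g ` ({1..m} - {i}) = {1..<i} \<union> {i + n..?N}"
    proof (intro Set.set_eqI iffI)
      fix k assume k: "k \<in> {1..<i} \<union> {i + n..?N}"
      show "k \<in> ?g ` ({1..m} - {i})"
      proof (cases "k < i")
        case True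
        then have "k = ?g k" "k \<in> {1..m} - {i}" using k i by auto
        then show ?thesis by blast
      next
        case False
        then have "k = ?g (k + 1 - n)" "k + 1 - n \<in> {1..m} - {i}" using k i n by auto
        then show ?thesis by blast
      qed
    qed (use i n in auto)
    have "{1..<i} \<union> {i + n..?N} \<union> {i..<i + n} = {1..?N}" using i n by auto
    then have set: "set (map ?g others @ map ?h [1..<n + 1]) = set [1..<?N + 1]"
      unfolding set_append set_map os(2) using h g by (simp del: upt_Suc)
    have "inj_on ?g (set others)" unfolding os(2) using n by (auto simp: inj_on_def)
    moreover have "inj_on ?h {1..n}" using i by (auto simp: inj_on_def)
    ultimately have dist: "distinct (map ?g others @ map ?h [1..<n + 1])"
      using os(3) h g unfolding distinct_append distinct_map set_map os(2)
      by (auto simp del: upt_Suc)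
    show "mset (map ?g others @ map ?h [1..<n + 1]) = mset [1..<?N + 1]"
      using set dist set_eq_iff_mset_eq_distinct[of "map ?g others @ map ?h [1..<n + 1]" "[1..<?N + 1]"]
      by (simp del: upt_Suc)
    show "set (map ?g others @ map ?h [1..<n + 1]) \<subseteq> {1..?N}" unfolding set by (simp del: upt_Suc)
    show "pcomp P 1 ?N 1 a (pcomp P m n i x y) \<in> carrier (Sp P ?N)"
      by (rule unary_comp_left_closed[OF a _ pcomp_closed[OF n i x y]]) (use m n in auto)
  qed
  finally show ?thesis .
qed

end

section \<open>Perturbing a map of operads along a unary operation\<close>

context dg_operad
begin

abbreviation mul (infixl "**" 70) where "x ** y \<equiv> pcomp P 1 1 1 x y"

lemma one_arity: "1 + 1 - 1 = (1 :: nat)" by arith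

lemma mul_closed [simp, intro]: "x \<in> carrier (Sp P 1) \<Longrightarrow> y \<in> carrier (Sp P 1) \<Longrightarrow> x ** y \<in> carrier (Sp P 1)"
  by (rule unary_comp_left_closed) auto

lemma mul_assoc:
  "x \<in> carrier (Sp P 1) \<Longrightarrow> y \<in> carrier (Sp P 1) \<Longrightarrow> z \<in> carrier (Sp P 1) \<Longrightarrow> x ** y ** z = x ** (y ** z)"
  using pcomp_sequential[of 1 1 1 1 1 x y z, unfolded one_arity] by simp

lemma mul_add_left:
  "x \<in> carrier (Sp P 1) \<Longrightarrow> y \<in> carrier (Sp P 1) \<Longrightarrow> z \<in> carrier (Sp P 1) \<Longrightarrow>
    (x \<oplus>\<^bsub>Sp P 1\<^esub> y) ** z = x ** z \<oplus>\<^bsub>Sp P 1\<^esub> y ** z"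
  using pcomp_add_left[of 1 1 1 z x y, unfolded one_arity] by simp

lemma mul_add_right:
  "x \<in> carrier (Sp P 1) \<Longrightarrow> y \<in> carrier (Sp P 1) \<Longrightarrow> z \<in> carrier (Sp P 1) \<Longrightarrow>
    x ** (y \<oplus>\<^bsub>Sp P 1\<^esub> z) = x ** y \<oplus>\<^bsub>Sp P 1\<^esub> x ** z"
  using pcomp_add_right[of 1 1 1 x y z, unfolded one_arity] by simp

lemma mul_scale_left:
  "x \<in> carrier (Sp P 1) \<Longrightarrow> y \<in> carrier (Sp P 1) \<Longrightarrow> (c \<odot>\<^bsub>Sp P 1\<^esub> x) ** y = c \<odot>\<^bsub>Sp P 1\<^esub> (x ** y)"
  using pcomp_scale_left[of 1 1 1 y x c, unfolded one_arity] by simp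

lemma mul_scale_right:
  "x \<in> carrier (Sp P 1) \<Longrightarrow> y \<in> carrier (Sp P 1) \<Longrightarrow> x ** (c \<odot>\<^bsub>Sp P 1\<^esub> y) = c \<odot>\<^bsub>Sp P 1\<^esub> (x ** y)"
  using pcomp_scale_right[of 1 1 1 x y c, unfolded one_arity] by simp

lemma mul_zero: "x \<in> carrier (Sp P 1) \<Longrightarrow> \<zero>\<^bsub>Sp P 1\<^esub> ** x = \<zero>\<^bsub>Sp P 1\<^esub>"
  "x \<in> carrier (Sp P 1) \<Longrightarrow> x ** \<zero>\<^bsub>Sp P 1\<^esub> = \<zero>\<^bsub>Sp P 1\<^esub>"
  using pcomp_zero_left[of 1 1 1 x, unfolded one_arity] pcomp_zero_right[of 1 1 1 x, unfolded one_arity] by simp_all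

lemma mul_homogeneous:
  "x \<in> homogeneous (Sp P 1) p \<Longrightarrow> y \<in> homogeneous (Sp P 1) q \<Longrightarrow> x ** y \<in> homogeneous (Sp P 1) (p + q)"
  using pcomp_degree[of 1 1 1 x p y q, unfolded one_arity] by simp

lemma mul_dif:
  "x \<in> carrier (Sp P 1) \<Longrightarrow> y \<in> carrier (Sp P 1) \<Longrightarrow>
    dif (Sp P 1) (x ** y) = dif (Sp P 1) x ** y \<oplus>\<^bsub>Sp P 1\<^esub> gsign (Sp P 1) x ** dif (Sp P 1) y"
  using pcomp_dif[of 1 1 1 x y, unfolded one_arity] by simp

lemma admissible_scalar:
  assumes "admissible P"
  shows "(THE c. d \<odot>\<^bsub>Sp P 1\<^esub> ounit P = c \<odot>\<^bsub>Sp P 1\<^esub> ounit P) = d"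
proof (rule the_equality)
  interpret U: dg_space "Sp P 1" by (rule space) simp
  fix c assume eq: "d \<odot>\<^bsub>Sp P 1\<^esub> ounit P = c \<odot>\<^bsub>Sp P 1\<^esub> ounit P"
  show "c = d"
  proof (rule ccontr)
    assume ne: "c \<noteq> d"
    have "(c - d) \<odot>\<^bsub>Sp P 1\<^esub> ounit P = c \<odot>\<^bsub>Sp P 1\<^esub> ounit P \<oplus>\<^bsub>Sp P 1\<^esub> (-1) \<odot>\<^bsub>Sp P 1\<^esub> (d \<odot>\<^bsub>Sp P 1\<^esub> ounit P)"
      using U.scale_left_distrib[OF unit_closed, of c "- d"] by (simp add: U.scale_scale)
    also have "\<dots> = \<zero>\<^bsub>Sp P 1\<^esub>" unfolding eq by (rule U.add_minus_scale) auto
    finally have "(1 / (c - d)) \<odot>\<^bsub>Sp P 1\<^esub> ((c - d) \<odot>\<^bsub>Sp P 1\<^esub> ounit P) = \<zero>\<^bsub>Sp P 1\<^esub>" by simp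
    then have "ounit P = \<zero>\<^bsub>Sp P 1\<^esub>" using ne by (simp add: U.scale_scale)
    then show False using assms by (simp add: admissible_def)
  qed
qed simp

end

text \<open>
  Abstract unary operations of the cylinder $U = V \oplus V \oplus V[1]$. With elements of $U$ written as
  $(a, b, c)$, they are $s = (0, 0, b)$, $t = (a, 0, 0)$, $j = (0, a, 0)$, $q = (b, 0, 0)$ and $r = (c, 0, 0)$, and
  \<open>\<sigma>\<close> is an odd operation of the first summand. Keeping them abstract separates the algebra
  of the deformation from calculations with forms.
\<close>

locale cylinder_data = R: dg_operad R
  for R :: "('k::field_char_0, 'b) operad" +
  fixes s t j q r \<sigma> :: 'b
  assumes s: "s \<in> homogeneous (Sp R 1) 1" and t: "t \<in> homogeneous (Sp R 1) 0"
    and j: "j \<in> homogeneous (Sp R 1) 0" and q: "q \<in> homogeneous (Sp R 1) 0"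
    and r: "r \<in> homogeneous (Sp R 1) 1" and \<sigma>: "\<sigma> \<in> homogeneous (Sp R 1) 1"
    and ss: "R.mul s s = \<zero>\<^bsub>Sp R 1\<^esub>" and tt: "R.mul t t = t"
    and st: "R.mul s t = \<zero>\<^bsub>Sp R 1\<^esub>" and ts: "R.mul t s = \<zero>\<^bsub>Sp R 1\<^esub>"
    and dif_s: "dif (Sp R 1) s = ounit R \<oplus>\<^bsub>Sp R 1\<^esub> (-1) \<odot>\<^bsub>Sp R 1\<^esub> t"
    and dif_t: "dif (Sp R 1) t = \<zero>\<^bsub>Sp R 1\<^esub>" and dif_j: "dif (Sp R 1) j = \<zero>\<^bsub>Sp R 1\<^esub>"
    and dif_q: "dif (Sp R 1) q = (-1) \<odot>\<^bsub>Sp R 1\<^esub> r" and dif_r: "dif (Sp R 1) r = \<zero>\<^bsub>Sp R 1\<^esub>"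
    and tj: "R.mul t j = \<zero>\<^bsub>Sp R 1\<^esub>" and qt: "R.mul q t = \<zero>\<^bsub>Sp R 1\<^esub>" and rt: "R.mul r t = \<zero>\<^bsub>Sp R 1\<^esub>"
    and qj: "R.mul q j = t" and rj: "R.mul r j = \<zero>\<^bsub>Sp R 1\<^esub>"
    and t\<sigma>: "R.mul t \<sigma> = \<sigma>" and \<sigma>t: "R.mul \<sigma> t = \<sigma>"
begin

sublocale U: dg_space "Sp R 1"
  by (rule R.space) simp

abbreviation plus (infixl "+\<^sub>R" 65) where "x +\<^sub>R y \<equiv> x \<oplus>\<^bsub>Sp R 1\<^esub> y"
abbreviation times (infixl "*\<^sub>R" 70) where "x *\<^sub>R y \<equiv> pcomp R 1 1 1 x y"
abbreviation neg where "neg x \<equiv> (-1) \<odot>\<^bsub>Sp R 1\<^esub> x"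
abbreviation zeroR ("0\<^sub>R") where "0\<^sub>R \<equiv> \<zero>\<^bsub>Sp R 1\<^esub>"
abbreviation dR where "dR \<equiv> dif (Sp R 1)"

text \<open>
  The first summand stands for $V$, and \<open>t\<close> is its identity. Since \<open>\<kappa>\<close> is the differential of \<open>\<theta>\<close>, the
  formula $d(\pi) = 0$ fixes the coefficient of \<open>r\<close> in \<open>\<pi>\<close> once that of \<open>q\<close> is chosen; and \<open>\<kappa>\<close> is
  $t - \tau^2$, which is what the identity $\pi\iota = t$ requires.
\<close>

definition \<tau> where "\<tau> = t +\<^sub>R neg (dR \<sigma>)"
definition \<theta> where "\<theta> = \<sigma> +\<^sub>R \<sigma> *\<^sub>R \<tau>"
definition \<kappa> where "\<kappa> = dR \<sigma> +\<^sub>R dR \<sigma> *\<^sub>R \<tau>"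
definition \<iota> where "\<iota> = \<tau> +\<^sub>R j"
definition \<pi> where "\<pi> = \<tau> +\<^sub>R \<kappa> *\<^sub>R q +\<^sub>R \<theta> *\<^sub>R r"

lemmas hom = s t j q r \<sigma>
lemmas cl [simp] = hom[THEN U.homogeneousD]

lemma d\<sigma>: "dR \<sigma> \<in> homogeneous (Sp R 1) 0"
  using U.dif_homogeneous[OF \<sigma>] by simp

lemma \<tau>_hom: "\<tau> \<in> homogeneous (Sp R 1) 0"
  unfolding \<tau>_def by (intro U.homogeneous_add U.homogeneous_scale t d\<sigma>)

lemma \<kappa>_hom: "\<kappa> \<in> homogeneous (Sp R 1) 0"
  unfolding \<kappa>_def using R.mul_homogeneous[OF d\<sigma> \<tau>_hom] by (intro U.homogeneous_add d\<sigma>) simp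

lemma \<theta>_hom: "\<theta> \<in> homogeneous (Sp R 1) 1"
  unfolding \<theta>_def using R.mul_homogeneous[OF \<sigma> \<tau>_hom] by (intro U.homogeneous_add \<sigma>) simp

lemma \<iota>_hom: "\<iota> \<in> homogeneous (Sp R 1) 0"
  unfolding \<iota>_def by (intro U.homogeneous_add \<tau>_hom j)

lemma \<pi>_hom: "\<pi> \<in> homogeneous (Sp R 1) 0"
  unfolding \<pi>_def using R.mul_homogeneous[OF \<kappa>_hom q] R.mul_homogeneous[OF \<theta>_hom r]
  by (intro U.homogeneous_add \<tau>_hom) simp_all

lemmas cl' [simp] = d\<sigma>[THEN U.homogeneousD] \<tau>_hom[THEN U.homogeneousD] \<kappa>_hom[THEN U.homogeneousD]
  \<theta>_hom[THEN U.homogeneousD] \<iota>_hom[THEN U.homogeneousD] \<pi>_hom[THEN U.homogeneousD]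

lemma gsign_even: "x \<in> homogeneous (Sp R 1) 0 \<Longrightarrow> gsign (Sp R 1) x = x"
  using U.gsign_homogeneous[of x 0] U.homogeneousD[of x 0] by simp

lemma td\<sigma>: "t *\<^sub>R dR \<sigma> = dR \<sigma>"
proof -
  have "dR \<sigma> = dR (t *\<^sub>R \<sigma>)" by (simp only: t\<sigma>)
  also have "\<dots> = t *\<^sub>R dR \<sigma>" by (subst R.mul_dif) (simp_all add: dif_t gsign_even[OF t] R.mul_zero)
  finally show ?thesis by simp
qed

lemma d\<sigma>t: "dR \<sigma> *\<^sub>R t = dR \<sigma>"
proof -
  have "dR \<sigma> = dR (\<sigma> *\<^sub>R t)" by (simp only: \<sigma>t)
  also have "\<dots> = dR \<sigma> *\<^sub>R t" by (subst R.mul_dif) (simp_all add: dif_t R.mul_zero)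
  finally show ?thesis by simp
qed

lemma t\<tau>: "t *\<^sub>R \<tau> = \<tau>" and \<tau>t: "\<tau> *\<^sub>R t = \<tau>"
  unfolding \<tau>_def by (simp_all add: R.mul_add_left R.mul_add_right R.mul_scale_left R.mul_scale_right tt td\<sigma> d\<sigma>t)

lemma dif_\<tau>: "dR \<tau> = 0\<^sub>R"
  unfolding \<tau>_def by (simp add: U.dif_add U.dif_scale dif_t U.dif_dif)

lemma dif_\<theta>: "dR \<theta> = \<kappa>"
  unfolding \<theta>_def \<kappa>_def by (simp add: U.dif_add R.mul_dif dif_\<tau> R.mul_zero)

lemma dif_\<kappa>: "dR \<kappa> = 0\<^sub>R"
  using U.dif_dif[of \<theta>] by (simp add: dif_\<theta>)

lemma dif_\<iota>: "dR \<iota> = 0\<^sub>R"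
  unfolding \<iota>_def by (simp add: U.dif_add dif_\<tau> dif_j)

lemma dif_\<pi>: "dR \<pi> = 0\<^sub>R"
proof -
  have "dR \<pi> = neg (\<kappa> *\<^sub>R r) +\<^sub>R \<kappa> *\<^sub>R r"
    unfolding \<pi>_def
    by (simp add: U.dif_add R.mul_dif dif_\<tau> dif_\<kappa> dif_\<theta> dif_q dif_r gsign_even[OF \<kappa>_hom] R.mul_zero R.mul_scale_right)
  also have "\<dots> = 0\<^sub>R" using U.add_minus_scale[of "\<kappa> *\<^sub>R r"] by (simp add: U.M.a_comm)
  finally show ?thesis .
qed

lemma \<tau>j: "\<tau> *\<^sub>R j = 0\<^sub>R"
  using R.mul_assoc[of \<tau> t j] by (simp add: \<tau>t tj R.mul_zero)

lemma q\<tau>: "q *\<^sub>R \<tau> = 0\<^sub>R"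
proof -
  have "q *\<^sub>R \<tau> = q *\<^sub>R (t *\<^sub>R \<tau>)" by (simp only: t\<tau>)
  also have "\<dots> = (q *\<^sub>R t) *\<^sub>R \<tau>" by (simp add: R.mul_assoc)
  also have "\<dots> = 0\<^sub>R" by (simp add: qt R.mul_zero)
  finally show ?thesis .
qed

lemma r\<tau>: "r *\<^sub>R \<tau> = 0\<^sub>R"
proof -
  have "r *\<^sub>R \<tau> = r *\<^sub>R (t *\<^sub>R \<tau>)" by (simp only: t\<tau>)
  also have "\<dots> = (r *\<^sub>R t) *\<^sub>R \<tau>" by (simp add: R.mul_assoc)
  also have "\<dots> = 0\<^sub>R" by (simp add: rt R.mul_zero)
  finally show ?thesis .
qed

lemma \<kappa>t: "\<kappa> *\<^sub>R t = \<kappa>"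
  unfolding \<kappa>_def by (simp add: R.mul_add_left d\<sigma>t R.mul_assoc \<tau>t)

lemma \<tau>\<tau>: "\<tau> *\<^sub>R \<tau> +\<^sub>R \<kappa> = t"
proof -
  have "\<tau> *\<^sub>R \<tau> = t *\<^sub>R \<tau> +\<^sub>R neg (dR \<sigma> *\<^sub>R \<tau>)"
    by (subst (1) \<tau>_def) (simp add: R.mul_add_left R.mul_scale_left)
  also have "\<dots> = t +\<^sub>R neg (dR \<sigma>) +\<^sub>R neg (dR \<sigma> *\<^sub>R \<tau>)" by (simp add: t\<tau>) (simp add: \<tau>_def)
  finally have "\<tau> *\<^sub>R \<tau> +\<^sub>R \<kappa> = (t +\<^sub>R neg (dR \<sigma>) +\<^sub>R neg (dR \<sigma> *\<^sub>R \<tau>)) +\<^sub>R (dR \<sigma> +\<^sub>R dR \<sigma> *\<^sub>R \<tau>)"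
    by (simp add: \<kappa>_def)
  also have "\<dots> = t +\<^sub>R ((dR \<sigma> +\<^sub>R neg (dR \<sigma>)) +\<^sub>R (dR \<sigma> *\<^sub>R \<tau> +\<^sub>R neg (dR \<sigma> *\<^sub>R \<tau>)))"
    by (simp add: U.M.a_ac)
  also have "\<dots> = t" by (simp add: U.add_minus_scale)
  finally show ?thesis .
qed

text \<open>
  The composite is $\tau^2 + \kappa = t$: the two summands of \<open>\<iota>\<close> contribute $\tau\tau$ and $\kappa$.
\<close>

lemma \<pi>\<iota>: "\<pi> *\<^sub>R \<iota> = t"
proof -
  have "\<pi> *\<^sub>R \<iota> = \<tau> *\<^sub>R \<tau> +\<^sub>R \<kappa>"
    unfolding \<pi>_def \<iota>_def
    by (simp add: R.mul_add_left R.mul_add_right R.mul_assoc \<tau>j q\<tau> r\<tau> qj rj R.mul_zero \<kappa>t U.M.a_ac)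
  then show ?thesis by (simp add: \<tau>\<tau>)
qed

end

text \<open>
  A map of operads into the operations of the first summand of the cylinder.
\<close>

locale cylinder_map = cylinder_data R s t j q r \<sigma> + P: dg_operad P
  for R :: "('k::field_char_0, 'b) operad" and s t j q r \<sigma> and P :: "('k, 'a) operad" +
  fixes g :: "nat \<Rightarrow> 'a \<Rightarrow> 'b"
  assumes adm: "admissible P" and g: "operad_map P (R\<lparr>ounit := t\<rparr>) g"
begin

text \<open>
  In arity one the unit has to go to the unit of \<open>R\<close>, and not to the conjugate $\iota\pi$ of its image. This
  is possible because arity one of \<open>P\<close> is spanned by the unit.
\<close>

definition g_ext :: "nat \<Rightarrow> 'a \<Rightarrow> 'b" where
  "g_ext n x = (if n = 1 then (THE c. x = c \<odot>\<^bsub>Sp P 1\<^esub> ounit P) \<odot>\<^bsub>Sp R 1\<^esub> ounit R else R.conj_by n \<iota> \<pi> (g n x))"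

lemma g_ext_1: "g_ext 1 (c \<odot>\<^bsub>Sp P 1\<^esub> ounit P) = c \<odot>\<^bsub>Sp R 1\<^esub> ounit R"
  by (simp add: g_ext_def P.admissible_scalar[OF adm])

lemma arity_1: "x \<in> carrier (Sp P 1) \<Longrightarrow> \<exists>c. x = c \<odot>\<^bsub>Sp P 1\<^esub> ounit P"
  using adm by (auto simp: admissible_def)

lemma g_linear: "n \<ge> 1 \<Longrightarrow> linear_map (Sp P n) (Sp R n) (g n)"
  using g by (simp add: operad_map_def)

lemmas g_closed = linear_mapD(1)[OF g_linear]

lemma t_g: "n \<ge> 1 \<Longrightarrow> x \<in> carrier (Sp P n) \<Longrightarrow> pcomp R 1 n 1 t (g n x) = g n x"
proof -
  assume n: "n \<ge> 1" and x: "x \<in> carrier (Sp P n)"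
  have "g (1 + n - 1) (pcomp P 1 n 1 (ounit P) x) = pcomp R 1 n 1 (g 1 (ounit P)) (g n x)"
    using g n x P.unit_closed unfolding operad_map_def by fastforce
  then show ?thesis using g n x by (simp add: P.unit_left operad_map_def)
qed

lemma g_ext_linear: "n \<ge> 1 \<Longrightarrow> linear_map (Sp P n) (Sp R n) (g_ext n)"
proof -
  assume n: "n \<ge> 1"
  show ?thesis
  proof (cases "n = 1")
    case True
    interpret PU: dg_space "Sp P 1" by (rule P.space) simp
    show ?thesis
      unfolding True linear_map_def
    proof (intro conjI ballI allI Pi_I)
      fix x assume "x \<in> carrier (Sp P 1)"
      then obtain c where x: "x = c \<odot>\<^bsub>Sp P 1\<^esub> ounit P" using arity_1 by blast
      show "g_ext 1 x \<in> carrier (Sp R 1)" unfolding x g_ext_1 by simp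
      fix d
      show "g_ext 1 (d \<odot>\<^bsub>Sp P 1\<^esub> x) = d \<odot>\<^bsub>Sp R 1\<^esub> g_ext 1 x"
        unfolding x by (simp add: PU.scale_scale g_ext_1 U.scale_scale)
      fix y assume "y \<in> carrier (Sp P 1)"
      then obtain e where y: "y = e \<odot>\<^bsub>Sp P 1\<^esub> ounit P" using arity_1 by blast
      show "g_ext 1 (x \<oplus>\<^bsub>Sp P 1\<^esub> y) = g_ext 1 x \<oplus>\<^bsub>Sp R 1\<^esub> g_ext 1 y"
        unfolding x y by (simp add: g_ext_1 flip: PU.scale_left_distrib U.scale_left_distrib)
    qed
  next
    case False
    then have "g_ext n = (\<lambda>x. R.conj_by n \<iota> \<pi> (g n x))" by (simp add: g_ext_def fun_eq_iff)
    then show ?thesis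
      using linear_map_comp[OF g_linear[OF n] R.linear_map_conj_by[OF _ _ n]] by simp
  qed
qed

text \<open>
  Compatibility with compositions is \<open>conj_by_pcomp\<close>, whose hypothesis holds by \<open>\<pi>\<iota>\<close>; compatibility with the
  differential holds because \<open>\<iota>\<close> and \<open>\<pi>\<close> are even cycles.
\<close>

lemma operad_map_g_ext: "operad_map P R g_ext"
  unfolding operad_map_def
proof (intro conjI allI impI ballI)
  fix n :: nat assume "1 \<le> n"
  then show "linear_map (Sp P n) (Sp R n) (g_ext n)" by (rule g_ext_linear)
next
  fix n :: nat and x and p :: bit assume n: "1 \<le> n" and x: "x \<in> carrier (Sp P n)"
  interpret PN: dg_space "Sp P n" by (rule P.space[OF n])
  note gx = g_closed[OF n x]
  have gh: "g n (hcomp (Sp P n) p x) = hcomp (Sp R n) p (g n x)" and gd: "g n (dif (Sp P n) x) = dif (Sp R n) (g n x)"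
    and ga: "\<sigma>' permutes {1..n} \<Longrightarrow> g n (act P n x \<sigma>') = act R n (g n x) \<sigma>'" for \<sigma>'
    using g n x by (auto simp: operad_map_def)
  show "g_ext n (hcomp (Sp P n) p x) = hcomp (Sp R n) p (g_ext n x)"
  proof (cases "n = 1")
    case True
    then interpret PU: dg_space "Sp P 1" using PN.dg_space_axioms by simp
    obtain c where c: "x = c \<odot>\<^bsub>Sp P 1\<^esub> ounit P" using arity_1 x True by blast
    show ?thesis
      unfolding True c using g_ext_1[of 0] by (simp add: g_ext_1 PU.hcomp_scale U.hcomp_scale PU.hcomp_homogeneous[OF P.unit_even] U.hcomp_homogeneous[OF R.unit_even])
  next
    case False
    then show ?thesis using R.conj_by_hcomp[OF \<iota>_hom \<pi>_hom n gx] by (simp add: g_ext_def gh)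
  qed
  show "g_ext n (dif (Sp P n) x) = dif (Sp R n) (g_ext n x)"
  proof (cases "n = 1")
    case True
    then interpret PU: dg_space "Sp P 1" using PN.dg_space_axioms by simp
    obtain c where c: "x = c \<odot>\<^bsub>Sp P 1\<^esub> ounit P" using arity_1 x True by blast
    show ?thesis
      unfolding True c using g_ext_1[of 0] by (simp add: g_ext_1 PU.dif_scale U.dif_scale P.dif_unit R.dif_unit)
  next
    case False
    then show ?thesis using R.conj_by_dif[OF \<iota>_hom dif_\<iota> \<pi>_hom dif_\<pi> n gx] by (simp add: g_ext_def gd)
  qed
  fix \<sigma>' assume \<sigma>': "\<sigma>' permutes {1..n}"
  show "g_ext n (act P n x \<sigma>') = act R n (g_ext n x) \<sigma>'"
  proof (cases "n = 1")
    case True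
    then have "\<sigma>' = id" using \<sigma>' by simp
    then show ?thesis using x n g_ext_linear[OF n] by (simp add: P.act_id R.act_id linear_mapD(1))
  next
    case False
    then show ?thesis using R.conj_by_act[OF _ \<pi>_hom n \<sigma>' gx, of \<iota>] by (simp add: g_ext_def ga[OF \<sigma>'])
  qed
next
  fix m n :: nat and i x y assume m: "1 \<le> m" and n: "1 \<le> n" and i: "i \<in> {1..m}"
    and x: "x \<in> carrier (Sp P m)" and y: "y \<in> carrier (Sp P n)"
  note gxc = linear_mapD[OF g_ext_linear[OF m]] and gyc = linear_mapD[OF g_ext_linear[OF n]]
  consider "m = 1" | "n = 1" | "m \<noteq> 1" "n \<noteq> 1" by blast
  then show "g_ext (m + n - 1) (pcomp P m n i x y) = pcomp R m n i (g_ext m x) (g_ext n y)"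
  proof cases
    case 1
    obtain c where c: "x = c \<odot>\<^bsub>Sp P 1\<^esub> ounit P" using arity_1 x 1 by blast
    have "i = 1" using i 1 by simp
    then show ?thesis
      unfolding 1 c g_ext_1 using n y gyc P.pcomp_scale_left[of n 1 1 y "ounit P" c] R.pcomp_scale_left[of n 1 1 "g_ext n y" "ounit R" c]
      by (simp add: P.unit_left R.unit_left)
  next
    case 2
    obtain c where c: "y = c \<odot>\<^bsub>Sp P 1\<^esub> ounit P" using arity_1 y 2 by blast
    show ?thesis
      unfolding 2 c g_ext_1 using i x gxc P.pcomp_scale_right[of 1 i m x "ounit P" c] R.pcomp_scale_right[of 1 i m "g_ext m x" "ounit R" c]
      by (simp add: P.unit_right R.unit_right)
  next
    case 3
    then have mn: "m + n - 1 \<noteq> 1" using m n by auto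
    have "g (m + n - 1) (pcomp P m n i x y) = pcomp R m n i (g m x) (g n y)"
      using g m n i x y by (auto simp: operad_map_def)
    then show ?thesis
      using R.conj_by_pcomp[OF _ \<pi>_hom n i g_closed[OF m x] g_closed[OF n y], of \<iota>] t_g[OF n y] 3 mn
      by (simp add: g_ext_def \<pi>\<iota>)
  qed
next
  interpret PU: dg_space "Sp P 1" by (rule P.space) simp
  show "g_ext 1 (ounit P) = ounit R" using g_ext_1[of 1] by simp
qed

sublocale BV: BV_target P R g_ext s t
  by unfold_locales (auto intro: operad_map_g_ext s t ss tt st ts dif_s dif_t)

end

section \<open>Naturality of evaluation and coefficientwise maps\<close>

lemma operad_mapD:
  assumes "operad_map P Q f" and n: "n \<ge> 1"
  shows "linear_map (Sp P n) (Sp Q n) (f n)"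
    and "x \<in> carrier (Sp P n) \<Longrightarrow> f n (hcomp (Sp P n) p x) = hcomp (Sp Q n) p (f n x)"
    and "x \<in> carrier (Sp P n) \<Longrightarrow> f n (dif (Sp P n) x) = dif (Sp Q n) (f n x)"
    and "x \<in> carrier (Sp P n) \<Longrightarrow> \<sigma> permutes {1..n} \<Longrightarrow> f n (act P n x \<sigma>) = act Q n (f n x) \<sigma>"
    and "i \<in> {1..m} \<Longrightarrow> y \<in> carrier (Sp P m) \<Longrightarrow> x \<in> carrier (Sp P n) \<Longrightarrow>
      f (m + n - 1) (pcomp P m n i y x) = pcomp Q m n i (f m y) (f n x)"
    and "f 1 (ounit P) = ounit Q"
  using assms by (auto simp: operad_map_def)

lemma operad_map_comp:
  assumes f: "operad_map P Q f" and g: "operad_map Q R g"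
  shows "operad_map P R (\<lambda>n x. g n (f n x))"
  unfolding operad_map_def
proof (intro conjI allI impI ballI)
  fix n :: nat assume "1 \<le> n"
  then show "linear_map (Sp P n) (Sp R n) (\<lambda>x. g n (f n x))"
    by (intro linear_map_comp[OF operad_mapD(1)[OF f] operad_mapD(1)[OF g]])
next
  fix m n :: nat and i x y
  assume *: "1 \<le> m" "1 \<le> n" "i \<in> {1..m}" "x \<in> carrier (Sp P m)" "y \<in> carrier (Sp P n)"
  show "g (m + n - 1) (f (m + n - 1) (pcomp P m n i x y)) = pcomp R m n i (g m (f m x)) (g n (f n y))"
    using * linear_mapD(1)[OF operad_mapD(1)[OF f]]
    by (simp add: operad_mapD(5)[OF f] operad_mapD(5)[OF g])
next
  show "g 1 (f 1 (ounit P)) = ounit R"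
    using operad_mapD(6)[OF f, of 1] operad_mapD(6)[OF g, of 1] by simp
qed (auto simp: operad_mapD[OF f] operad_mapD[OF g] linear_mapD(1)[OF operad_mapD(1)[OF f]])

lemma (in dg_operad) operad_map_cong:
  assumes f: "operad_map P Q f" and eq: "\<And>n x. n \<ge> 1 \<Longrightarrow> x \<in> carrier (Sp P n) \<Longrightarrow> f' n x = f n x"
  shows "operad_map P Q f'"
  unfolding operad_map_def
proof (intro conjI allI impI ballI)
  fix n :: nat assume n: "1 \<le> n"
  interpret N: dg_space "Sp P n" by (rule space[OF n])
  show "linear_map (Sp P n) (Sp Q n) (f' n)"
    using operad_mapD(1)[OF f n] eq[OF n] by (simp add: linear_map_def Pi_iff)
  fix x assume x: "x \<in> carrier (Sp P n)"
  show "f' n (hcomp (Sp P n) p x) = hcomp (Sp Q n) p (f' n x)" for p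
    using operad_mapD(2)[OF f n x] x eq[OF n] by simp
  show "f' n (dif (Sp P n) x) = dif (Sp Q n) (f' n x)"
    using operad_mapD(3)[OF f n x] x eq[OF n] by simp
  show "f' n (act P n x \<sigma>) = act Q n (f' n x) \<sigma>" if "\<sigma> permutes {1..n}" for \<sigma>
    using operad_mapD(4)[OF f n x that] x eq[OF n] act_closed[OF n that x] by simp
next
  fix m n :: nat and i x y
  assume *: "1 \<le> m" "1 \<le> n" "i \<in> {1..m}" "x \<in> carrier (Sp P m)" "y \<in> carrier (Sp P n)"
  then have "1 \<le> m + n - 1" by auto
  from eq[OF this pcomp_closed[OF *(2-5)]]
  show "f' (m + n - 1) (pcomp P m n i x y) = pcomp Q m n i (f' m x) (f' n y)"
    by (simp only: operad_mapD(5)[OF f *(2-5)] eq[OF *(1,4)] eq[OF *(2,5)])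
next
  show "f' 1 (ounit P) = ounit Q" using eq[of 1 "ounit P"] operad_mapD(6)[OF f, of 1] by simp
qed

lemma (in BV_target) ev_natural:
  assumes \<phi>: "operad_map Q R \<phi>" and eq: "\<And>n x. n \<ge> 1 \<Longrightarrow> x \<in> carrier (Sp P n) \<Longrightarrow> f' n x = \<phi> n (f n x)"
  shows "bv_wf P u \<Longrightarrow> \<phi> (bv_arity u) (ev u) = bv_eval R f' (\<phi> 1 s) (\<phi> 1 t) u"
proof (induction u)
  case (Add u v)
  then show ?case using P.bv_arity_pos[of u] ev_closed[of u] ev_closed[of v]
    by (simp add: linear_mapD(2)[OF operad_mapD(1)[OF \<phi>]])
next
  case (Scale c u)
  then show ?case using P.bv_arity_pos[of u] ev_closed[of u]
    by (simp add: linear_mapD(3)[OF operad_mapD(1)[OF \<phi>]])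
next
  case (Act u \<sigma>)
  then show ?case using P.bv_arity_pos[of u] ev_closed[of u] by (simp add: operad_mapD(4)[OF \<phi>])
next
  case (Comp u i v)
  then show ?case using P.bv_arity_pos[of v] ev_closed[of u] ev_closed[of v]
    by (simp add: operad_mapD(5)[OF \<phi>])
qed (simp_all add: eq)

locale operad_hom = P: dg_operad P + Q: dg_operad Q
  for P :: "('k::field_char_0, 'a) operad" and Q :: "('k, 'b) operad" +
  fixes \<phi> :: "nat \<Rightarrow> 'a \<Rightarrow> 'b"
  assumes hom: "operad_map P Q \<phi>"
begin

lemmas closed = linear_mapD(1)[OF operad_mapD(1)[OF hom]]
  and add = linear_mapD(2)[OF operad_mapD(1)[OF hom]]
  and scale = linear_mapD(3)[OF operad_mapD(1)[OF hom]]

lemma zero: "n \<ge> 1 \<Longrightarrow> \<phi> n \<zero>\<^bsub>Sp P n\<^esub> = \<zero>\<^bsub>Sp Q n\<^esub>"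
  by (rule linear_map_zero[OF P.space Q.space operad_mapD(1)[OF hom]])

lemma homogeneous: "n \<ge> 1 \<Longrightarrow> x \<in> homogeneous (Sp P n) p \<Longrightarrow> \<phi> n x \<in> homogeneous (Sp Q n) p"
  using closed[of n x] operad_mapD(2)[OF hom, of n x p] by (simp add: homogeneous_def)

lemma mul: "x \<in> carrier (Sp P 1) \<Longrightarrow> y \<in> carrier (Sp P 1) \<Longrightarrow> \<phi> 1 (P.mul x y) = Q.mul (\<phi> 1 x) (\<phi> 1 y)"
  using operad_mapD(5)[OF hom, of 1 1 1 x y, unfolded P.one_arity] by simp

lemma precomp:
  assumes b: "b \<in> carrier (Sp P 1)" and "set js \<subseteq> {1..n}" "x \<in> carrier (Sp P n)"
  shows "\<phi> n (P.precomp n b js x) = Q.precomp n (\<phi> 1 b) js (\<phi> n x)"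
  using assms(2,3)
proof (induction js arbitrary: x)
  case (Cons j js)
  then have j: "j \<in> {1..n}" and n: "n \<ge> 1" by auto
  have "\<phi> n (pcomp P n 1 j x b) = pcomp Q n 1 j (\<phi> n x) (\<phi> 1 b)"
    using operad_mapD(5)[OF hom, of 1 j n x b] j b Cons.prems by simp
  then show ?case using Cons P.unary_comp_closed[OF b j] by simp
qed simp

lemma conj_by:
  assumes a: "a \<in> carrier (Sp P 1)" and b: "b \<in> carrier (Sp P 1)" and n: "n \<ge> 1" and x: "x \<in> carrier (Sp P n)"
  shows "\<phi> n (P.conj_by n a b x) = Q.conj_by n (\<phi> 1 a) (\<phi> 1 b) (\<phi> n x)"
proof -
  have "\<phi> n (pcomp P 1 n 1 a x) = pcomp Q 1 n 1 (\<phi> 1 a) (\<phi> n x)"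
    using operad_mapD(5)[OF hom, of n 1 1 a x] n a x by simp
  moreover have "set [1..<n + 1] \<subseteq> {1..n}" by auto
  ultimately show ?thesis
    unfolding P.conj_by_def Q.conj_by_def
    by (simp add: precomp[OF b _ P.unary_comp_left_closed[OF a n x]] del: upt_Suc)
qed

end

text \<open>
  Linear maps that are multiplicative only when the inner operation belongs to a suitable subset \<open>A\<close>. Both
  inclusion of operations of $V$ into those of the cylinder and restriction to $V$ are of this kind. Neither of
  them is a map of operads: inclusion does not preserve the unit, restriction does not preserve all compositions.
\<close>

locale coeff_map = Q: dg_operad Q + Q': dg_operad Q'
  for Q :: "('k::field_char_0, 'b) operad" and Q' :: "('k, 'c) operad" +
  fixes K :: "nat \<Rightarrow> 'b \<Rightarrow> 'c" and A :: "nat \<Rightarrow> 'b set"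
  assumes K_linear: "n \<ge> 1 \<Longrightarrow> linear_map (Sp Q n) (Sp Q' n) (K n)"
    and K_hcomp: "n \<ge> 1 \<Longrightarrow> x \<in> carrier (Sp Q n) \<Longrightarrow> K n (hcomp (Sp Q n) p x) = hcomp (Sp Q' n) p (K n x)"
    and K_dif: "n \<ge> 1 \<Longrightarrow> x \<in> carrier (Sp Q n) \<Longrightarrow> K n (dif (Sp Q n) x) = dif (Sp Q' n) (K n x)"
    and K_act: "n \<ge> 1 \<Longrightarrow> \<sigma> permutes {1..n} \<Longrightarrow> x \<in> carrier (Sp Q n) \<Longrightarrow> K n (act Q n x \<sigma>) = act Q' n (K n x) \<sigma>"
    and A_closed: "n \<ge> 1 \<Longrightarrow> A n \<subseteq> carrier (Sp Q n)"
    and A_gsign: "n \<ge> 1 \<Longrightarrow> x \<in> A n \<Longrightarrow> gsign (Sp Q n) x \<in> A n"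
    and K_pcomp: "n \<ge> 1 \<Longrightarrow> i \<in> {1..m} \<Longrightarrow> x \<in> carrier (Sp Q m) \<Longrightarrow> y \<in> A n \<Longrightarrow>
      K (m + n - 1) (pcomp Q m n i x y) = pcomp Q' m n i (K m x) (K n y)"
begin

lemmas K_closed = linear_mapD(1)[OF K_linear]
  and K_add = linear_mapD(2)[OF K_linear]
  and K_scale = linear_mapD(3)[OF K_linear]

lemma K_zero: "n \<ge> 1 \<Longrightarrow> K n \<zero>\<^bsub>Sp Q n\<^esub> = \<zero>\<^bsub>Sp Q' n\<^esub>"
  by (rule linear_map_zero[OF Q.space Q'.space K_linear])

lemma K_gsign:
  assumes n: "n \<ge> 1" and x: "x \<in> carrier (Sp Q n)"
  shows "K n (gsign (Sp Q n) x) = gsign (Sp Q' n) (K n x)"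
proof -
  interpret N: dg_space "Sp Q n" by (rule Q.space[OF n])
  show ?thesis using n x by (simp add: gsign_def K_add K_scale K_hcomp)
qed

lemma coeffwise_closed:
  assumes n: "n \<ge> 1" and a: "a \<in> carrier (tensor_D_space (Sp Q n))"
  shows "(\<lambda>e k. K n (a e k)) \<in> carrier (tensor_D_space (Sp Q' n))"
  using a K_closed[OF n] K_zero[OF n] unfolding tensor_D_space_carrier by metis

text \<open>
  The map is applied to each coefficient of a form. It has to be multiplicative only on the coefficients of
  values of \<open>F\<close>, which are assumed to lie in \<open>A\<close>.
\<close>

lemma operad_map_coeffwise:
  assumes F: "operad_map P ((tensor_D Q)\<lparr>ounit := u\<rparr>) F"
    and A: "\<And>n x e k. n \<ge> 1 \<Longrightarrow> x \<in> carrier (Sp P n) \<Longrightarrow> F n x e k \<in> A n"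
    and u: "\<And>e k. K 1 (u e k) = u' e k"
  shows "operad_map P ((tensor_D Q')\<lparr>ounit := u'\<rparr>) (\<lambda>n x e k. K n (F n x e k))"
  unfolding operad_map_def
proof (intro conjI allI impI ballI)
  fix n :: nat assume n: "1 \<le> n"
  interpret N: dg_space "Sp Q n" by (rule Q.space[OF n])
  note FD = operad_mapD[OF F n]
  note lin = FD(1)
  have cl: "F n x e k \<in> carrier (Sp Q n)" if "x \<in> carrier (Sp P n)" for x e k
    using A[OF n that] A_closed[OF n] by blast
  show "linear_map (Sp P n) (Sp (tensor_D Q'\<lparr>ounit := u'\<rparr>) n) (\<lambda>x e k. K n (F n x e k))"
    unfolding linear_map_def
  proof (intro conjI ballI allI Pi_I)
    fix x assume x: "x \<in> carrier (Sp P n)"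
    show "(\<lambda>e k. K n (F n x e k)) \<in> carrier (Sp (tensor_D Q'\<lparr>ounit := u'\<rparr>) n)"
      using coeffwise_closed[OF n, of "F n x"] linear_mapD(1)[OF lin x] by simp
    show "(\<lambda>e k. K n (F n (c \<odot>\<^bsub>Sp P n\<^esub> x) e k)) = c \<odot>\<^bsub>Sp (tensor_D Q'\<lparr>ounit := u'\<rparr>) n\<^esub> (\<lambda>e k. K n (F n x e k))" for c
      using linear_mapD(3)[OF lin x, of c] cl[OF x] n by (simp add: K_scale)
    show "(\<lambda>e k. K n (F n (x \<oplus>\<^bsub>Sp P n\<^esub> y) e k)) =
        (\<lambda>e k. K n (F n x e k)) \<oplus>\<^bsub>Sp (tensor_D Q'\<lparr>ounit := u'\<rparr>) n\<^esub> (\<lambda>e k. K n (F n y e k))"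
      if y: "y \<in> carrier (Sp P n)" for y
      using linear_mapD(2)[OF lin x y] cl[OF x] cl[OF y] n by (simp add: K_add)
  qed
  fix x assume x: "x \<in> carrier (Sp P n)"
  show "(\<lambda>e k. K n (F n (hcomp (Sp P n) p x) e k)) = hcomp (Sp (tensor_D Q'\<lparr>ounit := u'\<rparr>) n) p (\<lambda>e k. K n (F n x e k))" for p
    using FD(2)[OF x, of p] cl[OF x] n by (simp add: K_hcomp)
  show "(\<lambda>e k. K n (F n (dif (Sp P n) x) e k)) = dif (Sp (tensor_D Q'\<lparr>ounit := u'\<rparr>) n) (\<lambda>e k. K n (F n x e k))"
  proof (intro ext)
    fix e k
    have "F n (dif (Sp P n) x) = dif (tensor_D_space (Sp Q n)) (F n x)" using FD(3)[OF x] by simp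
    then show "K n (F n (dif (Sp P n) x) e k) = dif (Sp (tensor_D Q'\<lparr>ounit := u'\<rparr>) n) (\<lambda>e k. K n (F n x e k)) e k"
      using cl[OF x] n by (simp add: dif_tensor_D_space K_dif K_add K_scale K_gsign del: of_nat_Suc)
  qed
  show "(\<lambda>e k. K n (F n (act P n x \<sigma>) e k)) = act (tensor_D Q'\<lparr>ounit := u'\<rparr>) n (\<lambda>e k. K n (F n x e k)) \<sigma>"
    if \<sigma>: "\<sigma> permutes {1..n}" for \<sigma>
    using FD(4)[OF x \<sigma>] cl[OF x] n \<sigma> by (simp add: K_act)
next
  fix m n :: nat and i x y
  assume m: "1 \<le> m" and n: "1 \<le> n" and i: "i \<in> {1..m}" and x: "x \<in> carrier (Sp P m)" and y: "y \<in> carrier (Sp P n)"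
  have mn: "1 \<le> m + n - 1" using m n by simp
  let ?a = "F m x" and ?b = "F n y"
  have a: "?a e k \<in> carrier (Sp Q m)" and b: "?b e k \<in> A n" for e k
    using A[OF m x] A_closed[OF m] A[OF n y] by blast+
  have b': "?b e k \<in> carrier (Sp Q n)" for e k using b A_closed[OF n] by blast
  have form: "K (m + n - 1) (form_comp Q m n i e (\<lambda>e. ?a e j) (\<lambda>e. ?b e l)) =
      form_comp Q' m n i e (\<lambda>e. K m (?a e j)) (\<lambda>e. K n (?b e l))" for e j l
    using a b b' n i mn A_gsign[OF n b] Q.space[OF n, THEN dg_space.gsign_closed]
    by (simp add: form_comp_def K_pcomp K_add K_gsign Q.pcomp_closed)
  show "(\<lambda>e k. K (m + n - 1) (F (m + n - 1) (pcomp P m n i x y) e k)) =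
      pcomp (tensor_D Q'\<lparr>ounit := u'\<rparr>) m n i (\<lambda>e k. K m (?a e k)) (\<lambda>e k. K n (?b e k))"
  proof (intro ext)
    fix e k
    have "F (m + n - 1) (pcomp P m n i x y) = pcomp (tensor_D Q) m n i ?a ?b"
      using operad_mapD(5)[OF F n i x y] by simp
    then have "K (m + n - 1) (F (m + n - 1) (pcomp P m n i x y) e k) =
        K (m + n - 1) (\<Oplus>\<^bsub>Sp Q (m + n - 1)\<^esub>j\<in>{..k}. form_comp Q m n i e (\<lambda>e. ?a e j) (\<lambda>e. ?b e (k - j)))"
      by (simp only: pcomp_tensor_D)
    also have "\<dots> = (\<Oplus>\<^bsub>Sp Q' (m + n - 1)\<^esub>j\<in>{..k}. K (m + n - 1) (form_comp Q m n i e (\<lambda>e. ?a e j) (\<lambda>e. ?b e (k - j))))"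
      by (rule linear_map_finsum[OF Q.space[OF mn] Q'.space[OF mn] K_linear[OF mn]])
        (use a b' n i in \<open>auto intro!: Q.form_comp_closed\<close>)
    also have "\<dots> = pcomp (tensor_D Q') m n i (\<lambda>e k. K m (?a e k)) (\<lambda>e k. K n (?b e k)) e k"
      by (simp only: form pcomp_tensor_D)
    finally show "K (m + n - 1) (F (m + n - 1) (pcomp P m n i x y) e k) =
        pcomp (tensor_D Q'\<lparr>ounit := u'\<rparr>) m n i (\<lambda>e k. K m (?a e k)) (\<lambda>e k. K n (?b e k)) e k" by simp
  qed
next
  show "(\<lambda>e k. K 1 (F 1 (ounit P) e k)) = ounit (tensor_D Q'\<lparr>ounit := u'\<rparr>)"
    using operad_mapD(6)[OF F, of 1] u by simp
qed

lemma ev_D_coeffwise: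
  assumes n: "n \<ge> 1" and a: "a \<in> carrier (tensor_D_space (Sp Q n))"
  shows "ev_D Q' c n (\<lambda>e k. K n (a e k)) = K n (ev_D Q c n a)"
proof -
  obtain N where N: "\<And>e k. N < k \<Longrightarrow> a e k = \<zero>\<^bsub>Sp Q n\<^esub>" using Q.tensor_D_bound[OF a] by blast
  interpret N: dg_space "Sp Q n" by (rule Q.space[OF n])
  have cl: "a e k \<in> carrier (Sp Q n)" for e k using a by (simp add: tensor_D_space_carrier)
  have "ev_D Q' c n (\<lambda>e k. K n (a e k)) = (\<Oplus>\<^bsub>Sp Q' n\<^esub>k\<in>{..N}. c ^ k \<odot>\<^bsub>Sp Q' n\<^esub> K n (a 0 k))"
    by (rule Q'.ev_D_eq[OF n coeffwise_closed[OF n a]]) (simp add: N K_zero[OF n])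
  also have "\<dots> = (\<Oplus>\<^bsub>Sp Q' n\<^esub>k\<in>{..N}. K n (c ^ k \<odot>\<^bsub>Sp Q n\<^esub> a 0 k))" by (simp add: K_scale[OF n] cl)
  also have "\<dots> = K n (\<Oplus>\<^bsub>Sp Q n\<^esub>k\<in>{..N}. c ^ k \<odot>\<^bsub>Sp Q n\<^esub> a 0 k)"
    by (rule linear_map_finsum[OF Q.space[OF n] Q'.space[OF n] K_linear[OF n], symmetric]) (simp add: cl)
  also have "\<dots> = K n (ev_D Q c n a)" by (simp add: Q.ev_D_eq[OF n a N])
  finally show ?thesis .
qed

end

section \<open>Unary operations and transport\<close>

context dg_vect_space
begin

text \<open>
  Graded linear maps commute with the sign operator up to the sign of their parity.
\<close>

lemma S_graded:
  assumes g: "vlinear V g" and e: "\<And>p v. h (p + e) (g v) = g (h p v)"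
  shows "S (g v) = ksign 1 e \<cdot> g (S v)"
  using e[of 0 v] e[of 1 v] bit_cases[of e] by (auto simp: vsign_def vlinear_simps[OF g])

lemma homogeneous_unary:
  assumes g: "vlinear V g" and e: "\<And>p v. h (p + e) (g v) = g (h p v)"
  shows "unary g \<in> homogeneous (Sp (End_operad V) 1) e"
  unfolding homogeneous_End using multilinear_unary[OF g] parity_unary[OF g S_graded[OF g e]] by simp

lemma mul_unary:
  assumes "vlinear V f" "vlinear V g"
  shows "pcomp (End_operad V) 1 1 1 (unary f) (unary g) = unary (\<lambda>v. f (g v))"
  using end_pcomp_unary_left[OF assms(1) _ multilinear_unary[OF assms(2)]] vlinear_simps(3)[OF assms(1)]
  by (auto simp: unary_def fun_eq_iff)

lemma dif_unary:
  assumes "vlinear V g"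
  shows "dif (Sp (End_operad V) 1) (unary g) = unary (\<lambda>v. d (g v) - S (g (S (d v))))"
proof
  fix vs show "dif (Sp (End_operad V) 1) (unary g) vs = unary (\<lambda>v. d (g v) - S (g (S (d v)))) vs"
  proof (cases "length vs = 1")
    case True
    then obtain v where "vs = [v]" by (auto simp: length_Suc_conv One_nat_def)
    then show ?thesis by (simp add: end_dif_eq end_sign_def unary_def)
  next
    case False
    then show ?thesis
      using multilinear_length[OF multilinear_dif[OF multilinear_unary[OF assms]]] by (simp add: unary_def)
  qed
qed

lemma precomp_End:
  assumes b: "unary b \<in> homogeneous (Sp (End_operad V) 1) 0" and \<phi>: "\<phi> \<in> multilinear V n"
    and "k \<le> n" "length vs = n"
  shows "dg_operad.precomp (End_operad V) n (unary b) [1..<k + 1] \<phi> vs = \<phi> (map b (take k vs) @ drop k vs)"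
  using assms(3,4)
proof (induction k arbitrary: vs)
  case 0
  then show ?case by (simp add: dg_operad.precomp_simps[OF dg_operad_End])
next
  case (Suc k)
  let ?F = "dg_operad.precomp (End_operad V) n (unary b) [1..<k + 1] \<phi>"
  have bc: "unary b \<in> carrier (Sp (End_operad V) 1)" using b by (simp add: homogeneous_def)
  have "?F \<in> carrier (Sp (End_operad V) n)"
    by (rule dg_operad.precomp_closed[OF dg_operad_End bc]) (use Suc.prems \<phi> in auto)
  then have F: "slotwise_linear n ?F" by (simp add: multilinearD)
  have "dg_operad.precomp (End_operad V) n (unary b) [1..<Suc k + 1] \<phi> vs = end_pcomp V n 1 (Suc k) ?F (unary b) vs"
    by (simp add: dg_operad.precomp_simps[OF dg_operad_End] flip: Suc_eq_plus1)
  also have "\<dots> = ?F (vs[k := b (vs ! k)])"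
    by (rule end_pcomp_unary[OF F]) (use b Suc.prems in \<open>auto simp: homogeneous_End\<close>)
  also have "\<dots> = \<phi> (map b (take k vs) @ b (vs ! k) # drop (Suc k) vs)"
    using Suc.IH[of "vs[k := b (vs ! k)]"] Suc.prems by (simp add: drop_update_swap Cons_nth_drop_Suc[symmetric])
  also have "map b (take k vs) @ b (vs ! k) # drop (Suc k) vs = map b (take (Suc k) vs) @ drop (Suc k) vs"
    using Suc.prems by (simp add: take_Suc_conv_app_nth)
  finally show ?case .
qed

lemma conj_by_End:
  assumes a: "vlinear V a" and b: "unary b \<in> homogeneous (Sp (End_operad V) 1) 0"
    and n: "n \<ge> 1" and \<phi>: "\<phi> \<in> multilinear V n" and vs: "length vs = n"
  shows "dg_operad.conj_by (End_operad V) n (unary a) (unary b) \<phi> vs = a (\<phi> (map b vs))"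
proof -
  have eq: "pcomp (End_operad V) 1 n 1 (unary a) \<phi> = (\<lambda>vs. a (\<phi> vs))"
    using end_pcomp_unary_left[OF a n \<phi>] by simp
  have "pcomp (End_operad V) 1 n 1 (unary a) \<phi> \<in> carrier (Sp (End_operad V) n)"
    by (rule dg_operad.unary_comp_left_closed[OF dg_operad_End _ n]) (use \<phi> multilinear_unary[OF a] in auto)
  then have "(\<lambda>vs. a (\<phi> vs)) \<in> multilinear V n" unfolding eq by simp
  from precomp_End[OF b this, of n vs] vs show ?thesis
    by (simp add: dg_operad.conj_by_def[OF dg_operad_End] eq[simplified] del: upt_Suc)
qed

end

locale even_map = V: dg_vect_space V + W: dg_vect_space W
  for V :: "('k::field_char_0, 'v::ab_group_add) dg_vect" and W :: "('k, 'w::ab_group_add) dg_vect" +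
  fixes g :: "'v \<Rightarrow> 'w"
  assumes add: "g (x + y) = g x + g y" and scale: "g (vscale V c x) = vscale W c (g x)"
    and hc: "g (vhcomp V e x) = vhcomp W e (g x)"
begin

lemma zero [simp]: "g 0 = 0"
  using add[of 0 0] by simp

lemma minus: "g (- x) = - g x"
  using add[of x "- x"] by (simp add: eq_neg_iff_add_eq_0 add.commute)

lemma diff: "g (x - y) = g x - g y"
  using add[of x "- y"] by (simp add: minus)

lemma sum: "g (sum F B) = (\<Sum>b\<in>B. g (F b))"
  by (induction B rule: infinite_finite_induct) (simp_all add: add)

lemma sign: "g (vsign V x) = vsign W (g x)"
  by (simp add: vsign_def diff hc)

lemma map_hc: "map g (map2 (vhcomp V) ps vs) = map2 (vhcomp W) ps (map g vs)"
  by (rule nth_equalityI) (simp_all add: hc)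

end

text \<open>
  Operations of $V$ are moved to $W$ along dg linear maps \<open>i\<close> from $V$ to $W$ and \<open>p\<close> back.
\<close>

locale dg_map_pair = i: even_map V W i + p: even_map W V p
  for V :: "('k::field_char_0, 'v::ab_group_add) dg_vect" and W :: "('k, 'w::ab_group_add) dg_vect"
    and i :: "'v \<Rightarrow> 'w" and p :: "'w \<Rightarrow> 'v" +
  assumes i_dif: "i (vdif V x) = vdif W (i x)" and p_dif: "p (vdif W y) = vdif V (p y)"
begin

definition transport :: "('v list \<Rightarrow> 'v) \<Rightarrow> 'w list \<Rightarrow> 'w" where
  "transport \<phi> ws = i (\<phi> (map p ws))"

text \<open>
  The inner operations for which transport preserves compositions: between the two operations the factor
  \<open>p \<circ> i\<close> appears.
\<close>

definition fixed :: "nat \<Rightarrow> ('v list \<Rightarrow> 'v) set" where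
  "fixed n = {\<phi> \<in> multilinear V n. \<forall>us. p (i (\<phi> us)) = \<phi> us}"

lemma transport_sign: "end_sign W (transport \<phi>) = transport (end_sign V \<phi>)"
  by (rule ext) (simp add: end_sign_def transport_def i.sign p.sign o_def)

lemma transport_hcomp: "end_hcomp W e (transport \<phi>) = transport (end_hcomp V e \<phi>)"
  by (rule ext) (simp add: i.V.end_hcomp_eq i.W.end_hcomp_eq transport_sign transport_def i.add i.scale)

lemma transport_multilinear:
  assumes \<phi>: "\<phi> \<in> multilinear V n"
  shows "transport \<phi> \<in> multilinear W n"
proof (rule i.W.multilinearI)
  note sl = i.V.slot_simps[OF i.V.multilinearD[OF \<phi>]]
  show "i.W.slotwise_linear n (transport \<phi>)"
    by (rule i.W.slotwise_linearI) (simp_all add: transport_def p.add p.scale sl i.add i.scale)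
qed (simp add: transport_def i.V.multilinear_length[OF \<phi>])

lemma transport_dif: "end_dif W (transport \<phi>) = transport (end_dif V \<phi>)"
proof
  fix ws
  have "i.W.dsum (transport \<psi>) ws = i (i.V.dsum \<psi> (map p ws))" for \<psi>
    by (simp add: i.V.dsum_def i.W.dsum_def transport_def i.sum take_map drop_map p_dif p.sign o_def)
  then show "end_dif W (transport \<phi>) ws = transport (end_dif V \<phi>) ws"
    by (simp add: i.V.end_dif_eq i.W.end_dif_eq transport_sign) (simp add: transport_def i.diff i_dif i.V.end_dif_eq)
qed

lemma transport_act:
  assumes \<sigma>: "\<sigma> permutes {1..n}"
  shows "end_act W n (transport \<phi>) \<sigma> = transport (end_act V n \<phi> \<sigma>)"
proof
  fix ws show "end_act W n (transport \<phi>) \<sigma> ws = transport (end_act V n \<phi> \<sigma>) ws"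
  proof (cases "length ws = n")
    case True
    have "map p (act_list \<sigma> (map2 (vhcomp W) ps ws)) = act_list \<sigma> (map2 (vhcomp V) ps (map p ws))"
      if "length ps = n" for ps
      using act_list_map[of \<sigma> "map2 (vhcomp W) ps ws" p] \<sigma> True that by (simp only: p.map_hc) simp
    then show ?thesis
      using True \<sigma> by (simp add: i.V.end_act_eq i.W.end_act_eq transport_def i.sum i.scale)
  qed (simp add: i.V.end_act_length i.W.end_act_length transport_def)
qed

lemma fixed_sign: "\<phi> \<in> fixed n \<Longrightarrow> end_sign V \<phi> \<in> fixed n"
  by (simp add: fixed_def i.V.multilinear_sign) (simp add: end_sign_def i.sign p.sign)

lemma fixed_hcomp: "\<phi> \<in> fixed n \<Longrightarrow> p (i (end_hcomp V e \<phi> us)) = end_hcomp V e \<phi> us"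
  using fixed_sign[of \<phi> n] by (simp add: fixed_def i.V.end_hcomp_eq i.add i.scale p.add p.scale)

lemma transport_pcomp:
  assumes "\<psi> \<in> fixed n"
  shows "transport (end_pcomp V m n j \<phi> \<psi>) = end_pcomp W m n j (transport \<phi>) (transport \<psi>)"
  by (rule ext) (simp add: transport_def[of "end_pcomp V m n j \<phi> \<psi>"] end_pcomp_def Let_def transport_hcomp, simp add: transport_def take_map drop_map
      fixed_hcomp[OF assms] i.add p.sign o_def)

sublocale coeff_map "End_operad V" "End_operad W" "\<lambda>n. transport" fixed
proof (intro coeff_map.intro i.V.dg_operad_End i.W.dg_operad_End coeff_map_axioms.intro)
  fix n :: nat
  show "linear_map (Sp (End_operad V) n) (Sp (End_operad W) n) transport"
    by (simp add: linear_map_def transport_multilinear) (simp add: transport_def fun_eq_iff i.add i.scale)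
qed (auto simp: transport_hcomp transport_dif transport_act transport_pcomp fixed_sign, auto simp: fixed_def)

lemma transport_unary: "transport (unary g) = unary (\<lambda>w. i (g (p w)))"
  by (rule ext) (auto simp: transport_def unary_def hd_map length_Suc_conv One_nat_def)

end

section \<open>The cylinder\<close>

context dg_vect_space
begin

text \<open>
  The summand \<open>z\<close> has shifted parity, so that its differential carries a sign and the component from \<open>z\<close>
  to \<open>y\<close> is odd.
\<close>

definition cylinder :: "('k, 'v \<times> 'v \<times> 'v) dg_vect" where
  "cylinder =
    \<lparr>vscale = (\<lambda>c (x, y, z). (c \<cdot> x, c \<cdot> y, c \<cdot> z)),
     vhcomp = (\<lambda>p (x, y, z). (h p x, h p y, h (p + 1) z)),
     vdif = (\<lambda>(x, y, z). (d x, d y + z, - d z))\<rparr>"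

lemma cylinder_simps [simp]:
  "vscale cylinder c (x, y, z) = (c \<cdot> x, c \<cdot> y, c \<cdot> z)"
  "vhcomp cylinder p (x, y, z) = (h p x, h p y, h (p + 1) z)"
  "vdif cylinder (x, y, z) = (d x, d y + z, - d z)"
  by (simp_all add: cylinder_def)

lemma cylinder_sign [simp]: "vsign cylinder (x, y, z) = (S x, S y, - S z)"
  by (simp add: vsign_def)

lemma cylinder_vector_space: "vector_space (vscale cylinder)"
  by unfold_locales (auto simp: vs.scale_right_distrib vs.scale_left_distrib)

lemma cylinder_linearI:
  assumes "\<And>x y. f (x + y) = f x + f y" "\<And>c x. f (vscale cylinder c x) = vscale cylinder c (f x)"
  shows "vlinear cylinder f"
  using assms cylinder_vector_space by (simp add: Vector_Spaces.linear_iff)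

lemma dg_cylinder: "dg_vector_space cylinder"
  unfolding dg_vector_space_def
proof (intro conjI allI)
  show "vector_space (vscale cylinder)" by (rule cylinder_vector_space)
  show "vlinear cylinder (vhcomp cylinder p)" for p by (rule cylinder_linearI) auto
  show "vlinear cylinder (vdif cylinder)"
    by (rule cylinder_linearI) (auto simp: vs.scale_right_distrib)
  show "vhcomp cylinder (p + 1) (vdif cylinder v) = vdif cylinder (vhcomp cylinder p v)" for p v
    by (cases v) (use h_d[of p] h_d[of "p + 1"] bit_cases[of p] in auto)
  show "vhcomp cylinder p (vhcomp cylinder q v) = (if p = q then vhcomp cylinder p v else 0)" for p q v
    by (cases v) (auto simp: zero_prod_def)
  show "vhcomp cylinder 0 v + vhcomp cylinder 1 v = v" for v
    by (cases v) (use h_sum in \<open>auto simp: add.commute\<close>)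
  show "vdif cylinder (vdif cylinder v) = 0" for v
    by (cases v) (auto simp: zero_prod_def)
qed

definition "cyl_s = (\<lambda>(x :: 'v, y :: 'v, z :: 'v). (0 :: 'v, 0 :: 'v, y))"
definition "cyl_t = (\<lambda>(x :: 'v, y :: 'v, z :: 'v). (x, 0 :: 'v, 0 :: 'v))"
definition "cyl_j = (\<lambda>(x :: 'v, y :: 'v, z :: 'v). (0 :: 'v, x, 0 :: 'v))"
definition "cyl_q = (\<lambda>(x :: 'v, y :: 'v, z :: 'v). (y, 0 :: 'v, 0 :: 'v))"
definition "cyl_r = (\<lambda>(x :: 'v, y :: 'v, z :: 'v). (z, 0 :: 'v, 0 :: 'v))"
definition "cyl_in = (\<lambda>v :: 'v. (v, 0 :: 'v, 0 :: 'v))"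

lemmas cyl_defs = cyl_s_def cyl_t_def cyl_j_def cyl_q_def cyl_r_def cyl_in_def

lemma cyl_linear:
  "vlinear cylinder cyl_s" "vlinear cylinder cyl_t" "vlinear cylinder cyl_j" "vlinear cylinder cyl_q" "vlinear cylinder cyl_r"
  by (auto intro!: cylinder_linearI simp: cyl_defs split_beta)

end

locale cylinder_space = dg_vect_space V for V :: "('k::field_char_0, 'v::ab_group_add) dg_vect"
begin

sublocale U: dg_vect_space cylinder
  by unfold_locales (rule dg_cylinder)

sublocale EV: dg_operad "End_operad V" by (rule dg_operad_End)
sublocale EU: dg_operad "End_operad cylinder" by (rule U.dg_operad_End)
sublocale TV: dg_operad "tensor_D (End_operad V)" by (rule EV.dg_operad_tensor_D)
sublocale TU: dg_operad "tensor_D (End_operad cylinder)" by (rule EU.dg_operad_tensor_D)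

sublocale E: dg_map_pair V cylinder cyl_in fst
  by unfold_locales (auto simp: cyl_in_def)

sublocale C: dg_map_pair cylinder V fst cyl_in
  by unfold_locales (auto simp: cyl_in_def)

abbreviation const where "const g \<equiv> const_D (End_operad cylinder) 1 (unary g)"

sublocale const: operad_hom "End_operad cylinder" "tensor_D (End_operad cylinder)" "const_D (End_operad cylinder)"
  by unfold_locales (rule EU.operad_map_const_D)

lemma cyl_hom:
  "unary cyl_s \<in> homogeneous (Sp (End_operad cylinder) 1) 1"
  "unary cyl_t \<in> homogeneous (Sp (End_operad cylinder) 1) 0"
  "unary cyl_j \<in> homogeneous (Sp (End_operad cylinder) 1) 0"
  "unary cyl_q \<in> homogeneous (Sp (End_operad cylinder) 1) 0"
  "unary cyl_r \<in> homogeneous (Sp (End_operad cylinder) 1) 1"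
  by (rule U.homogeneous_unary, rule cyl_linear, clarsimp simp: cyl_defs)+

lemmas cyl_carrier = cyl_hom[THEN EU.homogeneous_closed[OF le_refl]]

lemma const_mul:
  assumes "vlinear cylinder f" "vlinear cylinder g"
  shows "pcomp (tensor_D (End_operad cylinder)) 1 1 1 (const f) (const g) = const (\<lambda>u. f (g u))"
  using const.mul[of "unary f" "unary g"] U.multilinear_unary assms U.mul_unary[OF assms] by simp

lemma const_dif:
  assumes "vlinear cylinder g"
  shows "dif (Sp (tensor_D (End_operad cylinder)) 1) (const g) =
    const (\<lambda>v. vdif cylinder (g v) - vsign cylinder (g (vsign cylinder (vdif cylinder v))))"
  using operad_mapD(3)[OF const.hom le_refl, of "unary g"] U.multilinear_unary[OF assms]
  unfolding U.dif_unary[OF assms] by simp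

lemma unary_zero: "unary (\<lambda>_. 0) = (\<lambda>_. 0)"
  by (auto simp: unary_def)

lemma const_zero: "const (\<lambda>_. 0) = zero (Sp (tensor_D (End_operad cylinder)) 1)"
  by (simp add: const_D_def unary_zero fun_eq_iff)

text \<open>
  The operation \<open>\<eta>\<close> of \<open>V\<close> is transported to the first summand of the cylinder, where \<open>cyl_t\<close> is the
  identity. All other equations hold already between linear maps of the cylinder.
\<close>

lemma cylinder_data:
  assumes \<eta>: "\<eta> \<in> homogeneous (tensor_D_space (Sp (End_operad V) 1)) 1"
  shows "cylinder_data (tensor_D (End_operad cylinder)) (const cyl_s) (const cyl_t) (const cyl_j) (const cyl_q) (const cyl_r)
    (\<lambda>e k. E.transport (\<eta> e k))"
proof (intro cylinder_data.intro cylinder_data_axioms.intro TU.dg_operad_axioms)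
  have hom: "const g \<in> homogeneous (Sp (tensor_D (End_operad cylinder)) 1) p"
    if "unary g \<in> homogeneous (Sp (End_operad cylinder) 1) p" for g p
    by (rule const.homogeneous[OF le_refl that])
  show "const cyl_s \<in> homogeneous (Sp (tensor_D (End_operad cylinder)) 1) 1"
    "const cyl_t \<in> homogeneous (Sp (tensor_D (End_operad cylinder)) 1) 0"
    "const cyl_j \<in> homogeneous (Sp (tensor_D (End_operad cylinder)) 1) 0"
    "const cyl_q \<in> homogeneous (Sp (tensor_D (End_operad cylinder)) 1) 0"
    "const cyl_r \<in> homogeneous (Sp (tensor_D (End_operad cylinder)) 1) 1"
    by (rule hom, rule cyl_hom)+
  interpret N: dg_space "Sp (End_operad V) 1" by (rule EV.space) simp
  interpret NU: dg_space "Sp (End_operad cylinder) 1" by (rule EU.space) simp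
  have \<eta>c: "\<eta> e k \<in> multilinear V 1" and \<eta>h: "end_hcomp V (1 + e) (\<eta> e k) = \<eta> e k" for e k
    using \<eta> unfolding N.homogeneous_tensor_D by (auto simp: homogeneous_def)
  have Ec: "(\<lambda>e k. E.transport (\<eta> e k)) \<in> carrier (tensor_D_space (Sp (End_operad cylinder) 1))"
    using E.coeffwise_closed[of 1 \<eta>] \<eta> unfolding N.homogeneous_tensor_D by simp
  then show "(\<lambda>e k. E.transport (\<eta> e k)) \<in> homogeneous (Sp (tensor_D (End_operad cylinder)) 1) 1"
    using \<eta>h by (simp add: homogeneous_def E.transport_hcomp)
  have two: "1 + 1 - 1 = (1 :: nat)" by arith
  have "pcomp (tensor_D (End_operad cylinder)) 1 1 1 (const cyl_t) (\<lambda>e k. E.transport (\<eta> e k)) =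
      (\<lambda>e k. pcomp (End_operad cylinder) 1 1 1 (unary cyl_t) (E.transport (\<eta> e k)))"
    by (rule EU.const_D_pcomp_left) (use cyl_carrier Ec in auto)
  also have "\<dots> = (\<lambda>e k. E.transport (\<eta> e k))"
    by (simp add: U.end_pcomp_unary_left[OF cyl_linear(2) le_refl E.transport_multilinear[OF \<eta>c]],
        simp add: E.transport_def fun_eq_iff, simp add: cyl_defs)
  finally show "pcomp (tensor_D (End_operad cylinder)) 1 1 1 (const cyl_t) (\<lambda>e k. E.transport (\<eta> e k)) = (\<lambda>e k. E.transport (\<eta> e k))" .
  have "pcomp (tensor_D (End_operad cylinder)) 1 1 1 (\<lambda>e k. E.transport (\<eta> e k)) (const cyl_t) =
      (\<lambda>e k. pcomp (End_operad cylinder) 1 1 1 (E.transport (\<eta> e k)) (unary cyl_t))"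
    by (rule EU.const_D_pcomp_right) (use cyl_hom Ec in auto)
  also have "\<dots> = (\<lambda>e k. E.transport (\<eta> e k))"
  proof (intro ext)
    fix e k us
    show "pcomp (End_operad cylinder) 1 1 1 (E.transport (\<eta> e k)) (unary cyl_t) us = E.transport (\<eta> e k) us"
    proof (cases "length us = 1")
      case True
      then obtain u where u: "us = [u]" by (auto simp: length_Suc_conv One_nat_def)
      have "end_pcomp cylinder 1 1 (Suc 0) (E.transport (\<eta> e k)) (unary cyl_t) us = E.transport (\<eta> e k) (us[0 := cyl_t (us ! 0)])"
        by (rule U.end_pcomp_unary)
          (use True cyl_hom(2) U.multilinearD[OF E.transport_multilinear[OF \<eta>c]] in \<open>auto simp: U.homogeneous_End\<close>)
      then show ?thesis by (simp add: u flip: One_nat_def, simp add: E.transport_def, simp add: cyl_defs split_beta)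
    next
      case False
      then show ?thesis
        using U.end_pcomp_length[of us 1 1] U.multilinear_length[OF E.transport_multilinear[OF \<eta>c]] by simp
    qed
  qed
  finally show "pcomp (tensor_D (End_operad cylinder)) 1 1 1 (\<lambda>e k. E.transport (\<eta> e k)) (const cyl_t) = (\<lambda>e k. E.transport (\<eta> e k))" .
  note mul = const_mul[OF cyl_linear(1) cyl_linear(1)] const_mul[OF cyl_linear(2) cyl_linear(2)]
    const_mul[OF cyl_linear(1) cyl_linear(2)] const_mul[OF cyl_linear(2) cyl_linear(1)]
    const_mul[OF cyl_linear(2) cyl_linear(3)] const_mul[OF cyl_linear(4) cyl_linear(2)]
    const_mul[OF cyl_linear(5) cyl_linear(2)] const_mul[OF cyl_linear(4) cyl_linear(3)] const_mul[OF cyl_linear(5) cyl_linear(3)]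
  have z: "(0 :: 'v, 0 :: 'v, 0 :: 'v) = 0" by (simp add: zero_prod_def)
  show "pcomp (tensor_D (End_operad cylinder)) 1 1 1 (const cyl_s) (const cyl_s) = zero (Sp (tensor_D (End_operad cylinder)) 1)"
    "pcomp (tensor_D (End_operad cylinder)) 1 1 1 (const cyl_s) (const cyl_t) = zero (Sp (tensor_D (End_operad cylinder)) 1)"
    "pcomp (tensor_D (End_operad cylinder)) 1 1 1 (const cyl_t) (const cyl_s) = zero (Sp (tensor_D (End_operad cylinder)) 1)"
    "pcomp (tensor_D (End_operad cylinder)) 1 1 1 (const cyl_t) (const cyl_j) = zero (Sp (tensor_D (End_operad cylinder)) 1)"
    "pcomp (tensor_D (End_operad cylinder)) 1 1 1 (const cyl_q) (const cyl_t) = zero (Sp (tensor_D (End_operad cylinder)) 1)"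
    "pcomp (tensor_D (End_operad cylinder)) 1 1 1 (const cyl_r) (const cyl_t) = zero (Sp (tensor_D (End_operad cylinder)) 1)"
    "pcomp (tensor_D (End_operad cylinder)) 1 1 1 (const cyl_r) (const cyl_j) = zero (Sp (tensor_D (End_operad cylinder)) 1)"
    unfolding mul const_zero[symmetric] by (simp_all add: cyl_defs split_beta z)
  have idem: "(\<lambda>u. cyl_t (cyl_t u)) = cyl_t" "(\<lambda>u. cyl_q (cyl_j u)) = cyl_t"
    by (auto simp: cyl_defs fun_eq_iff)
  show "pcomp (tensor_D (End_operad cylinder)) 1 1 1 (const cyl_t) (const cyl_t) = const cyl_t"
    "pcomp (tensor_D (End_operad cylinder)) 1 1 1 (const cyl_q) (const cyl_j) = const cyl_t"
    unfolding mul by (simp_all add: idem)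
  have dif: "dif (Sp (tensor_D (End_operad cylinder)) 1) (const f) = const g"
    if "vlinear cylinder f" "\<And>x y z. vdif cylinder (f (x, y, z)) - vsign cylinder (f (vsign cylinder (vdif cylinder (x, y, z)))) = g (x, y, z)" for f g
  proof -
    have "(\<lambda>v. vdif cylinder (f v) - vsign cylinder (f (vsign cylinder (vdif cylinder v)))) = g"
      using that(2) by (auto simp: fun_eq_iff split_paired_all)
    then show ?thesis using const_dif[OF that(1)] by simp
  qed
  show "dif (Sp (tensor_D (End_operad cylinder)) 1) (const cyl_t) = zero (Sp (tensor_D (End_operad cylinder)) 1)"
    "dif (Sp (tensor_D (End_operad cylinder)) 1) (const cyl_j) = zero (Sp (tensor_D (End_operad cylinder)) 1)"
    "dif (Sp (tensor_D (End_operad cylinder)) 1) (const cyl_r) = zero (Sp (tensor_D (End_operad cylinder)) 1)"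
    unfolding const_zero[symmetric] by (rule dif[OF cyl_linear(2)] dif[OF cyl_linear(3)] dif[OF cyl_linear(5)];
      simp add: cyl_defs S_d zero_prod_def)+
  have "dif (Sp (tensor_D (End_operad cylinder)) 1) (const cyl_s) = const (\<lambda>u. u - cyl_t u)"
    by (rule dif[OF cyl_linear(1)]) (simp add: cyl_defs S_d zero_prod_def)
  also have "\<dots> = ounit (tensor_D (End_operad cylinder)) \<oplus>\<^bsub>Sp (tensor_D (End_operad cylinder)) 1\<^esub>
      (-1) \<odot>\<^bsub>Sp (tensor_D (End_operad cylinder)) 1\<^esub> const cyl_t"
    by (auto simp: const_D_def unary_def fun_eq_iff)
  finally show "dif (Sp (tensor_D (End_operad cylinder)) 1) (const cyl_s) = \<dots>" .
  have "dif (Sp (tensor_D (End_operad cylinder)) 1) (const cyl_q) = const (\<lambda>u. - cyl_r u)"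
    by (rule dif[OF cyl_linear(4)]) (simp add: cyl_defs S_d zero_prod_def)
  also have "\<dots> = (-1) \<odot>\<^bsub>Sp (tensor_D (End_operad cylinder)) 1\<^esub> const cyl_r"
    by (auto simp: const_D_def unary_def fun_eq_iff)
  finally show "dif (Sp (tensor_D (End_operad cylinder)) 1) (const cyl_q) = \<dots>" .
qed

end

section \<open>Intertwiners and invariant subspaces\<close>

context even_map
begin

text \<open>
  The relation $g \circ \phi = \psi \circ g^{\otimes n}$. It survives all operations of the endomorphism operad except the
  differential, as \<open>g\<close> need not be a chain map.
\<close>

definition intertwines :: "nat \<Rightarrow> ('v list \<Rightarrow> 'v) \<Rightarrow> ('w list \<Rightarrow> 'w) \<Rightarrow> bool" where
  "intertwines n \<phi> \<psi> \<longleftrightarrow> (\<forall>us. length us = n \<longrightarrow> g (\<phi> us) = \<psi> (map g us))"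

lemma intertwines_hcomp: "intertwines n \<phi> \<psi> \<Longrightarrow> intertwines n (end_hcomp V e \<phi>) (end_hcomp W e \<psi>)"
  by (simp add: intertwines_def V.end_hcomp_eq W.end_hcomp_eq end_sign_def add scale sign o_def)

lemma intertwines_act:
  assumes \<sigma>: "\<sigma> permutes {1..n}" and \<phi>: "intertwines n \<phi> \<psi>"
  shows "intertwines n (end_act V n \<phi> \<sigma>) (end_act W n \<psi> \<sigma>)"
  unfolding intertwines_def
proof (intro allI impI)
  fix us :: "'v list" assume us: "length us = n"
  have "g (\<phi> (act_list \<sigma> (map2 (vhcomp V) ps us))) = \<psi> (act_list \<sigma> (map2 (vhcomp W) ps (map g us)))"
    if "length ps = n" for ps
  proof -
    have "map g (act_list \<sigma> (map2 (vhcomp V) ps us)) = act_list \<sigma> (map2 (vhcomp W) ps (map g us))"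
      using act_list_map[of \<sigma> "map2 (vhcomp V) ps us" g] \<sigma> us that by (simp only: map_hc) simp
    moreover have "length (act_list \<sigma> (map2 (vhcomp V) ps us)) = n" using us that by simp
    ultimately show ?thesis using \<phi> unfolding intertwines_def by metis
  qed
  then show "g (end_act V n \<phi> \<sigma> us) = end_act W n \<psi> \<sigma> (map g us)"
    using us \<sigma> by (simp add: V.end_act_eq W.end_act_eq sum scale)
qed

lemma intertwines_pcomp:
  assumes n: "n \<ge> 1" and i: "i \<in> {1..m}" and \<phi>: "intertwines m \<phi> \<phi>'" and \<psi>: "intertwines n \<psi> \<psi>'"
  shows "intertwines (m + n - 1) (end_pcomp V m n i \<phi> \<psi>) (end_pcomp W m n i \<phi>' \<psi>')"
  unfolding intertwines_def
proof (intro allI impI)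
  fix us :: "'v list" assume us: "length us = m + n - 1"
  obtain l where l: "i = Suc l" "l < m" using i by (cases i) auto
  obtain as bs cs where split: "us = as @ bs @ cs" "length as = l" "length bs = n" "Suc (l + length cs) = m"
    using V.block_split[OF us l(2) n] .
  have h: "g (end_hcomp V e \<psi> bs) = end_hcomp W e \<psi>' (map g bs)" for e
    using intertwines_hcomp[OF \<psi>, of e] split(3) by (simp add: intertwines_def)
  have e1: "end_pcomp V m n i \<phi> \<psi> us =
      \<phi> (as @ end_hcomp V 0 \<psi> bs # cs) + \<phi> (map (vsign V) as @ end_hcomp V 1 \<psi> bs # cs)"
    unfolding split(1) l(1) by (rule V.end_pcomp_block[OF split(2-4)])
  have e2: "end_pcomp W m n i \<phi>' \<psi>' (map g us) =
      \<phi>' (map g as @ end_hcomp W 0 \<psi>' (map g bs) # map g cs) +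
      \<phi>' (map (vsign W) (map g as) @ end_hcomp W 1 \<psi>' (map g bs) # map g cs)"
    unfolding split(1) l(1) map_append by (rule W.end_pcomp_block) (use split in simp_all)
  have "g (\<phi> (as @ end_hcomp V 0 \<psi> bs # cs)) = \<phi>' (map g (as @ end_hcomp V 0 \<psi> bs # cs))"
    "g (\<phi> (map (vsign V) as @ end_hcomp V 1 \<psi> bs # cs)) = \<phi>' (map g (map (vsign V) as @ end_hcomp V 1 \<psi> bs # cs))"
    using \<phi> split unfolding intertwines_def by (metis length_append length_map length_Cons add_Suc_right)+
  then show "g (end_pcomp V m n i \<phi> \<psi> us) = end_pcomp W m n i \<phi>' \<psi>' (map g us)"
    unfolding e1 e2 by (simp add: add h sign o_def)
qed

text \<open>
  Evaluation of terms does not involve the differential, so it suffices to intertwine the images of the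
  generators.
\<close>

lemma intertwines_eval:
  assumes P: "dg_operad P"
    and f: "\<And>n x. n \<ge> 1 \<Longrightarrow> x \<in> carrier (Sp P n) \<Longrightarrow> intertwines n (f n x) (f' n x)"
    and s: "intertwines 1 s s'" and t: "intertwines 1 t t'"
  shows "bv_wf P u \<Longrightarrow>
    intertwines (bv_arity u) (bv_eval (End_operad V) f s t u) (bv_eval (End_operad W) f' s' t' u)"
proof (induction u)
  case (Gen n x) then show ?case by (simp add: f)
next
  case (Comp u i v)
  then show ?case using dg_operad.bv_arity_pos[OF P, of v] by (auto intro: intertwines_pcomp)
next
  case (Act u \<sigma>)
  then show ?case by (auto intro: intertwines_act)
next
  case (Add u v)
  then show ?case by (simp add: intertwines_def add)
next
  case (Scale c u)
  then show ?case by (simp add: intertwines_def scale)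
qed (simp_all add: s t)

end

text \<open>
  If a graded subspace contains all values in arity at least two and is preserved in arity one, then evaluation
  has the same property. In a composition of arity at least two with unary outer operation, the inner operation
  has arity at least two.
\<close>

lemma (in dg_vect_space) invariant_eval:
  assumes P: "dg_operad P"
    and A: "0 \<in> A" "\<And>x y. x \<in> A \<Longrightarrow> y \<in> A \<Longrightarrow> x + y \<in> A" "\<And>c x. x \<in> A \<Longrightarrow> c \<cdot> x \<in> A" "\<And>p x. x \<in> A \<Longrightarrow> h p x \<in> A"
    and f: "\<And>n x us. n \<ge> 1 \<Longrightarrow> x \<in> carrier (Sp P n) \<Longrightarrow> length us = n \<Longrightarrow> n \<ge> 2 \<or> set us \<subseteq> A \<Longrightarrow> f n x us \<in> A"
    and s: "\<And>v. v \<in> A \<Longrightarrow> s [v] \<in> A" and t: "\<And>v. v \<in> A \<Longrightarrow> t [v] \<in> A"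
  shows "bv_wf P u \<Longrightarrow> length us = bv_arity u \<Longrightarrow> bv_arity u \<ge> 2 \<or> set us \<subseteq> A \<Longrightarrow>
    bv_eval (End_operad V) f s t u us \<in> A"
proof (induction u arbitrary: us)
  case (Gen n x)
  then show ?case using f by simp
next
  case GenS
  then obtain v where "us = [v]" by (auto simp: length_Suc_conv One_nat_def)
  then show ?case using GenS s by simp
next
  case GenT
  then obtain v where "us = [v]" by (auto simp: length_Suc_conv One_nat_def)
  then show ?case using GenT t by simp
next
  case (Add u v)
  then show ?case using A(2) by simp
next
  case (Scale c u)
  then show ?case using A(3) by simp
next
  case (Act u \<sigma>)
  define n where "n = bv_arity u"
  have \<sigma>: "\<sigma> permutes {1..n}" and us: "length us = n" using Act.prems by (simp_all add: n_def)
  have sums: "sum F B \<in> A" if "\<And>b. b \<in> B \<Longrightarrow> F b \<in> A" for F :: "bit list \<Rightarrow> 'v" and B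
    using that by (induction B rule: infinite_finite_induct) (simp_all add: A(1,2))
  have "bv_eval (End_operad V) f s t u (act_list \<sigma> (map2 h ps us)) \<in> A" if ps: "length ps = n" for ps
  proof (rule Act.IH)
    show "bv_wf P u" using Act.prems by simp
    show "length (act_list \<sigma> (map2 h ps us)) = bv_arity u" using us ps by (simp add: n_def)
    have "set (act_list \<sigma> (map2 h ps us)) = set (map2 h ps us)"
      by (rule set_act_list) (use us ps \<sigma> in simp)
    moreover have "set (map2 h ps us) \<subseteq> A" if "set us \<subseteq> A"
      using that A(4) by (auto dest!: set_zip_rightD)
    ultimately show "2 \<le> bv_arity u \<or> set (act_list \<sigma> (map2 h ps us)) \<subseteq> A" using Act.prems by auto
  qed
  then show ?case using us \<sigma> by (simp add: end_act_eq flip: n_def) (auto intro!: sums A(3))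
next
  case (Comp u i v)
  define m n where "m = bv_arity u" and "n = bv_arity v"
  have i: "i \<in> {1..m}" and wf: "bv_wf P u" "bv_wf P v" and us: "length us = m + n - 1"
    using Comp.prems by (auto simp: m_def n_def)
  have n: "n \<ge> 1" using dg_operad.bv_arity_pos[OF P wf(2)] by (simp add: n_def)
  obtain l where l: "i = Suc l" "l < m" using i by (cases i) auto
  obtain as bs cs where split: "us = as @ bs @ cs" "length as = l" "length bs = n" "Suc (l + length cs) = m"
    using block_split[OF us l(2) n] .
  let ?u = "bv_eval (End_operad V) f s t u" and ?v = "bv_eval (End_operad V) f s t v"
  have S: "S x \<in> A" if "x \<in> A" for x
    using A(2)[OF A(4)[OF that, of 0] A(3)[OF A(4)[OF that, of 1], of "- 1"]] by (simp add: vsign_def)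
  have inner: "end_hcomp V e ?v bs \<in> A" if "m = 1" for e
  proof -
    have big: "n \<ge> 2 \<or> set bs \<subseteq> A" using Comp.prems(3) that split by (auto simp: m_def n_def)
    have "?v bs \<in> A" by (rule Comp.IH(2)) (use wf split(3) big in \<open>auto simp: n_def\<close>)
    moreover have "?v (map S bs) \<in> A"
      by (rule Comp.IH(2)) (use wf split(3) big S in \<open>auto simp: n_def\<close>)
    ultimately show ?thesis unfolding end_hcomp_eq end_sign_def by (intro A(2,3) S)
  qed
  have outer: "?u (as' @ end_hcomp V e ?v bs # cs) \<in> A" if "length as' = l" for as' e
  proof (rule Comp.IH(1)[OF wf(1)])
    show "length (as' @ end_hcomp V e ?v bs # cs) = bv_arity u" using that split(4) by (simp add: m_def)
    show "2 \<le> bv_arity u \<or> set (as' @ end_hcomp V e ?v bs # cs) \<subseteq> A"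
    proof (cases "m = 1")
      case True
      then have "as' = []" "cs = []" using that split(4) by (auto simp: One_nat_def)
      then show ?thesis using inner[OF True] by simp
    next
      case False
      then show ?thesis using l by (auto simp: m_def One_nat_def)
    qed
  qed
  have "end_pcomp V m n i ?u ?v us = ?u (as @ end_hcomp V 0 ?v bs # cs) + ?u (map S as @ end_hcomp V 1 ?v bs # cs)"
    unfolding split(1) l(1) by (rule end_pcomp_block[OF split(2-4)])
  moreover have "\<dots> \<in> A" by (intro A(2) outer) (simp_all add: split(2))
  ultimately show ?case by (simp add: m_def n_def)
qed

section \<open>Splittings and Hodge decompositions\<close>

context BV_target
begin

lemma target_natural:
  assumes "operad_hom Q R \<phi>"
  shows "BV_target P R (\<lambda>n x. \<phi> n (f n x)) (\<phi> 1 s) (\<phi> 1 t)"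
proof -
  interpret \<phi>: operad_hom Q R \<phi> by fact
  interpret U: dg_space "Sp Q 1" by (rule Q.space) simp
  show ?thesis
  proof (unfold_locales, goal_cases)
    case 1 show ?case by (rule operad_map_comp[OF f \<phi>.hom])
  next
    case 8
    then show ?case using operad_mapD(3)[OF \<phi>.hom, of 1 s] operad_mapD(6)[OF \<phi>.hom, of 1]
      by (simp add: dif_s \<phi>.add \<phi>.scale)
  next
    case 9
    then show ?case using operad_mapD(3)[OF \<phi>.hom, of 1 t] by (simp add: dif_t \<phi>.zero)
  qed (simp_all add: \<phi>.homogeneous s t ss tt st ts \<phi>.zero flip: \<phi>.mul)
qed

context
  fixes k assumes k: "operad_map P (bv P) k"
begin

text \<open>
  The image of the unit under \<open>k\<close> is \<open>t\<close>, so the values of the composite are fixed by \<open>t\<close> on both sides.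
\<close>

lemma splitting_unit:
  assumes n: "n \<ge> 1" and x: "x \<in> carrier (Sp P n)"
  shows "pcomp Q 1 n 1 t (bv_extend Q f s t n (k n x)) = bv_extend Q f s t n (k n x)"
    and "i \<in> {1..n} \<Longrightarrow> pcomp Q n 1 i (bv_extend Q f s t n (k n x)) t = bv_extend Q f s t n (k n x)"
proof -
  note map = operad_map_splitting[OF k]
  have u: "bv_extend Q f s t 1 (k 1 (ounit P)) = t" using operad_mapD(6)[OF map, of 1] by simp
  show "pcomp Q 1 n 1 t (bv_extend Q f s t n (k n x)) = bv_extend Q f s t n (k n x)"
    using operad_mapD(5)[OF map n, of 1 1 "ounit P" x] n x by (simp add: u P.unit_left)
  show "pcomp Q n 1 i (bv_extend Q f s t n (k n x)) t = bv_extend Q f s t n (k n x)" if "i \<in> {1..n}"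
    using operad_mapD(5)[OF map, of 1 i n x "ounit P"] that x by (simp add: u P.unit_right)
qed

end

end

lemma (in dg_vect_space) hodge_target:
  assumes P: "dg_operad P" and g: "operad_map P (End_operad V) g" and hodge: "hodge_decomposition V s t"
  shows "BV_target P (End_operad V) g (unary s) (unary t)"
proof -
  have s: "vlinear V s" and t: "vlinear V t" and sh: "h (p + 1) (s v) = s (h p v)" and th: "h (p + 0) (t v) = t (h p v)"
    and ss: "s (s v) = 0" and tt: "t (t v) = t v" and td: "t (d v) = d (t v)" and st: "s (t v) = 0" and ts: "t (s v) = 0"
    and ds: "d (s v) + s (d v) = v - t v" for p v
    using hodge by (auto simp: hodge_decomposition_def)
  have zero: "unary (\<lambda>v :: 'v. 0) = (\<lambda>_. 0 :: 'v)" by (auto simp: unary_def)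
  note sS = S_graded[OF s sh, simplified] and tS = S_graded[OF t th, simplified]
  have e1: "(\<lambda>v. d (s v) - S (s (S (d v)))) = (\<lambda>v. v - t v)" by (simp add: sS flip: ds)
  have e2: "(\<lambda>v. d (t v) - S (t (S (d v)))) = (\<lambda>v. 0)" by (simp add: tS td)
  show ?thesis
  proof (intro BV_target.intro BV_target_axioms.intro P dg_operad_End g)
    show "unary s \<in> homogeneous (Sp (End_operad V) 1) 1" by (rule homogeneous_unary[OF s sh])
    show "unary t \<in> homogeneous (Sp (End_operad V) 1) 0" by (rule homogeneous_unary[OF t th])
    show "dif (Sp (End_operad V) 1) (unary s) =
        ounit (End_operad V) \<oplus>\<^bsub>Sp (End_operad V) 1\<^esub> (-1) \<odot>\<^bsub>Sp (End_operad V) 1\<^esub> unary t"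
      unfolding dif_unary[OF s] e1 by (auto simp: unary_def)
    show "dif (Sp (End_operad V) 1) (unary t) = zero (Sp (End_operad V) 1)"
      unfolding dif_unary[OF t] e2 by (simp add: zero)
  qed (simp_all only: Sp_End mul_unary[unfolded Sp_End] s t ss tt st ts zero)
qed

text \<open>
  The endpoint at which nothing is deformed.
\<close>

lemma (in dg_vect_space) hodge_trivial: "hodge_decomposition V (\<lambda>_. 0) id"
  using vlinearI[of "\<lambda>_. 0"] id_linear by (simp add: hodge_decomposition_def)

text \<open>
  With the trivial decomposition, evaluation factors as \<open>g\<close> after the projection of \<open>bv P\<close> to \<open>P\<close>, of which \<open>k\<close>
  is a section.
\<close>

lemma (in dg_vect_space) hodge_extend_trivial:
  assumes P: "dg_operad P" and g: "operad_map P (End_operad V) g" and k: "bv_splitting P k"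
    and n: "n \<ge> 1" and x: "x \<in> carrier (Sp P n)"
  shows "hodge_extend V g (\<lambda>_. 0) id n (k n x) = g n x"
proof -
  interpret P: dg_operad P by fact
  interpret U: dg_space "Sp P 1" by (rule P.space) simp
  interpret g: operad_hom P "End_operad V" g
    by (intro operad_hom.intro operad_hom_axioms.intro P dg_operad_End g)
  interpret T: BV_target P P "\<lambda>n x. x" "\<zero>\<^bsub>Sp P 1\<^esub>" "ounit P"
    by unfold_locales
      (auto simp: operad_map_def linear_map_def U.homogeneous_zero P.unit_even P.mul_zero P.unit_left P.dif_unit U.add_minus_scale)
  interpret W: BV_target P "End_operad V" g "unary (\<lambda>_. 0)" "unary id"
    by (rule hodge_target[OF P g hodge_trivial])
  have kx: "k n x \<in> carrier (Sp (bv P) n)" and px: "bv_p P n (k n x) = x"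
    using linear_mapD(1)[OF operad_mapD(1)[OF _ n] x] k n x by (auto simp: bv_splitting_def)
  obtain u where u: "bv_wf P u" "bv_arity u = n" "k n x = bv_class P u" by (rule P.bv_carrier_class[OF n kx])
  note self = P.bv_class_self[OF u(1)]
  have "T.ev u = x"
    using px T.bv_extend_class[OF u(1) self, of n] by (simp add: bv_p_def BV_q_def bv_incl_def u(3))
  moreover have "g 1 \<zero>\<^bsub>Sp P 1\<^esub> = unary (\<lambda>_. 0)" using g.zero[of 1] by (auto simp: unary_def)
  moreover have "g 1 (ounit P) = unary id" using operad_mapD(6)[OF g, of 1] by simp
  ultimately have "g n x = W.ev u" using T.ev_natural[OF g, of g u] u by simp
  then show ?thesis
    unfolding hodge_extend_def u(3) using W.bv_extend_class[OF u(1) self, of n] by simp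
qed

lemma (in dg_operad) bv_extend_cong:
  assumes A: "A \<in> carrier (Sp (bv P) n)" and n: "n \<ge> 1"
    and eq: "\<And>n x. n \<ge> 1 \<Longrightarrow> x \<in> carrier (Sp P n) \<Longrightarrow> f n x = f' n x"
  shows "bv_extend Q f s t n A = bv_extend Q f' s t n A"
proof -
  have ev: "bv_wf P u \<Longrightarrow> bv_eval Q f s t u = bv_eval Q f' s t u" for u
    by (induction u) (simp_all add: eq)
  obtain u where u: "A = bv_class P u" by (rule bv_carrier_class[OF n A])
  have "bv_eval Q f s t ` A = bv_eval Q f' s t ` A"
    by (rule image_cong[OF HOL.refl]) (use ev bv_eq_wf in \<open>auto simp: u bv_class_def\<close>)
  then show ?thesis by (simp add: bv_extend_def)
qed

section \<open>Deforming an algebra structure\<close>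

lemma ounit_update_same: "Q\<lparr>ounit := ounit Q\<rparr> = (Q :: ('k, 'a) operad)"
  by (cases Q) simp

text \<open>
  A path \<open>G\<close> of algebra structures on \<open>V\<close> and an odd operation \<open>\<eta>\<close> with coefficients in forms, along which \<open>G\<close>
  is deformed.
\<close>

locale algebra_deformation = cylinder_space V + P: dg_operad P
  for V :: "('k::field_char_0, 'v::ab_group_add) dg_vect" and P :: "('k, 'a) operad" +
  fixes G :: "nat \<Rightarrow> 'a \<Rightarrow> bit \<Rightarrow> nat \<Rightarrow> 'v list \<Rightarrow> 'v" and \<eta> :: "bit \<Rightarrow> nat \<Rightarrow> 'v list \<Rightarrow> 'v"
    and k :: "nat \<Rightarrow> 'a \<Rightarrow> ('k, 'a) bv_term set"
  assumes adm: "admissible P" and G: "operad_map P (tensor_D (End_operad V)) G"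
    and \<eta>: "\<eta> \<in> homogeneous (tensor_D_space (Sp (End_operad V) 1)) 1"
    and k: "operad_map P (bv P) k"
begin

definition g where "g n x = (\<lambda>e l. E.transport (G n x e l))"
definition \<eta>' where "\<eta>' = (\<lambda>e l. E.transport (\<eta> e l))"

lemma G_closed: "n \<ge> 1 \<Longrightarrow> x \<in> carrier (Sp P n) \<Longrightarrow> G n x \<in> carrier (tensor_D_space (Sp (End_operad V) n))"
  using linear_mapD(1)[OF operad_mapD(1)[OF G]] by simp

lemma operad_map_g: "operad_map P ((tensor_D (End_operad cylinder))\<lparr>ounit := const cyl_t\<rparr>) g"
  unfolding g_def[abs_def]
proof (rule E.operad_map_coeffwise)
  show "operad_map P ((tensor_D (End_operad V))\<lparr>ounit := ounit (tensor_D (End_operad V))\<rparr>) G"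
    using G by (simp only: ounit_update_same)
  show "G n x e l \<in> E.fixed n" if "n \<ge> 1" "x \<in> carrier (Sp P n)" for n x e l
    using tensor_D_coeff[OF G_closed[OF that], of e l] by (simp add: E.fixed_def, simp add: cyl_in_def)
  show "E.transport (ounit (tensor_D (End_operad V)) e l) = const cyl_t e l" for e l
    by (auto simp: const_D_def E.transport_unary, auto simp: E.transport_def fun_eq_iff, auto simp: cyl_defs unary_def split_beta zero_prod_def)
qed

sublocale X: cylinder_map "tensor_D (End_operad cylinder)" "const cyl_s" "const cyl_t" "const cyl_j" "const cyl_q" "const cyl_r"
  \<eta>' P g
  unfolding \<eta>'_def by (intro cylinder_map.intro cylinder_data[OF \<eta>] P.dg_operad_axioms cylinder_map_axioms.intro adm operad_map_g)

definition H where "H n x = bv_extend (tensor_D (End_operad cylinder)) X.g_ext (const cyl_s) (const cyl_t) n (k n x)"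

definition F where "F n x = (\<lambda>e l. C.transport (H n x e l))"

lemma operad_map_H: "operad_map P ((tensor_D (End_operad cylinder))\<lparr>ounit := const cyl_t\<rparr>) H"
  unfolding H_def[abs_def] by (rule X.BV.operad_map_splitting[OF k])

lemma H_closed: "n \<ge> 1 \<Longrightarrow> x \<in> carrier (Sp P n) \<Longrightarrow> H n x \<in> carrier (tensor_D_space (Sp (End_operad cylinder) n))"
  using linear_mapD(1)[OF operad_mapD(1)[OF operad_map_H]] by simp

text \<open>
  The output of \<open>H\<close> lies in the first summand of the cylinder; hence restriction to that summand respects
  compositions.
\<close>

lemma H_fixed:
  assumes n: "n \<ge> 1" and x: "x \<in> carrier (Sp P n)"
  shows "H n x e l \<in> C.fixed n"
proof -
  have m: "H n x e l \<in> multilinear cylinder n" using tensor_D_coeff[OF H_closed[OF n x], of e l] by simp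
  have "pcomp (tensor_D (End_operad cylinder)) 1 n 1 (const cyl_t) (H n x) = H n x"
    unfolding H_def by (rule X.BV.splitting_unit(1)[OF k n x])
  moreover have "pcomp (tensor_D (End_operad cylinder)) 1 n 1 (const cyl_t) (H n x) =
      (\<lambda>e l. pcomp (End_operad cylinder) 1 n 1 (unary cyl_t) (H n x e l))"
    by (rule EU.const_D_pcomp_left) (use n cyl_carrier H_closed[OF n x] in auto)
  ultimately have "H n x e l = pcomp (End_operad cylinder) 1 n 1 (unary cyl_t) (H n x e l)" by metis
  also have "\<dots> = (\<lambda>us. cyl_t (H n x e l us))"
    using U.end_pcomp_unary_left[OF cyl_linear(2) n m] by simp
  finally have "cyl_t (H n x e l us) = H n x e l us" for us by metis
  moreover have "cyl_in (fst u) = cyl_t u" for u by (simp add: cyl_defs split_beta)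
  ultimately show ?thesis using m by (simp add: C.fixed_def)
qed

lemma operad_map_F: "operad_map P (tensor_D (End_operad V)) F"
proof -
  have "operad_map P ((tensor_D (End_operad V))\<lparr>ounit := ounit (tensor_D (End_operad V))\<rparr>) F"
    unfolding F_def[abs_def]
  proof (rule C.operad_map_coeffwise[OF operad_map_H H_fixed])
    show "C.transport (const cyl_t e l) = ounit (tensor_D (End_operad V)) e l" for e l
      by (auto simp: const_D_def C.transport_unary, auto simp: C.transport_def fun_eq_iff, auto simp: cyl_defs unary_def split_beta)
  qed
  then show ?thesis by (simp only: ounit_update_same)
qed

context
  fixes c :: 'k and s t
  assumes hodge: "hodge_decomposition V s t" and \<eta>_c: "ev_D (End_operad V) c 1 \<eta> = unary s"
begin

abbreviation \<psi> where "\<psi> \<equiv> ev_D (End_operad cylinder) c"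
definition gc where "gc n x = ev_D (End_operad V) c n (G n x)"

interpretation \<psi>: operad_hom "tensor_D (End_operad cylinder)" "End_operad cylinder" \<psi>
  by unfold_locales (rule EU.operad_map_ev_D)

lemma operad_map_gc: "operad_map P (End_operad V) gc"
  unfolding gc_def[abs_def] by (rule operad_map_comp[OF G EV.operad_map_ev_D])

lemma hodge_simps:
  shows s_linear: "vlinear V s" and t_linear: "vlinear V t" and s_h: "h (p + 1) (s v) = s (h p v)" and t_h: "h p (t v) = t (h p v)"
    and t_t: "t (t v) = t v" and t_s: "t (s v) = 0" and s_t: "s (t v) = 0" and s_s: "s (s v) = 0"
    and d_s: "d (s v) + s (d v) = v - t v"
  using hodge by (auto simp: hodge_decomposition_def)

lemmas lin = vlinear_simps[OF s_linear] vlinear_simps[OF t_linear]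

text \<open>
  The components of the evaluations of \<open>\<pi>\<close> and \<open>\<iota>\<close> at a point where \<open>\<eta>\<close> becomes a Hodge operator \<open>s\<close>. There
  $\tau$ is $t$, $\kappa$ is $1 - t$ and $\theta$ is $s$.
\<close>

definition proj :: "'v \<times> 'v \<times> 'v \<Rightarrow> 'v" where
  "proj = (\<lambda>(x, y, z). t x + (y - t y) + s z)"

lemma proj_eq: "proj (x, y, z) = t x + (y - t y) + s z"
  by (simp add: proj_def)

definition lift :: "'v \<times> 'v \<times> 'v \<Rightarrow> 'v \<times> 'v \<times> 'v" where
  "lift = (\<lambda>(x, y, z). (t x, x, 0))"

interpretation proj: even_map cylinder V proj
proof
  show "proj (u + v) = proj u + proj v" for u v by (cases u; cases v) (simp add: proj_def lin)
  show "proj (vscale cylinder a u) = vscale V a (proj u)" for a u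
    by (cases u) (simp add: proj_def lin vs.scale_right_distrib vs.scale_right_diff_distrib)
  show "proj (vhcomp cylinder e u) = vhcomp V e (proj u)" for e u
    by (cases u) (use s_h[of 0] s_h[of 1] bit_cases[of e] in \<open>auto simp: proj_def t_h\<close>)
qed

lemma in_linear: "vlinear V a \<Longrightarrow> vlinear V b \<Longrightarrow> vlinear V b' \<Longrightarrow>
    vlinear cylinder (\<lambda>(x, y, z). (a x + b y + b' z, 0, 0))"
  by (rule U.vlinearI) (auto simp: vlinear_simps vs.scale_right_distrib)

lemma zero_linear: "vlinear V (\<lambda>_. 0)"
  by (rule vlinearI) auto

lemma first_linear: "vlinear V a \<Longrightarrow> vlinear cylinder (\<lambda>(x, y, z). (a x, 0, 0))"
  using in_linear[OF _ zero_linear zero_linear, of a] by simp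

lemma unary_plus: "(\<lambda>vs. unary a vs + unary b vs) = unary (\<lambda>v. a v + b v)"
  for a b :: "'v \<times> 'v \<times> 'v \<Rightarrow> 'v \<times> 'v \<times> 'v"
  by (auto simp: unary_def)

lemma \<psi>_const: "\<psi> 1 (const f) = unary f" if "vlinear cylinder f"
  by (rule EU.ev_D_const) (use U.multilinear_unary[OF that] in auto)

lemma \<psi>_\<eta>: "\<psi> 1 \<eta>' = unary (\<lambda>(x, y, z). (s x, 0, 0))"
proof -
  have "\<eta> \<in> carrier (tensor_D_space (Sp (End_operad V) 1))" using \<eta> by (simp add: homogeneous_def)
  then have "\<psi> 1 \<eta>' = E.transport (ev_D (End_operad V) c 1 \<eta>)"
    unfolding \<eta>'_def using E.ev_D_coeffwise[of 1 \<eta> c] by simp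
  then show ?thesis unfolding \<eta>_c E.transport_unary by (simp add: cyl_in_def split_def)
qed

lemma \<psi>_d\<eta>: "\<psi> 1 (dif (Sp (tensor_D (End_operad cylinder)) 1) \<eta>') = unary (\<lambda>(x, y, z). (x - t x, 0, 0))"
proof -
  have "\<psi> 1 (dif (Sp (tensor_D (End_operad cylinder)) 1) \<eta>') = dif (Sp (End_operad cylinder) 1) (\<psi> 1 \<eta>')"
    by (rule operad_mapD(3)[OF \<psi>.hom]) (use X.cl in simp_all)
  also have "\<dots> = unary (\<lambda>(x, y, z). (x - t x, 0, 0))"
    unfolding \<psi>_\<eta> U.dif_unary[OF first_linear[OF s_linear]]
    using S_graded[OF s_linear s_h] d_s
    by (intro arg_cong[where f = unary]) (auto simp: fun_eq_iff zero_prod_def)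
  finally show ?thesis .
qed

lemma id_t_linear: "vlinear V (\<lambda>x. x - t x)"
  by (rule vlinearI) (simp_all add: lin vs.scale_right_diff_distrib)

lemma \<psi>_\<tau>: "\<psi> 1 X.\<tau> = unary (\<lambda>(x, y, z). (t x, 0, 0))"
proof -
  have "\<psi> 1 X.\<tau> = \<psi> 1 (const cyl_t) \<oplus>\<^bsub>Sp (End_operad cylinder) 1\<^esub>
      (-1) \<odot>\<^bsub>Sp (End_operad cylinder) 1\<^esub> \<psi> 1 (X.dR \<eta>')"
    unfolding X.\<tau>_def
    by (simp only: \<psi>.add[OF le_refl X.cl(2) X.U.scale_closed[OF X.cl'(1)]] \<psi>.scale[OF le_refl X.cl'(1)])
  also have "\<dots> = (\<lambda>vs. unary cyl_t vs + vscale cylinder (-1) (unary (\<lambda>(x, y, z). (x - t x, 0, 0)) vs))"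
    unfolding \<psi>_d\<eta> \<psi>_const[OF cyl_linear(2)] by (simp only: U.Sp_End)
  also have "\<dots> = unary (\<lambda>(x, y, z). (t x, 0, 0))"
    by (auto simp: unary_def fun_eq_iff cyl_defs split_beta zero_prod_def)
  finally show ?thesis .
qed

lemma \<psi>_sum_mul:
  assumes "a \<in> carrier (Sp (tensor_D (End_operad cylinder)) 1)" "\<psi> 1 a = unary a'" "vlinear cylinder a'"
    and "b \<in> carrier (Sp (tensor_D (End_operad cylinder)) 1)" "\<psi> 1 b = unary b'" "vlinear cylinder b'"
    and "c0 \<in> carrier (Sp (tensor_D (End_operad cylinder)) 1)" "\<psi> 1 c0 = unary c'"
  shows "\<psi> 1 (c0 \<oplus>\<^bsub>Sp (tensor_D (End_operad cylinder)) 1\<^esub> pcomp (tensor_D (End_operad cylinder)) 1 1 1 a b) =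
    unary (\<lambda>v. c' v + a' (b' v))"
proof -
  have "pcomp (tensor_D (End_operad cylinder)) 1 1 1 a b \<in> carrier (Sp (tensor_D (End_operad cylinder)) 1)"
    by (rule TU.mul_closed[OF assms(1,4)])
  then have "\<psi> 1 (c0 \<oplus>\<^bsub>Sp (tensor_D (End_operad cylinder)) 1\<^esub> pcomp (tensor_D (End_operad cylinder)) 1 1 1 a b) =
      \<psi> 1 c0 \<oplus>\<^bsub>Sp (End_operad cylinder) 1\<^esub> pcomp (End_operad cylinder) 1 1 1 (\<psi> 1 a) (\<psi> 1 b)"
    using \<psi>.add[OF le_refl assms(7)] \<psi>.mul[OF assms(1,4)] by simp
  also have "\<dots> = unary (\<lambda>v. c' v + a' (b' v))"
    unfolding assms(2,5,8) U.mul_unary[OF assms(3,6)] by (simp add: unary_plus)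
  finally show ?thesis .
qed

lemma \<psi>_\<kappa>: "\<psi> 1 X.\<kappa> = unary (\<lambda>(x, y, z). (x - t x, 0, 0))"
proof -
  have "\<psi> 1 X.\<kappa> = unary (\<lambda>v. (case v of (x, y, z) \<Rightarrow> (x - t x, 0, 0)) +
      (case (case v of (x, y, z) \<Rightarrow> (t x, 0 :: 'v, 0 :: 'v)) of (x, y, z) \<Rightarrow> (x - t x, 0, 0)))"
    unfolding X.\<kappa>_def
    by (rule \<psi>_sum_mul[OF X.cl'(1) \<psi>_d\<eta> first_linear[OF id_t_linear] X.cl'(2) \<psi>_\<tau> first_linear[OF t_linear] X.cl'(1) \<psi>_d\<eta>])
  also have "\<dots> = unary (\<lambda>(x, y, z). (x - t x, 0, 0))"
    by (intro arg_cong[where f = unary]) (auto simp: fun_eq_iff t_t)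
  finally show ?thesis .
qed

lemma \<psi>_\<theta>: "\<psi> 1 X.\<theta> = unary (\<lambda>(x, y, z). (s x, 0, 0))"
proof -
  have "\<psi> 1 X.\<theta> = unary (\<lambda>v. (case v of (x, y, z) \<Rightarrow> (s x, 0, 0)) +
      (case (case v of (x, y, z) \<Rightarrow> (t x, 0 :: 'v, 0 :: 'v)) of (x, y, z) \<Rightarrow> (s x, 0, 0)))"
    unfolding X.\<theta>_def
    by (rule \<psi>_sum_mul[OF X.cl(6) \<psi>_\<eta> first_linear[OF s_linear] X.cl'(2) \<psi>_\<tau> first_linear[OF t_linear] X.cl(6) \<psi>_\<eta>])
  also have "\<dots> = unary (\<lambda>(x, y, z). (s x, 0, 0))"
    by (intro arg_cong[where f = unary]) (auto simp: fun_eq_iff s_t)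
  finally show ?thesis .
qed

lemma \<psi>_\<iota>: "\<psi> 1 X.\<iota> = unary lift"
proof -
  have "\<psi> 1 X.\<iota> = (\<lambda>vs. unary (\<lambda>(x, y, z). (t x, 0, 0)) vs + unary cyl_j vs)"
    unfolding X.\<iota>_def using \<psi>.add[OF le_refl X.cl'(2) X.cl(3)] by (simp add: \<psi>_\<tau> \<psi>_const[OF cyl_linear(3)])
  also have "\<dots> = unary lift"
    unfolding unary_plus by (intro arg_cong[where f = unary]) (auto simp: fun_eq_iff cyl_defs lift_def)
  finally show ?thesis .
qed

lemma \<psi>_\<pi>: "\<psi> 1 X.\<pi> = unary (\<lambda>u. cyl_in (proj u))"
proof -
  have "\<psi> 1 (X.\<tau> \<oplus>\<^bsub>Sp (tensor_D (End_operad cylinder)) 1\<^esub> pcomp (tensor_D (End_operad cylinder)) 1 1 1 X.\<kappa> (const cyl_q)) =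
    unary (\<lambda>v. (case v of (x, y, z) \<Rightarrow> (t x, 0, 0)) + (case cyl_q v of (x, y, z) \<Rightarrow> (x - t x, 0, 0)))"
    by (rule \<psi>_sum_mul[OF X.cl'(3) \<psi>_\<kappa> first_linear[OF id_t_linear] X.cl(4) \<psi>_const[OF cyl_linear(4)] cyl_linear(4) X.cl'(2) \<psi>_\<tau>])
  then have "\<psi> 1 X.\<pi> = unary (\<lambda>v. ((case v of (x, y, z) \<Rightarrow> (t x, 0, 0)) + (case cyl_q v of (x, y, z) \<Rightarrow> (x - t x, 0, 0))) +
      (case cyl_r v of (x, y, z) \<Rightarrow> (s x, 0, 0)))"
    unfolding X.\<pi>_def
    by (rule \<psi>_sum_mul[OF X.cl'(4) \<psi>_\<theta> first_linear[OF s_linear] X.cl(5) \<psi>_const[OF cyl_linear(5)] cyl_linear(5), rotated])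
      (rule X.U.M.a_closed[OF X.cl'(2) TU.mul_closed[OF X.cl'(3) X.cl(4)]])
  also have "\<dots> = unary (\<lambda>u. cyl_in (proj u))"
    by (intro arg_cong[where f = unary]) (auto simp: fun_eq_iff cyl_defs proj_def)
  finally show ?thesis .
qed

definition f' where "f' n x = \<psi> n (X.g_ext n x)"

lemma f'_1: "f' 1 (a \<odot>\<^bsub>Sp P 1\<^esub> ounit P) = (\<lambda>us. vscale cylinder a (unary id us))"
  unfolding f'_def X.g_ext_1 \<psi>.scale[OF le_refl TU.unit_closed] operad_mapD(6)[OF \<psi>.hom le_refl] by simp

lemma gc_1: "gc 1 (a \<odot>\<^bsub>Sp P 1\<^esub> ounit P) = (\<lambda>vs. a \<cdot> unary id vs)"
  using linear_mapD(3)[OF operad_mapD(1)[OF operad_map_gc], of 1 "ounit P" a] operad_mapD(6)[OF operad_map_gc, of 1]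
  by simp

lemma f'_eq:
  assumes n: "n \<ge> 2" and x: "x \<in> carrier (Sp P n)" and us: "length us = n"
  shows "f' n x us = (t (gc n x (map proj us)), gc n x (map proj us), 0)"
proof -
  have n1: "n \<ge> 1" "n \<noteq> 1" using n by auto
  have gx: "g n x \<in> carrier (Sp (tensor_D (End_operad cylinder)) n)" by (rule X.g_closed[OF n1(1) x])
  have "\<psi> n (g n x) = E.transport (gc n x)"
    unfolding g_def gc_def by (rule E.ev_D_coeffwise[OF n1(1) G_closed[OF n1(1) x]])
  moreover have "gc n x \<in> multilinear V n" using linear_mapD(1)[OF operad_mapD(1)[OF operad_map_gc n1(1)] x] by simp
  ultimately have m: "\<psi> n (g n x) = E.transport (gc n x)" "\<psi> n (g n x) \<in> multilinear cylinder n"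
    using E.transport_multilinear by simp_all
  have lift: "vlinear cylinder lift" unfolding lift_def by (rule U.vlinearI) (auto simp: lin)
  have hom: "unary (\<lambda>u. cyl_in (proj u)) \<in> homogeneous (Sp (End_operad cylinder) 1) 0"
    using \<psi>.homogeneous[OF le_refl X.\<pi>_hom] unfolding \<psi>_\<pi> .
  have "f' n x = EU.conj_by n (unary lift) (unary (\<lambda>u. cyl_in (proj u))) (\<psi> n (g n x))"
    unfolding f'_def X.g_ext_def using n1 \<psi>.conj_by[OF X.cl'(5,6) n1(1) gx] by (simp add: \<psi>_\<iota> \<psi>_\<pi>)
  then have "f' n x us = lift (\<psi> n (g n x) (map (\<lambda>u. cyl_in (proj u)) us))"
    using U.conj_by_End[OF lift hom n1(1) m(2) us] by simp
  then show ?thesis unfolding m(1) E.transport_def by (simp add: lift_def cyl_in_def o_def)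
qed

lemma BU: "BV_target P (End_operad cylinder) f' (unary cyl_s) (unary cyl_t)"
  using X.BV.target_natural[OF \<psi>.operad_hom_axioms] unfolding \<psi>_const[OF cyl_linear(1)] \<psi>_const[OF cyl_linear(2)]
  by (simp add: f'_def[abs_def])

text \<open>
  Both sides are evaluations of the same term \<open>u\<close>, once with values in the cylinder and once with values in
  \<open>V\<close>. The map \<open>proj\<close> intertwines the images of all generators, hence the evaluations. On the first summand
  \<open>proj\<close> is $t$ and not the identity, so one more fact is needed: in arity at least two the first component of
  the evaluation in the cylinder lies in the image of $t$, since this holds for the images of operations of \<open>P\<close>
  and is preserved by composition.
\<close>

lemma F_endpoint:
  assumes n: "n \<ge> 2" and x: "x \<in> carrier (Sp P n)"
  shows "ev_D (End_operad V) c n (F n x) = hodge_extend V gc s t n (k n x)"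
proof
  fix vs
  interpret BU: BV_target P "End_operad cylinder" f' "unary cyl_s" "unary cyl_t" by (rule BU)
  interpret W: BV_target P "End_operad V" gc "unary s" "unary t"
    by (rule hodge_target[OF P.dg_operad_axioms operad_map_gc hodge])
  have n1: "n \<ge> 1" using n by simp
  obtain u where u: "bv_wf P u" "bv_arity u = n" "k n x = bv_class P u"
    by (rule P.bv_carrier_class[OF n1 linear_mapD(1)[OF operad_mapD(1)[OF k n1] x]])
  note self = P.bv_class_self[OF u(1)]
  have He: "\<psi> n (H n x) = BU.ev u"
    using X.BV.ev_natural[OF \<psi>.hom, of f' u] X.BV.bv_extend_class[OF u(1) self, of n] u
    by (simp add: H_def f'_def \<psi>_const[OF cyl_linear(1)] \<psi>_const[OF cyl_linear(2)])
  have Fe: "ev_D (End_operad V) c n (F n x) = C.transport (BU.ev u)"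
    unfolding F_def He[symmetric] by (rule C.ev_D_coeffwise[OF n1 H_closed[OF n1 x]])
  have We: "hodge_extend V gc s t n (k n x) = W.ev u"
    unfolding hodge_extend_def u(3) by (rule W.bv_extend_class[OF u(1) self])
  have Um: "BU.ev u \<in> multilinear cylinder n" and Vm: "W.ev u \<in> multilinear V n"
    using BU.ev_closed[OF u(1)] W.ev_closed[OF u(1)] u(2) by simp_all
  show "ev_D (End_operad V) c n (F n x) vs = hodge_extend V gc s t n (k n x) vs"
  proof (cases "length vs = n")
    case False
    then show ?thesis
      unfolding Fe We using multilinear_length[OF C.transport_multilinear[OF Um]] multilinear_length[OF Vm] by simp
  next
    case True
    let ?A = "{u. t (fst u) = fst u}"
    let ?us = "map cyl_in vs"
    have "proj.intertwines (bv_arity u) (BU.ev u) (W.ev u)"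
    proof (rule proj.intertwines_eval[OF P.dg_operad_axioms _ _ _ u(1)])
      fix m y assume m: "m \<ge> 1" and y: "y \<in> carrier (Sp P m)"
      show "proj.intertwines m (f' m y) (gc m y)"
      proof (cases "m = 1")
        case True
        then obtain a where a: "y = a \<odot>\<^bsub>Sp P 1\<^esub> ounit P" using X.arity_1 y by blast
        show ?thesis unfolding True a f'_1 gc_1
          by (auto simp: proj.intertwines_def unary_def proj.scale One_nat_def length_Suc_conv)
      next
        case False
        then show ?thesis using m y
          by (auto simp: proj.intertwines_def f'_eq proj_eq t_t lin)
      qed
    qed (auto simp: proj.intertwines_def unary_def One_nat_def length_Suc_conv cyl_defs proj_eq lin s_t s_s t_t t_s)
    then have int: "proj (BU.ev u ?us) = W.ev u (map proj ?us)"
      using True u(2) by (simp add: proj.intertwines_def)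
    have inv: "BU.ev u ?us \<in> ?A"
    proof (rule U.invariant_eval[OF P.dg_operad_axioms _ _ _ _ _ _ _ u(1)])
      show "0 \<in> ?A" by (simp add: lin)
      show "x + y \<in> ?A" if "x \<in> ?A" "y \<in> ?A" for x y using that by (simp add: lin)
      show "vscale cylinder a x \<in> ?A" if "x \<in> ?A" for a x using that by (cases x) (simp add: lin)
      show "vhcomp cylinder p x \<in> ?A" if "x \<in> ?A" for p x using that by (cases x) (simp flip: t_h)
      show "unary cyl_s [v] \<in> ?A" for v by (simp add: unary_def cyl_defs split_beta lin)
      show "unary cyl_t [v] \<in> ?A" if "v \<in> ?A" for v using that by (simp add: unary_def cyl_defs split_beta lin)
      show "f' m y us \<in> ?A" if m: "m \<ge> 1" and my: "y \<in> carrier (Sp P m)" and len: "length us = m" and big: "m \<ge> 2 \<or> set us \<subseteq> ?A" for m y us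
      proof (cases "m = 1")
        case m1: True
        then obtain a where a: "y = a \<odot>\<^bsub>Sp P 1\<^esub> ounit P" using X.arity_1 my by blast
        obtain v where v: "us = [v]" using len m1 by (auto simp: length_Suc_conv One_nat_def)
        show ?thesis unfolding m1 a f'_1 using big m1 by (cases v) (auto simp: v unary_def lin)
      next
        case False
        then show ?thesis using f'_eq[of m y us] m my len by (simp add: t_t)
      qed
    qed (use True u(2) n in auto)
    have hU: "bv_extend (End_operad cylinder) f' (unary cyl_s) (unary cyl_t) n (k n x) = BU.ev u"
      unfolding u(3) by (rule BU.bv_extend_class[OF u(1) self])
    have hW: "bv_extend (End_operad V) gc (unary s) (unary t) n (k n x) = W.ev u"
      unfolding u(3) by (rule W.bv_extend_class[OF u(1) self])
    have "(\<lambda>us. cyl_t (BU.ev u us)) = BU.ev u"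
      using BU.splitting_unit(1)[OF k n1 x] U.end_pcomp_unary_left[OF cyl_linear(2) n1 Um] unfolding hU by simp
    then have "cyl_t (BU.ev u ?us) = BU.ev u ?us" by metis
    moreover have "proj w = t (fst w)" if "cyl_t w = w" for w
      using that by (cases w) (auto simp: cyl_defs proj_eq lin)
    ultimately have "proj (BU.ev u ?us) = t (fst (BU.ev u ?us))" by blast
    then have "fst (BU.ev u ?us) = W.ev u (map proj ?us)" using inv int by simp
    also have "map proj ?us = map t vs" by (simp add: proj_eq cyl_in_def lin)
    also have "W.ev u (map t vs) = W.ev u vs"
    proof -
      have "EV.precomp n (unary t) js (W.ev u) = W.ev u" if "set js \<subseteq> {1..n}" for js
        using that W.splitting_unit(2)[OF k n1 x] unfolding hW by (induction js) simp_all
      then have "EV.precomp n (unary t) [1..<n + 1] (W.ev u) = W.ev u" by (simp del: upt_Suc)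
      then show ?thesis using precomp_End[OF W.t Vm le_refl True] True by (simp del: upt_Suc)
    qed
    finally show ?thesis unfolding Fe We C.transport_def .
  qed
qed

end

end

section \<open>Homotopies between minimal models\<close>

context cylinder_space
begin

lemma deformation:
  assumes adm: "admissible P" and G: "operad_map P (tensor_D (End_operad V)) G"
    and \<eta>: "\<eta> \<in> homogeneous (tensor_D_space (Sp (End_operad V) 1)) 1" and k: "bv_splitting P k"
  shows "\<exists>F. operad_map P (tensor_D (End_operad V)) F \<and>
    (\<forall>c s t n x. hodge_decomposition V s t \<longrightarrow> ev_D (End_operad V) c 1 \<eta> = unary s \<longrightarrow> n \<ge> 2 \<longrightarrow>
      x \<in> carrier (Sp P n) \<longrightarrow>
      ev_D (End_operad V) c n (F n x) = hodge_extend V (\<lambda>n x. ev_D (End_operad V) c n (G n x)) s t n (k n x))"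
proof -
  have P: "dg_operad P" and k': "operad_map P (bv P) k" using adm k by (auto simp: admissible_def bv_splitting_def)
  interpret algebra_deformation V P G \<eta> k
    by (intro algebra_deformation.intro algebra_deformation_axioms.intro cylinder_space_axioms P adm G \<eta> k')
  show ?thesis
  proof (intro exI[of _ F] conjI operad_map_F allI impI)
    fix c s t n x
    assume a: "hodge_decomposition V s t" "ev_D (End_operad V) c 1 \<eta> = unary s"
      and n: "(n :: nat) \<ge> 2" and x: "x \<in> carrier (Sp P n)"
    show "ev_D (End_operad V) c n (F n x) = hodge_extend V (\<lambda>n x. ev_D (End_operad V) c n (G n x)) s t n (k n x)"
      using F_endpoint[OF a n x] unfolding gc_def[OF a, abs_def] .
  qed
qed

lemma unit_multiple: "admissible P \<Longrightarrow> x \<in> carrier (Sp P 1) \<Longrightarrow> \<exists>a. x = a \<odot>\<^bsub>Sp P 1\<^esub> ounit P"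
  by (auto simp: admissible_def)

lemma minimal_model_1:
  "admissible P \<Longrightarrow> minimal_model P V f s t k 1 (a \<odot>\<^bsub>Sp P 1\<^esub> ounit P) = (\<lambda>vs. a \<cdot> unary id vs)"
  using dg_operad.admissible_scalar[of P a] by (simp add: minimal_model_def admissible_def)

lemma operad_map_unit_multiple:
  "dg_operad P \<Longrightarrow> operad_map P (End_operad V) f \<Longrightarrow> f 1 (a \<odot>\<^bsub>Sp P 1\<^esub> ounit P) = (\<lambda>vs. a \<cdot> unary id vs)"
  using linear_mapD(3)[OF operad_mapD(1)[of P "End_operad V" f 1], of "ounit P" a] operad_mapD(6)[of P "End_operad V" f 1]
    dg_operad.unit_closed[of P] by simp

text \<open>
  Arity one is determined by the unit, so the endpoints of \<open>F\<close> only need to be compared in higher arities.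
\<close>

lemma homotopicI:
  assumes adm: "admissible P" and F: "operad_map P (tensor_D (End_operad V)) F"
    and f0: "\<And>n x. n \<ge> 2 \<Longrightarrow> x \<in> carrier (Sp P n) \<Longrightarrow> ev_D (End_operad V) 0 n (F n x) = f0 n x"
    and f1: "\<And>n x. n \<ge> 2 \<Longrightarrow> x \<in> carrier (Sp P n) \<Longrightarrow> ev_D (End_operad V) 1 n (F n x) = f1 n x"
    and u0: "\<And>a. f0 1 (a \<odot>\<^bsub>Sp P 1\<^esub> ounit P) = (\<lambda>vs. a \<cdot> unary id vs)"
    and u1: "\<And>a. f1 1 (a \<odot>\<^bsub>Sp P 1\<^esub> ounit P) = (\<lambda>vs. a \<cdot> unary id vs)"
  shows "homotopic P (End_operad V) f0 f1"
proof -
  interpret P: dg_operad P using adm by (simp add: admissible_def)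
  have map: "operad_map P (End_operad V) (\<lambda>n x. ev_D (End_operad V) c n (F n x))" for c
    by (rule operad_map_comp[OF F EV.operad_map_ev_D])
  have one: "ev_D (End_operad V) c 1 (F 1 (a \<odot>\<^bsub>Sp P 1\<^esub> ounit P)) = (\<lambda>vs. a \<cdot> unary id vs)" for c a
    using operad_map_unit_multiple[OF P.dg_operad_axioms map] .
  have eq: "ev_D (End_operad V) 0 n (F n x) = f0 n x" "ev_D (End_operad V) 1 n (F n x) = f1 n x"
    if n: "n \<ge> 1" and x: "x \<in> carrier (Sp P n)" for n x
  proof -
    have "(ev_D (End_operad V) 0 n (F n x) = f0 n x) \<and> (ev_D (End_operad V) 1 n (F n x) = f1 n x)"
    proof (cases "n = 1")
      case True
      obtain a where "x = a \<odot>\<^bsub>Sp P 1\<^esub> ounit P" using unit_multiple[OF adm] x True by blast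
      then show ?thesis unfolding True by (simp only: one u0 u1)
    next
      case False
      then show ?thesis using n x f0 f1 by simp
    qed
    then show "ev_D (End_operad V) 0 n (F n x) = f0 n x" "ev_D (End_operad V) 1 n (F n x) = f1 n x" by auto
  qed
  then show ?thesis
    unfolding homotopic_def using F P.operad_map_cong[OF map[of 0], of f0] P.operad_map_cong[OF map[of 1], of f1] by auto
qed

lemma unary_scaled: "unary s \<in> homogeneous (Sp (End_operad V) 1) 1 \<Longrightarrow>
    unary (\<lambda>_. 0) \<in> homogeneous (Sp (End_operad V) 1) 1 \<and> unary (\<lambda>v. - s v) \<in> homogeneous (Sp (End_operad V) 1) 1"
proof -
  interpret N: dg_space "Sp (End_operad V) 1" by (rule EV.space) simp
  assume s: "unary s \<in> homogeneous (Sp (End_operad V) 1) 1"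
  have "unary (\<lambda>v. - s v) = (-1) \<odot>\<^bsub>Sp (End_operad V) 1\<^esub> unary s" "unary (\<lambda>_. 0) = zero (Sp (End_operad V) 1)"
    by (auto simp: unary_def)
  then show ?thesis using N.homogeneous_scale[OF s] N.homogeneous_zero by metis
qed

text \<open>
  The deformation of the constant path along $\eta = z s$, which is $0$ at $z = 0$ and $s$ at $z = 1$.
\<close>

lemma structure_to_minimal_model:
  assumes adm: "admissible P" and f: "operad_map P (End_operad V) f"
    and hodge: "hodge_decomposition V s t" and k: "bv_splitting P k"
  shows "\<exists>F. operad_map P (tensor_D (End_operad V)) F \<and>
    (\<forall>n x. n \<ge> 2 \<longrightarrow> x \<in> carrier (Sp P n) \<longrightarrow>
      ev_D (End_operad V) 0 n (F n x) = f n x \<and> ev_D (End_operad V) 1 n (F n x) = minimal_model P V f s t k n x)"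
proof -
  interpret P: dg_operad P using adm by (simp add: admissible_def)
  interpret W: BV_target P "End_operad V" f "unary s" "unary t" by (rule hodge_target[OF P.dg_operad_axioms f hodge])
  let ?G = "\<lambda>n x. const_D (End_operad V) n (f n x)" and ?\<eta> = "affine_D (Sp (End_operad V) 1) (unary (\<lambda>_. 0)) (unary s)"
  note z = unary_scaled[OF W.s, THEN conjunct1]
  have ev\<eta>: "ev_D (End_operad V) c 1 ?\<eta> = unary (\<lambda>v. c \<cdot> s v)" for c
    using EV.ev_D_affine[OF le_refl EV.homogeneous_closed[OF le_refl z] W.s_closed, of c] by (auto simp: unary_def fun_eq_iff)
  have G: "operad_map P (tensor_D (End_operad V)) ?G" by (rule operad_map_comp[OF f EV.operad_map_const_D])
  have Gf: "ev_D (End_operad V) c n (?G n x) = f n x" if "n \<ge> 1" "x \<in> carrier (Sp P n)" for c n x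
    by (rule EV.ev_D_const[OF that(1) W.f_closed[OF that]])
  obtain F where F: "operad_map P (tensor_D (End_operad V)) F"
    and ev: "\<forall>c s t n x. hodge_decomposition V s t \<longrightarrow> ev_D (End_operad V) c 1 ?\<eta> = unary s \<longrightarrow> n \<ge> 2 \<longrightarrow>
      x \<in> carrier (Sp P n) \<longrightarrow>
      ev_D (End_operad V) c n (F n x) = hodge_extend V (\<lambda>n x. ev_D (End_operad V) c n (?G n x)) s t n (k n x)"
    using deformation[OF adm G EV.affine_D_homogeneous[OF le_refl z W.s] k] by blast
  have kx: "k n x \<in> carrier (Sp (bv P) n)" if "n \<ge> 1" "x \<in> carrier (Sp P n)" for n x
    using k linear_mapD(1)[OF operad_mapD(1)[of P "bv P" k]] that by (simp add: bv_splitting_def)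
  have ext: "hodge_extend V (\<lambda>n x. ev_D (End_operad V) c n (?G n x)) s' t' n (k n x) = hodge_extend V f s' t' n (k n x)"
    if "n \<ge> 1" "x \<in> carrier (Sp P n)" for c s' t' n x
    unfolding hodge_extend_def by (rule P.bv_extend_cong[OF kx[OF that] that(1)]) (rule Gf)
  show ?thesis
  proof (intro exI[of _ F] conjI F allI impI)
    fix n x assume n: "(n :: nat) \<ge> 2" and x: "x \<in> carrier (Sp P n)"
    have n1: "n \<ge> 1" "n \<noteq> 1" using n by auto
    show "ev_D (End_operad V) 0 n (F n x) = f n x"
      using ev[rule_format, OF hodge_trivial _ n x, of 0] ext[OF n1(1) x] hodge_extend_trivial[OF P.dg_operad_axioms f k n1(1) x]
      by (simp add: ev\<eta>)
    show "ev_D (End_operad V) 1 n (F n x) = minimal_model P V f s t k n x"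
      using ev[rule_format, OF hodge _ n x, of 1] ext[OF n1(1) x] n1 by (simp add: ev\<eta> minimal_model_def bv_incl_def)
  qed
qed

lemma homotopic_minimal_model:
  assumes adm: "admissible P" and f: "operad_map P (End_operad V) f"
    and hodge: "hodge_decomposition V s t" and k: "bv_splitting P k"
  shows "homotopic P (End_operad V) f (minimal_model P V f s t k)"
proof -
  obtain F where F: "operad_map P (tensor_D (End_operad V)) F"
    and ends: "\<forall>n x. n \<ge> 2 \<longrightarrow> x \<in> carrier (Sp P n) \<longrightarrow>
      ev_D (End_operad V) 0 n (F n x) = f n x \<and> ev_D (End_operad V) 1 n (F n x) = minimal_model P V f s t k n x"
    using structure_to_minimal_model[OF assms] by blast
  have P: "dg_operad P" using adm by (simp add: admissible_def)
  show ?thesis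
  proof (rule homotopicI[OF adm F])
    fix n x assume "(n :: nat) \<ge> 2" and "x \<in> carrier (Sp P n)"
    with ends show "ev_D (End_operad V) 0 n (F n x) = f n x" "ev_D (End_operad V) 1 n (F n x) = minimal_model P V f s t k n x"
      by simp_all
  qed (rule operad_map_unit_multiple[OF P f] minimal_model_1[OF adm])+
qed

text \<open>
  The homotopy from \<open>f\<close> to the second minimal model is itself deformed along $\eta = (1 - z) s$: at $z = 0$ it
  becomes the first minimal model of \<open>f\<close>, and at $z = 1$ nothing changes. So no composition of homotopies is
  needed.
\<close>

lemma homotopic_minimal_models:
  assumes adm: "admissible P" and f: "operad_map P (End_operad V) f"
    and hodge: "hodge_decomposition V s t" and k: "bv_splitting P k"
    and hodge': "hodge_decomposition V s' t'" and k': "bv_splitting P k'"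
  shows "homotopic P (End_operad V) (minimal_model P V f s t k) (minimal_model P V f s' t' k')"
proof -
  interpret P: dg_operad P using adm by (simp add: admissible_def)
  interpret W: BV_target P "End_operad V" f "unary s" "unary t" by (rule hodge_target[OF P.dg_operad_axioms f hodge])
  obtain G where G: "operad_map P (tensor_D (End_operad V)) G"
    and ends: "\<forall>n x. n \<ge> 2 \<longrightarrow> x \<in> carrier (Sp P n) \<longrightarrow>
      ev_D (End_operad V) 0 n (G n x) = f n x \<and> ev_D (End_operad V) 1 n (G n x) = minimal_model P V f s' t' k' n x"
    using structure_to_minimal_model[OF adm f hodge' k'] by blast
  have Gmap: "operad_map P (End_operad V) (\<lambda>n x. ev_D (End_operad V) c n (G n x))" for c
    by (rule operad_map_comp[OF G EV.operad_map_ev_D])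
  have Gf: "ev_D (End_operad V) 0 n (G n x) = f n x" if "n \<ge> 1" "x \<in> carrier (Sp P n)" for n x
  proof (cases "n = 1")
    case True
    have "x \<in> carrier (Sp P 1)" using that(2) unfolding True .
    from unit_multiple[OF adm this] obtain a where x: "x = a \<odot>\<^bsub>Sp P 1\<^esub> ounit P" ..
    show ?thesis
      unfolding True x
      by (rule HOL.trans[OF operad_map_unit_multiple[OF P.dg_operad_axioms Gmap]
            operad_map_unit_multiple[OF P.dg_operad_axioms f, symmetric]])
  next
    case False
    then have "n \<ge> 2" using that(1) by simp
    then show ?thesis using ends that(2) by blast
  qed
  let ?\<eta> = "affine_D (Sp (End_operad V) 1) (unary s) (unary (\<lambda>v. - s v))"
  note ms = unary_scaled[OF W.s, THEN conjunct2]
  have ev\<eta>: "ev_D (End_operad V) c 1 ?\<eta> = unary (\<lambda>v. s v - c \<cdot> s v)" for c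
    using EV.ev_D_affine[OF le_refl W.s_closed EV.homogeneous_closed[OF le_refl ms], of c] by (auto simp: unary_def fun_eq_iff)
  obtain F where F: "operad_map P (tensor_D (End_operad V)) F"
    and ev: "\<forall>c s t n x. hodge_decomposition V s t \<longrightarrow> ev_D (End_operad V) c 1 ?\<eta> = unary s \<longrightarrow> n \<ge> 2 \<longrightarrow>
      x \<in> carrier (Sp P n) \<longrightarrow>
      ev_D (End_operad V) c n (F n x) = hodge_extend V (\<lambda>n x. ev_D (End_operad V) c n (G n x)) s t n (k n x)"
    using deformation[OF adm G EV.affine_D_homogeneous[OF le_refl W.s ms] k] by blast
  have kx: "k n x \<in> carrier (Sp (bv P) n)" if "n \<ge> 1" "x \<in> carrier (Sp P n)" for n x
    using k linear_mapD(1)[OF operad_mapD(1)[of P "bv P" k]] that by (simp add: bv_splitting_def)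
  show ?thesis
  proof (rule homotopicI[OF adm F])
    fix n x assume n: "(n :: nat) \<ge> 2" and x: "x \<in> carrier (Sp P n)"
    have n1: "n \<ge> 1" "n \<noteq> 1" using n by auto
    have "hodge_extend V (\<lambda>n x. ev_D (End_operad V) 0 n (G n x)) s t n (k n x) = hodge_extend V f s t n (k n x)"
      unfolding hodge_extend_def by (rule P.bv_extend_cong[OF kx[OF n1(1) x] n1(1)]) (rule Gf)
    then show "ev_D (End_operad V) 0 n (F n x) = minimal_model P V f s t k n x"
      using ev[rule_format, OF hodge _ n x, of 0] n1 by (simp add: ev\<eta> minimal_model_def bv_incl_def)
    show "ev_D (End_operad V) 1 n (F n x) = minimal_model P V f s' t' k' n x"
      using ev[rule_format, OF hodge_trivial _ n x, of 1] hodge_extend_trivial[OF P.dg_operad_axioms Gmap k n1(1) x, of 1] ends n x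
      by (simp add: ev\<eta>)
  qed (rule minimal_model_1[OF adm])+
qed

end

theorem corollary4p17:
  fixes P :: "('k::field_char_0, 'a) operad"
    and V :: "('k, 'v::ab_group_add) dg_vect"
    and f :: "nat \<Rightarrow> 'a \<Rightarrow> 'v list \<Rightarrow> 'v"
  assumes "admissible P"
    and "dg_vector_space V"
    and "algebra_structure P V f"
  shows "(\<forall>s t k. canonical_hodge V s t \<and> bv_splitting P k \<longrightarrow>
            homotopy_equivalent P V f (minimal_model P V f s t k)) \<and>
         (\<forall>s t k s' t' k'. canonical_hodge V s t \<and> bv_splitting P k \<and>
            canonical_hodge V s' t' \<and> bv_splitting P k' \<longrightarrow>
            homotopy_equivalent P V (minimal_model P V f s t k) (minimal_model P V f s' t' k'))"
proof -
  interpret cylinder_space V by unfold_locales fact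
  have f: "operad_map P (End_operad V) f" using assms(3) by (simp add: algebra_structure_def)
  show ?thesis
    unfolding homotopy_equivalent_def canonical_hodge_def
    using homotopic_minimal_model[OF assms(1) f] homotopic_minimal_models[OF assms(1) f] by blast
qed

end
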